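(* Let $n \geq 2$ and let $q$ be a prime power with $q > (n-1)^2$. For $s \in \mathbb{N}$ let $\mathcal{R}_s = \mathbb{F}_q[t]/\langle t^s \rangle$, regarded as an $\mathbb{F}_q$-algebra with generating set $\{1,t\}$, so that $T = \{a+bt : a,b \in \mathbb{F}_q\}$ (images in $\mathcal{R}_s$). Let $X^{(s)} = X(\operatorname{EL}_{n+1}(\mathcal{R}_s), (K_{\{i\}})_{i \in \{0,\dots,n\}})$ where $K_{\{i\}} = \langle e_{j,j+1}(m) : j \in \{0,\dots,n\}\setminus\{i\},\ m \in T\rangle$ (indices mod $n+1$). Then for every $s > n$: 1. $X^{(s)}$ is a pure $n$-dimensional, $(n+1)$-partite, strongly gallery connected clique complex with no free faces. 2. $X^{(s)}$ is finite, and the number of vertices of $X^{(s)}$ tends to infinity as $s \to \infty$. 3. There is a constant $Q = Q(q)$ such that for every $s$, each vertex of $X^{(s)}$ is contained in exactly $Q$ $n$-dimensional simplices. 4. For each $1$-dimensional link of $X^{(s)}$, the second largest eigenvalue of the simple random walk on it is at most $\frac{1}{\sqrt{q}}$. 5. $X^{(s)}$ is a one-sided $\frac{1}{\sqrt{q}-(n-1)}$-local spectral expander; in particular the second largest eigenvalue $\mu_\emptyset$ of the weighted random walk on the $1$-skeleton of $X^{(s)}$ is at most $\frac{1}{\sqrt{q}-(n-1)}$. 6. The automorphism group of $X^{(s)}$ contains $\operatorname{EL}_{n+1}(\mathcal{R}_s) \rtimes D_{n+1}$, where $\operatorname{EL}_{n+1}(\mathcal{R}_s)$ acts by left multiplication,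 transitively on the $n$-dimensional simplices, and $D_{n+1}$ rotates/inverts the types (a simplex of type $\tau$ is mapped to a simplex of type $\rho(\tau)$ for the corresponding $\rho \in D_{n+1}$). Consequently, for every $\lambda > 0$ one can choose $q$ large enough so that $\{X^{(s)} : s > 2^{n-1}\}$ is an infinite family of $n$-dimensional one-sided $\lambda$-local spectral expanders which are uniformly locally finite (the number of $n$-simplices containing a vertex is bounded uniformly in $s$).
   Context: Matrices are $(n+1)\times(n+1)$ with rows/columns indexed by $0,\dots,n$; $e_{i,j}(r)$ ($i\neq j$) is the matrix with $1$'s on the diagonal, $r$ in entry $(i,j)$, $0$ elsewhere; $\operatorname{EL}_{n+1}(\mathcal{R})$ is the group generated by all $e_{i,j}(r)$. For a group $G$ with subgroups $K_{\{i\}}$, $i\in I$ ($I$ finite), the coset complex $X(G,(K_{\{i\}})_{i\in I})$ is the simplicial complex whose vertices are the cosets $gK_{\{i\}}$ ($g\in G$, $i\in I$; cosets for different $i$ are distinct vertices, and $gK_{\{i\}}$ has type $i$), where $gK_{\{i\}}, g'K_{\{j\}}$ span an edge iff $i\neq j$ and $gK_{\{i\}}\cap g'K_{\{j\}}\neq\emptyset$, and which is the clique complex of this graph; $G$ acts by left multiplication. The type of a simplex is the set of types of its vertices. Terminology: $X$ is pure $n$-dimensional if every simplex lies in an $n$-simplex; $(n+1)$-partite if its vertices split into $n+1$ sides with every $n$-simplex having one vertex in each; a clique complex if every clique of the $1$-skeleton spans a simplex; the link of $\tau$ is $X_\tau=\{\eta : \eta\cap\tau=\emptyset, \eta\cup\tau\in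 X\}$; $X$ is strongly gallery connected if $X$ and every link $X_\tau$ with $\tau\in X(k)$, $0\le k\le n-2$, is gallery connected (any two top simplices joined by a sequence of top simplices, consecutive ones sharing a codimension-one face); a free face is a simplex of dimension $<n$ lying in exactly one $n$-simplex. $X(k)$ is the set of $k$-simplices, $X(-1)=\{\emptyset\}$. For $\tau\in X(k)$, $-1\le k\le n-2$, the $1$-skeleton of $X_\tau$ carries edge weights $w(\{u,v\})=(n-k-2)!\,|\{\sigma\in X_\tau(n-1-k):\{u,v\}\subseteq\sigma\}|$, and $\mu_\tau$ is the second largest eigenvalue of the random walk on it with transition probabilities proportional to these weights. $X$ is a one-sided $\lambda$-local spectral expander if $\mu_\tau\le\lambda$ for all $\tau\in X(k)$, $-1\le k\le n-2$. $D_{n+1}$ is the dihedral group, viewed as the subgroup of permutations $\rho$ of $\{0,\dots,n\}$ such that $(i-j)\bmod(n+1)=\pm1$ iff $(\rho(i)-\rho(j))\bmod(n+1)=\pm1$. *)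

theory Defs
  imports
    "HOL-Algebra.UnivPoly"
    "HOL-Algebra.QuotRing"
    "HOL-Algebra.Bij"
    "HOL-Algebra.Generated_Groups"
    "HOL-Number_Theory.Cong"
    "HOL-Number_Theory.Prime_Powers"
    "Jordan_Normal_Form.Char_Poly"
begin

text \<open>A complex is its set of simplices and contains the empty simplex; dimensions are integers,
  so that the empty simplex has dimension -1.\<close>

definition simplicial_complex :: "'v set set \<Rightarrow> bool" where
  "simplicial_complex X \<longleftrightarrow>
     {} \<in> X \<and> (\<forall>\<sigma>\<in>X. finite \<sigma>) \<and> (\<forall>\<sigma>\<in>X. \<forall>\<tau>. \<tau> \<subseteq> \<sigma> \<longrightarrow> \<tau> \<in> X)"

definition vertices :: "'v set set \<Rightarrow> 'v set" where
  "vertices X = \<Union>X"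

definition simplices :: "'v set set \<Rightarrow> int \<Rightarrow> 'v set set" where
  "simplices X k = {\<sigma> \<in> X. finite \<sigma> \<and> int (card \<sigma>) = k + 1}"

definition link :: "'v set set \<Rightarrow> 'v set \<Rightarrow> 'v set set" where
  "link X \<tau> = {\<eta>. \<eta> \<inter> \<tau> = {} \<and> \<eta> \<union> \<tau> \<in> X}"

definition pure_dim :: "'v set set \<Rightarrow> int \<Rightarrow> bool" where
  "pure_dim X d \<longleftrightarrow> (\<forall>\<sigma>\<in>X. \<exists>\<tau>\<in>simplices X d. \<sigma> \<subseteq> \<tau>)"

definition partite :: "'v set set \<Rightarrow> nat \<Rightarrow> bool" where
  "partite X n \<longleftrightarrow> (\<exists>S :: nat \<Rightarrow> 'v set.
     (\<Union>i\<in>{..n}. S i) = vertices X \<and> disjoint_family_on S {..n} \<and>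
     (\<forall>\<sigma>\<in>simplices X (int n). \<forall>i\<in>{..n}. card (\<sigma> \<inter> S i) = 1))"

definition clique_complex :: "'v set set \<Rightarrow> bool" where
  "clique_complex X \<longleftrightarrow> simplicial_complex X \<and>
     (\<forall>\<sigma>. finite \<sigma> \<and> \<sigma> \<subseteq> vertices X \<and> (\<forall>u\<in>\<sigma>. \<forall>v\<in>\<sigma>. u \<noteq> v \<longrightarrow> {u, v} \<in> X) \<longrightarrow> \<sigma> \<in> X)"

definition gallery_connected :: "'v set set \<Rightarrow> int \<Rightarrow> bool" where
  "gallery_connected X d \<longleftrightarrow> (\<forall>\<sigma>\<in>simplices X d. \<forall>\<sigma>'\<in>simplices X d.
     (\<sigma>, \<sigma>') \<in> {(\<alpha>, \<beta>). \<alpha> \<in> simplices X d \<and> \<beta> \<in> simplices X d \<and>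
                         \<alpha> \<inter> \<beta> \<in> simplices X (d - 1)}\<^sup>*)"

definition strongly_gallery_connected :: "'v set set \<Rightarrow> nat \<Rightarrow> bool" where
  "strongly_gallery_connected X n \<longleftrightarrow> gallery_connected X (int n) \<and>
     (\<forall>k\<in>{0..int n - 2}. \<forall>\<tau>\<in>simplices X k. gallery_connected (link X \<tau>) (int n - 1 - k))"

definition free_face :: "'v set set \<Rightarrow> nat \<Rightarrow> 'v set \<Rightarrow> bool" where
  "free_face X n \<sigma> \<longleftrightarrow> \<sigma> \<in> X \<and> int (card \<sigma>) - 1 < int n \<and>
     (\<exists>!\<tau>. \<tau> \<in> simplices X (int n) \<and> \<sigma> \<subseteq> \<tau>)"

definition simplicial_automorphisms :: "'v set set \<Rightarrow> ('v \<Rightarrow> 'v) monoid" where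
  "simplicial_automorphisms X = BijGroup (vertices X)
     \<lparr>carrier := {f \<in> Bij (vertices X). \<forall>\<sigma>. \<sigma> \<subseteq> vertices X \<longrightarrow> (f ` \<sigma> \<in> X \<longleftrightarrow> \<sigma> \<in> X)}\<rparr>"

definition transition_prob :: "'v set set \<Rightarrow> ('v set \<Rightarrow> real) \<Rightarrow> 'v \<Rightarrow> 'v \<Rightarrow> real" where
  "transition_prob E w u v =
     (if {u, v} \<in> E then w {u, v} / (\<Sum>e | e \<in> E \<and> u \<in> e. w e) else 0)"

text \<open>The characteristic polynomial does not depend on the enumeration \<open>vs\<close> of the
  vertex set \<open>V\<close>.\<close>

definition walk_char_poly :: "'v set \<Rightarrow> 'v set set \<Rightarrow> ('v set \<Rightarrow> real) \<Rightarrow> real poly" where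
  "walk_char_poly V E w = (let vs = (SOME vs. set vs = V \<and> distinct vs) in
     char_poly (Matrix.mat (card V) (card V) (\<lambda>(i, j). transition_prob E w (vs ! i) (vs ! j))))"

text \<open>Eigenvalues are counted with multiplicity (all of them are real, since the walk is
  reversible), so \<open>second_eigenvalue\<close> is 1 when the graph is disconnected.\<close>

definition second_eigenvalue :: "'v set \<Rightarrow> 'v set set \<Rightarrow> ('v set \<Rightarrow> real) \<Rightarrow> real" where
  "second_eigenvalue V E w =
     rev (sorted_list_of_multiset (proots (walk_char_poly V E w))) ! 1"

definition link_weight :: "'v set set \<Rightarrow> nat \<Rightarrow> int \<Rightarrow> 'v set \<Rightarrow> 'v set \<Rightarrow> real" where
  "link_weight X n k \<tau> e = fact (nat (int n - k - 2)) *
     real (card {\<sigma> \<in> simplices (link X \<tau>) (int n - 1 - k). e \<subseteq> \<sigma>})"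

definition link_mu :: "'v set set \<Rightarrow> nat \<Rightarrow> int \<Rightarrow> 'v set \<Rightarrow> real" where
  "link_mu X n k \<tau> =
     second_eigenvalue (vertices (link X \<tau>)) (simplices (link X \<tau>) 1) (link_weight X n k \<tau>)"

definition simple_walk_mu :: "'v set set \<Rightarrow> real" where
  "simple_walk_mu Y = second_eigenvalue (vertices Y) (simplices Y 1) (\<lambda>_. 1)"

definition one_sided_local_spectral_expander :: "'v set set \<Rightarrow> nat \<Rightarrow> real \<Rightarrow> bool" where
  "one_sided_local_spectral_expander X n l \<longleftrightarrow>
     (\<forall>k\<in>{-1..int n - 2}. \<forall>\<tau>\<in>simplices X k. link_mu X n k \<tau> \<le> l)"

text \<open>A vertex is a pair of a type and a coset, so cosets for different types are distinct
  vertices even if they agree as sets.\<close>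

definition coset_vertices :: "('g, 'm) monoid_scheme \<Rightarrow> ('i \<Rightarrow> 'g set) \<Rightarrow> 'i set \<Rightarrow> ('i \<times> 'g set) set"
  where "coset_vertices G K I = {(i, g <#\<^bsub>G\<^esub> K i) | i g. i \<in> I \<and> g \<in> carrier G}"

definition coset_complex :: "('g, 'm) monoid_scheme \<Rightarrow> ('i \<Rightarrow> 'g set) \<Rightarrow> 'i set \<Rightarrow> ('i \<times> 'g set) set set"
  where "coset_complex G K I = {\<sigma>. finite \<sigma> \<and> \<sigma> \<subseteq> coset_vertices G K I \<and>
     (\<forall>u\<in>\<sigma>. \<forall>v\<in>\<sigma>. u \<noteq> v \<longrightarrow> fst u \<noteq> fst v \<and> snd u \<inter> snd v \<noteq> {})}"

definition simplex_type :: "('i \<times> 'c) set \<Rightarrow> 'i set" where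
  "simplex_type \<sigma> = fst ` \<sigma>"

definition left_mult :: "('g, 'm) monoid_scheme \<Rightarrow> 'g \<Rightarrow> 'i \<times> 'g set \<Rightarrow> 'i \<times> 'g set" where
  "left_mult G g v = (fst v, g <#\<^bsub>G\<^esub> snd v)"

definition semidirect_product ::
  "('g, 'm) monoid_scheme \<Rightarrow> ('h, 'k) monoid_scheme \<Rightarrow> ('h \<Rightarrow> 'g \<Rightarrow> 'g) \<Rightarrow> ('g \<times> 'h) monoid" where
  "semidirect_product G H \<theta> =
     \<lparr>carrier = carrier G \<times> carrier H,
      monoid.mult = (\<lambda>(g, h) (g', h'). (g \<otimes>\<^bsub>G\<^esub> \<theta> h g', h \<otimes>\<^bsub>H\<^esub> h')),
      one = (\<one>\<^bsub>G\<^esub>, \<one>\<^bsub>H\<^esub>)\<rparr>"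

text \<open>\<open>dihedral n\<close> is the dihedral group of order \<open>2 (n + 1)\<close>, acting on \<open>{0, \<dots>, n}\<close>.\<close>

definition cyclically_adjacent :: "nat \<Rightarrow> nat \<Rightarrow> nat \<Rightarrow> bool" where
  "cyclically_adjacent n i j \<longleftrightarrow>
     [int i - int j = 1] (mod int (n + 1)) \<or> [int i - int j = - 1] (mod int (n + 1))"

definition dihedral :: "nat \<Rightarrow> (nat \<Rightarrow> nat) monoid" where
  "dihedral n = BijGroup {..n}
     \<lparr>carrier := {\<rho> \<in> Bij {..n}. \<forall>i\<in>{..n}. \<forall>j\<in>{..n}.
        cyclically_adjacent n i j \<longleftrightarrow> cyclically_adjacent n (\<rho> i) (\<rho> j)}\<rparr>"

text \<open>Here \<open>n\<close> is the largest index: matrices have size \<open>n + 1\<close>, with rows and columns indexed by \<open>0, \<dots>, n\<close>.\<close>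

definition matrix_monoid :: "('r, 'm) ring_scheme \<Rightarrow> nat \<Rightarrow> (nat \<Rightarrow> nat \<Rightarrow> 'r) monoid" where
  "matrix_monoid R n =
     \<lparr>carrier = {..n} \<rightarrow>\<^sub>E ({..n} \<rightarrow>\<^sub>E carrier R),
      monoid.mult = (\<lambda>A B. \<lambda>i\<in>{..n}. \<lambda>j\<in>{..n}. \<Oplus>\<^bsub>R\<^esub>k\<in>{..n}. A i k \<otimes>\<^bsub>R\<^esub> B k j),
      one = (\<lambda>i\<in>{..n}. \<lambda>j\<in>{..n}. if i = j then \<one>\<^bsub>R\<^esub> else \<zero>\<^bsub>R\<^esub>)\<rparr>"

definition elementary :: "('r, 'm) ring_scheme \<Rightarrow> nat \<Rightarrow> nat \<Rightarrow> nat \<Rightarrow> 'r \<Rightarrow> nat \<Rightarrow> nat \<Rightarrow> 'r" where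
  "elementary R n i j r = (\<lambda>k\<in>{..n}. \<lambda>l\<in>{..n}.
     if k = l then \<one>\<^bsub>R\<^esub> else if k = i \<and> l = j then r else \<zero>\<^bsub>R\<^esub>)"

definition EL :: "('r, 'm) ring_scheme \<Rightarrow> nat \<Rightarrow> (nat \<Rightarrow> nat \<Rightarrow> 'r) monoid" where
  "EL R n = subgroup_generated (units_of (matrix_monoid R n))
     {elementary R n i j r | i j r. i \<le> n \<and> j \<le> n \<and> i \<noteq> j \<and> r \<in> carrier R}"

definition K_subgroup :: "('r, 'm) ring_scheme \<Rightarrow> 'r set \<Rightarrow> nat \<Rightarrow> nat \<Rightarrow> (nat \<Rightarrow> nat \<Rightarrow> 'r) set" where
  "K_subgroup R T n i = generate (EL R n)
     {elementary R n j ((j + 1) mod (n + 1)) m | j m. j \<in> {..n} - {i} \<and> m \<in> T}"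

text \<open>\<open>F[t]/(t^s)\<close>; elements are cosets of polynomials.\<close>

definition t_power_ideal :: "'a ring \<Rightarrow> nat \<Rightarrow> (nat \<Rightarrow> 'a) set" where
  "t_power_ideal F s = genideal (UP F) {UnivPoly.up_ring.monom (UP F) \<one>\<^bsub>F\<^esub> s}"

definition trunc_poly_ring :: "'a ring \<Rightarrow> nat \<Rightarrow> (nat \<Rightarrow> 'a) set ring" where
  "trunc_poly_ring F s = UP F Quot t_power_ideal F s"

definition T_set :: "'a ring \<Rightarrow> nat \<Rightarrow> (nat \<Rightarrow> 'a) set set" where
  "T_set F s = {t_power_ideal F s +>\<^bsub>UP F\<^esub>
     (UnivPoly.up_ring.monom (UP F) a 0 \<oplus>\<^bsub>UP F\<^esub> UnivPoly.up_ring.monom (UP F) b 1)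
     | a b. a \<in> carrier F \<and> b \<in> carrier F}"

definition EL_trunc :: "'a ring \<Rightarrow> nat \<Rightarrow> nat \<Rightarrow> (nat \<Rightarrow> nat \<Rightarrow> (nat \<Rightarrow> 'a) set) monoid" where
  "EL_trunc F n s = EL (trunc_poly_ring F s) n"

definition X_complex ::
  "'a ring \<Rightarrow> nat \<Rightarrow> nat \<Rightarrow> (nat \<times> (nat \<Rightarrow> nat \<Rightarrow> (nat \<Rightarrow> 'a) set) set) set set" where
  "X_complex F n s =
     coset_complex (EL_trunc F n s) (K_subgroup (trunc_poly_ring F s) (T_set F s) n) {..n}"

definition finite_field_of_order :: "'a ring \<Rightarrow> nat \<Rightarrow> bool" where
  "finite_field_of_order F q \<longleftrightarrow> field F \<and> finite (carrier F) \<and> card (carrier F) = q"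

text \<open>\<open>\<theta>\<close> is the action of the dihedral group on the group by which the semidirect product is
  formed; it is determined by the embedding \<open>\<Phi>\<close> of the semidirect product.\<close>

definition automorphisms_contain_semidirect ::
  "'a ring \<Rightarrow> nat \<Rightarrow> nat \<Rightarrow> bool" where
  "automorphisms_contain_semidirect F n s \<longleftrightarrow>
     (let X = X_complex F n s; G = EL_trunc F n s; D = dihedral n in
      \<exists>\<theta> \<Phi>. \<theta> \<in> hom D (AutoGroup G) \<and>
        \<Phi> \<in> mon (semidirect_product G D \<theta>) (simplicial_automorphisms X) \<and>
        (\<forall>g\<in>carrier G. \<forall>v\<in>vertices X. \<Phi> (g, \<one>\<^bsub>D\<^esub>) v = left_mult G g v) \<and>
        (\<forall>\<sigma>\<in>simplices X (int n). \<forall>\<sigma>'\<in>simplices X (int n).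
           \<exists>g\<in>carrier G. \<Phi> (g, \<one>\<^bsub>D\<^esub>) ` \<sigma> = \<sigma>') \<and>
        (\<forall>\<rho>\<in>carrier D. \<forall>\<sigma>\<in>X.
           simplex_type (\<Phi> (\<one>\<^bsub>G\<^esub>, \<rho>) ` \<sigma>) = \<rho> ` simplex_type \<sigma>))"

definition X_family :: "'a ring \<Rightarrow> nat \<Rightarrow> (nat \<times> (nat \<Rightarrow> nat \<Rightarrow> (nat \<Rightarrow> 'a) set) set) set set set" where
  "X_family F n = {X_complex F n s | s. s > 2 ^ (n - 1)}"

definition uniformly_locally_finite :: "'v set set set \<Rightarrow> nat \<Rightarrow> bool" where
  "uniformly_locally_finite \<X> n \<longleftrightarrow> (\<exists>B. \<forall>X\<in>\<X>. \<forall>v\<in>vertices X.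
     finite {\<sigma> \<in> simplices X (int n). v \<in> \<sigma>} \<and> card {\<sigma> \<in> simplices X (int n). v \<in> \<sigma>} \<le> B)"

end

theory Submission
  imports Defs
    "Jordan_Normal_Form.Schur_Decomposition"
    "HOL-Analysis.Function_Topology"
    "HOL-Analysis.Convex"
    "HOL-Number_Theory.Residues"
begin

text \<open>Let \<open>P d\<close> be the image in \<open>\<R>\<^sub>s\<close> of the polynomials of degree at most \<open>d\<close>. The group
  \<open>K\<^sub>i\<close> consists of the matrices that are unitriangular for the cyclic order \<open>i + 1, \<dots>, n, 0, \<dots>, i\<close> of
  the indices and whose entry between positions \<open>k < l\<close> lies in \<open>P (l - k)\<close>; this gives its order, and
  elimination shows that every intersection of such groups is generated by the root groups it contains.
  The elements of \<open>K\<^sub>i\<close> factor as a lower times an upper triangular matrix for the order belonging to \<open>k\<close>,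
  both factors lying in \<open>K\<^sub>i\<close>. By uniqueness of this factorisation, pairwise intersecting cosets
  of different types have a common point. So the simplices of type \<open>\<sigma>\<close> are the cosets of the
  intersection \<open>K\<^sub>\<sigma>\<close> of the \<open>K\<^sub>i\<close> with \<open>i \<in> \<sigma>\<close>, and the geometric properties follow.

  A one-dimensional link is the coset graph of \<open>K\<^sub>\<sigma>\<close> for two root groups, which either commute, giving a
  complete bipartite graph, or generate a Heisenberg group over \<open>T = P 1\<close>. In the latter case the bound
  \<open>1/\<surd>q\<close> for the graph reduces to the fact that the averages over the translates of the lines \<open>T d\<close> in
  \<open>P 2\<close>, one for each line, are mutually orthogonal projections on the functions of mean zero; this holds
  because any two distinct lines together span \<open>P 2\<close>. Oppenheim's trickle-down argument then
  propagates the bound to all links, \<open>\<lambda>\<close> becoming \<open>\<lambda>/(1 - \<lambda>)\<close> at each step.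

  Rotations of the types act on the group by permuting indices, reflections by permuting indices
  and taking the inverse transpose.\<close>

section \<open>Coset complexes\<close>

text \<open>The groups for different types share one filtration for a simple reason: in every cyclic
  order in which k precedes l, the distance from k to l is the residue of l - k modulo n + 1. The
  condition on the entry (k, l) therefore never depends on the order, and this keeps triangular
  factors and clearing matrices inside all the groups concerned. The eigenvalue in question is
  defined as the second root of a characteristic polynomial, which does not interact with links.
  Everything is therefore proved for Poincare inequalities on functions of mean zero, which can be
  summed over links, and translated only once by a min-max argument. Chambers of a link are treated
  as hyperedges, because counting them reproduces the prescribed edge weights. The constant 1/sqrt q
  arises as q^(3/2) / q^2, the norm of the incidence operator on functions of mean zero divided by
  the degree. Iterating \<lambda> / (1 - \<lambda>) from there gives 1/(sqrt q - m) after m steps;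
  at most n - 1 steps occur, whence q > (n - 1)^2. The hypothesis s > n keeps all distances between
  indices below the truncation degree.\<close>

definition meet_subgroup :: "('g, 'm) monoid_scheme \<Rightarrow> ('i \<Rightarrow> 'g set) \<Rightarrow> 'i set \<Rightarrow> 'g set" where
  "meet_subgroup G K \<sigma> = {g \<in> carrier G. \<forall>i\<in>\<sigma>. g \<in> K i}"

definition face :: "('g, 'm) monoid_scheme \<Rightarrow> ('i \<Rightarrow> 'g set) \<Rightarrow> 'g \<Rightarrow> 'i set \<Rightarrow> ('i \<times> 'g set) set" where
  "face G K g \<sigma> = (\<lambda>i. (i, g <#\<^bsub>G\<^esub> K i)) ` \<sigma>"

text \<open>\<open>clique_lift\<close> says that a coset of \<open>K k\<close> that meets every
  \<open>K i\<close> with i \<in> \<sigma> meets their intersection; it is the induction step for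
  finding a common point of a clique. \<open>meet_generated\<close> yields galleries,
  \<open>meet_all\<close> makes the action on chambers free, and \<open>meet_nontrivial\<close>
  provides a second chamber on every panel. Since \<open>meet_subgroup\<close> asks for membership
  in \<open>carrier G\<close>, the empty set of types gives the whole group, so the complex itself
  is handled as the link of the empty face.\<close>

locale coset_geometry = group G for G (structure) +
  fixes n :: nat and K :: "nat \<Rightarrow> 'a set"
  assumes finite_carrier: "finite (carrier G)"
    and subgroup_K: "i \<le> n \<Longrightarrow> subgroup (K i) G"
    and clique_lift: "\<lbrakk>k \<le> n; \<sigma> \<subseteq> {..n} - {k}; h \<in> carrier G; \<forall>i\<in>\<sigma>. h \<in> K i <#> K k\<rbrakk>
      \<Longrightarrow> \<exists>a\<in>meet_subgroup G K \<sigma>. h \<in> a <#\<^bsub>G\<^esub> K k"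
    and meet_generated: "\<sigma> \<subseteq> {..n} \<Longrightarrow>
      meet_subgroup G K \<sigma> \<subseteq> generate G (\<Union>j\<in>{..n} - \<sigma>. meet_subgroup G K ({..n} - {j}))"
    and meet_all: "meet_subgroup G K {..n} = {\<one>}"
    and meet_nontrivial: "j \<le> n \<Longrightarrow> meet_subgroup G K ({..n} - {j}) \<noteq> {\<one>}"
begin

abbreviation "KK \<equiv> meet_subgroup G K"
abbreviation "F \<equiv> face G K"
abbreviation "X \<equiv> coset_complex G K {..n}"

lemma subgroup_KK: "\<sigma> \<subseteq> {..n} \<Longrightarrow> subgroup (KK \<sigma>) G"
proof (unfold_locales, goal_cases)
  case 1 then show ?case by (auto simp: meet_subgroup_def)
next
  case (2 x y) then show ?case
    by (auto simp: meet_subgroup_def intro!: subgroup.m_closed[OF subgroup_K])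
next
  case 3 then show ?case
    by (auto simp: meet_subgroup_def intro!: subgroup.one_closed[OF subgroup_K])
next
  case (4 x) then show ?case
    by (auto simp: meet_subgroup_def intro!: subgroup.m_inv_closed[OF subgroup_K])
qed

lemma KK_carrier: "x \<in> KK \<sigma> \<Longrightarrow> x \<in> carrier G"
  by (simp add: meet_subgroup_def)

lemma KK_anti: "\<sigma> \<subseteq> \<tau> \<Longrightarrow> KK \<tau> \<subseteq> KK \<sigma>"
  by (auto simp: meet_subgroup_def)

lemma KK_Un: "x \<in> KK \<sigma> \<Longrightarrow> x \<in> KK \<tau> \<Longrightarrow> x \<in> KK (\<sigma> \<union> \<tau>)"
  by (auto simp: meet_subgroup_def)

lemma KK_singleton: "i \<le> n \<Longrightarrow> KK {i} = K i"
  using subgroup.mem_carrier[OF subgroup_K] by (auto simp: meet_subgroup_def)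

lemma K_carrier: "i \<le> n \<Longrightarrow> x \<in> K i \<Longrightarrow> x \<in> carrier G"
  using subgroup.mem_carrier[OF subgroup_K] by blast

lemma inv_mult_cancel: "g \<in> carrier G \<Longrightarrow> h \<in> carrier G \<Longrightarrow> inv g \<otimes> (g \<otimes> h) = h"
  using m_assoc[of "inv g" g h] by simp

lemma mult_inv_cancel: "g \<in> carrier G \<Longrightarrow> h \<in> carrier G \<Longrightarrow> g \<otimes> (inv g \<otimes> h) = h"
  using m_assoc[of g "inv g" h] by simp

lemma mem_coset_iff:
  assumes "subgroup H G" "g \<in> carrier G"
  shows "x \<in> g <#\<^bsub>G\<^esub> H \<longleftrightarrow> x \<in> carrier G \<and> inv g \<otimes> x \<in> H"
proof
  assume "x \<in> g <#\<^bsub>G\<^esub> H"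
  then obtain h where h: "h \<in> H" "x = g \<otimes> h" by (auto simp: l_coset_def)
  then have "h \<in> carrier G" using subgroup.mem_carrier[OF assms(1)] by simp
  then show "x \<in> carrier G \<and> inv g \<otimes> x \<in> H" using h assms(2) by (simp add: inv_mult_cancel)
next
  assume x: "x \<in> carrier G \<and> inv g \<otimes> x \<in> H"
  then have "x = g \<otimes> (inv g \<otimes> x)" using assms(2) by (simp add: mult_inv_cancel)
  then show "x \<in> g <#\<^bsub>G\<^esub> H" using x unfolding l_coset_def by blast
qed

lemma coset_eq_iff:
  assumes "subgroup H G" "g \<in> carrier G" "h \<in> carrier G"
  shows "g <#\<^bsub>G\<^esub> H = h <#\<^bsub>G\<^esub> H \<longleftrightarrow> inv g \<otimes> h \<in> H"
proof
  assume "g <#\<^bsub>G\<^esub> H = h <#\<^bsub>G\<^esub> H"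
  moreover have "h \<in> h <#\<^bsub>G\<^esub> H" using assms(1,3) subgroup.one_closed[OF assms(1)] by (simp add: mem_coset_iff)
  ultimately show "inv g \<otimes> h \<in> H" using mem_coset_iff[OF assms(1,2)] by blast
next
  assume "inv g \<otimes> h \<in> H"
  then have "h \<in> g <#\<^bsub>G\<^esub> H" using assms by (simp add: mem_coset_iff)
  then show "g <#\<^bsub>G\<^esub> H = h <#\<^bsub>G\<^esub> H" using l_repr_independence assms by blast
qed

section \<open>Faces as cosets of the intersection groups\<close>

lemma F_eq_iff:
  assumes "\<sigma> \<subseteq> {..n}" "g \<in> carrier G" "h \<in> carrier G"
  shows "F g \<sigma> = F h \<sigma> \<longleftrightarrow> inv g \<otimes> h \<in> KK \<sigma>"
proof -
  have "F g \<sigma> = F h \<sigma> \<longleftrightarrow> (\<forall>i\<in>\<sigma>. g <#\<^bsub>G\<^esub> K i = h <#\<^bsub>G\<^esub> K i)"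
    by (auto simp: face_def image_iff set_eq_iff[of "_ ` _"])
  also have "\<dots> \<longleftrightarrow> (\<forall>i\<in>\<sigma>. inv g \<otimes> h \<in> K i)"
    using assms by (intro ball_cong) (simp_all add: coset_eq_iff subgroup_K subset_iff)
  finally show ?thesis using assms by (auto simp: meet_subgroup_def)
qed

lemma F_subset_iff:
  assumes "\<sigma> \<subseteq> {..n}" "g \<in> carrier G" "h \<in> carrier G"
  shows "F g \<sigma> \<subseteq> F h \<tau> \<longleftrightarrow> \<sigma> \<subseteq> \<tau> \<and> inv g \<otimes> h \<in> KK \<sigma>"
proof -
  have "F g \<sigma> \<subseteq> F h \<tau> \<longleftrightarrow> \<sigma> \<subseteq> \<tau> \<and> F g \<sigma> = F h \<sigma>"
    unfolding face_def by fastforce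
  then show ?thesis using F_eq_iff[OF assms] by simp
qed

lemma card_F: "card (F g \<sigma>) = card \<sigma>"
  unfolding face_def by (intro card_image) (auto simp: inj_on_def)

lemma fst_F: "fst ` F g \<sigma> = \<sigma>"
  unfolding face_def by force

lemma F_mult:
  assumes "\<sigma> \<subseteq> {..n}" "g \<in> carrier G" "x \<in> KK \<sigma>"
  shows "F (g \<otimes> x) \<sigma> = F g \<sigma>"
  using F_eq_iff[of \<sigma> g "g \<otimes> x"] assms KK_carrier[OF assms(3)] by (simp add: inv_mult_cancel mult_inv_cancel)

lemma F_in_X:
  assumes "\<sigma> \<subseteq> {..n}" "g \<in> carrier G"
  shows "F g \<sigma> \<in> X"
proof -
  have g: "g \<in> g <#\<^bsub>G\<^esub> K i" if "i \<le> n" for i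
    using that assms subgroup.one_closed[OF subgroup_K[OF that]] by (simp add: mem_coset_iff subgroup_K)
  have "finite (F g \<sigma>)" using finite_subset[OF assms(1)] unfolding face_def by simp
  moreover have "F g \<sigma> \<subseteq> coset_vertices G K {..n}"
    using assms unfolding coset_vertices_def face_def by blast
  moreover have "fst u \<noteq> fst v \<and> snd u \<inter> snd v \<noteq> {}" if uv: "u \<in> F g \<sigma>" "v \<in> F g \<sigma>" "u \<noteq> v" for u v
  proof -
    obtain i j where "u = (i, g <#\<^bsub>G\<^esub> K i)" "v = (j, g <#\<^bsub>G\<^esub> K j)" "i \<in> \<sigma>" "j \<in> \<sigma>"
      using uv(1,2) unfolding face_def by blast
    then show ?thesis using g[of i] g[of j] assms(1) uv(3) by auto
  qed
  ultimately show ?thesis unfolding coset_complex_def by simp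
qed

lemma X_down: "\<sigma> \<in> X \<Longrightarrow> \<tau> \<subseteq> \<sigma> \<Longrightarrow> \<tau> \<in> X"
  unfolding coset_complex_def using finite_subset by blast

text \<open>Induction on the number of vertices. If the vertices so far are cosets of a common point
  g, translation by the inverse of g turns the new coset into one that meets each
  \<open>K i\<close>. Then \<open>clique_lift\<close> corrects g by an element of
  \<open>KK \<sigma>\<close>, which leaves the old cosets unchanged, to a point that lies in the new
  coset as well.\<close>

lemma X_eq_F:
  assumes "s \<in> X"
  shows "\<exists>g\<in>carrier G. \<exists>\<sigma>\<subseteq>{..n}. s = F g \<sigma>"
proof -
  have "finite s" using assms by (simp add: coset_complex_def)
  then show ?thesis using assms
  proof (induction s)
    case empty
    then show ?case by (intro bexI[of _ \<one>] exI[of _ "{}"]) (auto simp: face_def)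
  next
    case (insert v s)
    have "s \<in> X" using X_down[OF insert.prems] by blast
    then obtain g \<sigma> where g: "g \<in> carrier G" "\<sigma> \<subseteq> {..n}" "s = F g \<sigma>" using insert.IH by blast
    obtain k h where v: "v = (k, h <#\<^bsub>G\<^esub> K k)" "k \<le> n" "h \<in> carrier G"
      using insert.prems unfolding coset_complex_def coset_vertices_def by auto
    have fst_ne: "i \<noteq> k \<and> (g <#\<^bsub>G\<^esub> K i) \<inter> (h <#\<^bsub>G\<^esub> K k) \<noteq> {}" if "i \<in> \<sigma>" for i
    proof -
      have "(i, g <#\<^bsub>G\<^esub> K i) \<in> s" using g that by (auto simp: face_def)
      moreover from this have "(i, g <#\<^bsub>G\<^esub> K i) \<noteq> v" using insert.hyps(2) by metis
      moreover have "\<forall>u\<in>insert v s. \<forall>w\<in>insert v s. u \<noteq> w \<longrightarrow> fst u \<noteq> fst w \<and> snd u \<inter> snd w \<noteq> {}"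
        using insert.prems unfolding coset_complex_def by simp
      ultimately have "fst (i, g <#\<^bsub>G\<^esub> K i) \<noteq> fst v \<and> snd (i, g <#\<^bsub>G\<^esub> K i) \<inter> snd v \<noteq> {}"
        by (meson insertI1 insertI2)
      then show ?thesis using v by simp
    qed
    have gh: "inv g \<otimes> h \<in> K i <#> K k" if "i \<in> \<sigma>" for i
    proof -
      have i: "i \<le> n" using that g by auto
      obtain x where "x \<in> g <#\<^bsub>G\<^esub> K i" "x \<in> h <#\<^bsub>G\<^esub> K k" using fst_ne[OF \<open>i \<in> \<sigma>\<close>] by blast
      then have x: "x \<in> carrier G" "inv g \<otimes> x \<in> K i" "inv h \<otimes> x \<in> K k"
        using mem_coset_iff subgroup_K i v g by auto
      have "inv g \<otimes> h = (inv g \<otimes> x) \<otimes> inv (inv h \<otimes> x)"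
        using x g v by (metis inv_closed inv_inv inv_mult_group inv_solve_right m_assoc m_closed r_inv l_inv r_one l_one)
      moreover have "inv (inv h \<otimes> x) \<in> K k"
        using subgroup.m_inv_closed[OF subgroup_K] x v by blast
      ultimately show ?thesis using x unfolding set_mult_def by blast
    qed
    have "k \<notin> \<sigma>" using fst_ne by metis
    then have \<sigma>k: "\<sigma> \<subseteq> {..n} - {k}" using g(2) by blast
    obtain a where a: "a \<in> KK \<sigma>" "inv g \<otimes> h \<in> a <#\<^bsub>G\<^esub> K k"
      using clique_lift[OF v(2) \<sigma>k, of "inv g \<otimes> h"] v(3) g(1) gh by auto
    have ac: "a \<in> carrier G" using a KK_carrier by blast
    have "inv (g \<otimes> a) \<otimes> h \<in> K k"
      using a(2) ac v g by (simp add: mem_coset_iff subgroup_K inv_mult_group m_assoc)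
    then have "(g \<otimes> a) <#\<^bsub>G\<^esub> K k = h <#\<^bsub>G\<^esub> K k" using coset_eq_iff[of "K k" "g \<otimes> a" h] subgroup_K v g ac by auto
    then have "insert v s = F (g \<otimes> a) (insert k \<sigma>)"
      using F_mult[OF g(2,1) a(1)] g v by (simp add: face_def)
    then show ?case using g ac v by (intro bexI[of _ "g \<otimes> a"] exI[of _ "insert k \<sigma>"]) auto
  qed
qed

lemma simplices_X_cases:
  assumes "s \<in> simplices X k"
  obtains g \<sigma> where "g \<in> carrier G" "\<sigma> \<subseteq> {..n}" "s = F g \<sigma>" "int (card \<sigma>) = k + 1"
proof -
  have s: "s \<in> X" "int (card s) = k + 1" using assms by (auto simp: simplices_def)
  then obtain g \<sigma> where "g \<in> carrier G" "\<sigma> \<subseteq> {..n}" "s = F g \<sigma>" using X_eq_F by blast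
  then show thesis using that[of g \<sigma>] s(2) card_F by simp
qed

lemma finite_X: "finite X"
proof -
  have "X \<subseteq> (\<lambda>(g, \<sigma>). F g \<sigma>) ` (carrier G \<times> Pow {..n})"
  proof
    fix s assume "s \<in> X"
    then obtain g \<sigma> where "g \<in> carrier G" "\<sigma> \<subseteq> {..n}" "s = F g \<sigma>" using X_eq_F by blast
    then show "s \<in> (\<lambda>(g, \<sigma>). F g \<sigma>) ` (carrier G \<times> Pow {..n})"
      by (intro image_eqI[of _ _ "(g, \<sigma>)"]) auto
  qed
  then show ?thesis by (rule finite_subset) (simp add: finite_carrier)
qed

section \<open>Purity, partition by types, and chambers\<close>

lemma simplicial_complex_X: "simplicial_complex X"
  unfolding simplicial_complex_def
proof (intro conjI ballI allI impI)
  show "{} \<in> X" by (simp add: coset_complex_def)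
  show "finite \<sigma>" if "\<sigma> \<in> X" for \<sigma> using that by (simp add: coset_complex_def)
qed (rule X_down)

lemma vertices_X: "vertices X = coset_vertices G K {..n}"
proof -
  have "{v} \<in> X" if "v \<in> coset_vertices G K {..n}" for v
    using that by (auto simp: coset_complex_def)
  then show ?thesis unfolding vertices_def by (auto simp: coset_complex_def)
qed

lemma clique_complex_X: "clique_complex X"
proof -
  have "fst u \<noteq> fst v \<and> snd u \<inter> snd v \<noteq> {}" if "{u, v} \<in> X" "u \<noteq> v" for u v
    using that by (auto simp: coset_complex_def)
  then show ?thesis unfolding clique_complex_def vertices_X using simplicial_complex_X
    by (simp add: coset_complex_def)
qed

lemma top_simplices_X: "simplices X (int n) = (\<lambda>g. F g {..n}) ` carrier G"
proof -
  have "s \<in> simplices X (int n) \<longleftrightarrow> (\<exists>g\<in>carrier G. s = F g {..n})" for s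
  proof
    assume "s \<in> simplices X (int n)"
    then obtain g \<sigma> where g: "g \<in> carrier G" "\<sigma> \<subseteq> {..n}" "s = F g \<sigma>" "card s = n + 1"
      using X_eq_F unfolding simplices_def by force
    then have "\<sigma> = {..n}" by (intro card_subset_eq) (auto simp: card_F)
    then show "\<exists>g\<in>carrier G. s = F g {..n}" using g by blast
  next
    assume "\<exists>g\<in>carrier G. s = F g {..n}"
    then show "s \<in> simplices X (int n)" using F_in_X
      by (auto simp: simplices_def card_F) (simp add: face_def)
  qed
  then show ?thesis by auto
qed

lemma pure_X: "pure_dim X (int n)"
  unfolding pure_dim_def
proof
  fix s assume "s \<in> X"
  then obtain g \<sigma> where g: "g \<in> carrier G" "\<sigma> \<subseteq> {..n}" "s = F g \<sigma>" using X_eq_F by blast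
  then have "s \<subseteq> F g {..n}" by (auto simp: face_def)
  then show "\<exists>\<tau>\<in>simplices X (int n). s \<subseteq> \<tau>" using top_simplices_X g by blast
qed

lemma partite_X: "partite X n"
  unfolding partite_def
proof (intro exI[of _ "\<lambda>i. {v \<in> vertices X. fst v = i}"] conjI ballI)
  show "(\<Union>i\<in>{..n}. {v \<in> vertices X. fst v = i}) = vertices X"
    by (auto simp: vertices_X coset_vertices_def)
  show "disjoint_family_on (\<lambda>i. {v \<in> vertices X. fst v = i}) {..n}"
    by (auto simp: disjoint_family_on_def)
next
  fix s i assume s: "s \<in> simplices X (int n)" and i: "i \<in> {..n}"
  then obtain g where g: "g \<in> carrier G" "s = F g {..n}" unfolding top_simplices_X by (elim imageE)
  have "s \<subseteq> vertices X" using s by (auto simp: simplices_def vertices_def)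
  then have "s \<inter> {v \<in> vertices X. fst v = i} = {(i, g <#\<^bsub>G\<^esub> K i)}"
    using g i by (auto simp: face_def)
  then show "card (s \<inter> {v \<in> vertices X. fst v = i}) = 1" by simp
qed

lemma inj_chamber: "inj_on (\<lambda>g. F g {..n}) (carrier G)"
proof (rule inj_onI)
  fix g h assume gh: "g \<in> carrier G" "h \<in> carrier G" "F g {..n} = F h {..n}"
  then have "inv g \<otimes> h = \<one>" using F_eq_iff[of "{..n}" g h] meet_all by auto
  then show "g = h" using gh by (metis inv_closed inv_equality inv_inv)
qed

text \<open>Chambers correspond to group elements, and two of them share the face of type \<sigma>
  exactly when the elements differ on the right by \<open>KK \<sigma>\<close>.\<close>

lemma chambers_containing:
  assumes "\<sigma> \<subseteq> {..n}" "g \<in> carrier G"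
  shows "{s \<in> simplices X (int n). F g \<sigma> \<subseteq> s} = (\<lambda>x. F (g \<otimes> x) {..n}) ` KK \<sigma>"
proof (intro equalityI subsetI)
  fix s assume "s \<in> {s \<in> simplices X (int n). F g \<sigma> \<subseteq> s}"
  then have "s \<in> simplices X (int n)" and sub: "F g \<sigma> \<subseteq> s" by simp_all
  then obtain h where h: "h \<in> carrier G" "s = F h {..n}" unfolding top_simplices_X by (elim imageE)
  then have "F g \<sigma> \<subseteq> F h {..n}" using sub by simp
  then have "inv g \<otimes> h \<in> KK \<sigma>" using F_subset_iff[OF assms h(1), of "{..n}"] by metis
  moreover have "h = g \<otimes> (inv g \<otimes> h)" using h assms by (simp add: inv_mult_cancel mult_inv_cancel)
  ultimately show "s \<in> (\<lambda>x. F (g \<otimes> x) {..n}) ` KK \<sigma>" using h(2) by (metis imageI)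
next
  fix s assume "s \<in> (\<lambda>x. F (g \<otimes> x) {..n}) ` KK \<sigma>"
  then obtain x where x: "x \<in> KK \<sigma>" "s = F (g \<otimes> x) {..n}" by blast
  then have xc: "x \<in> carrier G" using KK_carrier by blast
  have "F g \<sigma> = F (g \<otimes> x) \<sigma>" using F_mult[OF assms x(1)] by simp
  also have "\<dots> \<subseteq> s" using x assms by (auto simp: face_def)
  finally show "s \<in> {s \<in> simplices X (int n). F g \<sigma> \<subseteq> s}" using x xc assms top_simplices_X by auto
qed

lemma inj_chambers_containing:
  assumes "\<sigma> \<subseteq> {..n}" "g \<in> carrier G"
  shows "inj_on (\<lambda>x. F (g \<otimes> x) {..n}) (KK \<sigma>)"
proof (rule inj_onI)
  fix x y assume xy: "x \<in> KK \<sigma>" "y \<in> KK \<sigma>" "F (g \<otimes> x) {..n} = F (g \<otimes> y) {..n}"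
  then have c: "x \<in> carrier G" "y \<in> carrier G" using KK_carrier by auto
  then have "g \<otimes> x = g \<otimes> y" using inj_onD[OF inj_chamber xy(3)] assms by auto
  then show "x = y" using c assms by simp
qed

lemma card_chambers_containing:
  assumes "\<sigma> \<subseteq> {..n}" "g \<in> carrier G"
  shows "card {s \<in> simplices X (int n). F g \<sigma> \<subseteq> s} = card (KK \<sigma>)"
  unfolding chambers_containing[OF assms] by (rule card_image[OF inj_chambers_containing[OF assms]])

lemma card_chambers_at_vertex:
  assumes "v \<in> vertices X"
  shows "card {s \<in> simplices X (int n). v \<in> s} = card (K (fst v))" "fst v \<le> n"
proof -
  obtain i g where v: "v = (i, g <#\<^bsub>G\<^esub> K i)" "i \<le> n" "g \<in> carrier G"
    using assms by (auto simp: vertices_X coset_vertices_def)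
  have "{s \<in> simplices X (int n). v \<in> s} = {s \<in> simplices X (int n). F g {i} \<subseteq> s}"
    using v by (auto simp: face_def)
  then show "card {s \<in> simplices X (int n). v \<in> s} = card (K (fst v))"
    using card_chambers_containing[of "{i}" g] v KK_singleton by simp
  show "fst v \<le> n" using v by simp
qed

text \<open>A face that is not a chamber misses some type j. Right multiplication by a nontrivial
  element common to all \<open>K i\<close> with i \<noteq> j keeps the face and changes the
  chamber.\<close>

lemma no_free_face: "\<not> free_face X n \<sigma>"
proof
  assume f: "free_face X n \<sigma>"
  then have "\<sigma> \<in> X" "card \<sigma> \<le> n" unfolding free_face_def by simp_all
  then obtain g \<tau> where g: "g \<in> carrier G" "\<tau> \<subseteq> {..n}" "\<sigma> = F g \<tau>" "card \<tau> \<le> n"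
    using X_eq_F card_F by metis
  then have "\<tau> \<noteq> {..n}" by auto
  then obtain j where j: "j \<le> n" "j \<notin> \<tau>" using g(2) by auto
  obtain x where x: "x \<in> KK ({..n} - {j})" "x \<noteq> \<one>"
    using meet_nontrivial[OF j(1)] subgroup.one_closed[OF subgroup_KK[of "{..n} - {j}"]] by auto
  have x': "x \<in> KK \<tau>" using x KK_anti[of \<tau> "{..n} - {j}"] g j by blast
  have one: "\<one> \<in> KK \<tau>" using subgroup.one_closed[OF subgroup_KK[OF g(2)]] .
  have "F (g \<otimes> y) {..n} \<in> simplices X (int n) \<and> F g \<tau> \<subseteq> F (g \<otimes> y) {..n}" if "y \<in> KK \<tau>" for y
  proof -
    have "F (g \<otimes> y) {..n} \<in> {s \<in> simplices X (int n). F g \<tau> \<subseteq> s}"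
      using that unfolding chambers_containing[OF g(2,1)] by (rule imageI)
    then show ?thesis by simp
  qed
  moreover have "\<exists>!t. t \<in> simplices X (int n) \<and> F g \<tau> \<subseteq> t"
    using f g(3) unfolding free_face_def by simp
  ultimately have "F (g \<otimes> x) {..n} = F (g \<otimes> \<one>) {..n}" using x' one by (metis (no_types))
  then show False using inj_onD[OF inj_chambers_containing[OF g(2,1)] _ x' one] x(2) by blast
qed

section \<open>Links and galleries\<close>

lemma link_F:
  assumes "\<sigma> \<subseteq> {..n}" "g \<in> carrier G"
  shows "link X (F g \<sigma>) = {F (g \<otimes> x) \<tau> | x \<tau>. x \<in> KK \<sigma> \<and> \<tau> \<subseteq> {..n} - \<sigma>}"
proof (intro equalityI subsetI)
  fix \<eta> assume "\<eta> \<in> link X (F g \<sigma>)"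
  then have \<eta>: "\<eta> \<inter> F g \<sigma> = {}" "\<eta> \<union> F g \<sigma> \<in> X" by (auto simp: link_def)
  obtain h \<tau> where h: "h \<in> carrier G" "\<tau> \<subseteq> {..n}" "\<eta> \<union> F g \<sigma> = F h \<tau>" using X_eq_F[OF \<eta>(2)] by blast
  \<comment> \<open>A face that contains \<open>F g \<sigma>\<close> has a representative differing
    from g by an element of \<open>KK \<sigma>\<close>; this parametrises the link.\<close>
  then have sub: "\<sigma> \<subseteq> \<tau>" "inv g \<otimes> h \<in> KK \<sigma>" using F_subset_iff[OF assms h(1), of \<tau>] by blast+
  have hg: "g \<otimes> (inv g \<otimes> h) = h" using h assms by (simp add: inv_mult_cancel mult_inv_cancel)
  have "F g \<sigma> = F h \<sigma>" using F_eq_iff[OF assms h(1)] sub by blast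
  then have "\<eta> = F h \<tau> - F h \<sigma>" using \<eta>(1) h(3) by auto
  also have "\<dots> = F h (\<tau> - \<sigma>)" by (auto simp: face_def)
  finally show "\<eta> \<in> {F (g \<otimes> x) \<tau> | x \<tau>. x \<in> KK \<sigma> \<and> \<tau> \<subseteq> {..n} - \<sigma>}"
    using sub(2) h(2) hg by (intro CollectI exI[of _ "inv g \<otimes> h"] exI[of _ "\<tau> - \<sigma>"]) auto
next
  fix \<eta> assume "\<eta> \<in> {F (g \<otimes> x) \<tau> | x \<tau>. x \<in> KK \<sigma> \<and> \<tau> \<subseteq> {..n} - \<sigma>}"
  then obtain x \<tau> where x: "\<eta> = F (g \<otimes> x) \<tau>" "x \<in> KK \<sigma>" "\<tau> \<subseteq> {..n} - \<sigma>" by blast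
  have e: "F g \<sigma> = F (g \<otimes> x) \<sigma>" using F_mult[OF assms x(2)] by simp
  have "\<eta> \<inter> F g \<sigma> = {}" using x unfolding face_def by auto
  moreover have "\<eta> \<union> F g \<sigma> = F (g \<otimes> x) (\<tau> \<union> \<sigma>)" unfolding e x(1) by (auto simp: face_def)
  moreover have "F (g \<otimes> x) (\<tau> \<union> \<sigma>) \<in> X" using F_in_X[of "\<tau> \<union> \<sigma>" "g \<otimes> x"] x assms KK_carrier by auto
  ultimately show "\<eta> \<in> link X (F g \<sigma>)" by (simp add: link_def)
qed

lemma top_simplices_link:
  assumes "\<sigma> \<subseteq> {..n}" "g \<in> carrier G"
  shows "simplices (link X (F g \<sigma>)) (int n - int (card \<sigma>)) = (\<lambda>x. F (g \<otimes> x) ({..n} - \<sigma>)) ` KK \<sigma>"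
proof (intro equalityI subsetI)
  have fs: "finite \<sigma>" using assms by (metis finite_subset finite_atMost)
  have cd: "int (card ({..n} - \<sigma>)) = int n - int (card \<sigma>) + 1"
    using assms fs card_mono[of "{..n}" \<sigma>] by (subst card_Diff_subset) auto
  {
    fix s assume "s \<in> simplices (link X (F g \<sigma>)) (int n - int (card \<sigma>))"
    then obtain x \<tau> where x: "s = F (g \<otimes> x) \<tau>" "x \<in> KK \<sigma>" "\<tau> \<subseteq> {..n} - \<sigma>" "card \<tau> = card ({..n} - \<sigma>)"
      unfolding simplices_def link_F[OF assms] using cd by (auto simp: card_F)
    then have "\<tau> = {..n} - \<sigma>" by (intro card_subset_eq) auto
    then show "s \<in> (\<lambda>x. F (g \<otimes> x) ({..n} - \<sigma>)) ` KK \<sigma>" using x by auto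
  next
    fix s assume "s \<in> (\<lambda>x. F (g \<otimes> x) ({..n} - \<sigma>)) ` KK \<sigma>"
    then obtain x where x: "x \<in> KK \<sigma>" "s = F (g \<otimes> x) ({..n} - \<sigma>)" by auto
    then show "s \<in> simplices (link X (F g \<sigma>)) (int n - int (card \<sigma>))"
      unfolding simplices_def link_F[OF assms] using cd
      by (auto simp: card_F) (simp add: face_def)
  }
qed

text \<open>Right multiplication by an element of all \<open>K i\<close> with i \<noteq> j changes
  at most the vertex of type j of a chamber. A word in such elements is therefore a gallery, and
  \<open>meet_generated\<close> provides a word between any two chambers of the link.\<close>

lemma link_gallery_connected:
  assumes s: "\<sigma> \<subseteq> {..n}" and g: "g \<in> carrier G"
  shows "gallery_connected (link X (F g \<sigma>)) (int n - int (card \<sigma>))"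
proof -
  define d where "d = int n - int (card \<sigma>)"
  define C where "C x = F (g \<otimes> x) ({..n} - \<sigma>)" for x
  define R where "R = {(\<alpha>, \<beta>). \<alpha> \<in> simplices (link X (F g \<sigma>)) d \<and> \<beta> \<in> simplices (link X (F g \<sigma>)) d \<and>
                         \<alpha> \<inter> \<beta> \<in> simplices (link X (F g \<sigma>)) (d - 1)}"
  have top: "simplices (link X (F g \<sigma>)) d = C ` KK \<sigma>"
    unfolding d_def C_def by (rule top_simplices_link[OF s g])
  note sg = subgroup_KK[OF s]
  have fs: "finite \<sigma>" using s by (metis finite_subset finite_atMost)
  have step: "(C x, C (x \<otimes> y)) \<in> R\<^sup>*"
    if x: "x \<in> KK \<sigma>" and j: "j \<in> {..n} - \<sigma>" and y: "y \<in> KK ({..n} - {j})" for x y j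
  proof (cases "y = \<one>")
    case True
    then show ?thesis using x KK_carrier by simp
  next
    case False
    have xc: "x \<in> carrier G" "y \<in> carrier G" using x y KK_carrier by auto
    have y': "y \<in> KK \<sigma>" using y KK_anti[of \<sigma> "{..n} - {j}"] j s by blast
    have xy: "x \<otimes> y \<in> KK \<sigma>" using x y' subgroup.m_closed[OF sg] by blast
    \<comment> \<open>Otherwise y would lie in every \<open>K i\<close> and be trivial; so the
      vertex of type j really changes.\<close>
    have ynj: "y \<notin> K j"
    proof
      assume "y \<in> K j"
      then have "y \<in> KK {..n}" using y j by (auto simp: meet_subgroup_def)
      then show False using meet_all False by blast
    qed
    have e: "g \<otimes> x <#\<^bsub>G\<^esub> K i = g \<otimes> (x \<otimes> y) <#\<^bsub>G\<^esub> K i \<longleftrightarrow> i \<noteq> j" if "i \<le> n" for i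
    proof -
      have "g \<otimes> x <#\<^bsub>G\<^esub> K i = g \<otimes> (x \<otimes> y) <#\<^bsub>G\<^esub> K i \<longleftrightarrow> inv (g \<otimes> x) \<otimes> (g \<otimes> (x \<otimes> y)) \<in> K i"
        using xc g that by (intro coset_eq_iff subgroup_K) auto
      also have "inv (g \<otimes> x) \<otimes> (g \<otimes> (x \<otimes> y)) = y" using xc g
        by (metis m_assoc inv_closed l_inv l_one m_closed)
      finally show ?thesis using ynj y that by (auto simp: meet_subgroup_def)
    qed
    have "C x \<inter> C (x \<otimes> y) = F (g \<otimes> x) ({..n} - \<sigma> - {j})"
      using e unfolding C_def face_def by auto
    moreover have "F (g \<otimes> x) ({..n} - \<sigma> - {j}) \<in> link X (F g \<sigma>)"
      using x unfolding link_F[OF s g] by blast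
    moreover have "int (card ({..n} - \<sigma> - {j})) = d"
    proof -
      have "card (insert j \<sigma>) = card \<sigma> + 1" using j fs by simp
      moreover have "card (insert j \<sigma>) \<le> card {..n}" using j s by (intro card_mono) auto
      moreover have "card ({..n} - insert j \<sigma>) = card {..n} - card (insert j \<sigma>)"
        using j s fs by (intro card_Diff_subset) auto
      moreover have "{..n} - \<sigma> - {j} = {..n} - insert j \<sigma>" by auto
      ultimately show ?thesis unfolding d_def by simp
    qed
    ultimately have "C x \<inter> C (x \<otimes> y) \<in> simplices (link X (F g \<sigma>)) (d - 1)"
      by (auto simp: simplices_def card_F) (simp add: face_def)
    then have "(C x, C (x \<otimes> y)) \<in> R" using x xy top unfolding R_def by auto
    then show ?thesis by blast
  qed
  let ?S = "\<Union>j\<in>{..n} - \<sigma>. KK ({..n} - {j})"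
  have SK: "?S \<subseteq> KK \<sigma>"
  proof
    fix y assume "y \<in> ?S"
    then obtain j where "j \<in> {..n} - \<sigma>" "y \<in> KK ({..n} - {j})" by blast
    then show "y \<in> KK \<sigma>" using KK_anti[of \<sigma> "{..n} - {j}"] s by blast
  qed
  have genK: "generate G ?S \<subseteq> KK \<sigma>" using generate_subgroup_incl[OF SK sg] .
  \<comment> \<open>The starting point x is universally quantified, since the second factor of a
    product acts after the first has moved the chamber.\<close>
  have conn: "\<forall>x\<in>KK \<sigma>. (C x, C (x \<otimes> y)) \<in> R\<^sup>*" if "y \<in> generate G ?S" for y
    using that
  proof (induction rule: generate.induct)
    case one
    then show ?case using KK_carrier by auto
  next
    case (incl h)
    then show ?case using step by blast
  next
    case (inv h)
    then obtain j where j: "j \<in> {..n} - \<sigma>" "h \<in> KK ({..n} - {j})" by blast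
    have "inv h \<in> KK ({..n} - {j})" using subgroup.m_inv_closed[OF subgroup_KK j(2)] by simp
    then show ?case using step[OF _ j(1)] by simp
  next
    case (eng h1 h2)
    show ?case
    proof
      fix x assume x: "x \<in> KK \<sigma>"
      have h: "h1 \<in> KK \<sigma>" "h2 \<in> KK \<sigma>" using eng genK by auto
      have "x \<otimes> h1 \<in> KK \<sigma>" using x h subgroup.m_closed[OF sg] by blast
      then have "(C (x \<otimes> h1), C (x \<otimes> h1 \<otimes> h2)) \<in> R\<^sup>*" using eng.IH by blast
      moreover have "(C x, C (x \<otimes> h1)) \<in> R\<^sup>*" using eng.IH x by blast
      moreover have "x \<otimes> h1 \<otimes> h2 = x \<otimes> (h1 \<otimes> h2)" using x h KK_carrier m_assoc by auto
      ultimately show "(C x, C (x \<otimes> (h1 \<otimes> h2))) \<in> R\<^sup>*" by auto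
    qed
  qed
  have "(C x, C y) \<in> R\<^sup>*" if "x \<in> KK \<sigma>" "y \<in> KK \<sigma>" for x y
  proof -
    have c: "x \<in> carrier G" "y \<in> carrier G" using that KK_carrier by auto
    have "inv x \<otimes> y \<in> KK \<sigma>" using that subgroup.m_closed[OF sg] subgroup.m_inv_closed[OF sg] by blast
    then have "inv x \<otimes> y \<in> generate G ?S" using meet_generated[OF s] by blast
    then have "(C x, C (x \<otimes> (inv x \<otimes> y))) \<in> R\<^sup>*" using conn that by blast
    moreover have "x \<otimes> (inv x \<otimes> y) = y" using c by (simp add: inv_mult_cancel mult_inv_cancel)
    ultimately show ?thesis by simp
  qed
  then have "\<forall>\<alpha>\<in>simplices (link X (F g \<sigma>)) d. \<forall>\<beta>\<in>simplices (link X (F g \<sigma>)) d. (\<alpha>, \<beta>) \<in> R\<^sup>*"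
    unfolding top by simp
  then show ?thesis unfolding gallery_connected_def d_def[symmetric] R_def .
qed

lemma link_empty: "link X {} = X"
  by (simp add: link_def)

lemma gallery_connected_X: "gallery_connected X (int n)"
  using link_gallery_connected[of "{}" \<one>] by (simp add: face_def link_empty)

lemma strongly_gallery_connected_X: "strongly_gallery_connected X n"
  unfolding strongly_gallery_connected_def
proof (intro conjI ballI)
  fix k \<tau> assume "\<tau> \<in> simplices X k"
  then obtain g \<sigma> where "g \<in> carrier G" "\<sigma> \<subseteq> {..n}" "\<tau> = F g \<sigma>" "int (card \<sigma>) = k + 1"
    by (elim simplices_X_cases)
  then show "gallery_connected (link X \<tau>) (int n - 1 - k)"
    using link_gallery_connected[of \<sigma> g] by (simp add: algebra_simps)
qed (rule gallery_connected_X)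

text \<open>The cosets of \<open>K 0\<close> are vertices and cover the group, so growth of the
  group becomes growth of the number of vertices as long as \<open>K 0\<close> keeps its
  size.\<close>

lemma card_carrier_le: "card (carrier G) \<le> card (vertices X) * card (K 0)"
proof -
  let ?V = "{v \<in> vertices X. fst v = 0}"
  have fV: "finite (vertices X)" using finite_X by (auto simp: vertices_def coset_complex_def)
  have "carrier G \<subseteq> (\<Union>v\<in>?V. snd v)"
  proof
    fix g assume g: "g \<in> carrier G"
    then have "g \<in> g <#\<^bsub>G\<^esub> K 0" using subgroup.one_closed[OF subgroup_K[of 0]] by (simp add: mem_coset_iff subgroup_K)
    moreover have "(0, g <#\<^bsub>G\<^esub> K 0) \<in> ?V" using g by (auto simp: vertices_X coset_vertices_def)
    ultimately show "g \<in> (\<Union>v\<in>?V. snd v)" by force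
  qed
  moreover have "finite (\<Union>v\<in>?V. snd v)"
    by (rule finite_subset[OF _ finite_carrier])
      (auto simp: vertices_X coset_vertices_def mem_coset_iff subgroup_K)
  ultimately have "card (carrier G) \<le> card (\<Union>v\<in>?V. snd v)" by (intro card_mono)
  also have "\<dots> \<le> (\<Sum>v\<in>?V. card (snd v))" using fV by (intro card_UN_le) auto
  also have "\<dots> = (\<Sum>v\<in>?V. card (K 0))"
  proof (rule sum.cong[OF refl])
    fix v assume "v \<in> ?V"
    then obtain g where g: "v = (0, g <#\<^bsub>G\<^esub> K 0)" "g \<in> carrier G" by (auto simp: vertices_X coset_vertices_def)
    have "g <#\<^bsub>G\<^esub> K 0 = (\<lambda>h. g \<otimes> h) ` K 0" by (auto simp: l_coset_def)
    moreover have "inj_on (\<lambda>h. g \<otimes> h) (K 0)" using g(2) K_carrier[of 0] by (simp add: inj_on_def)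
    ultimately show "card (snd v) = card (K 0)" using g by (simp add: card_image)
  qed
  also have "\<dots> = card ?V * card (K 0)" by simp
  also have "\<dots> \<le> card (vertices X) * card (K 0)" using fV by (intro mult_right_mono card_mono) auto
  finally show ?thesis .
qed

end

section \<open>Second eigenvalues and Rayleigh quotients\<close>

text \<open>The matrix is self-adjoint for the inner product with weights m, so its complex
  eigenvalues are real. Hence the sorted list of real roots has N entries, which makes its second
  entry meaningful.\<close>

lemma reversible_char_poly_splits:
  fixes A :: "real mat" and m :: "nat \<Rightarrow> real"
  assumes A: "A \<in> carrier_mat N N"
    and m: "\<And>i. i < N \<Longrightarrow> m i > 0"
    and sym: "\<And>i j. i < N \<Longrightarrow> j < N \<Longrightarrow> m i * A $$ (i, j) = m j * A $$ (j, i)"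
  shows "\<exists>es. char_poly A = (\<Prod>e\<leftarrow>es. [:- e, 1:]) \<and> length es = N"
proof -
  define B where "B = map_mat complex_of_real A"
  have B: "B \<in> carrier_mat N N" using A by (simp add: B_def)
  obtain as where as: "char_poly B = (\<Prod>a\<leftarrow>as. [:- a, 1:])" "length as = N"
    using char_poly_factorized[OF B] by blast
  have real: "a \<in> \<real>" if "a \<in> set as" for a
  proof -
    have "poly (char_poly B) a = 0"
      using that unfolding as(1) poly_prod_list prod_list_zero_iff by (force simp: o_def)
    then have "eigenvalue B a" using eigenvalue_root_char_poly[OF B] by simp
    then obtain v where v: "v \<in> carrier_vec N" "v \<noteq> 0\<^sub>v N" "B *\<^sub>v v = a \<cdot>\<^sub>v v"
      unfolding eigenvalue_def eigenvector_def using B by auto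
    have Bv: "(\<Sum>j<N. complex_of_real (A $$ (i, j)) * v $ j) = a * v $ i" if "i < N" for i
    proof -
      have "(B *\<^sub>v v) $ i = (\<Sum>j<N. complex_of_real (A $$ (i, j)) * v $ j)"
        using that A v(1) by (simp add: B_def scalar_prod_def atLeast0LessThan)
      then show ?thesis using v that by simp
    qed
    \<comment> \<open>The weighted norm and the weighted quadratic form of a complex eigenvector:
      \<open>T = a * S\<close>, where T is real and S is positive.\<close>
    define S where "S = (\<Sum>i<N. complex_of_real (m i * (cmod (v $ i))\<^sup>2))"
    define T where "T = (\<Sum>i<N. \<Sum>j<N. complex_of_real (m i * A $$ (i, j)) * (cnj (v $ i) * v $ j))"
    have TS: "T = a * S"
    proof -
      have "T = (\<Sum>i<N. complex_of_real (m i) * cnj (v $ i) * (\<Sum>j<N. complex_of_real (A $$ (i, j)) * v $ j))"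
        unfolding T_def by (simp add: sum_distrib_left mult_ac)
      also have "\<dots> = (\<Sum>i<N. complex_of_real (m i) * cnj (v $ i) * (a * v $ i))"
        by (intro sum.cong refl) (simp add: Bv)
      also have "\<dots> = a * S" unfolding S_def sum_distrib_left
        by (intro sum.cong refl) (simp add: complex_norm_square del: of_real_power)
      finally show ?thesis .
    qed
    have "cnj T = (\<Sum>i<N. \<Sum>j<N. complex_of_real (m i * A $$ (i, j)) * (v $ i * cnj (v $ j)))"
      unfolding T_def by simp
    also have "\<dots> = (\<Sum>i<N. \<Sum>j<N. complex_of_real (m j * A $$ (j, i)) * (v $ i * cnj (v $ j)))"
      by (intro sum.cong refl) (simp add: sym)
    also have "\<dots> = T" unfolding T_def by (subst sum.swap) (simp add: mult_ac)
    finally have "T \<in> \<real>" by (simp add: Reals_cnj_iff)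
    have Sr: "S = complex_of_real (\<Sum>i<N. m i * (cmod (v $ i))\<^sup>2)" unfolding S_def by simp
    obtain i where i: "i < N" "v $ i \<noteq> 0" using v(1,2) by (metis carrier_vecD eq_vecI index_zero_vec)
    have "0 < (\<Sum>i<N. m i * (cmod (v $ i))\<^sup>2)"
      using i m by (intro sum_pos2[of _ i]) (auto simp: less_imp_le)
    then have "S \<noteq> 0" unfolding Sr by (metis less_irrefl of_real_eq_0_iff)
    then have "a = T / S" using TS by simp
    then show "a \<in> \<real>" using \<open>T \<in> \<real>\<close> Sr by (metis Reals_divide Reals_of_real)
  qed
  define es where "es = map Re as"
  have "as = map complex_of_real es"
    unfolding es_def by (simp, rule map_idI[symmetric]) (simp add: real)
  interpret map_poly_inj_idom_hom complex_of_real ..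
  have "map_poly complex_of_real (char_poly A) = char_poly B"
    unfolding B_def by (rule of_real_hom.char_poly_hom[OF A, symmetric])
  also have "\<dots> = (\<Prod>e\<leftarrow>es. map_poly complex_of_real [:- e, 1:])"
    unfolding as(1) \<open>as = map complex_of_real es\<close> by (simp add: o_def)
  also have "\<dots> = map_poly complex_of_real (\<Prod>e\<leftarrow>es. [:- e, 1:])"
    by (simp add: hom_prod_list o_def)
  finally have "char_poly A = (\<Prod>e\<leftarrow>es. [:- e, 1:])" by simp
  then show ?thesis using as(2) es_def by (intro exI[of _ es]) simp
qed

lemma proots_prod_list_linear: "proots (\<Prod>e\<leftarrow>es. [:- e, 1:]) = mset (es :: real list)"
proof (induction es)
  case (Cons e es)
  have nz: "(\<Prod>e\<leftarrow>es. [:- e, 1:]) \<noteq> 0" by (auto simp: prod_list_zero_iff)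
  have "proots [:- e, 1:] = {#e#}" by simp
  then show ?case using Cons nz by (simp add: proots_mult del: mult_pCons_left)
qed simp

text \<open>One half of the min-max principle. Eigenvectors for the two largest roots span a plane,
  which contains a nonzero vector of mean zero. There the quadratic form is at least the second root
  times the norm, while \<open>poincare\<close> bounds it from above. The eigenvectors are read off
  the first two columns of a Schur form.\<close>

lemma second_root_le:
  fixes A :: "real mat" and m :: "nat \<Rightarrow> real"
  assumes A: "A \<in> carrier_mat N N" and N: "N \<ge> 2"
    and m: "\<And>i. i < N \<Longrightarrow> m i > 0"
    and sym: "\<And>i j. i < N \<Longrightarrow> j < N \<Longrightarrow> m i * A $$ (i, j) = m j * A $$ (j, i)"
    and poincare: "\<And>f. (\<Sum>i<N. m i * f i) = 0 \<Longrightarrow>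
      (\<Sum>i<N. m i * f i * (\<Sum>j<N. A $$ (i, j) * f j)) \<le> l * (\<Sum>i<N. m i * (f i)\<^sup>2)"
  shows "rev (sorted_list_of_multiset (proots (char_poly A))) ! 1 \<le> l"
proof -
  obtain es0 where es0: "char_poly A = (\<Prod>e\<leftarrow>es0. [:- e, 1:])" "length es0 = N"
    using reversible_char_poly_splits[OF A m sym] by blast
  \<comment> \<open>A Schur form exists for any order of the roots on the diagonal; decreasing order
    puts the two largest into the upper left corner.\<close>
  define es where "es = rev (sort es0)"
  have "(\<Prod>e\<leftarrow>es. [:- e, 1:]) = (\<Prod>e\<leftarrow>es0. [:- e, 1:])"
    unfolding prod_mset_prod_list[symmetric] es_def by simp
  then have es: "char_poly A = (\<Prod>e\<leftarrow>es. [:- e, 1:])" using es0 by simp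
  have roots: "rev (sorted_list_of_multiset (proots (char_poly A))) = es"
    unfolding es0(1) proots_prod_list_linear es_def by simp
  have len: "length es = N" using es0 by (simp add: es_def)
  have e12: "es ! 1 \<le> es ! 0"
    using len N sorted_nth_mono[OF sorted_sort[of es0], of "N - 2" "N - 1"] es0(2)
    by (simp add: es_def rev_nth numeral_2_eq_2 diff_le_mono2)
  obtain B P Q where BPQ: "schur_decomposition A es = (B, P, Q)" by (cases "schur_decomposition A es")
  from schur_decomposition[OF A es BPQ]
  have wit: "similar_mat_wit A B P Q" and ut: "upper_triangular B" and diag: "diag_mat B = es" by auto
  note w = similar_mat_witD2[OF A wit]
  have AP: "A * P = P * B"
  proof -
    have "A * P = P * B * Q * P" using w by simp
    also have "\<dots> = P * B * (Q * P)" using w by (intro assoc_mult_mat) auto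
    finally show ?thesis using w by simp
  qed
  have Bd: "B $$ (0, 0) = es ! 0" "B $$ (1, 1) = es ! 1"
    using w N unfolding diag[symmetric] diag_mat_def by auto
  define ip where "ip f g = (\<Sum>i<N. m i * f i * g i)" for f g :: "nat \<Rightarrow> real"
  define T where "T f = (\<lambda>i. \<Sum>j<N. A $$ (i, j) * f j)" for f :: "nat \<Rightarrow> real"
  have ip_sym: "ip f g = ip g f" for f g unfolding ip_def by (intro sum.cong) auto
  have ip_lin: "ip (\<lambda>i. a * f i + b * g i) h = a * ip f h + b * ip g h" for a b f g h
    unfolding ip_def sum_distrib_left sum.distrib[symmetric]
    by (intro sum.cong refl) (simp add: algebra_simps)
  have ip_lin2: "ip h (\<lambda>i. a * f i + b * g i) = a * ip h f + b * ip h g" for a b f g h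
    using ip_lin ip_sym by metis
  have T_lin: "T (\<lambda>i. a * f i + b * g i) = (\<lambda>i. a * T f i + b * T g i)" for a b f g
    unfolding T_def sum_distrib_left sum.distrib[symmetric]
    by (intro ext sum.cong refl) (simp add: algebra_simps)
  have T_adj: "ip (T f) g = ip f (T g)" for f g
  proof -
    have "ip (T f) g = (\<Sum>i<N. \<Sum>j<N. (m i * A $$ (i, j)) * (f j * g i))"
      unfolding ip_def T_def by (simp add: sum_distrib_left sum_distrib_right mult_ac)
    also have "\<dots> = (\<Sum>i<N. \<Sum>j<N. (m j * A $$ (j, i)) * (f j * g i))"
      by (intro sum.cong refl) (simp add: sym)
    also have "\<dots> = (\<Sum>j<N. \<Sum>i<N. (m j * A $$ (j, i)) * (f j * g i))" by (rule sum.swap)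
    also have "\<dots> = ip f (T g)"
      unfolding ip_def T_def by (simp add: sum_distrib_left mult_ac)
    finally show ?thesis .
  qed
  have ip_cong: "ip f g = ip f' g'" if "\<And>i. i < N \<Longrightarrow> f i = f' i" "\<And>i. i < N \<Longrightarrow> g i = g' i" for f g f' g'
    unfolding ip_def using that by (intro sum.cong) auto
  have ip_pos: "ip f f > 0" if "i < N" "f i \<noteq> 0" for f i
    unfolding ip_def using that m
    by (intro sum_pos2[of _ i]) (auto simp: mult.assoc less_imp_le zero_less_mult_iff)
  define v1 where "v1 i = P $$ (i, 0)" for i
  define v2 where "v2 i = P $$ (i, 1)" for i
  define b where "b = B $$ (0, 1)"
  have Tcol: "T (\<lambda>i. P $$ (i, c)) i = (\<Sum>j<N. P $$ (i, j) * B $$ (j, c))" if "i < N" "c < N" for i c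
  proof -
    have "(A * P) $$ (i, c) = (P * B) $$ (i, c)" using AP by simp
    then show ?thesis using that A w unfolding T_def
      by (simp add: scalar_prod_def atLeast0LessThan)
  qed
  have Tv1: "T v1 i = es ! 0 * v1 i" if "i < N" for i
  proof -
    have "T v1 i = (\<Sum>j<N. P $$ (i, j) * B $$ (j, 0))"
      using Tcol[OF that, of 0] N unfolding v1_def by simp
    also have "\<dots> = (\<Sum>j\<in>{0}. P $$ (i, j) * B $$ (j, 0))"
      using N ut w by (intro sum.mono_neutral_right) (auto simp: upper_triangular_def)
    finally show ?thesis using Bd by (simp add: v1_def)
  qed
  have Tv2: "T v2 i = b * v1 i + es ! 1 * v2 i" if "i < N" for i
  proof -
    have "T v2 i = (\<Sum>j<N. P $$ (i, j) * B $$ (j, 1))"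
      using Tcol[OF that, of 1] N unfolding v2_def by simp
    also have "\<dots> = (\<Sum>j\<in>{0, 1}. P $$ (i, j) * B $$ (j, 1))"
      using N ut w by (intro sum.mono_neutral_right) (auto simp: upper_triangular_def)
    finally show ?thesis using Bd by (simp add: v1_def v2_def b_def)
  qed
  have indep: "\<exists>i<N. x * v1 i + y * v2 i \<noteq> 0" if "x \<noteq> 0 \<or> y \<noteq> 0" for x y
  proof (rule ccontr)
    assume "\<not> ?thesis"
    then have z: "x * v1 i + y * v2 i = 0" if "i < N" for i using that by auto
    have QP: "(\<Sum>i<N. Q $$ (r, i) * P $$ (i, c)) = (if r = c then 1 else 0)" if "r < N" "c < N" for r c
    proof -
      have "(Q * P) $$ (r, c) = (1\<^sub>m N) $$ (r, c)" using w by simp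
      moreover have "(Q * P) $$ (r, c) = (\<Sum>i<N. Q $$ (r, i) * P $$ (i, c))"
        using that w(6,7) by (simp add: scalar_prod_def atLeast0LessThan)
      ultimately show ?thesis using that by simp
    qed
    have "x * (\<Sum>i<N. Q $$ (r, i) * P $$ (i, 0)) + y * (\<Sum>i<N. Q $$ (r, i) * P $$ (i, 1)) = 0" for r
    proof -
      have "x * (\<Sum>i<N. Q $$ (r, i) * P $$ (i, 0)) + y * (\<Sum>i<N. Q $$ (r, i) * P $$ (i, 1))
        = (\<Sum>i<N. Q $$ (r, i) * (x * v1 i + y * v2 i))"
        unfolding sum_distrib_left sum.distrib[symmetric] v1_def v2_def
        by (intro sum.cong refl) (simp add: algebra_simps)
      then show ?thesis using z by simp
    qed
    from this[of 0] this[of 1] show False using QP[of 0 0] QP[of 0 1] QP[of 1 0] QP[of 1 1] N that by auto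
  qed
  obtain i1 where i1: "i1 < N" "v1 i1 \<noteq> 0" using indep[of 1 0] by auto
  have n1: "ip v1 v1 > 0" using ip_pos[of i1 v1] i1 by blast
  \<comment> \<open>Gram-Schmidt against the first column. Self-adjointness then kills the remaining
    off-diagonal term, so \<open>w2\<close> is an eigenvector even if the two roots
    coincide.\<close>
  define c where "c = ip v2 v1 / ip v1 v1"
  define w2 where "w2 = (\<lambda>i. 1 * v2 i + (- c) * v1 i)"
  have orth: "ip w2 v1 = 0" unfolding w2_def ip_lin c_def using n1 by simp
  have Tw2: "T w2 i = es ! 1 * w2 i + (b + c * es ! 1 - c * es ! 0) * v1 i" if "i < N" for i
    unfolding w2_def T_lin using Tv1[OF that] Tv2[OF that] by (simp add: algebra_simps)
  have "b + c * es ! 1 - c * es ! 0 = 0"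
  proof -
    have "ip (T w2) v1 = ip (\<lambda>i. es ! 1 * w2 i + (b + c * es ! 1 - c * es ! 0) * v1 i) v1"
      by (intro ip_cong) (use Tw2 in auto)
    also have "\<dots> = (b + c * es ! 1 - c * es ! 0) * ip v1 v1" unfolding ip_lin orth by simp
    finally have "(b + c * es ! 1 - c * es ! 0) * ip v1 v1 = ip w2 (T v1)" using T_adj by simp
    also have "\<dots> = ip w2 (\<lambda>i. es ! 0 * v1 i + 0 * v1 i)" by (intro ip_cong) (use Tv1 in auto)
    also have "\<dots> = 0" unfolding ip_lin2 orth by simp
    finally show ?thesis using n1 by simp
  qed
  then have Tw2: "T w2 i = es ! 1 * w2 i" if "i < N" for i using Tw2[OF that] by simp
  \<comment> \<open>Some nonzero combination of the two orthogonal eigenvectors is orthogonal to the constants.\<close>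
  define s1 where "s1 = (\<Sum>i<N. m i * v1 i)"
  define s2 where "s2 = (\<Sum>i<N. m i * w2 i)"
  define x where "x = (if s1 = 0 \<and> s2 = 0 then 0 else s2)"
  define y where "y = (if s1 = 0 \<and> s2 = 0 then 1 else - s1)"
  have xy: "x \<noteq> 0 \<or> y \<noteq> 0" "x * s1 + y * s2 = 0" unfolding x_def y_def by auto
  define f where "f = (\<lambda>i. x * v1 i + y * w2 i)"
  have "(\<Sum>i<N. m i * f i) = x * s1 + y * s2"
    unfolding f_def s1_def s2_def sum_distrib_left sum.distrib[symmetric]
    by (intro sum.cong refl) (simp add: algebra_simps)
  then have f0: "(\<Sum>i<N. m i * f i) = 0" using xy by simp
  \<comment> \<open>Expressed in the columns of P, whose independence shows that f does not
    vanish.\<close>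
  have f_alt: "f = (\<lambda>i. (x - y * c) * v1 i + y * v2 i)"
    unfolding f_def w2_def by (intro ext) (simp add: algebra_simps)
  have "x - y * c \<noteq> 0 \<or> y \<noteq> 0" using xy by auto
  then obtain i where "i < N" "f i \<noteq> 0" using indep unfolding f_alt by blast
  then have fpos: "ip f f > 0" by (rule ip_pos)
  have ff: "ip f f = x\<^sup>2 * ip v1 v1 + y\<^sup>2 * ip w2 w2"
    unfolding f_def ip_lin ip_lin2 using orth ip_sym[of v1 w2] by (simp add: power2_eq_square algebra_simps)
  have Tf: "T f i = (x * es ! 0) * v1 i + (y * es ! 1) * w2 i" if "i < N" for i
    unfolding f_def T_lin using Tv1[OF that] Tw2[OF that] by simp
  have "ip f (T f) = ip f (\<lambda>i. (x * es ! 0) * v1 i + (y * es ! 1) * w2 i)"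
    by (intro ip_cong) (use Tf in auto)
  also have "\<dots> = es ! 0 * (x\<^sup>2 * ip v1 v1) + es ! 1 * (y\<^sup>2 * ip w2 w2)"
    unfolding f_def ip_lin ip_lin2 using orth ip_sym[of v1 w2] by (simp add: power2_eq_square algebra_simps)
  also have "\<dots> \<ge> es ! 1 * (x\<^sup>2 * ip v1 v1) + es ! 1 * (y\<^sup>2 * ip w2 w2)"
    using e12 n1 by (intro add_right_mono mult_right_mono) auto
  finally have "es ! 1 * ip f f \<le> ip f (T f)" unfolding ff by (simp add: algebra_simps)
  also have "\<dots> \<le> l * ip f f"
    using poincare[OF f0] unfolding ip_def T_def by (simp add: power2_eq_square mult_ac)
  finally have "es ! 1 \<le> l" using fpos by simp
  then show ?thesis using roots by simp
qed

section \<open>Trickling down in uniform hypergraphs\<close>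

text \<open>The first-order condition at a maximiser, to be applied to perturbations f + t
  g.\<close>

lemma linear_coefficient_zero:
  fixes a b :: real
  assumes "\<And>t. 2 * t * a + t\<^sup>2 * b \<ge> 0"
  shows "a = 0"
proof (rule ccontr)
  assume "a \<noteq> 0"
  have b: "b \<ge> 0" using assms[of 1] assms[of "- 1"] by simp
  \<comment> \<open>With \<open>b + 1\<close> instead of b the denominator stays positive when b is
    zero.\<close>
  define t where "t = - a / (b + 1)"
  have ta: "t * (b + 1) = - a" using b by (simp add: t_def)
  have "0 \<le> 2 * t * a + t\<^sup>2 * b" by (rule assms)
  also have "\<dots> = - (t\<^sup>2 * (b + 2))"
  proof -
    have "2 * t * a + t\<^sup>2 * b = - (t\<^sup>2 * (b + 2)) + 2 * t * (a + t * (b + 1))"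
      by (simp add: power2_eq_square algebra_simps)
    then show ?thesis using ta by simp
  qed
  finally have "t\<^sup>2 * (b + 2) \<le> 0" by simp
  moreover have "t\<^sup>2 > 0" using \<open>a \<noteq> 0\<close> b by (simp add: t_def)
  ultimately show False using b by (simp add: mult_le_0_iff)
qed

text \<open>Compactness of the unit sphere in the functions of mean zero gives a maximiser of the
  Rayleigh quotient. It is an eigenfunction because the derivative vanishes in every direction of
  mean zero, and the condition on the row sums makes the residual of the eigenvalue equation such a
  direction.\<close>

lemma rayleigh_maximizer:
  fixes V :: "'v set" and m :: "'v \<Rightarrow> real" and k :: "'v \<Rightarrow> 'v \<Rightarrow> real"
  assumes V: "finite V" and m: "\<And>v. v \<in> V \<Longrightarrow> m v > 0"
    and sym: "\<And>u v. u \<in> V \<Longrightarrow> v \<in> V \<Longrightarrow> k u v = k v u"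
    and row: "\<And>u. u \<in> V \<Longrightarrow> (\<Sum>v\<in>V. k u v) = m u"
    and f0: "(\<Sum>v\<in>V. m v * f0 v) = 0" "v0 \<in> V" "f0 v0 \<noteq> 0"
  obtains f \<mu> where "(\<Sum>v\<in>V. m v * f v) = 0" "(\<Sum>v\<in>V. m v * (f v)\<^sup>2) = 1"
    "\<And>u. u \<in> V \<Longrightarrow> (\<Sum>v\<in>V. k u v * f v) = \<mu> * m u * f u"
    "\<And>g. (\<Sum>v\<in>V. m v * g v) = 0 \<Longrightarrow>
      (\<Sum>u\<in>V. \<Sum>v\<in>V. k u v * g u * g v) \<le> \<mu> * (\<Sum>v\<in>V. m v * (g v)\<^sup>2)"
proof -
  define E where "E g = (\<Sum>v\<in>V. m v * (g v)\<^sup>2)" for g :: "'v \<Rightarrow> real"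
  define Q where "Q g = (\<Sum>u\<in>V. \<Sum>v\<in>V. k u v * g u * g v)" for g :: "'v \<Rightarrow> real"
  define L where "L g = (\<Sum>v\<in>V. m v * g v)" for g :: "'v \<Rightarrow> real"
  \<comment> \<open>Functions on the whole type form a product space, so coordinates outside V are
    pinned to 0. Inside V the bound \<open>1 + 1 / m v\<close> dominates
    \<open>1 / sqrt (m v)\<close>, the largest value that unit norm permits.\<close>
  define J where "J v = (if v \<in> V then {- (1 + 1 / m v)..1 + 1 / m v} else {0::real})" for v
  define S where "S = PiE UNIV J \<inter> {g. L g = 0} \<inter> {g. E g = 1}"
  have co[continuous_intros]: "continuous_on UNIV (\<lambda>x::'v \<Rightarrow> real. x i)" for i
    by (rule continuous_on_product_coordinates)
  have cont: "continuous_on UNIV E" "continuous_on UNIV Q" "continuous_on UNIV L"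
    unfolding E_def Q_def L_def by (intro continuous_intros)+
  have "compactin (product_topology (\<lambda>_::'v. euclidean :: real topology) UNIV) (PiE UNIV J)"
    unfolding compactin_PiE by (simp add: J_def)
  then have "compact (PiE UNIV J)" by (simp add: euclidean_product_topology)
  moreover have "closed {g. L g = 0}" "closed {g. E g = 1}"
    using closed_Collect_eq[OF cont(3), of "\<lambda>_. 0"] closed_Collect_eq[OF cont(1), of "\<lambda>_. 1"] by simp_all
  ultimately have "compact S" unfolding S_def by (intro compact_Int_closed)
  have E_nonneg: "E g \<ge> 0" for g unfolding E_def using m by (intro sum_nonneg) (simp add: less_imp_le)
  have E_zero: "g v = 0" if "E g = 0" "v \<in> V" for g v
  proof -
    have "m v * (g v)\<^sup>2 = 0" using that V m unfolding E_def
      by (subst (asm) sum_nonneg_eq_0_iff) (simp_all add: less_imp_le)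
    then show ?thesis using m[OF that(2)] by simp
  qed
  have normalize: "\<exists>h\<in>S. Q g = E g * Q h" if "L g = 0" "E g \<noteq> 0" for g
  proof -
    define s where "s = sqrt (E g)"
    have s: "s > 0" "s\<^sup>2 = E g" using that(2) E_nonneg[of g] by (simp_all add: s_def less_le)
    define h where "h v = (if v \<in> V then g v / s else 0)" for v
    have "L h = L g / s" unfolding L_def h_def sum_divide_distrib by (intro sum.cong) auto
    then have Lh: "L h = 0" using that by simp
    have "E h = E g / s\<^sup>2" unfolding E_def h_def sum_divide_distrib
      by (intro sum.cong) (auto simp: power_divide)
    then have Eh: "E h = 1" using s that by simp
    have "Q h = Q g / s\<^sup>2" unfolding Q_def h_def sum_divide_distrib
      by (intro sum.cong) (auto simp: power2_eq_square)
    then have Qh: "Q g = E g * Q h" using s that by simp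
    have "h v \<in> J v" for v
    proof (cases "v \<in> V")
      case True
      have "m v * (h v)\<^sup>2 \<le> E h" unfolding E_def
        using True V m by (intro member_le_sum[of v V "\<lambda>v. m v * (h v)\<^sup>2"]) (auto simp: less_imp_le)
      then have "(h v)\<^sup>2 \<le> 1 / m v" using Eh m[OF True] by (simp add: field_simps)
      also have "\<dots> \<le> (1 + 1 / m v)\<^sup>2" using m[OF True] by (simp add: power2_eq_square field_simps)
      finally have "\<bar>h v\<bar> \<le> 1 + 1 / m v" using m[OF True] by (simp add: abs_le_square_iff[symmetric])
      then show ?thesis using True by (simp add: J_def abs_le_iff)
    qed (simp add: J_def h_def)
    then have "h \<in> S" using Lh Eh by (simp add: S_def PiE_def)
    then show ?thesis using Qh by blast
  qed
  have "E f0 \<noteq> 0" using E_zero f0 by blast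
  moreover have "L f0 = 0" using f0 by (simp add: L_def)
  ultimately have "S \<noteq> {}" using normalize by blast
  then obtain f where f: "f \<in> S" "\<And>g. g \<in> S \<Longrightarrow> Q g \<le> Q f"
    using continuous_attains_sup[OF \<open>compact S\<close> _ continuous_on_subset[OF cont(2)]] by auto
  define \<mu> where "\<mu> = Q f"
  have Lf: "L f = 0" and Ef: "E f = 1" using f(1) by (auto simp: S_def)
  have max: "Q g \<le> \<mu> * E g" if "L g = 0" for g
  proof (cases "E g = 0")
    case True
    then have "Q g = 0" unfolding Q_def using E_zero[OF True] by (intro sum.neutral ballI) simp
    then show ?thesis using True by simp
  next
    case False
    with that obtain h where h: "h \<in> S" "Q g = E g * Q h" using normalize by blast
    then show ?thesis using f(2)[OF h(1)] E_nonneg[of g] by (simp add: \<mu>_def mult.commute mult_left_mono)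
  qed
  have stationary: "(\<Sum>u\<in>V. \<Sum>v\<in>V. k u v * g u * f v) = \<mu> * (\<Sum>v\<in>V. m v * f v * g v)" if "L g = 0" for g
  proof -
    define a where "a = \<mu> * (\<Sum>v\<in>V. m v * f v * g v) - (\<Sum>u\<in>V. \<Sum>v\<in>V. k u v * g u * f v)"
    define b where "b = \<mu> * E g - Q g"
    have "2 * t * a + t\<^sup>2 * b \<ge> 0" for t
    proof -
      define h where "h v = f v + t * g v" for v
      have "L h = L f + t * L g" unfolding L_def h_def
        by (simp add: algebra_simps sum.distrib sum_distrib_left)
      then have "Q h \<le> \<mu> * E h" using max Lf that by simp
      moreover have "E h = E f + 2 * t * (\<Sum>v\<in>V. m v * f v * g v) + t\<^sup>2 * E g"
        unfolding E_def h_def sum_distrib_left sum.distrib[symmetric]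
        by (intro sum.cong refl) (simp add: power2_eq_square algebra_simps)
      moreover have "(\<Sum>u\<in>V. \<Sum>v\<in>V. k u v * f u * g v) = (\<Sum>v\<in>V. \<Sum>u\<in>V. k v u * g v * f u)"
        by (subst sum.swap) (auto intro!: sum.cong simp: sym)
      moreover have "Q h = Q f + t * (\<Sum>u\<in>V. \<Sum>v\<in>V. k u v * f u * g v)
          + t * (\<Sum>u\<in>V. \<Sum>v\<in>V. k u v * g u * f v) + t\<^sup>2 * Q g"
        unfolding Q_def h_def sum_distrib_left sum.distrib[symmetric]
        by (intro sum.cong refl) (simp add: power2_eq_square algebra_simps)
      ultimately show ?thesis unfolding a_def b_def using Ef \<mu>_def by (simp add: algebra_simps)
    qed
    then have "a = 0" by (rule linear_coefficient_zero)
    then show ?thesis unfolding a_def by simp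
  qed
  have eigen: "(\<Sum>v\<in>V. k u v * f v) = \<mu> * m u * f u" if "u \<in> V" for u
  proof -
    \<comment> \<open>The residual of the eigenvalue equation. It has weighted mean zero, so
      stationarity can be tested against it, and this shows that its norm is zero.\<close>
    define g where "g u = (\<Sum>v\<in>V. k u v * f v) / m u - \<mu> * f u" for u
    have mg: "m u * g u = (\<Sum>v\<in>V. k u v * f v) - \<mu> * m u * f u" if "u \<in> V" for u
      using m[OF that] by (simp add: g_def field_simps)
    have "L g = (\<Sum>u\<in>V. (\<Sum>v\<in>V. k u v * f v) - \<mu> * m u * f u)"
      unfolding L_def by (intro sum.cong refl mg)
    also have "\<dots> = (\<Sum>u\<in>V. \<Sum>v\<in>V. k u v * f v) - \<mu> * L f"
      by (simp add: sum_subtractf L_def sum_distrib_left mult.assoc)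
    also have "(\<Sum>u\<in>V. \<Sum>v\<in>V. k u v * f v) = (\<Sum>v\<in>V. \<Sum>u\<in>V. k v u * f v)"
      by (subst sum.swap) (auto intro!: sum.cong simp: sym)
    also have "\<dots> = L f" unfolding L_def by (intro sum.cong refl) (simp add: sum_distrib_right[symmetric] row)
    finally have Lg: "L g = 0" using Lf by simp
    have "E g = (\<Sum>u\<in>V. g u * ((\<Sum>v\<in>V. k u v * f v) - \<mu> * m u * f u))"
      unfolding E_def by (intro sum.cong refl) (simp add: power2_eq_square mg[symmetric])
    also have "\<dots> = (\<Sum>u\<in>V. \<Sum>v\<in>V. k u v * g u * f v) - \<mu> * (\<Sum>v\<in>V. m v * f v * g v)"
      by (simp add: right_diff_distrib sum_subtractf sum_distrib_left mult_ac)
    also have "\<dots> = 0" using stationary[OF Lg] by simp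
    finally have "g u = 0" using E_zero that by blast
    then show ?thesis using mg[OF that] by simp
  qed
  show thesis
    by (rule that[of f \<mu>]) (use Lf Ef eigen max in \<open>auto simp: L_def E_def Q_def\<close>)
qed

text \<open>The Poincare inequality, with second eigenvalue at most \<open>l\<close>, of the walk that moves from a vertex
  to another vertex of a random hyperedge through it.\<close>

definition hyper_poincare :: "'v set set \<Rightarrow> nat \<Rightarrow> real \<Rightarrow> bool" where
  "hyper_poincare H r l \<longleftrightarrow> (\<forall>f :: 'v \<Rightarrow> real. (\<Sum>a\<in>H. \<Sum>v\<in>a. f v) = 0 \<longrightarrow>
     (\<Sum>a\<in>H. (\<Sum>v\<in>a. f v)\<^sup>2 - (\<Sum>v\<in>a. (f v)\<^sup>2)) \<le> l * (real r - 1) * (\<Sum>a\<in>H. \<Sum>v\<in>a. (f v)\<^sup>2))"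

definition hyper_link :: "'v set set \<Rightarrow> 'v \<Rightarrow> 'v set set" where
  "hyper_link H w = (\<lambda>a. a - {w}) ` {a \<in> H. w \<in> a}"

text \<open>Connectedness in terms of functions: in this form it rules out the eigenvalue 1, whose
  eigenfunctions are constant on every hyperedge.\<close>

definition hyper_connected :: "'v set set \<Rightarrow> bool" where
  "hyper_connected H \<longleftrightarrow> (\<forall>f :: 'v \<Rightarrow> real. (\<forall>a\<in>H. \<forall>u\<in>a. \<forall>v\<in>a. f u = f v) \<longrightarrow>
     (\<forall>u\<in>\<Union>H. \<forall>v\<in>\<Union>H. f u = f v))"

lemma sum_hyper_link:
  "(\<Sum>b\<in>hyper_link H w. F b) = (\<Sum>a | a \<in> H \<and> w \<in> a. F (a - {w}))"
  unfolding hyper_link_def by (subst sum.reindex) (auto simp: inj_on_def)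

locale uniform_hypergraph =
  fixes H :: "'v set set" and r :: nat
  assumes finite_H: "finite H" and uniform: "a \<in> H \<Longrightarrow> finite a \<and> card a = r"
    and r_ge_2: "r \<ge> 2"
begin

definition deg :: "'v \<Rightarrow> real" where "deg v = real (card {a \<in> H. v \<in> a})"

text \<open>The denominator makes the rows sum to \<open>deg\<close>, so that
  \<open>codeg u v / deg u\<close> is the transition probability of the walk from u to v.\<close>

definition codeg :: "'v \<Rightarrow> 'v \<Rightarrow> real" where
  "codeg u v = (if u = v then 0 else real (card {a \<in> H. u \<in> a \<and> v \<in> a}) / (real r - 1))"

lemma finite_vertices: "finite (\<Union>H)"
  using finite_H uniform by blast

lemma swap: "(\<Sum>a\<in>H. \<Sum>v\<in>a. F a v) = (\<Sum>v\<in>\<Union>H. \<Sum>a | a \<in> H \<and> v \<in> a. F a v)"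
proof -
  have "(\<Sum>a\<in>H. \<Sum>v\<in>a. F a v) = (\<Sum>a\<in>H. \<Sum>v | v \<in> \<Union>H \<and> v \<in> a. F a v)"
    by (intro sum.cong refl) auto
  also have "\<dots> = (\<Sum>v\<in>\<Union>H. \<Sum>a | a \<in> H \<and> v \<in> a. F a v)"
    by (rule sum.swap_restrict[OF finite_H finite_vertices])
  finally show ?thesis .
qed

lemma swap_deg: "(\<Sum>a\<in>H. \<Sum>v\<in>a. F v) = (\<Sum>v\<in>\<Union>H. deg v * F v)"
  unfolding swap deg_def by simp

lemma deg_pos: "v \<in> \<Union>H \<Longrightarrow> deg v > 0"
  unfolding deg_def using finite_H by (auto simp: card_gt_0_iff)

lemma codeg_sym: "codeg u v = codeg v u"
  unfolding codeg_def by (auto intro: arg_cong[where f = card])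

lemma sum_codeg:
  assumes u: "u \<in> \<Union>H"
  shows "(\<Sum>v\<in>\<Union>H. codeg u v * g v) = (\<Sum>a | a \<in> H \<and> u \<in> a. (\<Sum>v\<in>a. g v) - g u) / (real r - 1)"
proof -
  have "(\<Sum>a | a \<in> H \<and> u \<in> a. (\<Sum>v\<in>a. g v) - g u) = (\<Sum>a | a \<in> H \<and> u \<in> a. \<Sum>v\<in>a - {u}. g v)"
    using uniform by (intro sum.cong refl) (auto simp: sum_diff1)
  also have "\<dots> = (\<Sum>a | a \<in> H \<and> u \<in> a. \<Sum>v | v \<in> \<Union>H \<and> (v \<in> a \<and> v \<noteq> u). g v)"
    by (intro sum.cong refl) auto
  also have "\<dots> = (\<Sum>v\<in>\<Union>H. \<Sum>a | a \<in> {a. a \<in> H \<and> u \<in> a} \<and> (v \<in> a \<and> v \<noteq> u). g v)"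
    by (rule sum.swap_restrict) (use finite_H finite_vertices in auto)
  also have "\<dots> = (\<Sum>v\<in>\<Union>H. (real r - 1) * (codeg u v * g v))"
  proof (intro sum.cong refl)
    fix v
    show "(\<Sum>a | a \<in> {a. a \<in> H \<and> u \<in> a} \<and> (v \<in> a \<and> v \<noteq> u). g v) = (real r - 1) * (codeg u v * g v)"
    proof (cases "u = v")
      case False
      have "{a. a \<in> {a. a \<in> H \<and> u \<in> a} \<and> (v \<in> a \<and> v \<noteq> u)} = {a \<in> H. u \<in> a \<and> v \<in> a}"
        using False by auto
      then show ?thesis using False r_ge_2 by (simp add: codeg_def)
    qed (simp add: codeg_def)
  qed
  finally show ?thesis using r_ge_2 by (simp add: sum_distrib_left[symmetric])
qed

lemma codeg_row:
  assumes "u \<in> \<Union>H"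
  shows "(\<Sum>v\<in>\<Union>H. codeg u v) = deg u"
proof -
  have "(\<Sum>v\<in>\<Union>H. codeg u v) = (\<Sum>a | a \<in> H \<and> u \<in> a. (\<Sum>v\<in>a. 1) - 1) / (real r - 1)"
    using sum_codeg[OF assms, of "\<lambda>_. 1"] by simp
  also have "(\<Sum>a | a \<in> H \<and> u \<in> a. (\<Sum>v\<in>a. 1) - 1) = (\<Sum>a | a \<in> H \<and> u \<in> a. real r - 1)"
    using uniform by (intro sum.cong refl) auto
  finally show ?thesis using r_ge_2 by (simp add: deg_def)
qed

lemma quadratic_codeg:
  "(\<Sum>u\<in>\<Union>H. \<Sum>v\<in>\<Union>H. codeg u v * g u * g v) * (real r - 1)
    = (\<Sum>a\<in>H. (\<Sum>v\<in>a. g v)\<^sup>2 - (\<Sum>v\<in>a. (g v)\<^sup>2))"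
proof -
  have "(\<Sum>a\<in>H. (\<Sum>v\<in>a. g v)\<^sup>2 - (\<Sum>v\<in>a. (g v)\<^sup>2)) = (\<Sum>a\<in>H. \<Sum>u\<in>a. g u * ((\<Sum>v\<in>a. g v) - g u))"
    by (simp add: power2_eq_square sum_distrib_right right_diff_distrib sum_subtractf)
  also have "\<dots> = (\<Sum>u\<in>\<Union>H. g u * (\<Sum>a | a \<in> H \<and> u \<in> a. (\<Sum>v\<in>a. g v) - g u))"
    unfolding swap sum_distrib_left ..
  also have "\<dots> = (\<Sum>u\<in>\<Union>H. g u * ((\<Sum>v\<in>\<Union>H. codeg u v * g v) * (real r - 1)))"
    using r_ge_2 by (intro sum.cong refl) (simp add: sum_codeg)
  also have "\<dots> = (\<Sum>u\<in>\<Union>H. \<Sum>v\<in>\<Union>H. codeg u v * g u * g v) * (real r - 1)"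
    by (simp add: sum_distrib_left sum_distrib_right mult_ac)
  finally show ?thesis by simp
qed

text \<open>The sums over hyperedges in \<open>hyper_poincare\<close> suit the passage to links; the
  same inequality written as a Rayleigh bound over vertices suits maximisers and matrices.\<close>

lemma hyper_poincare_iff:
  "hyper_poincare H r l \<longleftrightarrow> (\<forall>g. (\<Sum>v\<in>\<Union>H. deg v * g v) = 0 \<longrightarrow>
    (\<Sum>u\<in>\<Union>H. \<Sum>v\<in>\<Union>H. codeg u v * g u * g v) \<le> l * (\<Sum>v\<in>\<Union>H. deg v * (g v)\<^sup>2))"
proof -
  have "x * (real r - 1) \<le> l * (real r - 1) * y \<longleftrightarrow> x \<le> l * y" for x y
    using r_ge_2 mult_le_cancel_right_pos[of "real r - 1" x "l * y"] by (simp add: mult_ac)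
  then show ?thesis unfolding hyper_poincare_def swap_deg quadratic_codeg[symmetric] by simp
qed

text \<open>Oppenheim's trickle-down argument: the local inequalities, applied to a maximiser of the
  Rayleigh quotient with eigenvalue \<open>\<mu>\<close> and summed over all vertices, give
  \<open>\<mu> - \<mu>\<^sup>2 \<le> l (1 - \<mu>\<^sup>2)\<close>; connectedness excludes \<open>\<mu> = 1\<close>.\<close>

lemma trickle_down:
  assumes r: "r \<ge> 3" and conn: "hyper_connected H" and l: "l < 1"
    and links: "\<And>w. w \<in> \<Union>H \<Longrightarrow> hyper_poincare (hyper_link H w) (r - 1) l"
  shows "hyper_poincare H r (l / (1 - l))"
  unfolding hyper_poincare_iff
proof (intro allI impI)
  fix g assume g: "(\<Sum>v\<in>\<Union>H. deg v * g v) = 0"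
  let ?V = "\<Union>H"
  show "(\<Sum>u\<in>?V. \<Sum>v\<in>?V. codeg u v * g u * g v) \<le> l / (1 - l) * (\<Sum>v\<in>?V. deg v * (g v)\<^sup>2)"
  proof (cases "\<forall>v\<in>?V. g v = 0")
    case True
    then have "(\<Sum>u\<in>?V. \<Sum>v\<in>?V. codeg u v * g u * g v) = 0" "(\<Sum>v\<in>?V. deg v * (g v)\<^sup>2) = 0"
      by (auto intro!: sum.neutral)
    then show ?thesis by simp
  next
    case False
    then obtain v0 where v0: "v0 \<in> ?V" "g v0 \<noteq> 0" by blast
    obtain f \<mu> where f: "(\<Sum>v\<in>?V. deg v * f v) = 0" "(\<Sum>v\<in>?V. deg v * (f v)\<^sup>2) = 1"
      and eigen: "\<And>u. u \<in> ?V \<Longrightarrow> (\<Sum>v\<in>?V. codeg u v * f v) = \<mu> * deg u * f u"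
      and max: "\<And>g. (\<Sum>v\<in>?V. deg v * g v) = 0 \<Longrightarrow>
        (\<Sum>u\<in>?V. \<Sum>v\<in>?V. codeg u v * g u * g v) \<le> \<mu> * (\<Sum>v\<in>?V. deg v * (g v)\<^sup>2)"
      by (rule rayleigh_maximizer[OF finite_vertices deg_pos codeg_sym codeg_row g v0]) (assumption | rule that)+
    define S where "S a = (\<Sum>v\<in>a. f v)" for a
    define Z where "Z a = (\<Sum>v\<in>a. (f v)\<^sup>2)" for a
    have Z1: "(\<Sum>a\<in>H. Z a) = 1" unfolding Z_def swap_deg f(2) ..
    have Smu: "(\<Sum>a\<in>H. (S a)\<^sup>2 - Z a) = (real r - 1) * \<mu>"
    proof -
      have "(\<Sum>a\<in>H. (S a)\<^sup>2 - Z a) = (\<Sum>u\<in>?V. \<Sum>v\<in>?V. codeg u v * f u * f v) * (real r - 1)"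
        unfolding quadratic_codeg S_def Z_def ..
      also have "(\<Sum>u\<in>?V. \<Sum>v\<in>?V. codeg u v * f u * f v) = (\<Sum>u\<in>?V. f u * (\<Sum>v\<in>?V. codeg u v * f v))"
        by (simp add: sum_distrib_left mult_ac)
      also have "\<dots> = (\<Sum>u\<in>?V. f u * (\<mu> * deg u * f u))"
        by (intro sum.cong refl) (simp add: eigen)
      also have "\<dots> = \<mu> * (\<Sum>v\<in>?V. deg v * (f v)\<^sup>2)"
        unfolding sum_distrib_left by (intro sum.cong refl) (simp add: power2_eq_square)
      finally show ?thesis using f(2) by simp
    qed
    have S2: "(\<Sum>a\<in>H. (S a)\<^sup>2) = (real r - 1) * \<mu> + 1"
      using Smu Z1 by (simp add: sum_subtractf)
    have local: "(\<Sum>a | a \<in> H \<and> w \<in> a. (S a - f w)\<^sup>2 - (Z a - (f w)\<^sup>2))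
        - (real r - 1) * (real r - 2) * (\<mu>\<^sup>2 * (deg w * (f w)\<^sup>2))
      \<le> l * (real r - 2) * ((\<Sum>a | a \<in> H \<and> w \<in> a. Z a - (f w)\<^sup>2) - (real r - 1) * (\<mu>\<^sup>2 * (deg w * (f w)\<^sup>2)))"
      if w: "w \<in> ?V" for w
    proof -
      \<comment> \<open>By the eigenvalue equation at w, c is the mean of f over the link of w, so
        \<open>h\<close> has mean zero there.\<close>
      define c where "c = \<mu> * f w"
      define h where "h v = f v - c" for v
      define Hw where "Hw = {a. a \<in> H \<and> w \<in> a}"
      have cardHw: "real (card Hw) = deg w" by (simp add: Hw_def deg_def)
      have Sw: "(\<Sum>a\<in>Hw. S a - f w) = (real r - 1) * c * deg w"
        using eigen[OF w] sum_codeg[OF w, of f] r_ge_2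
        unfolding S_def Hw_def c_def by (simp add: field_simps)
      have ct: "c\<^sup>2 * deg w = \<mu>\<^sup>2 * (deg w * (f w)\<^sup>2)" unfolding c_def by (simp add: power2_eq_square)
      have cardm: "card (a - {w}) = r - 1" "finite a" "w \<in> a" if "a \<in> Hw" for a
        using that uniform unfolding Hw_def by auto
      have rr: "real (r - 1) = real r - 1" using r by simp
      have h1: "(\<Sum>v\<in>a - {w}. h v) = (S a - f w) - (real r - 1) * c" if "a \<in> Hw" for a
        using cardm[OF that] rr unfolding h_def S_def by (simp add: sum_subtractf sum_diff1)
      have h2: "(\<Sum>v\<in>a - {w}. (h v)\<^sup>2) = (Z a - (f w)\<^sup>2) - 2 * c * (S a - f w) + (real r - 1) * c\<^sup>2"
        if "a \<in> Hw" for a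
      proof -
        have "(\<Sum>v\<in>a - {w}. (h v)\<^sup>2) = (\<Sum>v\<in>a - {w}. (f v)\<^sup>2) - 2 * c * (\<Sum>v\<in>a - {w}. f v) + (\<Sum>v\<in>a - {w}. c\<^sup>2)"
          unfolding h_def sum_distrib_left sum.distrib[symmetric] sum_subtractf[symmetric]
          by (intro sum.cong refl) (simp add: power2_eq_square algebra_simps)
        then show ?thesis using cardm[OF that] rr by (simp add: Z_def S_def sum_diff1)
      qed
      have "(\<Sum>b\<in>hyper_link H w. \<Sum>v\<in>b. h v) = (\<Sum>a\<in>Hw. (S a - f w) - (real r - 1) * c)"
        unfolding sum_hyper_link Hw_def[symmetric] by (intro sum.cong refl h1)
      also have "\<dots> = 0" using Sw cardHw by (simp add: sum_subtractf)
      finally have "(\<Sum>b\<in>hyper_link H w. (\<Sum>v\<in>b. h v)\<^sup>2 - (\<Sum>v\<in>b. (h v)\<^sup>2))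
          \<le> l * (real (r - 1) - 1) * (\<Sum>b\<in>hyper_link H w. \<Sum>v\<in>b. (h v)\<^sup>2)"
        using links[OF w] unfolding hyper_poincare_def by blast
      moreover have D: "(\<Sum>b\<in>hyper_link H w. \<Sum>v\<in>b. (h v)\<^sup>2)
          = (\<Sum>a\<in>Hw. Z a - (f w)\<^sup>2) - (real r - 1) * (c\<^sup>2 * deg w)"
      proof -
        have "(\<Sum>b\<in>hyper_link H w. \<Sum>v\<in>b. (h v)\<^sup>2)
          = (\<Sum>a\<in>Hw. (Z a - (f w)\<^sup>2) - 2 * c * (S a - f w) + (real r - 1) * c\<^sup>2)"
          unfolding sum_hyper_link Hw_def[symmetric] by (intro sum.cong refl h2)
        also have "\<dots> = (\<Sum>a\<in>Hw. Z a - (f w)\<^sup>2) - 2 * c * (\<Sum>a\<in>Hw. S a - f w) + deg w * ((real r - 1) * c\<^sup>2)"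
          unfolding sum.distrib sum_subtractf[of "\<lambda>a. Z a - (f w)\<^sup>2"] sum_distrib_left[symmetric]
          by (simp add: cardHw)
        finally show ?thesis unfolding Sw by (simp add: power2_eq_square algebra_simps)
      qed
      moreover have "(\<Sum>b\<in>hyper_link H w. (\<Sum>v\<in>b. h v)\<^sup>2) = (\<Sum>a\<in>Hw. (S a - f w)\<^sup>2) - (real r - 1)\<^sup>2 * (c\<^sup>2 * deg w)"
      proof -
        have "(\<Sum>b\<in>hyper_link H w. (\<Sum>v\<in>b. h v)\<^sup>2)
          = (\<Sum>a\<in>Hw. (S a - f w)\<^sup>2 - 2 * ((real r - 1) * c) * (S a - f w) + ((real r - 1) * c)\<^sup>2)"
          unfolding sum_hyper_link Hw_def[symmetric]
          by (intro sum.cong refl) (simp add: h1 power2_eq_square algebra_simps)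
        also have "\<dots> = (\<Sum>a\<in>Hw. (S a - f w)\<^sup>2) - 2 * ((real r - 1) * c) * (\<Sum>a\<in>Hw. S a - f w)
            + deg w * ((real r - 1) * c)\<^sup>2"
          unfolding sum.distrib sum_subtractf[of "\<lambda>a. (S a - f w)\<^sup>2"] sum_distrib_left[symmetric]
          by (simp add: cardHw)
        finally show ?thesis unfolding Sw by (simp add: power2_eq_square algebra_simps)
      qed
      moreover have "real (r - 1) - 1 = real r - 2" using r by simp
      moreover define t where "t = c\<^sup>2 * deg w"
      moreover define X1 where "X1 = (\<Sum>a\<in>Hw. (S a - f w)\<^sup>2)"
      moreover define X2 where "X2 = (\<Sum>a\<in>Hw. Z a - (f w)\<^sup>2)"
      ultimately have "X1 - (real r - 1)\<^sup>2 * t - (X2 - (real r - 1) * t) \<le> l * (real r - 2) * (X2 - (real r - 1) * t)"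
        by (simp add: sum_subtractf[of "\<lambda>b. (\<Sum>v\<in>b. h v)\<^sup>2"])
      moreover have "(real r - 1)\<^sup>2 * t = (real r - 1) * (real r - 2) * t + (real r - 1) * t"
        by (simp add: power2_eq_square algebra_simps)
      ultimately have "X1 - X2 - (real r - 1) * (real r - 2) * t \<le> l * (real r - 2) * (X2 - (real r - 1) * t)"
        by linarith
      then show ?thesis
        unfolding Hw_def[symmetric] sum_subtractf[of "\<lambda>a. (S a - f w)\<^sup>2"] X1_def[symmetric] X2_def[symmetric]
          ct[symmetric] t_def[symmetric] .
    qed
    \<comment> \<open>Summing over w counts each hyperedge once for each of its r vertices, which
      turns the local terms into multiples of the global ones.\<close>
    have A1: "(\<Sum>w\<in>?V. \<Sum>a | a \<in> H \<and> w \<in> a. (S a - f w)\<^sup>2 - (Z a - (f w)\<^sup>2))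
        = (real r - 2) * ((real r - 1) * \<mu>)"
    proof -
      have "(\<Sum>w\<in>?V. \<Sum>a | a \<in> H \<and> w \<in> a. (S a - f w)\<^sup>2 - (Z a - (f w)\<^sup>2))
        = (\<Sum>a\<in>H. \<Sum>w\<in>a. (S a - f w)\<^sup>2 - (Z a - (f w)\<^sup>2))" unfolding swap ..
      also have "\<dots> = (\<Sum>a\<in>H. (real r - 2) * ((S a)\<^sup>2 - Z a))"
      proof (intro sum.cong refl)
        fix a assume a: "a \<in> H"
        have "(\<Sum>w\<in>a. (S a - f w)\<^sup>2 - (Z a - (f w)\<^sup>2))
          = (\<Sum>w\<in>a. (S a)\<^sup>2 - Z a) - 2 * S a * (\<Sum>w\<in>a. f w) + 2 * (\<Sum>w\<in>a. (f w)\<^sup>2)"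
          unfolding sum_distrib_left sum.distrib[symmetric] sum_subtractf[symmetric]
          by (intro sum.cong refl) (simp add: power2_eq_square algebra_simps)
        also have "\<dots> = real r * ((S a)\<^sup>2 - Z a) - 2 * S a * S a + 2 * Z a"
          using uniform[OF a] by (simp add: S_def Z_def)
        finally show "(\<Sum>w\<in>a. (S a - f w)\<^sup>2 - (Z a - (f w)\<^sup>2)) = (real r - 2) * ((S a)\<^sup>2 - Z a)"
          by (simp add: power2_eq_square algebra_simps)
      qed
      finally show ?thesis using Smu by (simp add: sum_distrib_left[symmetric])
    qed
    have A2: "(\<Sum>w\<in>?V. \<Sum>a | a \<in> H \<and> w \<in> a. Z a - (f w)\<^sup>2) = real r - 1"
    proof -
      have "(\<Sum>w\<in>?V. \<Sum>a | a \<in> H \<and> w \<in> a. Z a - (f w)\<^sup>2) = (\<Sum>a\<in>H. \<Sum>w\<in>a. Z a - (f w)\<^sup>2)"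
        unfolding swap ..
      also have "\<dots> = (\<Sum>a\<in>H. (real r - 1) * Z a)"
        using uniform by (intro sum.cong refl) (simp add: sum_subtractf Z_def algebra_simps)
      finally show ?thesis using Z1 by (simp add: sum_distrib_left[symmetric])
    qed
    have A3: "(\<Sum>w\<in>?V. x * (\<mu>\<^sup>2 * (deg w * (f w)\<^sup>2))) = x * \<mu>\<^sup>2" for x
      using f(2) by (simp add: sum_distrib_left[symmetric])
    have "(real r - 2) * ((real r - 1) * \<mu>) - (real r - 1) * (real r - 2) * \<mu>\<^sup>2
        \<le> l * (real r - 2) * ((real r - 1) - (real r - 1) * \<mu>\<^sup>2)"
    proof -
      define x where "x w = (\<Sum>a | a \<in> H \<and> w \<in> a. (S a - f w)\<^sup>2 - (Z a - (f w)\<^sup>2))" for w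
      define y where "y w = (\<Sum>a | a \<in> H \<and> w \<in> a. Z a - (f w)\<^sup>2)" for w
      define t where "t w = \<mu>\<^sup>2 * (deg w * (f w)\<^sup>2)" for w
      have "(\<Sum>w\<in>?V. x w - (real r - 1) * (real r - 2) * t w)
          \<le> (\<Sum>w\<in>?V. l * (real r - 2) * (y w - (real r - 1) * t w))"
        using local by (intro sum_mono) (simp add: x_def y_def t_def)
      then have "(\<Sum>w\<in>?V. x w) - (real r - 1) * (real r - 2) * (\<Sum>w\<in>?V. t w)
          \<le> l * (real r - 2) * ((\<Sum>w\<in>?V. y w) - (real r - 1) * (\<Sum>w\<in>?V. t w))"
        by (simp add: sum_subtractf sum_distrib_left right_diff_distrib)
      moreover have "(\<Sum>w\<in>?V. t w) = \<mu>\<^sup>2" using A3[of 1] by (simp add: t_def)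
      ultimately show ?thesis unfolding x_def y_def A1 A2 by simp
    qed
    then have "((real r - 2) * (real r - 1)) * (\<mu> - \<mu>\<^sup>2) \<le> ((real r - 2) * (real r - 1)) * (l * (1 - \<mu>\<^sup>2))"
      by (simp add: algebra_simps)
    then have key: "\<mu> - \<mu>\<^sup>2 \<le> l * (1 - \<mu>\<^sup>2)" using r by simp
    \<comment> \<open>The squared differences within hyperedges add up to a positive multiple of 1 -
      \<mu>. Hence \<mu> \<le> 1, with equality only if f is constant on every hyperedge.\<close>
    have var: "(\<Sum>u\<in>a. \<Sum>v\<in>a. (f u - f v)\<^sup>2) = 2 * real r * Z a - 2 * (S a)\<^sup>2" if a: "a \<in> H" for a
    proof -
      have "(\<Sum>u\<in>a. \<Sum>v\<in>a. (f u - f v)\<^sup>2) = (\<Sum>u\<in>a. \<Sum>v\<in>a. (f u)\<^sup>2) + (\<Sum>u\<in>a. \<Sum>v\<in>a. (f v)\<^sup>2)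
          - 2 * (\<Sum>u\<in>a. \<Sum>v\<in>a. f u * f v)"
        unfolding sum_distrib_left sum.distrib[symmetric] sum_subtractf[symmetric]
        by (intro sum.cong refl) (simp add: power2_eq_square algebra_simps)
      also have "(\<Sum>u\<in>a. \<Sum>v\<in>a. f u * f v) = (S a)\<^sup>2"
        by (simp add: S_def power2_eq_square sum_product)
      finally show ?thesis using uniform[OF a]
        by (simp add: Z_def sum_distrib_left[symmetric])
    qed
    have total: "(\<Sum>a\<in>H. \<Sum>u\<in>a. \<Sum>v\<in>a. (f u - f v)\<^sup>2) = 2 * (real r - 1) * (1 - \<mu>)"
    proof -
      have "(\<Sum>a\<in>H. \<Sum>u\<in>a. \<Sum>v\<in>a. (f u - f v)\<^sup>2) = (\<Sum>a\<in>H. 2 * real r * Z a - 2 * (S a)\<^sup>2)"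
        by (intro sum.cong refl var)
      also have "\<dots> = 2 * real r - 2 * ((real r - 1) * \<mu> + 1)"
        using Z1 S2 by (simp add: sum_subtractf sum_distrib_left[symmetric])
      finally show ?thesis by (simp add: algebra_simps)
    qed
    have nonneg: "0 \<le> (\<Sum>u\<in>a. \<Sum>v\<in>a. (f u - f v)\<^sup>2)" for a by (intro sum_nonneg) simp
    have "0 \<le> 2 * (real r - 1) * (1 - \<mu>)" unfolding total[symmetric] by (intro sum_nonneg nonneg)
    then have mu_le: "\<mu> \<le> 1" using r by (simp add: zero_le_mult_iff)
    have mu_ne: "\<mu> \<noteq> 1"
    proof
      assume "\<mu> = 1"
      then have "(\<Sum>a\<in>H. \<Sum>u\<in>a. \<Sum>v\<in>a. (f u - f v)\<^sup>2) = 0" using total by simp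
      then have z: "(\<Sum>u\<in>a. \<Sum>v\<in>a. (f u - f v)\<^sup>2) = 0" if "a \<in> H" for a
        using that sum_nonneg_eq_0_iff[OF finite_H, of "\<lambda>a. \<Sum>u\<in>a. \<Sum>v\<in>a. (f u - f v)\<^sup>2"] nonneg by blast
      have "f u = f v" if "a \<in> H" "u \<in> a" "v \<in> a" for a u v
      proof -
        have fin: "finite a" using uniform that by blast
        have "(\<Sum>v\<in>a. (f u - f v)\<^sup>2) = 0"
          using z[OF that(1)] that(2) fin by (subst (asm) sum_nonneg_eq_0_iff) (auto intro: sum_nonneg)
        then have "(f u - f v)\<^sup>2 = 0"
          using that(3) fin by (subst (asm) sum_nonneg_eq_0_iff) auto
        then show ?thesis by simp
      qed
      then have const: "f u = f v0" if "u \<in> ?V" for u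
        using conn that v0(1) unfolding hyper_connected_def by blast
      have "(\<Sum>v\<in>?V. deg v * f v) = (\<Sum>v\<in>?V. deg v) * f v0"
        unfolding sum_distrib_right by (intro sum.cong refl) (simp add: const)
      moreover have "(\<Sum>v\<in>?V. deg v) > 0"
        using v0(1) deg_pos finite_vertices by (intro sum_pos) auto
      ultimately have "f v0 = 0" using f(1) by simp
      then have "(\<Sum>v\<in>?V. deg v * (f v)\<^sup>2) = 0" using const by (intro sum.neutral) simp
      then show False using f(2) by simp
    qed
    \<comment> \<open>The inequality \<open>key\<close> has the factor 1 - \<mu>, which is now known
      to be positive and can be cancelled.\<close>
    have "(1 - \<mu>) * (\<mu> - l * (1 + \<mu>)) \<le> 0" using key by (simp add: power2_eq_square algebra_simps)
    then have "\<mu> \<le> l * (1 + \<mu>)" using mu_le mu_ne by (simp add: mult_le_0_iff)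
    then have "\<mu> * (1 - l) \<le> l" by (simp add: algebra_simps)
    then have mu: "\<mu> \<le> l / (1 - l)" using l by (simp add: field_simps)
    have "(\<Sum>u\<in>?V. \<Sum>v\<in>?V. codeg u v * g u * g v) \<le> \<mu> * (\<Sum>v\<in>?V. deg v * (g v)\<^sup>2)" by (rule max[OF g])
    also have "\<dots> \<le> l / (1 - l) * (\<Sum>v\<in>?V. deg v * (g v)\<^sup>2)"
      using mu deg_pos by (intro mult_right_mono sum_nonneg) (simp_all add: less_imp_le)
    finally show ?thesis .
  qed
qed

text \<open>The weights of the edges at u sum to c (r - 1) \<open>deg u\<close>, because the rows of
  \<open>codeg\<close> sum to \<open>deg\<close>. The factor c cancels; it accommodates the
  factorial in \<open>link_weight\<close>.\<close>

lemma transition_prob_hypergraph: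
  assumes E: "E = {e. card e = 2 \<and> (\<exists>a\<in>H. e \<subseteq> a)}" and c: "c > 0"
    and w: "\<And>e. e \<in> E \<Longrightarrow> w e = c * real (card {a \<in> H. e \<subseteq> a})"
    and u: "u \<in> \<Union>H" and v: "v \<in> \<Union>H"
  shows "deg u * transition_prob E w u v = codeg u v"
proof -
  have w0: "w {u, v} = c * ((real r - 1) * codeg u v)" if "{u, v} \<in> E" "u \<noteq> v" for u v
    using w[OF that(1)] that(2) r_ge_2 by (simp add: codeg_def)
  have notE: "codeg u v = 0" if "{u, v} \<notin> E" for u v
  proof (cases "u = v")
    case False
    then have "{a \<in> H. u \<in> a \<and> v \<in> a} = {}" using that unfolding E by auto
    then show ?thesis unfolding codeg_def by (metis card.empty div_0 of_nat_0)
  qed (simp add: codeg_def)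
  have EV: "e \<subseteq> \<Union>H" if "e \<in> E" for e using that unfolding E by blast
  have nE: "{x} \<notin> E" for x unfolding E by simp
  have "(\<Sum>e | e \<in> E \<and> u \<in> e. w e) = (\<Sum>x | x \<in> \<Union>H \<and> {u, x} \<in> E. w {u, x})"
  proof (rule sum.reindex_bij_betw[symmetric])
    show "bij_betw (\<lambda>x. {u, x}) {x. x \<in> \<Union>H \<and> {u, x} \<in> E} {e. e \<in> E \<and> u \<in> e}"
      unfolding bij_betw_def
    proof
      show "inj_on (\<lambda>x. {u, x}) {x. x \<in> \<Union>H \<and> {u, x} \<in> E}"
        by (auto simp: inj_on_def doubleton_eq_iff)
      show "(\<lambda>x. {u, x}) ` {x. x \<in> \<Union>H \<and> {u, x} \<in> E} = {e. e \<in> E \<and> u \<in> e}"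
      proof (intro equalityI subsetI)
        fix e assume e: "e \<in> {e. e \<in> E \<and> u \<in> e}"
        then have "card e = 2" "u \<in> e" unfolding E by auto
        then obtain x where "e = {u, x}" by (auto simp: card_2_iff)
        then show "e \<in> (\<lambda>x. {u, x}) ` {x. x \<in> \<Union>H \<and> {u, x} \<in> E}"
          using e EV[of e] by auto
      qed auto
    qed
  qed
  also have "\<dots> = (\<Sum>x | x \<in> \<Union>H \<and> {u, x} \<in> E. c * ((real r - 1) * codeg u x))"
    using nE by (intro sum.cong refl w0) auto
  also have "\<dots> = (\<Sum>x\<in>\<Union>H. c * ((real r - 1) * codeg u x))"
    using notE finite_vertices by (intro sum.mono_neutral_left) auto
  also have "\<dots> = c * ((real r - 1) * deg u)"
    by (simp add: sum_distrib_left[symmetric] codeg_row[OF u])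
  finally have S: "(\<Sum>e | e \<in> E \<and> u \<in> e. w e) = c * ((real r - 1) * deg u)" .
  show ?thesis
  proof (cases "{u, v} \<in> E")
    case True
    then have "u \<noteq> v" using nE by auto
    then show ?thesis unfolding transition_prob_def S using True w0[OF True] c r_ge_2 deg_pos[OF u] by simp
  qed (simp add: transition_prob_def notE)
qed

text \<open>Functions are transported along the enumeration chosen in \<open>walk_char_poly\<close>,
  whatever it is; the Poincare inequality then becomes the hypothesis of
  \<open>second_root_le\<close> with the degrees as weights.\<close>

lemma second_eigenvalue_hypergraph:
  assumes E: "E = {e. card e = 2 \<and> (\<exists>a\<in>H. e \<subseteq> a)}" and c: "c > 0"
    and w: "\<And>e. e \<in> E \<Longrightarrow> w e = c * real (card {a \<in> H. e \<subseteq> a})"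
    and ne: "H \<noteq> {}" and p: "hyper_poincare H r l"
  shows "second_eigenvalue (\<Union>H) E w \<le> l"
proof -
  let ?V = "\<Union>H"
  define vs where "vs = (SOME vs. set vs = ?V \<and> distinct vs)"
  have vs: "set vs = ?V" "distinct vs"
    using someI_ex[OF finite_distinct_list[OF finite_vertices]] unfolding vs_def by auto
  define N where "N = card ?V"
  have N: "N = length vs" using vs distinct_card N_def by metis
  have "N \<ge> 2"
  proof -
    obtain a where a: "a \<in> H" using ne by blast
    then have "card a \<le> N" unfolding N_def using finite_vertices by (intro card_mono) auto
    then show ?thesis using uniform[OF a] r_ge_2 by simp
  qed
  have bij: "bij_betw (\<lambda>i. vs ! i) {..<N} ?V"
    using bij_betw_nth[OF vs(2), of "{..<N}" ?V] vs(1) N by (simp add: lessThan_atLeast0)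
  have vsV: "vs ! i \<in> ?V" if "i < N" for i using that N vs(1) nth_mem by blast
  note reindex = sum.reindex_bij_betw[OF bij]
  define A where "A = Matrix.mat N N (\<lambda>(i, j). transition_prob E w (vs ! i) (vs ! j))"
  have A: "A \<in> carrier_mat N N" by (simp add: A_def)
  have tp: "deg (vs ! i) * A $$ (i, j) = codeg (vs ! i) (vs ! j)" if "i < N" "j < N" for i j
    using transition_prob_hypergraph[OF E c w, of "vs ! i" "vs ! j"] vsV that by (simp add: A_def)
  have "rev (sorted_list_of_multiset (proots (char_poly A))) ! 1 \<le> l"
  proof (rule second_root_le[OF A \<open>N \<ge> 2\<close>, of "\<lambda>i. deg (vs ! i)"])
    show "deg (vs ! i) > 0" if "i < N" for i using deg_pos vsV that by blast
    show "deg (vs ! i) * A $$ (i, j) = deg (vs ! j) * A $$ (j, i)" if "i < N" "j < N" for i j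
      using tp that codeg_sym by simp
    fix f :: "nat \<Rightarrow> real"
    assume f: "(\<Sum>i<N. deg (vs ! i) * f i) = 0"
    define g where "g v = f (the_inv_into {..<N} (\<lambda>i. vs ! i) v)" for v
    have g: "g (vs ! i) = f i" if "i < N" for i
      unfolding g_def using the_inv_into_f_f[of "\<lambda>i. vs ! i" "{..<N}" i] bij that by (simp add: bij_betw_def)
    have "(\<Sum>v\<in>?V. deg v * g v) = (\<Sum>i<N. deg (vs ! i) * g (vs ! i))" by (rule reindex[symmetric])
    also have "\<dots> = 0" using f g by simp
    finally have "(\<Sum>u\<in>?V. \<Sum>v\<in>?V. codeg u v * g u * g v) \<le> l * (\<Sum>v\<in>?V. deg v * (g v)\<^sup>2)"
      using p unfolding hyper_poincare_iff by blast
    also have "(\<Sum>v\<in>?V. deg v * (g v)\<^sup>2) = (\<Sum>i<N. deg (vs ! i) * (f i)\<^sup>2)"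
      unfolding reindex[symmetric] using g by (intro sum.cong) auto
    also have "(\<Sum>u\<in>?V. \<Sum>v\<in>?V. codeg u v * g u * g v)
      = (\<Sum>i<N. \<Sum>j<N. codeg (vs ! i) (vs ! j) * f i * f j)"
      unfolding reindex[symmetric] using g by (intro sum.cong refl) auto
    also have "\<dots> = (\<Sum>i<N. deg (vs ! i) * f i * (\<Sum>j<N. A $$ (i, j) * f j))"
      unfolding sum_distrib_left by (intro sum.cong refl) (simp add: tp[symmetric])
    finally show "(\<Sum>i<N. deg (vs ! i) * f i * (\<Sum>j<N. A $$ (i, j) * f j))
      \<le> l * (\<Sum>i<N. deg (vs ! i) * (f i)\<^sup>2)" .
  qed
  then show ?thesis
    unfolding second_eigenvalue_def walk_char_poly_def Let_def vs_def[symmetric] N_def[symmetric] A_def .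
qed

end

section \<open>Spectral expansion of coset complexes\<close>

text \<open>The last assumption is the Poincare inequality of the bipartite link of a face of type \<open>\<sigma>\<close>: a chamber
  of the link is an element \<open>x\<close> of the intersection group of \<open>\<sigma>\<close>, and \<open>a\<close> and \<open>b\<close> are the values of a
  function at its two vertices, whence their invariance.\<close>

locale coset_expander = coset_geometry G n K for G (structure) and n K +
  fixes q :: nat
  assumes n_ge_2: "n \<ge> 2" and q_large: "sqrt (real q) > real n - 1"
    and link_expansion: "\<lbrakk>\<sigma> \<subseteq> {..n}; {..n} - \<sigma> = {i, j}; i \<noteq> j;
      \<And>x y. x \<in> meet_subgroup G K \<sigma> \<Longrightarrow> y \<in> meet_subgroup G K ({..n} - {j}) \<Longrightarrow> a (x \<otimes> y) = a x;
      \<And>x y. x \<in> meet_subgroup G K \<sigma> \<Longrightarrow> y \<in> meet_subgroup G K ({..n} - {i}) \<Longrightarrow> b (x \<otimes> y) = b x;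
      (\<Sum>x\<in>meet_subgroup G K \<sigma>. a x + b x) = (0::real)\<rbrakk>
      \<Longrightarrow> 2 * (\<Sum>x\<in>meet_subgroup G K \<sigma>. a x * b x)
        \<le> 1 / sqrt (real q) * (\<Sum>x\<in>meet_subgroup G K \<sigma>. (a x)\<^sup>2 + (b x)\<^sup>2)"
begin

text \<open>The chambers of the link of \<open>F g \<sigma>\<close> (see
  \<open>top_link_Hyp\<close>), regarded as a uniform hypergraph whose walk is the weighted walk on
  the link.\<close>

definition Hyp :: "'a \<Rightarrow> nat set \<Rightarrow> (nat \<times> 'a set) set set" where
  "Hyp g \<sigma> = (\<lambda>x. F (g \<otimes> x) ({..n} - \<sigma>)) ` KK \<sigma>"

lemma finite_KK: "finite (KK \<sigma>)"
  by (rule finite_subset[OF _ finite_carrier]) (auto simp: meet_subgroup_def)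

lemma finite_types: "\<sigma> \<subseteq> {..n} \<Longrightarrow> finite \<sigma>"
  by (metis finite_subset finite_atMost)

lemma card_diff_types:
  assumes "\<sigma> \<subseteq> {..n}"
  shows "card ({..n} - \<sigma>) = n + 1 - card \<sigma>" "card \<sigma> \<le> n + 1"
  using card_Diff_subset[OF finite_types[OF assms] assms] card_mono[OF _ assms] by simp_all

text \<open>An element of \<open>KK \<sigma>\<close> that also lies in the groups of the
  complementary types lies in all \<open>K i\<close>, hence is trivial.\<close>

lemma inj_Hyp:
  assumes \<sigma>: "\<sigma> \<subseteq> {..n}" and g: "g \<in> carrier G"
  shows "inj_on (\<lambda>x. F (g \<otimes> x) ({..n} - \<sigma>)) (KK \<sigma>)"
proof (rule inj_onI)
  fix x y assume xy: "x \<in> KK \<sigma>" "y \<in> KK \<sigma>" "F (g \<otimes> x) ({..n} - \<sigma>) = F (g \<otimes> y) ({..n} - \<sigma>)"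
  have c: "x \<in> carrier G" "y \<in> carrier G" using xy KK_carrier by auto
  have "inv (g \<otimes> x) \<otimes> (g \<otimes> y) \<in> KK ({..n} - \<sigma>)"
    using F_eq_iff[of "{..n} - \<sigma>" "g \<otimes> x" "g \<otimes> y"] xy(3) c g by auto
  moreover have "inv (g \<otimes> x) \<otimes> (g \<otimes> y) = inv x \<otimes> y"
    using c g by (simp add: inv_mult_group m_assoc inv_mult_cancel)
  moreover have "inv x \<otimes> y \<in> KK \<sigma>"
    using subgroup.m_closed[OF subgroup_KK[OF \<sigma>]] subgroup.m_inv_closed[OF subgroup_KK[OF \<sigma>]] xy by blast
  ultimately have "inv x \<otimes> y \<in> KK (\<sigma> \<union> ({..n} - \<sigma>))" using KK_Un[of "inv x \<otimes> y" \<sigma> "{..n} - \<sigma>"] by simp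
  moreover have "\<sigma> \<union> ({..n} - \<sigma>) = {..n}" using \<sigma> by blast
  ultimately have "inv x \<otimes> y = \<one>" using meet_all by simp
  then show "x = y" using mult_inv_cancel[OF c] c by simp
qed

lemma sum_Hyp:
  assumes "\<sigma> \<subseteq> {..n}" "g \<in> carrier G"
  shows "(\<Sum>a\<in>Hyp g \<sigma>. f a) = (\<Sum>x\<in>KK \<sigma>. f (F (g \<otimes> x) ({..n} - \<sigma>)))"
  unfolding Hyp_def by (rule sum.reindex[OF inj_Hyp[OF assms], unfolded o_def])

lemma finite_F: "finite \<tau> \<Longrightarrow> finite (F g \<tau>)"
  by (simp add: face_def)

lemma uniform_Hyp:
  assumes "\<sigma> \<subseteq> {..n}" "card \<sigma> \<le> n - 1"
  shows "uniform_hypergraph (Hyp g \<sigma>) (n + 1 - card \<sigma>)"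
proof
  show "finite (Hyp g \<sigma>)" unfolding Hyp_def using finite_KK by simp
  show "finite a \<and> card a = n + 1 - card \<sigma>" if "a \<in> Hyp g \<sigma>" for a
    using that card_diff_types[OF assms(1)] unfolding Hyp_def by (auto simp: card_F finite_F)
  show "2 \<le> n + 1 - card \<sigma>" using assms(2) n_ge_2 by linarith
qed

lemma vertex_Hyp:
  assumes "\<sigma> \<subseteq> {..n}" "w \<in> \<Union>(Hyp g \<sigma>)"
  obtains i x where "i \<in> {..n} - \<sigma>" "x \<in> KK \<sigma>" "w = (i, g \<otimes> x <#\<^bsub>G\<^esub> K i)"
  using assms unfolding Hyp_def face_def by auto

text \<open>Links in links are links of larger faces: the chambers through the vertex of type i at g
  x differ from g x by elements lying in both \<open>KK \<sigma>\<close> and \<open>K i\<close>. The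
  induction in \<open>poincare_Hyp\<close> rests on this.\<close>

lemma hyper_link_Hyp:
  assumes \<sigma>: "\<sigma> \<subseteq> {..n}" and g: "g \<in> carrier G" and i: "i \<in> {..n} - \<sigma>" and x: "x \<in> KK \<sigma>"
  shows "hyper_link (Hyp g \<sigma>) (i, g \<otimes> x <#\<^bsub>G\<^esub> K i) = Hyp (g \<otimes> x) (insert i \<sigma>)"
proof -
  let ?w = "(i, g \<otimes> x <#\<^bsub>G\<^esub> K i)"
  have xc: "x \<in> carrier G" using x KK_carrier by blast
  have iff: "?w \<in> F (g \<otimes> y) ({..n} - \<sigma>) \<longleftrightarrow> inv x \<otimes> y \<in> K i" if y: "y \<in> KK \<sigma>" for y
  proof -
    have yc: "y \<in> carrier G" using y KK_carrier by blast
    have "?w \<in> F (g \<otimes> y) ({..n} - \<sigma>) \<longleftrightarrow> g \<otimes> x <#\<^bsub>G\<^esub> K i = g \<otimes> y <#\<^bsub>G\<^esub> K i"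
      using i unfolding face_def by auto
    also have "\<dots> \<longleftrightarrow> inv (g \<otimes> x) \<otimes> (g \<otimes> y) \<in> K i"
      using i g xc yc by (intro coset_eq_iff subgroup_K) auto
    also have "inv (g \<otimes> x) \<otimes> (g \<otimes> y) = inv x \<otimes> y"
      using xc yc g by (simp add: inv_mult_group m_assoc inv_mult_cancel)
    finally show ?thesis .
  qed
  have diff: "F (g \<otimes> y) ({..n} - \<sigma>) - {?w} = F (g \<otimes> y) ({..n} - insert i \<sigma>)"
    if "?w \<in> F (g \<otimes> y) ({..n} - \<sigma>)" for y
    using that unfolding face_def by auto
  show ?thesis
  proof (intro equalityI subsetI)
    fix b assume "b \<in> hyper_link (Hyp g \<sigma>) ?w"
    then obtain y where y: "y \<in> KK \<sigma>" "?w \<in> F (g \<otimes> y) ({..n} - \<sigma>)" "b = F (g \<otimes> y) ({..n} - \<sigma>) - {?w}"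
      unfolding hyper_link_def Hyp_def by blast
    have yc: "y \<in> carrier G" using y KK_carrier by blast
    define z where "z = inv x \<otimes> y"
    have "z \<in> KK \<sigma>" unfolding z_def
      using subgroup.m_closed[OF subgroup_KK[OF \<sigma>]] subgroup.m_inv_closed[OF subgroup_KK[OF \<sigma>]] x y by blast
    moreover have "z \<in> K i" using iff[OF y(1)] y(2) by (simp add: z_def)
    ultimately have z: "z \<in> KK (insert i \<sigma>)" by (auto simp: meet_subgroup_def)
    have "g \<otimes> x \<otimes> z = g \<otimes> y" unfolding z_def using xc yc g by (simp add: m_assoc mult_inv_cancel)
    then have "b = F (g \<otimes> x \<otimes> z) ({..n} - insert i \<sigma>)" using y(3) diff[OF y(2)] by simp
    then show "b \<in> Hyp (g \<otimes> x) (insert i \<sigma>)" unfolding Hyp_def using z by blast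
  next
    fix b assume "b \<in> Hyp (g \<otimes> x) (insert i \<sigma>)"
    then obtain z where z: "z \<in> KK (insert i \<sigma>)" "b = F (g \<otimes> x \<otimes> z) ({..n} - insert i \<sigma>)"
      unfolding Hyp_def by blast
    have zc: "z \<in> carrier G" using z KK_carrier by blast
    have zs: "z \<in> KK \<sigma>" "z \<in> K i" using z(1) by (auto simp: meet_subgroup_def)
    define y where "y = x \<otimes> z"
    have y: "y \<in> KK \<sigma>" unfolding y_def using subgroup.m_closed[OF subgroup_KK[OF \<sigma>]] x zs by blast
    have e: "g \<otimes> x \<otimes> z = g \<otimes> y" unfolding y_def using g xc zc by (simp add: m_assoc)
    have "inv x \<otimes> y = z" unfolding y_def using xc zc by (simp add: inv_mult_cancel)
    then have w: "?w \<in> F (g \<otimes> y) ({..n} - \<sigma>)" using iff[OF y] zs by simp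
    have "b = F (g \<otimes> y) ({..n} - \<sigma>) - {?w}" using z(2) diff[OF w] unfolding e by simp
    then show "b \<in> hyper_link (Hyp g \<sigma>) ?w" unfolding hyper_link_def Hyp_def using y w by blast
  qed
qed

lemma top_link_Hyp:
  assumes "\<sigma> \<subseteq> {..n}" "g \<in> carrier G"
  shows "simplices (link X (F g \<sigma>)) (int n - int (card \<sigma>)) = Hyp g \<sigma>"
  unfolding Hyp_def by (rule top_simplices_link[OF assms])

lemma connected_Hyp:
  assumes \<sigma>: "\<sigma> \<subseteq> {..n}" and g: "g \<in> carrier G" and c: "card \<sigma> \<le> n - 1"
  shows "hyper_connected (Hyp g \<sigma>)"
  unfolding hyper_connected_def
proof (intro allI impI ballI)
  fix f :: "nat \<times> 'a set \<Rightarrow> real" and u v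
  assume const: "\<forall>a\<in>Hyp g \<sigma>. \<forall>u\<in>a. \<forall>v\<in>a. f u = f v" and u: "u \<in> \<Union>(Hyp g \<sigma>)" and v: "v \<in> \<Union>(Hyp g \<sigma>)"
  obtain a b where ab: "a \<in> Hyp g \<sigma>" "u \<in> a" "b \<in> Hyp g \<sigma>" "v \<in> b" using u v by blast
  have "(a, b) \<in> {(\<alpha>, \<beta>). \<alpha> \<in> Hyp g \<sigma> \<and> \<beta> \<in> Hyp g \<sigma> \<and>
      \<alpha> \<inter> \<beta> \<in> simplices (link X (F g \<sigma>)) (int n - int (card \<sigma>) - 1)}\<^sup>*"
    using link_gallery_connected[OF \<sigma> g] ab unfolding gallery_connected_def top_link_Hyp[OF \<sigma> g] by blast
  then have "\<forall>v\<in>b. f u = f v"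
  proof (induction rule: rtrancl_induct)
    case base
    then show ?case using const ab by blast
  next
    case (step b' b)
    then have s: "b' \<in> Hyp g \<sigma>" "b \<in> Hyp g \<sigma>" "int (card (b' \<inter> b)) = int n - int (card \<sigma>)"
      by (auto simp: simplices_def)
    \<comment> \<open>Adjacent chambers share all vertices but one, and a chamber of this link has
      at least two.\<close>
    then have "card (b' \<inter> b) > 0" using c n_ge_2 by linarith
    then obtain w where "w \<in> b'" "w \<in> b" by (metis IntE card_gt_0_iff ex_in_conv)
    then show ?case using step.IH const s(2) by metis
  qed
  then show "f u = f v" using ab by blast
qed

text \<open>With two missing types a hyperedge is an edge, with values a x and b x at its ends, and
  (a + b)^2 - a^2 - b^2 = 2 a b. Sums over edges are sums over \<open>KK \<sigma>\<close>.\<close>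

lemma poincare_base:
  assumes \<sigma>: "\<sigma> \<subseteq> {..n}" and g: "g \<in> carrier G" and c: "card \<sigma> = n - 1"
  shows "hyper_poincare (Hyp g \<sigma>) 2 (1 / sqrt (real q))"
proof -
  have "card ({..n} - \<sigma>) = 2" using card_diff_types(1)[OF \<sigma>] c n_ge_2 by simp
  then obtain i j where ij: "{..n} - \<sigma> = {i, j}" "i \<noteq> j" by (auto simp: card_2_iff)
  have ij_le: "i \<le> n" "j \<le> n" using ij by auto
  have sub: "KK ({..n} - {k}) \<subseteq> K l" if "l \<le> n" "l \<noteq> k" for k l
    using that by (auto simp: meet_subgroup_def)
  show ?thesis unfolding hyper_poincare_def
  proof (intro allI impI)
    fix f :: "nat \<times> 'a set \<Rightarrow> real"
    assume s: "(\<Sum>a\<in>Hyp g \<sigma>. sum f a) = 0"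
    define a where "a x = f (i, g \<otimes> x <#\<^bsub>G\<^esub> K i)" for x
    define b where "b x = f (j, g \<otimes> x <#\<^bsub>G\<^esub> K j)" for x
    have Fsum: "sum h (F (g \<otimes> x) ({..n} - \<sigma>)) = h (i, g \<otimes> x <#\<^bsub>G\<^esub> K i) + h (j, g \<otimes> x <#\<^bsub>G\<^esub> K j)"
      for x and h :: "nat \<times> 'a set \<Rightarrow> real"
      unfolding ij(1) face_def using ij(2) by simp
    have inv: "g \<otimes> (x \<otimes> y) <#\<^bsub>G\<^esub> K l = g \<otimes> x <#\<^bsub>G\<^esub> K l"
      if x: "x \<in> KK \<sigma>" and y: "y \<in> KK ({..n} - {k})" and l: "l \<le> n" "l \<noteq> k" for x y k l
    proof -
      have c: "x \<in> carrier G" "y \<in> carrier G" using x y KK_carrier by auto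
      have "inv (g \<otimes> x) \<otimes> (g \<otimes> (x \<otimes> y)) = y"
        using c g by (simp add: inv_mult_group m_assoc inv_mult_cancel)
      then show ?thesis
        using coset_eq_iff[OF subgroup_K[OF l(1)], of "g \<otimes> x" "g \<otimes> (x \<otimes> y)"] sub[OF l] y c g by auto
    qed
    have "(\<Sum>x\<in>KK \<sigma>. a x + b x) = 0"
      using s unfolding sum_Hyp[OF \<sigma> g] Fsum a_def b_def .
    then have "2 * (\<Sum>x\<in>KK \<sigma>. a x * b x) \<le> 1 / sqrt (real q) * (\<Sum>x\<in>KK \<sigma>. (a x)\<^sup>2 + (b x)\<^sup>2)"
      by (intro link_expansion[OF \<sigma> ij])
        (use inv ij_le ij(2) in \<open>auto simp: a_def b_def\<close>)
    moreover have "(\<Sum>x\<in>KK \<sigma>. (a x + b x)\<^sup>2 - ((a x)\<^sup>2 + (b x)\<^sup>2)) = 2 * (\<Sum>x\<in>KK \<sigma>. a x * b x)"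
      unfolding sum_distrib_left by (intro sum.cong refl) (simp add: power2_eq_square algebra_simps)
    ultimately show "(\<Sum>a\<in>Hyp g \<sigma>. (sum f a)\<^sup>2 - (\<Sum>v\<in>a. (f v)\<^sup>2))
      \<le> 1 / sqrt (real q) * (real 2 - 1) * (\<Sum>a\<in>Hyp g \<sigma>. \<Sum>v\<in>a. (f v)\<^sup>2)"
      unfolding sum_Hyp[OF \<sigma> g] Fsum by (simp add: a_def b_def)
  qed
qed

text \<open>Here m + 2 is the number of missing types. The map \<lambda> / (1 - \<lambda>) takes
  1/(sqrt q - m) to 1/(sqrt q - (m + 1)), so passing to a face of one dimension less lowers the
  denominator by one.\<close>

lemma poincare_Hyp:
  "\<sigma> \<subseteq> {..n} \<Longrightarrow> g \<in> carrier G \<Longrightarrow> card \<sigma> + m = n - 1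
    \<Longrightarrow> hyper_poincare (Hyp g \<sigma>) (m + 2) (1 / (sqrt (real q) - real m))"
proof (induction m arbitrary: \<sigma> g)
  case 0
  then show ?case using poincare_base[of \<sigma> g] by (simp add: numeral_2_eq_2)
next
  case (Suc m)
  have fs: "finite \<sigma>" using finite_types Suc.prems(1) by blast
  have r: "n + 1 - card \<sigma> = Suc m + 2" using Suc.prems(3) n_ge_2 by linarith
  interpret uniform_hypergraph "Hyp g \<sigma>" "Suc m + 2"
    using uniform_Hyp[OF Suc.prems(1), of g] Suc.prems(3) unfolding r by simp
  define l where "l = 1 / (sqrt (real q) - real m)"
  \<comment> \<open>As m + 1 \<le> n - 1, the hypothesis on q keeps the current bound below 1, which
    trickling down requires.\<close>
  have qm: "sqrt (real q) - real m > 1" using q_large Suc.prems(3) n_ge_2 by linarith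
  have "hyper_poincare (Hyp g \<sigma>) (Suc m + 2) (l / (1 - l))"
  proof (rule trickle_down)
    show "hyper_connected (Hyp g \<sigma>)" using connected_Hyp Suc.prems by simp
    show "l < 1" unfolding l_def using qm by simp
    fix w assume "w \<in> \<Union>(Hyp g \<sigma>)"
    then obtain i x where ix: "i \<in> {..n} - \<sigma>" "x \<in> KK \<sigma>" "w = (i, g \<otimes> x <#\<^bsub>G\<^esub> K i)"
      by (rule vertex_Hyp[OF Suc.prems(1)])
    have "hyper_poincare (Hyp (g \<otimes> x) (insert i \<sigma>)) (m + 2) l"
      unfolding l_def using ix Suc.prems KK_carrier fs by (intro Suc.IH) auto
    then show "hyper_poincare (hyper_link (Hyp g \<sigma>) w) (Suc m + 2 - 1) l"
      unfolding ix(3) hyper_link_Hyp[OF Suc.prems(1,2) ix(1,2)] by simp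
  qed simp
  also have "l / (1 - l) = 1 / (sqrt (real q) - real (Suc m))"
    unfolding l_def using qm by (simp add: field_simps)
  finally show ?case .
qed

lemma vertices_link_Hyp:
  assumes "\<sigma> \<subseteq> {..n}" "g \<in> carrier G"
  shows "vertices (link X (F g \<sigma>)) = \<Union>(Hyp g \<sigma>)"
proof
  show "vertices (link X (F g \<sigma>)) \<subseteq> \<Union>(Hyp g \<sigma>)"
  proof
    fix v assume "v \<in> vertices (link X (F g \<sigma>))"
    then obtain x \<tau> where x: "x \<in> KK \<sigma>" "\<tau> \<subseteq> {..n} - \<sigma>" "v \<in> F (g \<otimes> x) \<tau>"
      unfolding vertices_def link_F[OF assms] by blast
    have "F (g \<otimes> x) \<tau> \<subseteq> F (g \<otimes> x) ({..n} - \<sigma>)" unfolding face_def using x(2) by (rule image_mono)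
    then have "v \<in> F (g \<otimes> x) ({..n} - \<sigma>)" using x(3) by (rule subsetD)
    then show "v \<in> \<Union>(Hyp g \<sigma>)" unfolding Hyp_def using x(1) by (rule UN_I[rotated])
  qed
  show "\<Union>(Hyp g \<sigma>) \<subseteq> vertices (link X (F g \<sigma>))"
    unfolding vertices_def link_F[OF assms] Hyp_def by blast
qed

lemma edges_link_Hyp:
  assumes "\<sigma> \<subseteq> {..n}" "g \<in> carrier G"
  shows "simplices (link X (F g \<sigma>)) 1 = {e. card e = 2 \<and> (\<exists>a\<in>Hyp g \<sigma>. e \<subseteq> a)}"
proof (intro equalityI subsetI)
  fix e assume "e \<in> simplices (link X (F g \<sigma>)) 1"
  then have e: "e \<in> link X (F g \<sigma>)" "card e = 2" by (auto simp: simplices_def)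
  then obtain x \<tau> where "e = F (g \<otimes> x) \<tau>" "x \<in> KK \<sigma>" "\<tau> \<subseteq> {..n} - \<sigma>" unfolding link_F[OF assms] by blast
  then have "F (g \<otimes> x) ({..n} - \<sigma>) \<in> Hyp g \<sigma>" "e \<subseteq> F (g \<otimes> x) ({..n} - \<sigma>)"
    unfolding Hyp_def by (blast, auto simp: face_def)
  then show "e \<in> {e. card e = 2 \<and> (\<exists>a\<in>Hyp g \<sigma>. e \<subseteq> a)}" using e by blast
next
  fix e assume "e \<in> {e. card e = 2 \<and> (\<exists>a\<in>Hyp g \<sigma>. e \<subseteq> a)}"
  then obtain x where e: "card e = 2" "x \<in> KK \<sigma>" "e \<subseteq> F (g \<otimes> x) ({..n} - \<sigma>)" unfolding Hyp_def by blast
  then obtain \<tau> where "\<tau> \<subseteq> {..n} - \<sigma>" "e = F (g \<otimes> x) \<tau>" unfolding face_def by (meson subset_imageE)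
  then have "e \<in> link X (F g \<sigma>)" unfolding link_F[OF assms] using e(2) by blast
  then show "e \<in> simplices (link X (F g \<sigma>)) 1" using e(1) by (auto simp: simplices_def intro: card_ge_0_finite)
qed

lemma Hyp_nonempty: "\<sigma> \<subseteq> {..n} \<Longrightarrow> Hyp g \<sigma> \<noteq> {}"
  unfolding Hyp_def using subgroup.one_closed[OF subgroup_KK] by blast

lemma link_mu_le:
  assumes \<sigma>: "\<sigma> \<subseteq> {..n}" and g: "g \<in> carrier G" and c: "card \<sigma> \<le> n - 1"
  shows "link_mu X n (int (card \<sigma>) - 1) (F g \<sigma>) \<le> 1 / (sqrt (real q) - (real n - 1))"
proof -
  define m where "m = n - 1 - card \<sigma>"
  have m: "card \<sigma> + m = n - 1" using c by (simp add: m_def)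
  have r: "n + 1 - card \<sigma> = m + 2" using m n_ge_2 by linarith
  interpret uniform_hypergraph "Hyp g \<sigma>" "m + 2"
    using uniform_Hyp[OF \<sigma> c, of g] unfolding r .
  have "link_mu X n (int (card \<sigma>) - 1) (F g \<sigma>) \<le> 1 / (sqrt (real q) - real m)"
    unfolding link_mu_def vertices_link_Hyp[OF \<sigma> g]
  proof (rule second_eigenvalue_hypergraph[OF edges_link_Hyp[OF \<sigma> g] _ _ Hyp_nonempty[OF \<sigma>] poincare_Hyp[OF \<sigma> g m]])
    show "link_weight X n (int (card \<sigma>) - 1) (F g \<sigma>) e
      = fact (nat (int n - (int (card \<sigma>) - 1) - 2)) * real (card {a \<in> Hyp g \<sigma>. e \<subseteq> a})" for e
      unfolding link_weight_def using top_link_Hyp[OF \<sigma> g] by (simp add: algebra_simps)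
  qed simp
  \<comment> \<open>The weakest of the bounds belongs to the empty face, where m = n - 1.\<close>
  also have "\<dots> \<le> 1 / (sqrt (real q) - (real n - 1))"
    using q_large m n_ge_2 by (intro divide_left_mono mult_pos_pos) auto
  finally show ?thesis .
qed

lemma simple_walk_mu_le:
  assumes \<sigma>: "\<sigma> \<subseteq> {..n}" and g: "g \<in> carrier G" and c: "card \<sigma> = n - 1"
  shows "simple_walk_mu (link X (F g \<sigma>)) \<le> 1 / sqrt (real q)"
proof -
  have r: "n + 1 - card \<sigma> = 2" using c n_ge_2 by linarith
  interpret uniform_hypergraph "Hyp g \<sigma>" 2
    using uniform_Hyp[OF \<sigma>, of g] c unfolding r by simp
  show ?thesis unfolding simple_walk_mu_def vertices_link_Hyp[OF \<sigma> g]
  proof (rule second_eigenvalue_hypergraph[OF edges_link_Hyp[OF \<sigma> g] _ _ Hyp_nonempty[OF \<sigma>] poincare_base[OF \<sigma> g c]])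
    \<comment> \<open>In a one-dimensional link the only hyperedge containing an edge is the edge
      itself, so the counting weight is the constant weight of the simple walk.\<close>
    show "1 = 1 * real (card {a \<in> Hyp g \<sigma>. e \<subseteq> a})" if e: "e \<in> simplices (link X (F g \<sigma>)) 1" for e
    proof -
      obtain a where a: "card e = 2" "a \<in> Hyp g \<sigma>" "e \<subseteq> a" using e unfolding edges_link_Hyp[OF \<sigma> g] by blast
      have "b = e" if "b \<in> Hyp g \<sigma>" "e \<subseteq> b" for b
        using uniform[OF that(1)] that(2) a(1) card_subset_eq[of b e] by simp
      then have "{a \<in> Hyp g \<sigma>. e \<subseteq> a} = {e}" using a by blast
      then show ?thesis by simp
    qed
  qed simp
qed

lemma local_spectral_expander_X:
  "one_sided_local_spectral_expander X n (1 / (sqrt (real q) - (real n - 1)))"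
  unfolding one_sided_local_spectral_expander_def
proof (intro ballI)
  fix k \<tau> assume k: "k \<in> {- 1..int n - 2}" and "\<tau> \<in> simplices X k"
  then obtain g \<sigma> where "g \<in> carrier G" "\<sigma> \<subseteq> {..n}" "\<tau> = F g \<sigma>" "int (card \<sigma>) = k + 1"
    by (elim simplices_X_cases)
  moreover from this have "card \<sigma> \<le> n - 1" "k = int (card \<sigma>) - 1" using k n_ge_2 by auto
  ultimately show "link_mu X n k \<tau> \<le> 1 / (sqrt (real q) - (real n - 1))" using link_mu_le[of \<sigma> g] by simp
qed

lemma empty_simplex: "{} \<in> simplices X (- 1)"
  by (simp add: simplices_def coset_complex_def)

lemma simple_walk_mu_X:
  assumes "\<tau> \<in> simplices X (int n - 2)"
  shows "simple_walk_mu (link X \<tau>) \<le> 1 / sqrt (real q)"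
proof -
  obtain g \<sigma> where g: "g \<in> carrier G" "\<sigma> \<subseteq> {..n}" "\<tau> = F g \<sigma>" "int (card \<sigma>) = int n - 2 + 1"
    using assms by (elim simplices_X_cases)
  then have "card \<sigma> = n - 1" using n_ge_2 by linarith
  then show ?thesis using simple_walk_mu_le g by simp
qed

end

section \<open>Matrix groups\<close>

text \<open>In a finite group translation by x is injective on the closed set H, hence onto, and the
  preimage of the unit is the inverse of x. This avoids inverting matrices explicitly.\<close>

lemma (in group) finite_submonoid_subgroup:
  assumes fin: "finite (carrier G)" and H: "H \<subseteq> carrier G" and one: "\<one> \<in> H"
    and mult: "\<And>x y. x \<in> H \<Longrightarrow> y \<in> H \<Longrightarrow> x \<otimes> y \<in> H"
  shows "subgroup H G"
proof (rule subgroupI)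
  show "H \<subseteq> carrier G" by (rule H)
  show "H \<noteq> {}" using one by blast
  show "x \<otimes> y \<in> H" if "x \<in> H" "y \<in> H" for x y using mult that .
  fix x assume x: "x \<in> H"
  have "finite H" using H fin finite_subset by metis
  moreover have "inj_on (\<lambda>y. x \<otimes> y) H"
    using H x by (auto simp: inj_on_def subset_iff)
  moreover have "(\<lambda>y. x \<otimes> y) ` H \<subseteq> H" using mult x by auto
  ultimately have "(\<lambda>y. x \<otimes> y) ` H = H" by (intro endo_inj_surj)
  then obtain y where y: "y \<in> H" "x \<otimes> y = \<one>" using one by (metis imageE)
  then have "inv x = y" using x H by (metis inv_equality inv_inv subsetD inv_closed r_inv l_inv inv_unique')
  then show "inv x \<in> H" using y by simp
qed

section \<open>Finite sums in abelian monoids\<close>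

lemma (in abelian_monoid) finsum_swap:
  assumes "finite A" "finite B" "\<And>i j. i \<in> A \<Longrightarrow> j \<in> B \<Longrightarrow> f i j \<in> carrier G"
  shows "(\<Oplus>i\<in>A. \<Oplus>j\<in>B. f i j) = (\<Oplus>j\<in>B. \<Oplus>i\<in>A. f i j)"
  using assms(1,3)
proof (induction A)
  case empty
  then show ?case by (simp add: finsum_zero)
next
  case (insert a A)
  have "(\<Oplus>i\<in>insert a A. \<Oplus>j\<in>B. f i j) = (\<Oplus>j\<in>B. f a j) \<oplus> (\<Oplus>i\<in>A. \<Oplus>j\<in>B. f i j)"
    using insert by (intro finsum_insert) (auto intro!: finsum_closed)
  also have "\<dots> = (\<Oplus>j\<in>B. f a j) \<oplus> (\<Oplus>j\<in>B. \<Oplus>i\<in>A. f i j)"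
    using insert by simp
  also have "\<dots> = (\<Oplus>j\<in>B. f a j \<oplus> (\<Oplus>i\<in>A. f i j))"
    using insert by (intro finsum_addf[symmetric]) (auto intro!: finsum_closed)
  also have "\<dots> = (\<Oplus>j\<in>B. \<Oplus>i\<in>insert a A. f i j)"
    using insert by (intro finsum_cong') (auto intro!: finsum_closed finsum_insert[symmetric])
  finally show ?case .
qed

lemma (in abelian_monoid) finsum_in_submonoid:
  assumes "finite I" "A \<subseteq> carrier G" "\<zero> \<in> A" "\<And>x y. x \<in> A \<Longrightarrow> y \<in> A \<Longrightarrow> x \<oplus> y \<in> A"
    and "\<And>i. i \<in> I \<Longrightarrow> f i \<in> A"
  shows "(\<Oplus>i\<in>I. f i) \<in> A"
  using assms(1,5)
proof (induction I)
  case (insert i I)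
  have "(\<Oplus>i\<in>insert i I. f i) = f i \<oplus> (\<Oplus>i\<in>I. f i)"
    using insert assms(2) by (intro finsum_insert) auto
  then show ?case using insert assms(4) by simp
qed (simp add: assms)

lemma (in abelian_monoid) finsum_single:
  assumes "finite I" "i \<in> I" "f i \<in> carrier G" "\<And>j. j \<in> I \<Longrightarrow> j \<noteq> i \<Longrightarrow> f j = \<zero>"
  shows "(\<Oplus>j\<in>I. f j) = f i"
proof -
  have "(\<Oplus>j\<in>I. f j) = (\<Oplus>j\<in>I. if i = j then f j else \<zero>)"
  proof (intro finsum_cong')
    show "(\<lambda>j. if i = j then f j else \<zero>) \<in> I \<rightarrow> carrier G" using assms(3) by auto
  qed (use assms in auto)
  also have "\<dots> = (\<Oplus>j\<in>I. if i = j then f i else \<zero>)"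
    using assms(3) by (intro finsum_cong') auto
  also have "\<dots> = f i" using assms(1-3) add.finprod_singleton[of i I "\<lambda>_. f i"] by auto
  finally show ?thesis .
qed

section \<open>The matrix monoid over a commutative ring\<close>

locale matrix_ring = cring R for R (structure) +
  fixes n :: nat
begin

abbreviation "M \<equiv> matrix_monoid R n"

lemma M_carrier_iff: "A \<in> carrier M \<longleftrightarrow> A \<in> extensional {..n} \<and> (\<forall>i\<le>n. A i \<in> extensional {..n} \<and> (\<forall>j\<le>n. A i j \<in> carrier R))"
  by (auto simp: matrix_monoid_def PiE_def Pi_def)

lemma M_entry: "A \<in> carrier M \<Longrightarrow> i \<le> n \<Longrightarrow> j \<le> n \<Longrightarrow> A i j \<in> carrier R"
  by (simp add: M_carrier_iff)

lemma M_eqI: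
  assumes "A \<in> carrier M" "B \<in> carrier M" "\<And>i j. i \<le> n \<Longrightarrow> j \<le> n \<Longrightarrow> A i j = B i j"
  shows "A = B"
proof (rule extensionalityI[of A "{..n}"])
  fix i assume i: "i \<in> {..n}"
  show "A i = B i"
    using assms i by (intro extensionalityI[of "A i" "{..n}"]) (auto simp: M_carrier_iff)
qed (use assms in \<open>simp_all add: M_carrier_iff\<close>)

lemma M_mult: "i \<le> n \<Longrightarrow> j \<le> n \<Longrightarrow> (A \<otimes>\<^bsub>M\<^esub> B) i j = (\<Oplus>k\<in>{..n}. A i k \<otimes> B k j)"
  by (simp add: matrix_monoid_def)

lemma M_one: "i \<le> n \<Longrightarrow> j \<le> n \<Longrightarrow> \<one>\<^bsub>M\<^esub> i j = (if i = j then \<one> else \<zero>)"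
  by (simp add: matrix_monoid_def)

lemma M_one_closed: "\<one>\<^bsub>M\<^esub> \<in> carrier M"
  by (auto simp: matrix_monoid_def)

lemma M_mult_closed: "A \<in> carrier M \<Longrightarrow> B \<in> carrier M \<Longrightarrow> A \<otimes>\<^bsub>M\<^esub> B \<in> carrier M"
  by (auto simp: matrix_monoid_def PiE_def Pi_def intro!: finsum_closed m_closed)

lemma M_assoc:
  assumes "A \<in> carrier M" "B \<in> carrier M" "C \<in> carrier M"
  shows "A \<otimes>\<^bsub>M\<^esub> B \<otimes>\<^bsub>M\<^esub> C = A \<otimes>\<^bsub>M\<^esub> (B \<otimes>\<^bsub>M\<^esub> C)"
proof (rule M_eqI)
  fix i j assume ij: "i \<le> n" "j \<le> n"
  note e = M_entry[OF assms(1)] M_entry[OF assms(2)] M_entry[OF assms(3)]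
  have "(A \<otimes>\<^bsub>M\<^esub> B \<otimes>\<^bsub>M\<^esub> C) i j = (\<Oplus>k\<in>{..n}. (\<Oplus>l\<in>{..n}. A i l \<otimes> B l k) \<otimes> C k j)"
    using ij unfolding M_mult[OF ij] by (intro finsum_cong') (auto simp: M_mult e intro!: finsum_closed m_closed)
  also have "\<dots> = (\<Oplus>k\<in>{..n}. \<Oplus>l\<in>{..n}. A i l \<otimes> B l k \<otimes> C k j)"
    using ij by (intro finsum_cong' finsum_ldistr) (auto simp: e intro!: finsum_closed m_closed)
  also have "\<dots> = (\<Oplus>l\<in>{..n}. \<Oplus>k\<in>{..n}. A i l \<otimes> B l k \<otimes> C k j)"
    using ij by (intro finsum_swap) (auto simp: e)
  also have "\<dots> = (\<Oplus>l\<in>{..n}. \<Oplus>k\<in>{..n}. A i l \<otimes> (B l k \<otimes> C k j))"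
    using ij by (intro finsum_cong') (auto simp: e m_assoc intro!: finsum_closed)
  also have "\<dots> = (\<Oplus>l\<in>{..n}. A i l \<otimes> (\<Oplus>k\<in>{..n}. B l k \<otimes> C k j))"
    using ij by (intro finsum_cong' finsum_rdistr[symmetric]) (auto simp: e intro!: finsum_closed m_closed)
  also have "\<dots> = (A \<otimes>\<^bsub>M\<^esub> (B \<otimes>\<^bsub>M\<^esub> C)) i j"
    using ij unfolding M_mult[OF ij] by (intro finsum_cong') (auto simp: M_mult e intro!: finsum_closed m_closed)
  finally show "(A \<otimes>\<^bsub>M\<^esub> B \<otimes>\<^bsub>M\<^esub> C) i j = (A \<otimes>\<^bsub>M\<^esub> (B \<otimes>\<^bsub>M\<^esub> C)) i j" .
qed (simp_all add: M_mult_closed assms)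

lemma M_l_one: "A \<in> carrier M \<Longrightarrow> \<one>\<^bsub>M\<^esub> \<otimes>\<^bsub>M\<^esub> A = A"
proof (rule M_eqI)
  fix i j assume A: "A \<in> carrier M" and ij: "i \<le> n" "j \<le> n"
  have "(\<one>\<^bsub>M\<^esub> \<otimes>\<^bsub>M\<^esub> A) i j = \<one>\<^bsub>M\<^esub> i i \<otimes> A i j"
    unfolding M_mult[OF ij] using ij M_entry[OF A] by (intro finsum_single) (auto simp: M_one)
  then show "(\<one>\<^bsub>M\<^esub> \<otimes>\<^bsub>M\<^esub> A) i j = A i j" using ij M_entry[OF A] by (simp add: M_one)
qed (simp_all add: M_mult_closed M_one_closed)

lemma M_r_one: "A \<in> carrier M \<Longrightarrow> A \<otimes>\<^bsub>M\<^esub> \<one>\<^bsub>M\<^esub> = A"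
proof (rule M_eqI)
  fix i j assume A: "A \<in> carrier M" and ij: "i \<le> n" "j \<le> n"
  have "(A \<otimes>\<^bsub>M\<^esub> \<one>\<^bsub>M\<^esub>) i j = A i j \<otimes> \<one>\<^bsub>M\<^esub> j j"
    unfolding M_mult[OF ij] using ij M_entry[OF A] by (intro finsum_single) (auto simp: M_one)
  then show "(A \<otimes>\<^bsub>M\<^esub> \<one>\<^bsub>M\<^esub>) i j = A i j" using ij M_entry[OF A] by (simp add: M_one)
qed (simp_all add: M_mult_closed M_one_closed)

lemma monoid_M: "monoid M"
  by (rule monoidI) (simp_all add: M_mult_closed M_one_closed M_assoc M_l_one M_r_one)

section \<open>Elementary matrices and the group they generate\<close>

abbreviation "el \<equiv> elementary R n"
abbreviation "GL \<equiv> units_of M"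
abbreviation "G \<equiv> EL R n"

lemma group_GL: "group GL"
  using monoid.units_group[OF monoid_M] .

lemma el_carrier: "r \<in> carrier R \<Longrightarrow> el k l r \<in> carrier M"
  by (auto simp: elementary_def matrix_monoid_def)

lemma el_entry: "i \<le> n \<Longrightarrow> j \<le> n \<Longrightarrow> el k l r i j = (if i = j then \<one> else if i = k \<and> j = l then r else \<zero>)"
  by (simp add: elementary_def)

lemma el_zero: "el k l \<zero> = \<one>\<^bsub>M\<^esub>"
  by (auto simp: elementary_def matrix_monoid_def intro!: restrict_ext)

lemma el_mult_entry:
  assumes A: "A \<in> carrier M" and kl: "k \<le> n" "l \<le> n" "k \<noteq> l" and r: "r \<in> carrier R" and ij: "i \<le> n" "j \<le> n"
  shows "(el k l r \<otimes>\<^bsub>M\<^esub> A) i j = (if i = k then A k j \<oplus> r \<otimes> A l j else A i j)"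
proof (cases "i = k")
  case False
  have "(el k l r \<otimes>\<^bsub>M\<^esub> A) i j = el k l r i i \<otimes> A i j"
    unfolding M_mult[OF ij] using ij M_entry[OF A] False by (intro finsum_single) (auto simp: el_entry)
  then show ?thesis using False ij M_entry[OF A] by (simp add: el_entry)
next
  case True
  have "(el k l r \<otimes>\<^bsub>M\<^esub> A) i j =
      (\<Oplus>m\<in>{..n}. (if k = m then A m j else \<zero>) \<oplus> (if l = m then r \<otimes> A m j else \<zero>))"
    unfolding M_mult[OF ij] using ij M_entry[OF A] kl r True by (intro finsum_cong') (auto simp: el_entry)
  also have "\<dots> = (\<Oplus>m\<in>{..n}. (if k = m then A m j else \<zero>)) \<oplus> (\<Oplus>m\<in>{..n}. (if l = m then r \<otimes> A m j else \<zero>))"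
    using ij M_entry[OF A] kl r by (intro finsum_addf) auto
  also have "(\<Oplus>m\<in>{..n}. (if k = m then A m j else \<zero>)) = A k j"
    using add.finprod_singleton[of k "{..n}" "\<lambda>m. A m j"] ij M_entry[OF A] kl by auto
  also have "(\<Oplus>m\<in>{..n}. (if l = m then r \<otimes> A m j else \<zero>)) = r \<otimes> A l j"
    using add.finprod_singleton[of l "{..n}" "\<lambda>m. r \<otimes> A m j"] ij M_entry[OF A] kl r by auto
  finally show ?thesis using True by simp
qed

lemma el_mult_elem:
  assumes "k \<le> n" "l \<le> n" "k \<noteq> l" "r \<in> carrier R" "s \<in> carrier R"
  shows "el k l r \<otimes>\<^bsub>M\<^esub> el k l s = el k l (r \<oplus> s)"
proof (rule M_eqI)
  fix i j assume ij: "i \<le> n" "j \<le> n"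
  show "(el k l r \<otimes>\<^bsub>M\<^esub> el k l s) i j = el k l (r \<oplus> s) i j"
    using assms ij by (simp add: el_mult_entry el_carrier) (auto simp: el_entry a_comm)
qed (simp_all add: assms el_carrier M_mult_closed)

lemma el_Units:
  assumes "k \<le> n" "l \<le> n" "k \<noteq> l" "r \<in> carrier R"
  shows "el k l r \<in> carrier GL"
proof -
  have "el k l r \<otimes>\<^bsub>M\<^esub> el k l (\<ominus> r) = \<one>\<^bsub>M\<^esub>" "el k l (\<ominus> r) \<otimes>\<^bsub>M\<^esub> el k l r = \<one>\<^bsub>M\<^esub>"
    using assms by (simp_all add: el_mult_elem r_neg l_neg el_zero)
  then show ?thesis unfolding units_of_carrier Units_def using assms el_carrier by auto
qed

text \<open>The Steinberg commutator relation. The trailing factor Z lets both sides be evaluated as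
  successive row operations on Z.\<close>

lemma el_commutator:
  assumes ijk: "i \<le> n" "j \<le> n" "k \<le> n" "i \<noteq> j" "j \<noteq> k" "i \<noteq> k"
    and ab: "a \<in> carrier R" "b \<in> carrier R" and Z: "Z \<in> carrier M"
  shows "el i j a \<otimes>\<^bsub>M\<^esub> (el j k b \<otimes>\<^bsub>M\<^esub> Z) = el i k (a \<otimes> b) \<otimes>\<^bsub>M\<^esub> (el j k b \<otimes>\<^bsub>M\<^esub> (el i j a \<otimes>\<^bsub>M\<^esub> Z))"
proof (rule M_eqI)
  fix x y assume xy: "x \<le> n" "y \<le> n"
  note e = M_entry[OF Z]
  have c: "Z i y \<in> carrier R" "Z j y \<in> carrier R" "Z k y \<in> carrier R" using e ijk xy by auto
  have "Z i y \<oplus> a \<otimes> (Z j y \<oplus> b \<otimes> Z k y) = Z i y \<oplus> a \<otimes> Z j y \<oplus> a \<otimes> b \<otimes> Z k y"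
    using c ab by (simp add: r_distr a_assoc m_assoc)
  then show "(el i j a \<otimes>\<^bsub>M\<^esub> (el j k b \<otimes>\<^bsub>M\<^esub> Z)) x y = (el i k (a \<otimes> b) \<otimes>\<^bsub>M\<^esub> (el j k b \<otimes>\<^bsub>M\<^esub> (el i j a \<otimes>\<^bsub>M\<^esub> Z))) x y"
    using ijk ab Z xy by (simp add: el_mult_entry el_carrier M_mult_closed)
qed (simp_all add: assms el_carrier M_mult_closed)

lemma group_G: "group G"
  unfolding EL_def using group.group_subgroup_generated[OF group_GL] .

lemma G_mult: "x \<otimes>\<^bsub>G\<^esub> y = x \<otimes>\<^bsub>M\<^esub> y"
  by (simp add: EL_def units_of_mult)

lemma G_one: "\<one>\<^bsub>G\<^esub> = \<one>\<^bsub>M\<^esub>"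
  by (simp add: EL_def units_of_one)

lemma G_GL: "x \<in> carrier G \<Longrightarrow> x \<in> carrier GL"
  unfolding EL_def using group.carrier_subgroup_generated_subset[OF group_GL] by blast

lemma G_M: "x \<in> carrier G \<Longrightarrow> x \<in> carrier M"
  using G_GL unfolding units_of_carrier Units_def by blast

lemma el_G:
  assumes "k \<le> n" "l \<le> n" "k \<noteq> l" "r \<in> carrier R"
  shows "el k l r \<in> carrier G"
proof -
  have "el k l r \<in> generate GL (carrier GL \<inter> {elementary R n i j r | i j r. i \<le> n \<and> j \<le> n \<and> i \<noteq> j \<and> r \<in> carrier R})"
    using assms el_Units by (intro generate.incl) blast
  then show ?thesis unfolding EL_def carrier_subgroup_generated .
qed

lemma G_subset:
  assumes "subgroup H G" "\<And>k l r. k \<le> n \<Longrightarrow> l \<le> n \<Longrightarrow> k \<noteq> l \<Longrightarrow> r \<in> carrier R \<Longrightarrow> el k l r \<in> H"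
  shows "carrier G \<subseteq> H"
proof -
  have "subgroup H GL"
    using assms(1) group.subgroup_subgroup_generated_iff[OF group_GL] unfolding EL_def by blast
  then show ?thesis
    unfolding EL_def carrier_subgroup_generated
    by (intro group.generate_subgroup_incl[OF group_GL]) (use assms(2) in blast)+
qed

lemma finite_G:
  assumes "finite (carrier R)"
  shows "finite (carrier G)"
proof -
  have "finite (carrier M)" using assms by (simp add: matrix_monoid_def finite_PiE)
  then show ?thesis using G_M by (metis finite_subset subsetI)
qed

text \<open>The commutator relation solved for its third root element; in this way root elements at
  longer distance are produced from the generators.\<close>

lemma el_product_in:
  assumes H: "subgroup H G"
    and ijk: "i \<le> n" "j \<le> n" "k \<le> n" "i \<noteq> j" "j \<noteq> k" "i \<noteq> k"
    and ab: "a \<in> carrier R" "b \<in> carrier R" "el i j a \<in> H" "el j k b \<in> H"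
  shows "el i k (a \<otimes> b) \<in> H"
proof -
  interpret G: group G by (rule group_G)
  have c: "el i j a \<in> carrier G" "el j k b \<in> carrier G" "el i k (a \<otimes> b) \<in> carrier G"
    using ijk ab el_G by auto
  have "el i j a \<otimes>\<^bsub>G\<^esub> el j k b = el i k (a \<otimes> b) \<otimes>\<^bsub>G\<^esub> (el j k b \<otimes>\<^bsub>G\<^esub> el i j a)"
    using el_commutator[OF ijk ab(1,2) M_one_closed] el_carrier ab unfolding G_mult by (simp add: M_r_one)
  then have "el i k (a \<otimes> b) = (el i j a \<otimes>\<^bsub>G\<^esub> el j k b) \<otimes>\<^bsub>G\<^esub> inv\<^bsub>G\<^esub> (el j k b \<otimes>\<^bsub>G\<^esub> el i j a)"
    using c by (simp add: G.inv_solve_right)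
  then show ?thesis using ab H by (simp add: subgroup.m_closed subgroup.m_inv_closed)
qed

end

text \<open>The order of the indices is encoded by the position function p and the size of the
  entries by P. One definition thus covers the groups \<open>K i\<close>, with cyclic positions, and
  the lower triangular matrices, with reversed positions and constant P.\<close>

definition unitriangular :: "('r, 'm) ring_scheme \<Rightarrow> nat \<Rightarrow> (nat \<Rightarrow> nat) \<Rightarrow> (nat \<Rightarrow> 'r set) \<Rightarrow> (nat \<Rightarrow> nat \<Rightarrow> 'r) set" where
  "unitriangular R n p P = {A \<in> carrier (matrix_monoid R n). \<forall>k\<le>n. \<forall>l\<le>n.
     (k = l \<longrightarrow> A k l = \<one>\<^bsub>R\<^esub>) \<and> (p l < p k \<longrightarrow> A k l = \<zero>\<^bsub>R\<^esub>) \<and> (p k < p l \<longrightarrow> A k l \<in> P (p l - p k))}"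

context matrix_ring
begin

lemma unitriangular_one:
  assumes "\<And>d. \<zero> \<in> P d"
  shows "\<one>\<^bsub>M\<^esub> \<in> unitriangular R n p P"
  using assms by (auto simp: unitriangular_def M_one_closed M_one)

text \<open>An index m strictly between k and l contributes a product from the degrees of its two
  distances, and these add up to the distance from k to l. Outside that range one of the factors is
  zero, and at the ends one of them is 1.\<close>

lemma unitriangular_mult:
  assumes inj: "inj_on p {..n}"
    and P: "\<And>d. P d \<subseteq> carrier R" "\<And>d. \<zero> \<in> P d" "\<And>d x y. x \<in> P d \<Longrightarrow> y \<in> P d \<Longrightarrow> x \<oplus> y \<in> P d"
      "\<And>d e x y. x \<in> P d \<Longrightarrow> y \<in> P e \<Longrightarrow> x \<otimes> y \<in> P (d + e)"
    and A: "A \<in> unitriangular R n p P" and B: "B \<in> unitriangular R n p P"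
  shows "A \<otimes>\<^bsub>M\<^esub> B \<in> unitriangular R n p P"
proof -
  have AM: "A \<in> carrier M" and BM: "B \<in> carrier M" using A B by (auto simp: unitriangular_def)
  note eA = M_entry[OF AM] and eB = M_entry[OF BM]
  have A1: "A k k = \<one>" and B1: "B k k = \<one>" if "k \<le> n" for k using A B that by (auto simp: unitriangular_def)
  have A0: "A k l = \<zero>" and B0: "B k l = \<zero>" if "k \<le> n" "l \<le> n" "p l < p k" for k l
    using A B that by (auto simp: unitriangular_def)
  have AP: "A k l \<in> P (p l - p k)" and BP: "B k l \<in> P (p l - p k)" if "k \<le> n" "l \<le> n" "p k < p l" for k l
    using A B that by (auto simp: unitriangular_def)
  have pne: "p k \<noteq> p l" if "k \<le> n" "l \<le> n" "k \<noteq> l" for k l using inj that by (auto simp: inj_on_def)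
  have diag: "(A \<otimes>\<^bsub>M\<^esub> B) k k = \<one>" if k: "k \<le> n" for k
  proof -
    have "A k m \<otimes> B m k = \<zero>" if "m \<in> {..n}" "m \<noteq> k" for m
      using A0[of k m] B0[of m k] pne[of k m] that k eA[of k m] eB[of m k] by (cases "p m < p k") auto
    then have "(A \<otimes>\<^bsub>M\<^esub> B) k k = A k k \<otimes> B k k"
      unfolding M_mult[OF k k] using k eA eB by (intro finsum_single) auto
    then show ?thesis using A1 B1 k by simp
  qed
  have low: "(A \<otimes>\<^bsub>M\<^esub> B) k l = \<zero>" if kl: "k \<le> n" "l \<le> n" "p l < p k" for k l
  proof -
    have "A k m \<otimes> B m l = \<zero>" if "m \<in> {..n}" for m
      using A0[of k m] B0[of m l] that kl eA[of k m] eB[of m l] by (cases "p m < p k") auto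
    then have "(A \<otimes>\<^bsub>M\<^esub> B) k l = (\<Oplus>m\<in>{..n}. \<zero>)"
      unfolding M_mult[OF kl(1,2)] by (intro finsum_cong') auto
    then show ?thesis by simp
  qed
  have up: "(A \<otimes>\<^bsub>M\<^esub> B) k l \<in> P (p l - p k)" if kl: "k \<le> n" "l \<le> n" "p k < p l" for k l
    unfolding M_mult[OF kl(1,2)]
  proof (rule finsum_in_submonoid)
    fix m assume "m \<in> {..n}"
    then have m: "m \<le> n" by simp
    consider "p m < p k" | "m = k" | "m = l" | "p l < p m" | "p k < p m" "p m < p l"
      using pne[of m k] pne[of m l] m kl by (metis linorder_neqE_nat)
    then show "A k m \<otimes> B m l \<in> P (p l - p k)"
    proof cases
      case 1
      then show ?thesis using A0[of k m] m kl eB P(2) by simp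
    next
      case 2
      then show ?thesis using A1 BP[OF kl] eB kl by simp
    next
      case 3
      then show ?thesis using B1 AP[OF kl] eA kl by simp
    next
      case 4
      then show ?thesis using B0[of m l] m kl eA P(2) by simp
    next
      case 5
      have "A k m \<otimes> B m l \<in> P ((p m - p k) + (p l - p m))"
        using AP[of k m] BP[of m l] 5 m kl by (intro P(4)) auto
      then show ?thesis using 5 by simp
    qed
  qed (use P in auto)
  show ?thesis unfolding unitriangular_def
    using M_mult_closed[OF AM BM] diag low up by simp
qed

end

section \<open>Filtered rings and cyclically unitriangular matrices\<close>

text \<open>The position of \<open>k\<close> in the order \<open>i + 1, \<dots>, n, 0, \<dots>, i\<close>.\<close>

definition cyclic_pos :: "nat \<Rightarrow> nat \<Rightarrow> nat \<Rightarrow> nat" where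
  "cyclic_pos n i k = (if k \<le> i then k + n - i else k - i - 1)"

lemma cyclic_pos_inj: "i \<le> n \<Longrightarrow> inj_on (cyclic_pos n i) {..n}"
  by (auto simp: inj_on_def cyclic_pos_def split: if_splits)

lemma cyclic_pos_le: "k \<le> n \<Longrightarrow> cyclic_pos n i k \<le> n"
  by (auto simp: cyclic_pos_def)

lemma cyclic_pos_self: "cyclic_pos n i i = n"
  by (simp add: cyclic_pos_def)

text \<open>Modulo n + 1 both differences equal l - k, and a positive difference of positions lies
  between 1 and n.\<close>

lemma cyclic_pos_distance:
  assumes "i \<le> n" "j \<le> n" "k \<le> n" "l \<le> n"
    "cyclic_pos n i k < cyclic_pos n i l" "cyclic_pos n j k < cyclic_pos n j l"
  shows "cyclic_pos n i l - cyclic_pos n i k = cyclic_pos n j l - cyclic_pos n j k"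
  using assms unfolding cyclic_pos_def
  by (cases "k \<le> i"; cases "l \<le> i"; cases "k \<le> j"; cases "l \<le> j"; simp)

lemma cyclic_pos_Suc:
  assumes "i \<le> n" "k \<le> n" "k \<noteq> i"
  shows "cyclic_pos n i ((k + 1) mod (n + 1)) = cyclic_pos n i k + 1"
proof (cases "k = n")
  case True
  then show ?thesis using assms by (auto simp: cyclic_pos_def)
next
  case False
  then have "(k + 1) mod (n + 1) = k + 1" using assms by simp
  then show ?thesis using assms by (auto simp: cyclic_pos_def)
qed

lemma cyclic_predecessor:
  assumes "l \<le> (n::nat)"
  obtains k where "k \<le> n" "(k + 1) mod (n + 1) = l"
proof (cases "l = 0")
  case True
  then show thesis using that[of n] by simp
next
  case False
  then show thesis using that[of "l - 1"] assms by simp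
qed

lemma bij_cyclic_pos: "i \<le> n \<Longrightarrow> bij_betw (cyclic_pos n i) {..n} {..n}"
  unfolding bij_betw_def using cyclic_pos_inj cyclic_pos_le
  by (intro conjI endo_inj_surj) auto

text \<open>\<open>P_span\<close> says that P (d + 1) is additively generated by the products of P d
  and P 1. It is phrased by closed sets A because A will be the set of coefficients r for which a
  root element belongs to a given subgroup. \<open>P_exhaust\<close> lets root elements of all
  degrees account for the whole elementary group.\<close>

locale filtered_matrix_ring = matrix_ring R n for R (structure) and n +
  fixes P :: "nat \<Rightarrow> 'a set"
  assumes n_ge_2: "n \<ge> 2" and finite_R: "finite (carrier R)" and one_neq_zero: "\<one> \<noteq> \<zero>"
    and P_carrier: "P d \<subseteq> carrier R" and P_zero: "\<zero> \<in> P d"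
    and P_add: "x \<in> P d \<Longrightarrow> y \<in> P d \<Longrightarrow> x \<oplus> y \<in> P d"
    and P_minus: "x \<in> P d \<Longrightarrow> \<ominus> x \<in> P d"
    and P_mult: "x \<in> P d \<Longrightarrow> y \<in> P e \<Longrightarrow> x \<otimes> y \<in> P (d + e)"
    and P_one: "\<one> \<in> P 1"
    and P_span: "\<lbrakk>d \<ge> 1; \<zero> \<in> A; \<And>x y. x \<in> A \<Longrightarrow> y \<in> A \<Longrightarrow> x \<oplus> y \<in> A;
      \<And>x y. x \<in> P d \<Longrightarrow> y \<in> P 1 \<Longrightarrow> x \<otimes> y \<in> A\<rbrakk> \<Longrightarrow> P (Suc d) \<subseteq> A"
    and P_exhaust: "carrier R \<subseteq> (\<Union>d\<in>{1..}. P d)"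
begin

abbreviation "pos \<equiv> cyclic_pos n"
abbreviation "UT i \<equiv> unitriangular R n (pos i) P"
abbreviation "cyc k \<equiv> (k + 1) mod (n + 1)"
abbreviation "K \<equiv> K_subgroup R (P 1) n"

sublocale G: group G by (rule group_G)

lemma cyc: "k \<le> n \<Longrightarrow> cyc k \<le> n" "k \<le> n \<Longrightarrow> cyc k \<noteq> k"
  using n_ge_2 by (auto simp: mod_Suc_le_divisor) (cases "k = n"; simp)

lemma cyc_inj: "i \<le> n \<Longrightarrow> j \<le> n \<Longrightarrow> cyc i = cyc j \<Longrightarrow> i = j"
  by (cases "i = n"; cases "j = n"; simp)

lemma cyc_cyc: "i \<le> n \<Longrightarrow> cyc (cyc i) \<noteq> i"
  using n_ge_2 by (cases "i = n"; cases "i = n - 1"; simp)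

lemma pos_neq: "i \<le> n \<Longrightarrow> k \<le> n \<Longrightarrow> l \<le> n \<Longrightarrow> k \<noteq> l \<Longrightarrow> pos i k \<noteq> pos i l"
  using cyclic_pos_inj by (auto simp: inj_on_def)

lemma PR: "x \<in> P d \<Longrightarrow> x \<in> carrier R"
  using P_carrier by blast

section \<open>Cyclically unitriangular groups and their generators\<close>

lemma mat_mult: "i \<le> n \<Longrightarrow> A \<in> UT i \<Longrightarrow> B \<in> UT i \<Longrightarrow> A \<otimes>\<^bsub>M\<^esub> B \<in> UT i"
  by (rule unitriangular_mult[OF cyclic_pos_inj]) (simp_all add: P_carrier P_zero P_add P_mult)

lemma mat_one: "\<one>\<^bsub>M\<^esub> \<in> UT i"
  using unitriangular_one P_zero .

lemma mat_M: "A \<in> UT i \<Longrightarrow> A \<in> carrier M"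
  by (simp add: unitriangular_def)

lemma el_mat:
  assumes "i \<le> n" "k \<le> n" "l \<le> n" "pos i k < pos i l" "r \<in> P (pos i l - pos i k)"
  shows "el k l r \<in> UT i"
  unfolding unitriangular_def using assms PR[OF assms(5)] P_zero
  by (auto simp: el_entry el_carrier)

text \<open>Induction on the distance from k to l. A generator leads from the predecessor l' of l to
  l; the commutator relation composes it with the root element from k to l', and
  \<open>P_span\<close> reaches all coefficients.\<close>

lemma el_generated:
  assumes H: "subgroup H G" and \<sigma>: "\<sigma> \<subseteq> {..n}" "i0 \<in> \<sigma>"
    and gen: "\<And>j m. j \<in> {..n} - \<sigma> \<Longrightarrow> m \<in> P 1 \<Longrightarrow> el j (cyc j) m \<in> H"
  shows "k \<le> n \<Longrightarrow> l \<le> n \<Longrightarrow> \<forall>i\<in>\<sigma>. pos i k < pos i l \<Longrightarrow> r \<in> P (pos i0 l - pos i0 k) \<Longrightarrow> el k l r \<in> H"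
proof (induction "pos i0 l - pos i0 k" arbitrary: l r)
  case 0
  then show ?case using \<sigma> by auto
next
  case (Suc d)
  have i0: "i0 \<le> n" using \<sigma> by auto
  obtain l' where l': "l' \<le> n" "cyc l' = l" using cyclic_predecessor[OF Suc.prems(2)] by blast
  \<comment> \<open>In the order belonging to l' the index l comes first, so k could not precede
    it.\<close>
  have "l' \<notin> \<sigma>"
  proof
    assume "l' \<in> \<sigma>"
    then have "pos l' k < pos l' l" using Suc.prems by blast
    moreover have "pos l' l = 0" using l' by (auto simp: cyclic_pos_def) (cases "l' = n"; simp)
    ultimately show False by simp
  qed
  then have pos_l: "pos i l = pos i l' + 1" if "i \<in> \<sigma>" for i
    using cyclic_pos_Suc[of i n l'] l' that \<sigma> by auto
  have l'_gen: "el l' l y \<in> H" if "y \<in> P 1" for y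
    using gen[of l' y] that l' \<open>l' \<notin> \<sigma>\<close> by auto
  show ?case
  proof (cases "d = 0")
    case True
    then have "pos i0 l' = pos i0 k" using Suc.hyps(2) pos_l[OF \<sigma>(2)] Suc.prems(3) \<sigma>(2) by fastforce
    then have "l' = k" using pos_neq i0 l' Suc.prems(1) by blast
    then show ?thesis using l'_gen Suc.prems(4) Suc.hyps(2) True by auto
  next
    case False
    \<comment> \<open>The distance from k to l is the same in all orders of \<sigma>. As it exceeds
      1, the predecessor l' comes strictly after k in each of them.\<close>
    have kl': "pos i k < pos i l'" if "i \<in> \<sigma>" for i
    proof -
      have "pos i l - pos i k = Suc d"
        using cyclic_pos_distance[of i n i0 k l] Suc.prems Suc.hyps(2) that \<sigma> i0 by auto
      then show ?thesis using pos_l[OF that] False by simp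
    qed
    have d': "d = pos i0 l' - pos i0 k" using Suc.hyps(2) pos_l[OF \<sigma>(2)] by simp
    have kne: "k \<noteq> l'" "k \<noteq> l" "l' \<noteq> l" using kl'[OF \<sigma>(2)] pos_l[OF \<sigma>(2)] by auto
    define A where "A = {r \<in> carrier R. el k l r \<in> H}"
    have "P (Suc d) \<subseteq> A"
    proof (rule P_span)
      show "\<zero> \<in> A" unfolding A_def using subgroup.one_closed[OF H] by (simp add: el_zero G_one)
      show "x \<oplus> y \<in> A" if "x \<in> A" "y \<in> A" for x y
        using that subgroup.m_closed[OF H, of "el k l x" "el k l y"] Suc.prems(1,2) kne
        unfolding A_def by (simp add: G_mult el_mult_elem)
      show "x \<otimes> y \<in> A" if x: "x \<in> P d" and y: "y \<in> P 1" for x y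
      proof -
        have "el k l' x \<in> H" using Suc.hyps(1)[OF d' Suc.prems(1) l'(1)] kl' x d' by simp
        then have "el k l (x \<otimes> y) \<in> H"
          using el_product_in[OF H Suc.prems(1) l'(1) Suc.prems(2) kne(1) kne(3) kne(2)] x y PR l'_gen by blast
        then show ?thesis using x y PR unfolding A_def by simp
      qed
    qed (use False in simp)
    then show ?thesis using Suc.prems(4) Suc.hyps(2) unfolding A_def by auto
  qed
qed

text \<open>Induction on the number of nonzero off-diagonal entries. Such an entry lies above the
  diagonal in every order of \<sigma>, so the matrix that clears it belongs to every
  \<open>UT i\<close>, and to H by \<open>el_generated\<close>.\<close>

lemma mat_generated:
  assumes H: "subgroup H G" and \<sigma>: "\<sigma> \<subseteq> {..n}" "i0 \<in> \<sigma>"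
    and gen: "\<And>j m. j \<in> {..n} - \<sigma> \<Longrightarrow> m \<in> P 1 \<Longrightarrow> el j (cyc j) m \<in> H"
  shows "\<forall>i\<in>\<sigma>. A \<in> UT i \<Longrightarrow> A \<in> H"
proof (induction "card {(k, l). k \<le> n \<and> l \<le> n \<and> k \<noteq> l \<and> A k l \<noteq> \<zero>}" arbitrary: A rule: less_induct)
  case (less A)
  define bad where "bad A = {(k, l). k \<le> n \<and> l \<le> n \<and> k \<noteq> l \<and> A k l \<noteq> \<zero>}" for A :: "nat \<Rightarrow> nat \<Rightarrow> 'a"
  have fin: "finite (bad A)" for A
    by (rule finite_subset[of _ "{..n} \<times> {..n}"]) (auto simp: bad_def)
  have AM: "A \<in> carrier M" using less.prems \<sigma>(2) mat_M by blast
  have A1: "A k k = \<one>" if "k \<le> n" for k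
    using less.prems \<sigma>(2) that by (auto simp: unitriangular_def)
  show ?case
  proof (cases "bad A = {}")
    case True
    have "A = \<one>\<^bsub>M\<^esub>"
      using True A1 by (intro M_eqI[OF AM M_one_closed]) (auto simp: M_one bad_def)
    then show ?thesis using subgroup.one_closed[OF H] by (simp add: G_one)
  next
    case False
    \<comment> \<open>An entry of the last non-trivial row is cleared by a row operation that affects no other entry.\<close>
    define f where "f kl = pos i0 (fst kl)" for kl :: "nat \<times> nat"
    have "Max (f ` bad A) \<in> f ` bad A" using False fin by (intro Max_in) auto
    then obtain k l where kl: "(k, l) \<in> bad A" "f (k, l) = Max (f ` bad A)" by (auto simp: image_iff)
    have max: "pos i0 x \<le> pos i0 k" if "(x, y) \<in> bad A" for x y
    proof -
      have "f (x, y) \<le> Max (f ` bad A)" using that fin by (intro Max_ge) auto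
      then show ?thesis using kl(2) by (simp add: f_def)
    qed
    have k: "k \<le> n" "l \<le> n" "k \<noteq> l" "A k l \<noteq> \<zero>" using kl(1) by (auto simp: bad_def)
    have lt: "pos i k < pos i l" if "i \<in> \<sigma>" for i
    proof -
      have "\<not> pos i l < pos i k" using less.prems that k by (auto simp: unitriangular_def)
      then show ?thesis using pos_neq[of i k l] that \<sigma> k by auto
    qed
    define r where "r = A k l"
    have r: "r \<in> P (pos i l - pos i k)" if "i \<in> \<sigma>" for i
      using less.prems that k lt[OF that] by (auto simp: unitriangular_def r_def)
    have rR: "r \<in> carrier R" using r[OF \<sigma>(2)] PR by blast
    define A' where "A' = el k l (\<ominus> r) \<otimes>\<^bsub>M\<^esub> A"
    have A'UT: "\<forall>i\<in>\<sigma>. A' \<in> UT i"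
      unfolding A'_def using less.prems \<sigma> k lt r P_minus by (intro ballI mat_mult el_mat) auto
    \<comment> \<open>Row l comes after k, the last non-trivial row, so it is a row of the
      identity.\<close>
    have rowl: "A l y = (if y = l then \<one> else \<zero>)" if "y \<le> n" for y
    proof -
      have "(l, y) \<notin> bad A" using max[of l y] lt[OF \<sigma>(2)] by auto
      then show ?thesis using A1 that k by (auto simp: bad_def)
    qed
    have entry: "A' x y = (if x = k \<and> y = l then \<zero> else A x y)" if "x \<le> n" "y \<le> n" for x y
      unfolding A'_def using that k rR rowl[of y] A1[of l] AM M_entry[OF AM]
      by (cases "y = l") (simp_all add: el_mult_entry r_def[symmetric] r_neg)
    have "bad A' = bad A - {(k, l)}" using entry k by (auto simp: bad_def split: if_splits)
    then have "card (bad A') < card (bad A)" using kl(1) fin by (metis card_Diff1_less)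
    then have "A' \<in> H" using less.hyps[of A'] A'UT unfolding bad_def by blast
    moreover have "el k l r \<in> H"
      using el_generated[OF H \<sigma> gen k(1,2)] lt r[OF \<sigma>(2)] by blast
    ultimately have "el k l r \<otimes>\<^bsub>M\<^esub> A' \<in> H" using subgroup.m_closed[OF H] by (simp add: G_mult)
    also have "el k l r \<otimes>\<^bsub>M\<^esub> A' = A"
      unfolding A'_def using k rR AM
      by (simp add: M_assoc[symmetric] el_carrier el_mult_elem r_neg el_zero M_l_one)
    finally show ?thesis .
  qed
qed

lemma generators_G:
  "{el j (cyc j) m | j m. j \<in> {..n} - \<sigma> \<and> m \<in> P 1} \<subseteq> carrier G"
  using cyc el_G PR by fastforce

lemma mat_subset_generate:
  assumes "\<sigma> \<subseteq> {..n}" "i0 \<in> \<sigma>" "\<forall>i\<in>\<sigma>. A \<in> UT i"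
  shows "A \<in> generate G {el j (cyc j) m | j m. j \<in> {..n} - \<sigma> \<and> m \<in> P 1}"
  by (rule mat_generated[OF G.generate_is_subgroup[OF generators_G] assms(1,2) _ assms(3)])
    (blast intro: generate.incl)

lemma mat_G: "i \<le> n \<Longrightarrow> A \<in> UT i \<Longrightarrow> A \<in> carrier G"
  using mat_subset_generate[of "{i}" i A] G.generate_incl[OF generators_G] by blast

lemma subgroup_mat: "i \<le> n \<Longrightarrow> subgroup (UT i) G"
  by (rule G.finite_submonoid_subgroup[OF finite_G[OF finite_R]])
    (use mat_G mat_one mat_mult in \<open>auto simp: G_one G_mult\<close>)

lemma generator_mat:
  assumes "i \<le> n" "j \<le> n" "j \<noteq> i" "m \<in> P 1"
  shows "el j (cyc j) m \<in> UT i"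
  using assms cyc cyclic_pos_Suc[of i n j] by (intro el_mat) auto

lemma K_eq_mat:
  assumes "i \<le> n"
  shows "K i = UT i"
proof
  show "K i \<subseteq> UT i" unfolding K_subgroup_def
    using generator_mat assms by (intro G.generate_subgroup_incl subgroup_mat) auto
  show "UT i \<subseteq> K i" unfolding K_subgroup_def using mat_subset_generate[of "{i}" i] assms by auto
qed

text \<open>A single cyclic order confines the coefficient at distance d to P d. Coefficient 1 is
  available between any two indices, through an order that starts with k. Combined with a generator
  at k it yields all coefficients of P 1, and a detour through a third index, which exists because n
  \<ge> 2, then raises the degree without limit.\<close>

lemma el_G_generated:
  assumes H: "subgroup H G" and gen: "\<And>j m. j \<le> n \<Longrightarrow> m \<in> P 1 \<Longrightarrow> el j (cyc j) m \<in> H"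
    and kl: "k \<le> n" "l \<le> n" "k \<noteq> l" and r: "r \<in> carrier R"
  shows "el k l r \<in> H"
proof -
  have one: "el k l \<one> \<in> H" if kl: "k \<le> n" "l \<le> n" "k \<noteq> l" for k l
  proof -
    have "pos k k \<ge> 1" using n_ge_2 by (simp add: cyclic_pos_def)
    \<comment> \<open>The order belonging to the predecessor of k starts with k, so every other
      index l comes after k.\<close>
    define i0 where "i0 = (if k = 0 then n else k - 1)"
    have i0: "i0 \<le> n" "pos i0 k = 0" using kl by (auto simp: i0_def cyclic_pos_def)
    have "pos i0 k < pos i0 l" using pos_neq[of i0 k l] i0 kl by simp
    have "\<one> \<in> P (pos i0 l - pos i0 k)"
    proof -
      have "\<one> \<in> P d" if "d \<ge> 1" for d
        using that
      proof (induction d rule: dec_induct)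
        case (step d)
        then show ?case using P_mult[OF step.IH P_one] by simp
      qed (rule P_one)
      then show ?thesis using \<open>pos i0 k < pos i0 l\<close> by simp
    qed
    then show ?thesis
      using el_generated[OF H, of "{i0}" i0 k l] gen i0 \<open>pos i0 k < pos i0 l\<close> kl by auto
  qed
  have third: "\<exists>j\<le>n. j \<noteq> k \<and> j \<noteq> l" for k l
  proof -
    have "card {k, l} < card {..n}" using n_ge_2 by (simp add: card_insert_if)
    then have "\<not> {..n} \<subseteq> {k, l}" by (metis card_mono finite.emptyI finite.insertI linorder_not_le)
    then show ?thesis by auto
  qed
  have deg1: "el k l r \<in> H" if kl: "k \<le> n" "l \<le> n" "k \<noteq> l" and r: "r \<in> P 1" for k l r
  proof (cases "l = cyc k")
    case True
    then show ?thesis using gen kl r by simp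
  next
    case False
    then have "el k l (r \<otimes> \<one>) \<in> H"
      using gen[OF kl(1) r] one[of "cyc k" l] cyc[OF kl(1)] kl r PR
      by (intro el_product_in[OF H, of k "cyc k" l]) auto
    then show ?thesis using r PR by simp
  qed
  have deg: "d \<ge> 1 \<Longrightarrow> k \<le> n \<Longrightarrow> l \<le> n \<Longrightarrow> k \<noteq> l \<Longrightarrow> r \<in> P d \<Longrightarrow> el k l r \<in> H" for d k l r
  proof (induction d arbitrary: k l r rule: nat_induct_at_least)
    case base
    then show ?case using deg1 by blast
  next
    case (Suc d)
    define A where "A = {r \<in> carrier R. el k l r \<in> H}"
    obtain j where j: "j \<le> n" "j \<noteq> k" "j \<noteq> l" using third by blast
    have "P (Suc d) \<subseteq> A"
    proof (rule P_span)
      show "\<zero> \<in> A" unfolding A_def using subgroup.one_closed[OF H] by (simp add: el_zero G_one)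
      show "x \<oplus> y \<in> A" if "x \<in> A" "y \<in> A" for x y
        using that subgroup.m_closed[OF H, of "el k l x" "el k l y"] Suc.prems
        unfolding A_def by (simp add: G_mult el_mult_elem)
      show "x \<otimes> y \<in> A" if x: "x \<in> P d" and y: "y \<in> P 1" for x y
      proof -
        have "el k l (x \<otimes> y) \<in> H"
          using Suc.IH[of k j x] deg1[of j l y] Suc.prems j x y PR
          by (intro el_product_in[OF H, of k j l]) auto
        then show ?thesis using x y PR unfolding A_def by simp
      qed
    qed (use Suc in simp)
    then show ?case using Suc.prems unfolding A_def by auto
  qed
  obtain d where "d \<ge> 1" "r \<in> P d" using r P_exhaust by auto
  then show ?thesis using deg kl by blast
qed

section \<open>Intersections and triangular factorisation\<close>

lemma meet_eq: "\<sigma> \<subseteq> {..n} \<Longrightarrow> meet_subgroup G K \<sigma> = {A \<in> carrier G. \<forall>i\<in>\<sigma>. A \<in> UT i}"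
  using K_eq_mat by (auto simp: meet_subgroup_def)

lemma generator_meet:
  assumes "j \<le> n" "m \<in> P 1"
  shows "el j (cyc j) m \<in> meet_subgroup G K ({..n} - {j})"
proof -
  have "el j (cyc j) m \<in> carrier G"
    using el_G[OF assms(1) cyc(1)[OF assms(1)] cyc(2)[OF assms(1), symmetric]] PR assms(2) by blast
  then show ?thesis using assms generator_mat[of _ j m] by (auto simp: meet_eq simp del: One_nat_def)
qed

text \<open>The factor u is A with its entries below the diagonal for the order of k deleted. That A
  times the inverse of u is lower triangular is seen by comparison with u times the inverse of u:
  above the diagonal the two products agree term by term.\<close>

lemma mat_factor:
  assumes i: "i \<le> n" and k: "k \<le> n" and ik: "i \<noteq> k" and A: "A \<in> UT i"
  obtains a u where "a \<in> UT i" "a \<in> unitriangular R n (\<lambda>x. n - pos k x) (\<lambda>_. carrier R)"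
    "u \<in> UT k" "A = a \<otimes>\<^bsub>G\<^esub> u"
proof -
  have AM: "A \<in> carrier M" using A mat_M by blast
  note eA = M_entry[OF AM]
  define u where "u = (\<lambda>x\<in>{..n}. \<lambda>y\<in>{..n}. if x = y \<or> pos k x < pos k y then A x y else \<zero>)"
  have u_entry: "u x y = (if x = y \<or> pos k x < pos k y then A x y else \<zero>)" if "x \<le> n" "y \<le> n" for x y
    using that by (simp add: u_def)
  have uM: "u \<in> carrier M" using eA by (auto simp: M_carrier_iff u_def)
  have ui: "u \<in> UT i" using A uM P_zero unfolding unitriangular_def by (auto simp: u_entry)
  have uk: "u \<in> UT k"
  proof -
    \<comment> \<open>An entry above the diagonal in both orders has the same distance in both;
      otherwise it is zero in A.\<close>
    have "A x y \<in> P (pos k y - pos k x)" if "x \<le> n" "y \<le> n" "pos k x < pos k y" for x y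
    proof (cases "pos i x < pos i y")
      case True
      then have "A x y \<in> P (pos i y - pos i x)" using A that by (simp add: unitriangular_def)
      then show ?thesis using cyclic_pos_distance[OF i k that(1,2) True that(3)] by simp
    next
      case False
      then have "pos i y < pos i x" using pos_neq[OF i that(1,2)] that(3) by fastforce
      then show ?thesis using A that P_zero by (auto simp: unitriangular_def)
    qed
    then show ?thesis using A uM unfolding unitriangular_def by (auto simp: u_entry)
  qed
  define w where "w = inv\<^bsub>G\<^esub> u"
  have uG: "u \<in> carrier G" using mat_G uk k by blast
  have AG: "A \<in> carrier G" using mat_G A i by blast
  have wi: "w \<in> UT i" and wk: "w \<in> UT k" unfolding w_def
    using ui uk subgroup.m_inv_closed[OF subgroup_mat] i k by auto
  have wM: "w \<in> carrier M" using wi mat_M by blast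
  note ew = M_entry[OF wM]
  have wG: "w \<in> carrier G" using mat_G wk k by blast
  define a where "a = A \<otimes>\<^bsub>G\<^esub> w"
  have ai: "a \<in> UT i" unfolding a_def G_mult using mat_mult i A wi by blast
  have aM: "a \<in> carrier M" using ai mat_M by blast
  have az: "a x y = \<zero>" if xy: "x \<le> n" "y \<le> n" "pos k x < pos k y" for x y
  proof -
    have "A x m \<otimes> w m y = u x m \<otimes> w m y" if m: "m \<le> n" for m
    proof (cases "x = m \<or> pos k x < pos k m")
      case True
      then show ?thesis using u_entry m xy by simp
    next
      case False
      then have mx: "pos k m < pos k x" using pos_neq[OF k xy(1) m] by auto
      \<comment> \<open>If both factors were nonzero, the order of i would read x, m, y and that of
        k would read m, x, y. The distances from x and from m to y are the same in both orders,
        which excludes this.\<close>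
      have "A x m = \<zero> \<or> w m y = \<zero>"
      proof (rule ccontr)
        assume c: "\<not> ?thesis"
        have "\<not> pos i m < pos i x" using c A xy m by (auto simp: unitriangular_def)
        then have 1: "pos i x < pos i m" using pos_neq[OF i xy(1) m] False by auto
        have my: "m \<noteq> y" using mx xy(3) by auto
        have "\<not> pos i y < pos i m" using c wi xy m by (auto simp: unitriangular_def)
        then have 2: "pos i m < pos i y" using pos_neq[OF i m xy(2) my] by auto
        have "pos k y - pos k m = pos i y - pos i m"
          using cyclic_pos_distance[OF k i m xy(2) _ 2] mx xy(3) by simp
        moreover have "pos k y - pos k x = pos i y - pos i x"
          using cyclic_pos_distance[OF k i xy(1,2,3)] 1 2 by simp
        ultimately show False using mx xy(3) 1 2 by linarith
      qed
      moreover have "u x m = \<zero>" using u_entry[OF xy(1) m] False by simp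
      ultimately show ?thesis using eA ew xy m by auto
    qed
    then have "a x y = (u \<otimes>\<^bsub>M\<^esub> w) x y"
      unfolding a_def G_mult M_mult[OF xy(1,2)] using ew xy M_entry[OF uM] by (intro finsum_cong') auto
    also have "u \<otimes>\<^bsub>M\<^esub> w = \<one>\<^bsub>M\<^esub>" using G.r_inv[OF uG] by (simp add: w_def G_mult G_one)
    finally show ?thesis using xy by (auto simp: M_one)
  qed
  have alow: "a \<in> unitriangular R n (\<lambda>x. n - pos k x) (\<lambda>_. carrier R)"
  proof -
    have "pos k x < pos k y" if "n - pos k y < n - pos k x" for x y using that by simp
    moreover have "a x x = \<one>" if "x \<le> n" for x using ai that by (auto simp: unitriangular_def)
    ultimately show ?thesis using az aM M_entry[OF aM] unfolding unitriangular_def by auto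
  qed
  have "a \<otimes>\<^bsub>G\<^esub> u = A" unfolding a_def w_def using AG uG by (simp add: G.m_assoc)
  then show thesis using that[OF ai alow uk] by simp
qed

text \<open>The positions \<open>n - pos k x\<close> reverse the order of k, and the constant
  filtration leaves the entries free, so closure is again \<open>unitriangular_mult\<close>.\<close>

lemma lower_subgroup:
  assumes "k \<le> n"
  shows "subgroup (carrier G \<inter> unitriangular R n (\<lambda>x. n - pos k x) (\<lambda>_. carrier R)) G"
proof (rule G.finite_submonoid_subgroup[OF finite_G[OF finite_R]])
  have "inj_on (\<lambda>x. n - pos k x) {..n}"
    using cyclic_pos_inj[OF assms] cyclic_pos_le[of _ n k] unfolding inj_on_def
    by (metis atMost_iff diff_diff_cancel)
  then show "x \<otimes>\<^bsub>G\<^esub> y \<in> carrier G \<inter> unitriangular R n (\<lambda>x. n - pos k x) (\<lambda>_. carrier R)"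
    if "x \<in> carrier G \<inter> unitriangular R n (\<lambda>x. n - pos k x) (\<lambda>_. carrier R)"
      "y \<in> carrier G \<inter> unitriangular R n (\<lambda>x. n - pos k x) (\<lambda>_. carrier R)" for x y
    using that unitriangular_mult[of "\<lambda>x. n - pos k x" "\<lambda>_. carrier R" x y]
    by (auto simp: G_mult) (metis G.m_closed G_mult)
  show "\<one>\<^bsub>G\<^esub> \<in> carrier G \<inter> unitriangular R n (\<lambda>x. n - pos k x) (\<lambda>_. carrier R)"
    using unitriangular_one[of "\<lambda>_. carrier R"] G.one_closed by (simp add: G_one)
qed blast

text \<open>This is what makes the factorisation unique: two factorisations of one element differ by
  a matrix that is triangular in both directions.\<close>

lemma lower_Int_mat:
  assumes k: "k \<le> n" and A: "A \<in> UT k" "A \<in> unitriangular R n (\<lambda>x. n - pos k x) (\<lambda>_. carrier R)"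
  shows "A = \<one>\<^bsub>G\<^esub>"
  unfolding G_one
proof (rule M_eqI[OF mat_M[OF A(1)] M_one_closed])
  fix x y assume xy: "x \<le> n" "y \<le> n"
  show "A x y = \<one>\<^bsub>M\<^esub> x y"
  proof (cases "x = y")
    case True
    then show ?thesis using A xy by (auto simp: unitriangular_def M_one)
  next
    case False
    then consider "pos k y < pos k x" | "n - pos k y < n - pos k x"
      using pos_neq[OF k xy] cyclic_pos_le[OF xy(1), of k] cyclic_pos_le[OF xy(2), of k] by linarith
    then have "A x y = \<zero>" using A xy unfolding unitriangular_def by cases auto
    then show ?thesis using False xy by (simp add: M_one)
  qed
qed

theorem coset_geometry_EL: "coset_geometry G n K"
proof (rule coset_geometry.intro[OF group_G coset_geometry_axioms.intro])
  show "finite (carrier G)" using finite_G finite_R .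
  show "subgroup (K i) G" if "i \<le> n" for i using subgroup_mat that K_eq_mat by simp
  show "\<exists>a\<in>meet_subgroup G K \<sigma>. h \<in> a <#\<^bsub>G\<^esub> K k"
    if k: "k \<le> n" and \<sigma>: "\<sigma> \<subseteq> {..n} - {k}" and h: "h \<in> carrier G" and cl: "\<forall>i\<in>\<sigma>. h \<in> K i <#>\<^bsub>G\<^esub> K k"
    for k \<sigma> h
  proof (cases "\<sigma> = {}")
    case True
    have "h \<in> h <#\<^bsub>G\<^esub> K k"
      using h k subgroup.one_closed[OF subgroup_mat[OF k]] unfolding K_eq_mat[OF k] l_coset_def
      by (intro UN_I[of "\<one>\<^bsub>G\<^esub>"]) auto
    then show ?thesis using True h by (intro bexI[of _ h]) (auto simp: meet_subgroup_def)
  next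
    case False
    let ?L = "unitriangular R n (\<lambda>x. n - pos k x) (\<lambda>_. carrier R)"
    have ex: "\<exists>a. a \<in> UT i \<and> a \<in> ?L \<and> (\<exists>x\<in>UT k. h = a \<otimes>\<^bsub>G\<^esub> x)" if i: "i \<in> \<sigma>" for i
    proof -
      have i': "i \<le> n" "i \<noteq> k" using i \<sigma> by auto
      obtain A B where AB: "A \<in> UT i" "B \<in> UT k" "h = A \<otimes>\<^bsub>G\<^esub> B"
        using bspec[OF cl i] unfolding set_mult_def K_eq_mat[OF i'(1)] K_eq_mat[OF k] by blast
      obtain a u where au: "a \<in> UT i" "a \<in> ?L" "u \<in> UT k" "A = a \<otimes>\<^bsub>G\<^esub> u"
        using mat_factor[OF i'(1) k i'(2) AB(1)] by blast
      have "h = a \<otimes>\<^bsub>G\<^esub> (u \<otimes>\<^bsub>G\<^esub> B)"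
        unfolding AB(3) au(4) using mat_G i'(1) k au(1,3) AB(2) by (intro G.m_assoc) blast+
      moreover have "u \<otimes>\<^bsub>G\<^esub> B \<in> UT k" using mat_mult k au(3) AB(2) by (simp add: G_mult)
      ultimately show ?thesis using au by blast
    qed
    obtain i0 where i0: "i0 \<in> \<sigma>" using False by blast
    have sub: "\<sigma> \<subseteq> {..n}" using \<sigma> by blast
    obtain a x where a: "a \<in> UT i0" "a \<in> ?L" "x \<in> UT k" "h = a \<otimes>\<^bsub>G\<^esub> x" using ex[OF i0] by blast
    have aG: "a \<in> carrier G" using mat_G a(1) i0 sub by blast
    have xG: "x \<in> carrier G" using mat_G a(3) k by blast
    \<comment> \<open>The lower factor of h is the same for all i: two of them differ by an element
      that is both lower and upper triangular. Hence this one factor lies in all the groups.\<close>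
    have "a \<in> UT i" if i: "i \<in> \<sigma>" for i
    proof -
      obtain b y where b: "b \<in> UT i" "b \<in> ?L" "y \<in> UT k" "h = b \<otimes>\<^bsub>G\<^esub> y" using ex[OF i] by blast
      have bG: "b \<in> carrier G" using mat_G b(1) i sub by blast
      have yG: "y \<in> carrier G" using mat_G b(3) k by blast
      have L: "inv\<^bsub>G\<^esub> b \<otimes>\<^bsub>G\<^esub> a \<in> carrier G \<inter> ?L"
        using subgroup.m_closed[OF lower_subgroup[OF k]] subgroup.m_inv_closed[OF lower_subgroup[OF k]] a(2) b(2) aG bG by auto
      have eq: "inv\<^bsub>G\<^esub> b \<otimes>\<^bsub>G\<^esub> a = y \<otimes>\<^bsub>G\<^esub> inv\<^bsub>G\<^esub> x"
      proof -
        have "a = (b \<otimes>\<^bsub>G\<^esub> y) \<otimes>\<^bsub>G\<^esub> inv\<^bsub>G\<^esub> x" using a(4) b(4) aG xG bG yG G.inv_solve_right by simp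
        then have "a = b \<otimes>\<^bsub>G\<^esub> (y \<otimes>\<^bsub>G\<^esub> inv\<^bsub>G\<^esub> x)" using bG yG xG by (simp add: G.m_assoc)
        then show ?thesis using G.m_assoc[of "inv\<^bsub>G\<^esub> b" b "y \<otimes>\<^bsub>G\<^esub> inv\<^bsub>G\<^esub> x"] bG yG xG by simp
      qed
      have "y \<otimes>\<^bsub>G\<^esub> inv\<^bsub>G\<^esub> x \<in> UT k"
        using subgroup.m_closed[OF subgroup_mat[OF k]] subgroup.m_inv_closed[OF subgroup_mat[OF k]] a(3) b(3) by blast
      then have "inv\<^bsub>G\<^esub> b \<otimes>\<^bsub>G\<^esub> a = \<one>\<^bsub>G\<^esub>" using lower_Int_mat[OF k] L eq by auto
      then have "a = b" using aG bG by (metis G.inv_closed G.inv_equality G.inv_inv)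
      then show ?thesis using b(1) by simp
    qed
    then have "a \<in> meet_subgroup G K \<sigma>" using aG unfolding meet_eq[OF sub] by simp
    moreover have "h \<in> a <#\<^bsub>G\<^esub> K k" using a(3,4) unfolding l_coset_def K_eq_mat[OF k] by blast
    ultimately show ?thesis by blast
  qed
  show "meet_subgroup G K \<sigma> \<subseteq> generate G (\<Union>j\<in>{..n} - \<sigma>. meet_subgroup G K ({..n} - {j}))"
    if \<sigma>: "\<sigma> \<subseteq> {..n}" for \<sigma>
  proof (cases "\<sigma> = {}")
    \<comment> \<open>Without a type there is no order in which to eliminate; the whole group is
      reached through \<open>el_G_generated\<close>.\<close>
    case True
    have "(\<Union>j\<in>{..n} - \<sigma>. meet_subgroup G K ({..n} - {j})) \<subseteq> carrier G" by (auto simp: meet_subgroup_def)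
    then have sg: "subgroup (generate G (\<Union>j\<in>{..n} - \<sigma>. meet_subgroup G K ({..n} - {j}))) G"
      by (rule G.generate_is_subgroup)
    have "carrier G \<subseteq> generate G (\<Union>j\<in>{..n} - \<sigma>. meet_subgroup G K ({..n} - {j}))"
    proof (rule G_subset[OF sg], rule el_G_generated[OF sg])
      show "el j (cyc j) m \<in> generate G (\<Union>j\<in>{..n} - \<sigma>. meet_subgroup G K ({..n} - {j}))"
        if "j \<le> n" "m \<in> P 1" for j m
        using generator_meet[OF that] that(1) True by (intro generate.incl) auto
    qed
    then show ?thesis by (auto simp: meet_subgroup_def)
  next
    case False
    then obtain i0 where i0: "i0 \<in> \<sigma>" by blast
    have "{el j (cyc j) m | j m. j \<in> {..n} - \<sigma> \<and> m \<in> P 1} \<subseteq> (\<Union>j\<in>{..n} - \<sigma>. meet_subgroup G K ({..n} - {j}))"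
      using generator_meet by fastforce
    then have "generate G {el j (cyc j) m | j m. j \<in> {..n} - \<sigma> \<and> m \<in> P 1}
      \<subseteq> generate G (\<Union>j\<in>{..n} - \<sigma>. meet_subgroup G K ({..n} - {j}))"
      by (rule G.mono_generate)
    then show ?thesis using mat_subset_generate[OF \<sigma> i0] unfolding meet_eq[OF \<sigma>] by blast
  qed
  show "meet_subgroup G K {..n} = {\<one>\<^bsub>G\<^esub>}"
  proof -
    have "A = \<one>\<^bsub>G\<^esub>" if "A \<in> carrier G" "\<forall>i\<in>{..n}. A \<in> UT i" for A
      unfolding G_one
    proof (rule M_eqI[OF G_M[OF that(1)] M_one_closed])
      fix x y assume xy: "x \<le> n" "y \<le> n"
      \<comment> \<open>The index x is last in its own order, so row x has no nonzero entry off the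
        diagonal.\<close>
      have "A \<in> UT x" using that(2) xy by blast
      moreover have "pos x y < pos x x" if "x \<noteq> y"
        using pos_neq[of x x y] cyclic_pos_le[OF xy(2), of x] cyclic_pos_self[of n x] xy that by linarith
      ultimately show "A x y = \<one>\<^bsub>M\<^esub> x y" using xy unfolding unitriangular_def by (auto simp: M_one)
    qed
    moreover have "\<one>\<^bsub>G\<^esub> \<in> UT i" for i using mat_one by (simp add: G_one)
    ultimately show ?thesis unfolding meet_eq[OF order.refl] by auto
  qed
  show "meet_subgroup G K ({..n} - {j}) \<noteq> {\<one>\<^bsub>G\<^esub>}" if j: "j \<le> n" for j
  proof
    assume "meet_subgroup G K ({..n} - {j}) = {\<one>\<^bsub>G\<^esub>}"
    then have "el j (cyc j) \<one> = \<one>\<^bsub>M\<^esub>" using generator_meet[OF j P_one] by (simp add: G_one)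
    then have "el j (cyc j) \<one> j (cyc j) = \<one>\<^bsub>M\<^esub> j (cyc j)" by simp
    then show False using cyc[OF j] j one_neq_zero by (simp add: el_entry M_one split: if_splits)
  qed
qed

text \<open>The entries vary independently, so the order is a product over pairs of indices.
  Renaming the indices by their positions removes the dependence on i, on which both the constant
  number of chambers at a vertex and \<open>aut_hom_K\<close> rely.\<close>

lemma card_K:
  assumes i: "i \<le> n"
  shows "card (K i) = (\<Prod>a\<le>n. \<Prod>b\<le>n. if a < b then card (P (b - a)) else 1)"
proof -
  define S where "S k l = (if k = l then {\<one>} else if pos i l < pos i k then {\<zero>} else P (pos i l - pos i k))" for k l
  have SR: "S k l \<subseteq> carrier R" for k l using P_carrier by (auto simp: S_def)
  have S_iff: "x \<in> S k l \<longleftrightarrow> x \<in> carrier R \<and> (k = l \<longrightarrow> x = \<one>) \<and> (pos i l < pos i k \<longrightarrow> x = \<zero>)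
      \<and> (pos i k < pos i l \<longrightarrow> x \<in> P (pos i l - pos i k))" if "k \<le> n" "l \<le> n" for k l x
    using that pos_neq[OF i, of k l] PR by (auto simp: S_def)
  have "UT i = PiE {..n} (\<lambda>k. PiE {..n} (\<lambda>l. S k l))"
    unfolding unitriangular_def by (auto simp: M_carrier_iff PiE_iff S_iff extensional_def)
  then have "card (K i) = (\<Prod>k\<le>n. \<Prod>l\<le>n. card (S k l))"
    unfolding K_eq_mat[OF i] by (simp add: card_PiE)
  also have "\<dots> = (\<Prod>k\<le>n. \<Prod>l\<le>n. if pos i k < pos i l then card (P (pos i l - pos i k)) else 1)"
  proof (intro prod.cong refl)
    fix k l assume "k \<in> {..n}" "l \<in> {..n}"
    then consider "k = l" | "pos i k < pos i l" | "k \<noteq> l" "pos i l < pos i k"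
      using pos_neq[OF i, of k l] by fastforce
    then show "card (S k l) = (if pos i k < pos i l then card (P (pos i l - pos i k)) else 1)"
      by cases (auto simp: S_def)
  qed
  also have "\<dots> = (\<Prod>k\<le>n. \<Prod>b\<le>n. if pos i k < b then card (P (b - pos i k)) else 1)"
    by (intro prod.cong refl prod.reindex_bij_betw[OF bij_cyclic_pos[OF i]])
  also have "\<dots> = (\<Prod>a\<le>n. \<Prod>b\<le>n. if a < b then card (P (b - a)) else 1)"
    by (rule prod.reindex_bij_betw[OF bij_cyclic_pos[OF i]])
  finally show ?thesis .
qed

lemma card_R_le: "card (carrier R) \<le> card (carrier G)"
proof (rule card_inj_on_le[where f = "\<lambda>r. el 0 1 r"])
  show "inj_on (\<lambda>r. el 0 1 r) (carrier R)"
  proof (rule inj_onI)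
    fix r s assume "el 0 1 r = el 0 1 s"
    then have "el 0 1 r 0 1 = el 0 1 s 0 1" by simp
    then show "r = s" using n_ge_2 by (simp add: el_entry)
  qed
  show "(\<lambda>r. el 0 1 r) ` carrier R \<subseteq> carrier G" using el_G n_ge_2 by auto
qed (rule finite_G[OF finite_R])

end

section \<open>Truncated polynomial rings\<close>

locale truncated_polynomials = field F for F :: "'a ring" (structure) +
  fixes s :: nat
  assumes finite_F: "finite (carrier F)" and s_pos: "s \<ge> 1"
begin

sublocale UP: UP_domain F "UP F"
  by unfold_locales

abbreviation "cf \<equiv> UnivPoly.up_ring.coeff (UP F)"
abbreviation "mn \<equiv> UnivPoly.up_ring.monom (UP F)"
abbreviation "I \<equiv> t_power_ideal F s"
abbreviation "Rs \<equiv> trunc_poly_ring F s"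

text \<open>Elements of \<open>UP F\<close> are coefficient functions, so a polynomial of degree at
  most d can be written down directly.\<close>

definition pol :: "nat \<Rightarrow> (nat \<Rightarrow> 'a) \<Rightarrow> nat \<Rightarrow> 'a" where
  "pol d f = (\<lambda>i. if i \<le> d then f i else \<zero>)"

lemma pol_closed: "(\<And>i. i \<le> d \<Longrightarrow> f i \<in> carrier F) \<Longrightarrow> pol d f \<in> carrier (UP F)"
  by (auto simp: pol_def UP_def up_def bound_def intro!: exI[of _ d])

lemma cf_pol:
  assumes "\<And>i. i \<le> d \<Longrightarrow> f i \<in> carrier F"
  shows "cf (pol d f) i = (if i \<le> d then f i else \<zero>)"
  using pol_closed[of d f, OF assms] by (simp add: UP_def pol_def)

lemma minus_eq_zero_iff:
  assumes "a \<in> carrier F" "b \<in> carrier F"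
  shows "a \<ominus> b = \<zero> \<longleftrightarrow> a = b"
proof
  assume "a \<ominus> b = \<zero>"
  then have "\<ominus> (\<ominus> b) = a" unfolding a_minus_def using assms by (intro minus_equality) auto
  then show "a = b" using assms by simp
qed (use assms in \<open>simp add: a_minus_def r_neg\<close>)

text \<open>The ideal is principal, so it consists of the multiples of the monomial. A polynomial
  with vanishing low coefficients is divided by it by shifting the coefficients down by s.\<close>

lemma I_eq: "I = {p \<in> carrier (UP F). \<forall>i<s. cf p i = \<zero>}"
proof -
  have m: "mn \<one> s \<in> carrier (UP F)" by (rule UP.monom_closed) simp
  have I: "I = {x \<otimes>\<^bsub>UP F\<^esub> mn \<one> s | x. x \<in> carrier (UP F)}"
    unfolding t_power_ideal_def UP.cgenideal_eq_genideal[OF m, symmetric] cgenideal_def ..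
  show ?thesis
  proof (intro equalityI subsetI)
    fix p assume "p \<in> I"
    then obtain x where x: "x \<in> carrier (UP F)" "p = x \<otimes>\<^bsub>UP F\<^esub> mn \<one> s" unfolding I by blast
    then have p: "p = mn \<one> s \<otimes>\<^bsub>UP F\<^esub> x" using m UP.P.m_comm by simp
    have "cf p i = \<zero>" if "i < s" for i
    proof -
      have "cf p i = (\<Oplus>k\<in>{..i}. cf (mn \<one> s) k \<otimes> cf x (i - k))"
        unfolding p by (rule UP.coeff_mult[OF m x(1)])
      also have "\<dots> = (\<Oplus>k\<in>{..i}. \<zero>)"
        using that x UP.coeff_closed[OF x(1)] by (intro finsum_cong') (auto simp: UP.coeff_monom)
      finally show ?thesis by simp
    qed
    then show "p \<in> {p \<in> carrier (UP F). \<forall>i<s. cf p i = \<zero>}" using x m by simp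
  next
    fix p assume "p \<in> {p \<in> carrier (UP F). \<forall>i<s. cf p i = \<zero>}"
    then have p: "p \<in> carrier (UP F)" "\<And>i. i < s \<Longrightarrow> cf p i = \<zero>" by auto
    define d where "d = UnivPoly.deg F p"
    define x where "x = pol d (\<lambda>i. cf p (i + s))"
    have xc: "x \<in> carrier (UP F)" unfolding x_def by (rule pol_closed) (rule UP.coeff_closed[OF p(1)])
    have "mn \<one> s \<otimes>\<^bsub>UP F\<^esub> x = p"
    proof (rule UP.up_eqI)
      fix i
      show "cf (mn \<one> s \<otimes>\<^bsub>UP F\<^esub> x) i = cf p i"
      proof (cases "i < s")
        case True
        have "cf (mn \<one> s \<otimes>\<^bsub>UP F\<^esub> x) i = (\<Oplus>k\<in>{..i}. cf (mn \<one> s) k \<otimes> cf x (i - k))"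
          by (rule UP.coeff_mult[OF m xc])
        also have "\<dots> = (\<Oplus>k\<in>{..i}. \<zero>)"
          using True UP.coeff_closed[OF xc] by (intro finsum_cong') (auto simp: UP.coeff_monom)
        finally show ?thesis using p(2)[OF True] by simp
      next
        case False
        then have "cf (mn \<one> s \<otimes>\<^bsub>UP F\<^esub> x) i = \<one> \<otimes> cf x (i - s)"
          using UP.coeff_monom_mult[OF one_closed xc, of s "i - s"] by simp
        also have "\<dots> = cf x (i - s)" using UP.coeff_closed[OF xc] by simp
        also have "\<dots> = (if i - s \<le> d then cf p i else \<zero>)"
          unfolding x_def using False UP.coeff_closed[OF p(1)] by (subst cf_pol) auto
        also have "\<dots> = cf p i" using UP.deg_aboveD[of p i] p(1) unfolding d_def by auto
        finally show ?thesis .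
      qed
    qed (use p m xc in simp_all)
    then show "p \<in> I" unfolding I using m xc UP.P.m_comm by force
  qed
qed

lemma ideal_I: "ideal I (UP F)"
  unfolding t_power_ideal_def by (rule UP.genideal_ideal) simp

abbreviation proj :: "(nat \<Rightarrow> 'a) \<Rightarrow> (nat \<Rightarrow> 'a) set" where
  "proj p \<equiv> I +>\<^bsub>UP F\<^esub> p"

lemma cring_Rs: "cring Rs"
  unfolding trunc_poly_ring_def by (rule ideal.quotient_is_cring[OF ideal_I UP.is_cring])

sublocale Rs: cring Rs by (rule cring_Rs)

sublocale proj: ring_hom_ring "UP F" Rs proj
  unfolding trunc_poly_ring_def by (rule ideal.rcos_ring_hom_ring[OF ideal_I])

lemma proj_eq_iff:
  assumes "p \<in> carrier (UP F)" "p' \<in> carrier (UP F)"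
  shows "proj p = proj p' \<longleftrightarrow> (\<forall>i<s. cf p i = cf p' i)"
proof -
  have "proj p = proj p' \<longleftrightarrow> p \<ominus>\<^bsub>UP F\<^esub> p' \<in> I"
    using UP.quotient_eq_iff_same_a_r_cos[OF ideal_I assms] by simp
  also have "\<dots> \<longleftrightarrow> (\<forall>i<s. cf p i \<ominus> cf p' i = \<zero>)"
    unfolding I_eq using assms by (simp add: UP.coeff_minus)
  also have "\<dots> \<longleftrightarrow> (\<forall>i<s. cf p i = cf p' i)"
    using minus_eq_zero_iff[OF UP.coeff_closed[OF assms(1)] UP.coeff_closed[OF assms(2)]] by simp
  finally show ?thesis .
qed

lemma Rs_carrier: "carrier Rs = proj ` carrier (UP F)"
  unfolding trunc_poly_ring_def FactRing_def A_RCOSETS_defs a_r_coset_def by auto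

section \<open>Filtration by degree\<close>

definition low :: "nat \<Rightarrow> (nat \<Rightarrow> 'a) set" where
  "low d = {p \<in> carrier (UP F). \<forall>i>d. cf p i = \<zero>}"

definition P :: "nat \<Rightarrow> (nat \<Rightarrow> 'a) set set" where
  "P d = proj ` low d"

lemma low_carrier: "p \<in> low d \<Longrightarrow> p \<in> carrier (UP F)"
  by (simp add: low_def)

lemma pol_low: "(\<And>i. i \<le> d \<Longrightarrow> f i \<in> carrier F) \<Longrightarrow> pol d f \<in> low d"
  by (simp add: low_def pol_closed cf_pol)

lemma low_eq_pol: "p \<in> low d \<Longrightarrow> p = pol d (cf p)"
  by (rule UP.up_eqI) (auto simp: low_def pol_closed cf_pol UP.coeff_closed)

lemma low_zero: "\<zero>\<^bsub>UP F\<^esub> \<in> low d"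
  by (simp add: low_def)

lemma low_add: "p \<in> low d \<Longrightarrow> p' \<in> low d \<Longrightarrow> p \<oplus>\<^bsub>UP F\<^esub> p' \<in> low d"
  by (simp add: low_def)

lemma low_minus: "p \<in> low d \<Longrightarrow> \<ominus>\<^bsub>UP F\<^esub> p \<in> low d"
  by (simp add: low_def)

lemma low_mult:
  assumes p: "p \<in> low d" and p': "p' \<in> low e"
  shows "p \<otimes>\<^bsub>UP F\<^esub> p' \<in> low (d + e)"
proof -
  have c: "p \<in> carrier (UP F)" "p' \<in> carrier (UP F)" using p p' low_carrier by auto
  have "cf (p \<otimes>\<^bsub>UP F\<^esub> p') i = \<zero>" if "i > d + e" for i
  proof -
    have "cf p k \<otimes> cf p' (i - k) = \<zero>" if "k \<in> {..i}" for k
    proof (cases "k > d")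
      case True
      then show ?thesis using p c UP.coeff_closed[OF c(2)] by (simp add: low_def)
    next
      case False
      then have "i - k > e" using \<open>i > d + e\<close> by simp
      then show ?thesis using p' c UP.coeff_closed[OF c(1)] by (simp add: low_def)
    qed
    then have "(\<Oplus>k\<in>{..i}. cf p k \<otimes> cf p' (i - k)) = (\<Oplus>k\<in>{..i}. \<zero>)"
      by (intro finsum_cong') auto
    then show ?thesis using UP.coeff_mult[OF c] by simp
  qed
  then show ?thesis using c by (simp add: low_def)
qed

lemma low_mono: "d \<le> e \<Longrightarrow> low d \<subseteq> low e"
  by (auto simp: low_def)

lemma mn_low: "a \<in> carrier F \<Longrightarrow> i \<le> d \<Longrightarrow> mn a i \<in> low d"
  by (simp add: low_def UP.coeff_monom)

lemma one_low: "\<one>\<^bsub>UP F\<^esub> \<in> low d"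
  by (simp add: low_def UP.coeff_one)

lemma P_carrier: "P d \<subseteq> carrier Rs"
  unfolding P_def Rs_carrier using low_carrier by blast

lemma P_zero: "\<zero>\<^bsub>Rs\<^esub> \<in> P d"
  unfolding P_def using low_zero proj.hom_zero by (metis imageI)

lemma P_one: "\<one>\<^bsub>Rs\<^esub> \<in> P d"
  unfolding P_def using one_low proj.hom_one by (metis imageI)

lemma P_add:
  assumes "x \<in> P d" "y \<in> P d"
  shows "x \<oplus>\<^bsub>Rs\<^esub> y \<in> P d"
proof -
  obtain p p' where "p \<in> low d" "p' \<in> low d" "x = proj p" "y = proj p'" using assms by (auto simp: P_def)
  then show ?thesis using proj.hom_add[of p p'] low_add low_carrier unfolding P_def by (metis imageI)
qed

lemma P_minus:
  assumes "x \<in> P d"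
  shows "\<ominus>\<^bsub>Rs\<^esub> x \<in> P d"
proof -
  obtain p where "p \<in> low d" "x = proj p" using assms by (auto simp: P_def)
  then show ?thesis using proj.hom_a_inv[of p] low_minus low_carrier unfolding P_def by (metis imageI)
qed

lemma P_mult:
  assumes "x \<in> P d" "y \<in> P e"
  shows "x \<otimes>\<^bsub>Rs\<^esub> y \<in> P (d + e)"
proof -
  obtain p p' where "p \<in> low d" "p' \<in> low e" "x = proj p" "y = proj p'" using assms by (auto simp: P_def)
  then show ?thesis using proj.hom_mult[of p p'] low_mult low_carrier unfolding P_def by (metis imageI)
qed

text \<open>Splitting off the term of degree d + 1 writes the polynomial as a * 1 + b * t with a and
  b of degree at most d, and both 1 and t lie in P 1.\<close>

lemma P_span:
  assumes add: "\<And>x y. x \<in> A \<Longrightarrow> y \<in> A \<Longrightarrow> x \<oplus>\<^bsub>Rs\<^esub> y \<in> A"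
    and mult: "\<And>x y. x \<in> P d \<Longrightarrow> y \<in> P 1 \<Longrightarrow> x \<otimes>\<^bsub>Rs\<^esub> y \<in> A"
  shows "P (Suc d) \<subseteq> A"
proof
  fix x assume "x \<in> P (Suc d)"
  then obtain p where p: "p \<in> low (Suc d)" "x = proj p" by (auto simp: P_def)
  define a where "a = pol d (cf p)"
  define b where "b = mn (cf p (Suc d)) d"
  have cp: "cf p i \<in> carrier F" for i using UP.coeff_closed low_carrier p(1) by blast
  have a: "a \<in> low d" unfolding a_def using cp by (intro pol_low)
  have b: "b \<in> low d" unfolding b_def using cp by (intro mn_low) auto
  have t: "mn \<one> 1 \<in> low 1" by (intro mn_low) auto
  have bt: "b \<otimes>\<^bsub>UP F\<^esub> mn \<one> 1 = mn (cf p (Suc d)) (Suc d)"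
    unfolding b_def using UP.monom_mult[of "cf p (Suc d)" \<one> d 1] cp by simp
  have "p = a \<otimes>\<^bsub>UP F\<^esub> \<one>\<^bsub>UP F\<^esub> \<oplus>\<^bsub>UP F\<^esub> b \<otimes>\<^bsub>UP F\<^esub> mn \<one> 1"
    unfolding bt
  proof (rule UP.up_eqI)
    fix i
    have aU: "a \<in> carrier (UP F)" and mU: "mn (cf p (Suc d)) (Suc d) \<in> carrier (UP F)"
      using a low_carrier cp by auto
    have "cf (a \<otimes>\<^bsub>UP F\<^esub> \<one>\<^bsub>UP F\<^esub> \<oplus>\<^bsub>UP F\<^esub> mn (cf p (Suc d)) (Suc d)) i
      = cf a i \<oplus> (if Suc d = i then cf p (Suc d) else \<zero>)"
      unfolding UP.P.r_one[OF aU] UP.coeff_add[OF aU mU] UP.coeff_monom[OF cp] ..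
    also have "cf a i = (if i \<le> d then cf p i else \<zero>)"
      unfolding a_def by (rule cf_pol) (rule cp)
    also have "(if i \<le> d then cf p i else \<zero>) \<oplus> (if Suc d = i then cf p (Suc d) else \<zero>) = cf p i"
    proof -
      consider "i \<le> d" | "i = Suc d" | "i > Suc d" by linarith
      then show ?thesis using cp[of i] p(1) by cases (auto simp: low_def)
    qed
    finally show "cf p i = cf (a \<otimes>\<^bsub>UP F\<^esub> \<one>\<^bsub>UP F\<^esub> \<oplus>\<^bsub>UP F\<^esub> mn (cf p (Suc d)) (Suc d)) i" ..
  qed (use p a cp low_carrier in auto)
  then have "x = proj a \<otimes>\<^bsub>Rs\<^esub> \<one>\<^bsub>Rs\<^esub> \<oplus>\<^bsub>Rs\<^esub> proj b \<otimes>\<^bsub>Rs\<^esub> proj (mn \<one> 1)"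
    unfolding p(2) using a b t low_carrier
    by (metis proj.hom_add proj.hom_mult proj.hom_one UP.P.m_closed UP.P.one_closed)
  moreover have "proj a \<in> P d" "proj b \<in> P d" "proj (mn \<one> 1) \<in> P 1" using a b t by (auto simp: P_def)
  ultimately show "x \<in> A" using add mult P_one by blast
qed

lemma carrier_Rs: "carrier Rs = P (s - 1)"
proof
  show "carrier Rs \<subseteq> P (s - 1)"
  proof
    fix x assume "x \<in> carrier Rs"
    then obtain p where p: "p \<in> carrier (UP F)" "x = proj p" unfolding Rs_carrier by blast
    have cp: "cf p i \<in> carrier F" for i using UP.coeff_closed p(1) by blast
    have "proj p = proj (pol (s - 1) (cf p))"
      using cp p(1) by (subst proj_eq_iff) (auto simp: pol_closed cf_pol)
    moreover have "pol (s - 1) (cf p) \<in> low (s - 1)" by (rule pol_low) (rule cp)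
    ultimately show "x \<in> P (s - 1)" using p(2) unfolding P_def by (metis imageI)
  qed
qed (rule P_carrier)

lemma P_eq_image: "P d = (\<lambda>f. proj (pol d f)) ` ({..d} \<rightarrow>\<^sub>E carrier F)"
proof
  show "P d \<subseteq> (\<lambda>f. proj (pol d f)) ` ({..d} \<rightarrow>\<^sub>E carrier F)"
  proof
    fix x assume "x \<in> P d"
    then obtain p where p: "p \<in> low d" "x = proj p" by (auto simp: P_def)
    have cp: "cf p i \<in> carrier F" for i using UP.coeff_closed low_carrier p(1) by blast
    have "pol d (cf p) = pol d (restrict (cf p) {..d})" by (auto simp: pol_def)
    then have "x = proj (pol d (restrict (cf p) {..d}))" using p(2) low_eq_pol[OF p(1)] by simp
    moreover have "restrict (cf p) {..d} \<in> {..d} \<rightarrow>\<^sub>E carrier F" using cp by auto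
    ultimately show "x \<in> (\<lambda>f. proj (pol d f)) ` ({..d} \<rightarrow>\<^sub>E carrier F)" by (rule image_eqI)
  qed
  show "(\<lambda>f. proj (pol d f)) ` ({..d} \<rightarrow>\<^sub>E carrier F) \<subseteq> P d"
  proof
    fix x assume "x \<in> (\<lambda>f. proj (pol d f)) ` ({..d} \<rightarrow>\<^sub>E carrier F)"
    then obtain f where f: "f \<in> {..d} \<rightarrow>\<^sub>E carrier F" "x = proj (pol d f)" by (elim imageE)
    have "pol d f \<in> low d" using f(1) by (intro pol_low) auto
    then show "x \<in> P d" unfolding P_def f(2) by (rule imageI)
  qed
qed

lemma finite_P: "finite (P d)"
  unfolding P_eq_image using finite_F by (intro finite_imageI finite_PiE) auto

text \<open>Below degree s the projection loses no coefficient, so these sizes do not depend on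
  s.\<close>

lemma card_P:
  assumes "d < s"
  shows "card (P d) = card (carrier F) ^ (d + 1)"
proof -
  have "inj_on (\<lambda>f. proj (pol d f)) ({..d} \<rightarrow>\<^sub>E carrier F)"
  proof (rule inj_onI)
    fix f g assume fg: "f \<in> {..d} \<rightarrow>\<^sub>E carrier F" "g \<in> {..d} \<rightarrow>\<^sub>E carrier F" "proj (pol d f) = proj (pol d g)"
    have c: "\<And>i. i \<le> d \<Longrightarrow> f i \<in> carrier F" "\<And>i. i \<le> d \<Longrightarrow> g i \<in> carrier F" using fg by auto
    have "\<forall>i<s. cf (pol d f) i = cf (pol d g) i" using fg(3) c by (simp add: proj_eq_iff pol_closed)
    then have "f i = g i" if "i \<le> d" for i
      using that assms cf_pol[of d f i] cf_pol[of d g i] c by simp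
    then show "f = g" using fg by (intro PiE_ext[of f "{..d}" "\<lambda>_. carrier F"]) auto
  qed
  then show ?thesis unfolding P_eq_image by (simp add: card_image card_PiE)
qed

lemma T_set_eq: "T_set F s = P 1"
proof -
  have "T_set F s = (\<lambda>f. proj (pol 1 f)) ` ({..1} \<rightarrow>\<^sub>E carrier F)"
  proof -
    have e: "proj (mn a 0 \<oplus>\<^bsub>UP F\<^esub> mn b 1) = proj (pol 1 f)"
      if "a \<in> carrier F" "b \<in> carrier F" "f 0 = a" "f 1 = b" for a b f
    proof -
      have "mn a 0 \<oplus>\<^bsub>UP F\<^esub> mn b 1 = pol 1 f"
      proof (rule UP.up_eqI)
        fix i :: nat
        have fc: "\<And>i. i \<le> 1 \<Longrightarrow> f i \<in> carrier F" using that by (auto simp: le_Suc_eq)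
        have cfp: "cf (pol 1 f) i = (if i \<le> 1 then f i else \<zero>)" by (rule cf_pol) (rule fc)
        have "i = 0 \<or> i = 1 \<or> i > 1" by linarith
        then show "cf (mn a 0 \<oplus>\<^bsub>UP F\<^esub> mn b 1) i = cf (pol 1 f) i"
          unfolding cfp using that by (elim disjE) (auto simp: UP.coeff_monom)
      qed (use that in \<open>auto intro!: pol_closed simp: le_Suc_eq\<close>)
      then show ?thesis by simp
    qed
    show ?thesis
    proof (intro equalityI subsetI)
      fix x assume "x \<in> T_set F s"
      then obtain a b where ab: "a \<in> carrier F" "b \<in> carrier F" "x = proj (mn a 0 \<oplus>\<^bsub>UP F\<^esub> mn b 1)"
        unfolding T_set_def by blast
      define f where "f = (\<lambda>i\<in>{..1::nat}. if i = 0 then a else b)"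
      have "f \<in> {..1} \<rightarrow>\<^sub>E carrier F" using ab by (auto simp: f_def)
      moreover have "x = proj (pol 1 f)" using e[of a b f] ab by (simp add: f_def)
      ultimately show "x \<in> (\<lambda>f. proj (pol 1 f)) ` ({..1} \<rightarrow>\<^sub>E carrier F)" by blast
    next
      fix x assume "x \<in> (\<lambda>f. proj (pol 1 f)) ` ({..1} \<rightarrow>\<^sub>E carrier F)"
      then obtain f where f: "f \<in> {..1} \<rightarrow>\<^sub>E carrier F" "x = proj (pol 1 f)" by blast
      then have "f 0 \<in> carrier F" "f 1 \<in> carrier F" by auto
      then show "x \<in> T_set F s" using e[of "f 0" "f 1" f] f(2) unfolding T_set_def by force
    qed
  qed
  then show ?thesis by (simp add: P_eq_image)
qed

lemma one_neq_zero_Rs: "\<one>\<^bsub>Rs\<^esub> \<noteq> \<zero>\<^bsub>Rs\<^esub>"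
proof
  assume "\<one>\<^bsub>Rs\<^esub> = \<zero>\<^bsub>Rs\<^esub>"
  then have "proj \<one>\<^bsub>UP F\<^esub> = proj \<zero>\<^bsub>UP F\<^esub>" by simp
  then have "cf \<one>\<^bsub>UP F\<^esub> 0 = cf \<zero>\<^bsub>UP F\<^esub> 0" using s_pos by (subst (asm) proj_eq_iff) auto
  then show False by (simp add: UP.coeff_one)
qed

end

section \<open>Sums over lines\<close>

text \<open>For truncated polynomials \<open>T = P 1\<close>, \<open>V = P 2\<close> and \<open>C\<close> is the set of nonzero constants.\<close>

locale expanding_product = cring R for R (structure) +
  fixes T V C :: "'a set" and q :: nat
  assumes T_sub: "additive_subgroup T R" and V_sub: "additive_subgroup V R"
    and finite_V: "finite V" and finite_T: "finite T" and card_T: "card T = q\<^sup>2" and q_pos: "q > 0"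
    and TT: "x \<in> T \<Longrightarrow> y \<in> T \<Longrightarrow> x \<otimes> y \<in> V"
    and finite_C: "finite C" and card_C: "card C < q" and C_carrier: "C \<subseteq> carrier R"
    and C_bij: "u \<in> C \<Longrightarrow> bij_betw (\<lambda>x. u \<otimes> x) T T"
    and span: "\<lbrakk>d \<in> T - {\<zero>}; e \<in> T - {\<zero>}; \<forall>u\<in>C. e \<noteq> u \<otimes> d; v \<in> V\<rbrakk>
      \<Longrightarrow> \<exists>x\<in>T. \<exists>y\<in>T. v = x \<otimes> d \<oplus> y \<otimes> e"
begin

lemma T_carrier: "x \<in> T \<Longrightarrow> x \<in> carrier R"
  using additive_subgroup.a_Hcarr[OF T_sub] .

lemma V_carrier: "x \<in> V \<Longrightarrow> x \<in> carrier R"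
  using additive_subgroup.a_Hcarr[OF V_sub] .

lemma V_add: "x \<in> V \<Longrightarrow> y \<in> V \<Longrightarrow> x \<oplus> y \<in> V"
  using additive_subgroup.a_closed[OF V_sub] .

lemma T_add: "x \<in> T \<Longrightarrow> y \<in> T \<Longrightarrow> x \<oplus> y \<in> T"
  using additive_subgroup.a_closed[OF T_sub] .

lemma V_minus: "x \<in> V \<Longrightarrow> \<ominus> x \<in> V"
  using additive_subgroup.a_inv_closed[OF V_sub] .

lemma T_minus: "x \<in> T \<Longrightarrow> \<ominus> x \<in> T"
  using additive_subgroup.a_inv_closed[OF T_sub] .

lemma T_diff: "x \<in> T \<Longrightarrow> y \<in> T \<Longrightarrow> x \<ominus> y \<in> T"
  unfolding a_minus_def by (intro T_add T_minus)

lemma bij_shift: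
  assumes "additive_subgroup H R" "v \<in> H"
  shows "bij_betw (\<lambda>z. z \<oplus> v) H H"
proof (rule bij_betw_byWitness[where f' = "\<lambda>z. z \<ominus> v"])
  note H = additive_subgroup.a_closed[OF assms(1)] additive_subgroup.a_inv_closed[OF assms(1)]
    additive_subgroup.a_Hcarr[OF assms(1)]
  show "\<forall>a\<in>H. a \<oplus> v \<ominus> v = a" "\<forall>a\<in>H. a \<ominus> v \<oplus> v = a"
    using H(3) assms(2) by (auto simp: a_minus_def a_assoc r_neg l_neg)
  show "(\<lambda>z. z \<oplus> v) ` H \<subseteq> H" "(\<lambda>z. z \<ominus> v) ` H \<subseteq> H"
    using H assms(2) by (auto simp: a_minus_def)
qed

lemma sum_shift_V: "v \<in> V \<Longrightarrow> (\<Sum>z\<in>V. f (z \<oplus> v)) = (\<Sum>z\<in>V. f z)"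
  for f :: "'a \<Rightarrow> real"
  using sum.reindex_bij_betw[OF bij_shift[OF V_sub]] .

lemma sum_shift_T: "v \<in> T \<Longrightarrow> (\<Sum>z\<in>T. f (z \<oplus> v)) = (\<Sum>z\<in>T. f z)"
  for f :: "'a \<Rightarrow> real"
  using sum.reindex_bij_betw[OF bij_shift[OF T_sub]] .

lemma bij_minus_T: "bij_betw (\<lambda>x. \<ominus> x) T T"
  by (rule bij_betw_byWitness[where f' = "\<lambda>x. \<ominus> x"]) (auto simp: T_carrier T_minus)

text \<open>Up to the factor q^2 this is the average over a translate of the line T d: symmetric by
  \<open>line_sum_adjoint\<close> and, after division by q^2, idempotent by
  \<open>line_sum_twice\<close>.\<close>

definition line_sum :: "'a \<Rightarrow> ('a \<Rightarrow> real) \<Rightarrow> 'a \<Rightarrow> real" where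
  "line_sum d f z = (\<Sum>x\<in>T. f (z \<oplus> x \<otimes> d))"

definition ip :: "('a \<Rightarrow> real) \<Rightarrow> ('a \<Rightarrow> real) \<Rightarrow> real" where
  "ip f g = (\<Sum>z\<in>V. f z * g z)"

lemma ip_nonneg: "ip f f \<ge> 0"
  unfolding ip_def by (intro sum_nonneg) simp

lemma line_sum_minus:
  assumes "d \<in> T" "z \<in> V"
  shows "line_sum (\<ominus> d) f z = line_sum d f z"
proof -
  have "line_sum (\<ominus> d) f z = (\<Sum>x\<in>T. f (z \<oplus> (\<ominus> x) \<otimes> d))"
    unfolding line_sum_def using assms T_carrier by (intro sum.cong refl) (simp add: l_minus r_minus)
  also have "\<dots> = line_sum d f z"
    unfolding line_sum_def by (rule sum.reindex_bij_betw[OF bij_minus_T])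
  finally show ?thesis .
qed

text \<open>Multiplication by u permutes T, so d and u d define the same line.\<close>

lemma line_sum_scaled:
  assumes "d \<in> T" "z \<in> V" "u \<in> C"
  shows "line_sum (u \<otimes> d) f z = line_sum d f z"
proof -
  have "line_sum (u \<otimes> d) f z = (\<Sum>x\<in>T. f (z \<oplus> (u \<otimes> x) \<otimes> d))"
    unfolding line_sum_def
  proof (intro sum.cong refl)
    fix x assume "x \<in> T"
    then have "x \<otimes> (u \<otimes> d) = u \<otimes> x \<otimes> d"
      using assms T_carrier subsetD[OF C_carrier] by (simp add: m_ac)
    then show "f (z \<oplus> x \<otimes> (u \<otimes> d)) = f (z \<oplus> u \<otimes> x \<otimes> d)" by simp
  qed
  also have "\<dots> = line_sum d f z"
    unfolding line_sum_def by (rule sum.reindex_bij_betw[OF C_bij[OF assms(3)]])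
  finally show ?thesis .
qed

lemma line_sum_adjoint:
  assumes d: "d \<in> T"
  shows "ip f (line_sum d g) = ip (line_sum d f) g"
proof -
  have "ip f (line_sum d g) = (\<Sum>x\<in>T. \<Sum>z\<in>V. f z * g (z \<oplus> x \<otimes> d))"
    unfolding ip_def line_sum_def sum_distrib_left by (rule sum.swap)
  also have "\<dots> = (\<Sum>x\<in>T. \<Sum>z\<in>V. f (z \<oplus> (\<ominus> x) \<otimes> d) * g z)"
  proof (rule sum.cong[OF refl])
    fix x assume x: "x \<in> T"
    have "(\<Sum>z\<in>V. f z * g (z \<oplus> x \<otimes> d)) = (\<Sum>z\<in>V. f (z \<oplus> (\<ominus> x) \<otimes> d) * g (z \<oplus> (\<ominus> x) \<otimes> d \<oplus> x \<otimes> d))"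
      using sum_shift_V[of "(\<ominus> x) \<otimes> d" "\<lambda>z. f z * g (z \<oplus> x \<otimes> d)"] TT T_minus x d by simp
    also have "\<dots> = (\<Sum>z\<in>V. f (z \<oplus> (\<ominus> x) \<otimes> d) * g z)"
      using x d T_carrier V_carrier by (intro sum.cong refl) (simp add: a_assoc l_minus l_neg)
    finally show "(\<Sum>z\<in>V. f z * g (z \<oplus> x \<otimes> d)) = (\<Sum>z\<in>V. f (z \<oplus> (\<ominus> x) \<otimes> d) * g z)" .
  qed
  also have "\<dots> = (\<Sum>x\<in>T. \<Sum>z\<in>V. f (z \<oplus> x \<otimes> d) * g z)"
    by (rule sum.reindex_bij_betw[OF bij_minus_T])
  also have "\<dots> = ip (line_sum d f) g"
    unfolding ip_def line_sum_def sum_distrib_right by (rule sum.swap)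
  finally show ?thesis .
qed

lemma line_sum_twice:
  assumes d: "d \<in> T" and z: "z \<in> V"
  shows "line_sum d (line_sum d f) z = real (q\<^sup>2) * line_sum d f z"
proof -
  have "line_sum d (line_sum d f) z = (\<Sum>x\<in>T. \<Sum>y\<in>T. f (z \<oplus> (y \<oplus> x) \<otimes> d))"
    unfolding line_sum_def
  proof (intro sum.cong refl)
    fix x y assume "x \<in> T" "y \<in> T"
    then have "z \<oplus> x \<otimes> d \<oplus> y \<otimes> d = z \<oplus> (y \<oplus> x) \<otimes> d"
      using d z T_carrier V_carrier by (simp add: l_distr a_ac)
    then show "f (z \<oplus> x \<otimes> d \<oplus> y \<otimes> d) = f (z \<oplus> (y \<oplus> x) \<otimes> d)" by simp
  qed
  also have "\<dots> = (\<Sum>x\<in>T. line_sum d f z)"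
    unfolding line_sum_def
    by (rule sum.cong[OF refl]) (rule sum_shift_T[of _ "\<lambda>y. f (z \<oplus> y \<otimes> d)"])
  finally show ?thesis by (simp add: card_T)
qed

lemma ip_cong: "(\<And>z. z \<in> V \<Longrightarrow> f z = f' z) \<Longrightarrow> (\<And>z. z \<in> V \<Longrightarrow> g z = g' z) \<Longrightarrow> ip f g = ip f' g'"
  unfolding ip_def by (intro sum.cong) auto

lemma ip_line_sum:
  assumes "d \<in> T"
  shows "real (q\<^sup>2) * ip f (line_sum d g) = ip (line_sum d f) (line_sum d g)"
proof -
  have "ip (line_sum d f) (line_sum d g) = ip f (line_sum d (line_sum d g))"
    using line_sum_adjoint[OF assms] by simp
  also have "\<dots> = ip f (\<lambda>z. real (q\<^sup>2) * line_sum d g z)"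
    using line_sum_twice[OF assms] by (intro ip_cong) auto
  also have "\<dots> = real (q\<^sup>2) * ip f (line_sum d g)"
    unfolding ip_def by (simp add: sum_distrib_left mult_ac)
  finally show ?thesis by simp
qed

lemma q2_pos: "real (q\<^sup>2) > 0"
  using q_pos by simp

lemma ip_line_sum_nonneg: "d \<in> T \<Longrightarrow> ip f (line_sum d f) \<ge> 0"
  using ip_line_sum[of d f f] ip_nonneg[of "line_sum d f"] q2_pos by (metis zero_le_mult_iff not_less)

text \<open>In the spanning case the double sum is invariant under translation by \<open>V\<close>.\<close>

lemma line_sum_orthogonal:
  assumes d: "d \<in> T - {\<zero>}" and e: "e \<in> T - {\<zero>}" and ne: "\<forall>u\<in>C. e \<noteq> u \<otimes> d"
    and mean: "(\<Sum>z\<in>V. f z) = 0" and z: "z \<in> V"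
  shows "line_sum d (line_sum e f) z = 0"
proof -
  define h where "h = line_sum d (line_sum e f)"
  have h: "h z = (\<Sum>x\<in>T. \<Sum>y\<in>T. f (z \<oplus> (x \<otimes> d \<oplus> y \<otimes> e)))" if "z \<in> V" for z
    unfolding h_def line_sum_def using that d e T_carrier V_carrier
    by (intro sum.cong refl) (auto simp: a_assoc)
  have const: "h (z \<oplus> v) = h z" if z: "z \<in> V" and v: "v \<in> V" for z v
  proof -
    obtain a b where ab: "a \<in> T" "b \<in> T" "v = a \<otimes> d \<oplus> b \<otimes> e" using span[OF d e ne v] by blast
    have "h (z \<oplus> v) = (\<Sum>x\<in>T. \<Sum>y\<in>T. f (z \<oplus> ((x \<oplus> a) \<otimes> d \<oplus> (y \<oplus> b) \<otimes> e)))"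
      unfolding h[OF V_add[OF z v]]
    proof (intro sum.cong refl)
      fix x y assume xy: "x \<in> T" "y \<in> T"
      have c: "x \<otimes> d \<in> carrier R" "y \<otimes> e \<in> carrier R" "a \<otimes> d \<in> carrier R" "b \<otimes> e \<in> carrier R" "z \<in> carrier R"
        "x \<in> carrier R" "y \<in> carrier R" "a \<in> carrier R" "b \<in> carrier R" "d \<in> carrier R" "e \<in> carrier R"
        using xy ab d e z T_carrier V_carrier by auto
      have "z \<oplus> v \<oplus> (x \<otimes> d \<oplus> y \<otimes> e) = z \<oplus> ((x \<oplus> a) \<otimes> d \<oplus> (y \<oplus> b) \<otimes> e)"
        unfolding ab(3) l_distr[OF c(6,8,10)] l_distr[OF c(7,9,11)] using c(1-5) by (simp add: a_ac)
      then show "f (z \<oplus> v \<oplus> (x \<otimes> d \<oplus> y \<otimes> e)) = f (z \<oplus> ((x \<oplus> a) \<otimes> d \<oplus> (y \<oplus> b) \<otimes> e))" by simp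
    qed
    also have "\<dots> = (\<Sum>x\<in>T. \<Sum>y\<in>T. f (z \<oplus> ((x \<oplus> a) \<otimes> d \<oplus> y \<otimes> e)))"
      by (rule sum.cong[OF refl]) (rule sum_shift_T[OF ab(2)])
    also have "\<dots> = (\<Sum>x\<in>T. \<Sum>y\<in>T. f (z \<oplus> (x \<otimes> d \<oplus> y \<otimes> e)))"
      by (rule sum_shift_T[OF ab(1), of "\<lambda>x. \<Sum>y\<in>T. f (z \<oplus> (x \<otimes> d \<oplus> y \<otimes> e))"])
    finally show ?thesis using h[OF z] by simp
  qed
  have "(\<Sum>v\<in>V. h v) = (\<Sum>v\<in>V. \<Sum>x\<in>T. \<Sum>y\<in>T. f (v \<oplus> (x \<otimes> d \<oplus> y \<otimes> e)))"
    by (intro sum.cong refl h)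
  also have "\<dots> = (\<Sum>x\<in>T. \<Sum>v\<in>V. \<Sum>y\<in>T. f (v \<oplus> (x \<otimes> d \<oplus> y \<otimes> e)))" by (rule sum.swap)
  also have "\<dots> = (\<Sum>x\<in>T. \<Sum>y\<in>T. \<Sum>v\<in>V. f (v \<oplus> (x \<otimes> d \<oplus> y \<otimes> e)))"
    by (intro sum.cong[OF refl] sum.swap)
  also have "\<dots> = 0"
  proof (rule sum.neutral, rule ballI, rule sum.neutral, rule ballI)
    fix x y assume "x \<in> T" "y \<in> T"
    then have "x \<otimes> d \<oplus> y \<otimes> e \<in> V" using TT V_add d e by blast
    then show "(\<Sum>v\<in>V. f (v \<oplus> (x \<otimes> d \<oplus> y \<otimes> e))) = 0" using sum_shift_V mean by simp
  qed
  finally have "(\<Sum>v\<in>V. h v) = 0" .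
  moreover have "(\<Sum>v\<in>V. h v) = (\<Sum>v\<in>V. h (v \<oplus> z))" using sum_shift_V[OF z] by simp
  moreover have "(\<Sum>v\<in>V. h (v \<oplus> z)) = (\<Sum>v\<in>V. h z)"
  proof (intro sum.cong refl)
    fix v assume v: "v \<in> V"
    then have "v \<oplus> z = z \<oplus> v" using z V_carrier a_comm by blast
    then show "h (v \<oplus> z) = h z" using const[OF z v] by simp
  qed
  ultimately have "real (card V) * h z = 0" by simp
  then show ?thesis using z finite_V unfolding h_def by auto
qed

text \<open>Let S be the sum of all line sums of f, and t its inner product with f. In the norm of S
  only pairs of directions on a common line survive, at most q - 1 for each d, and each contributes
  q^2 times a diagonal term; so the squared norm is at most q^2 (q - 1) t. Cauchy-Schwarz bounds t^2
  by this times the squared norm of f, and one factor t cancels.\<close>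

lemma sum_line_sum_bound:
  assumes mean: "(\<Sum>z\<in>V. f z) = 0"
  shows "(\<Sum>d\<in>T - {\<zero>}. ip f (line_sum d f)) \<le> real (q\<^sup>2) * (real q - 1) * ip f f"
proof -
  define D where "D = T - {\<zero>}"
  have DT: "d \<in> T" if "d \<in> D" for d using that D_def by auto
  have fD: "finite D" using finite_T by (simp add: D_def)
  define S where "S z = (\<Sum>d\<in>D. line_sum d f z)" for z
  define t where "t = (\<Sum>d\<in>D. ip f (line_sum d f))"
  have fS: "ip f S = t" unfolding t_def S_def ip_def by (simp add: sum_distrib_left) (rule sum.swap)
  have t0: "t \<ge> 0" unfolding t_def using ip_line_sum_nonneg DT by (intro sum_nonneg) blast
  have "ip S S = (\<Sum>e\<in>D. \<Sum>d\<in>D. ip (line_sum d f) (line_sum e f))"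
    unfolding ip_def S_def sum_product
    by (subst sum.swap, rule sum.cong[OF refl], subst sum.swap, rule sum.cong[OF refl], rule sum.cong) (auto simp: sum_distrib_left)
  also have "\<dots> = (\<Sum>d\<in>D. \<Sum>e\<in>D. ip f (line_sum d (line_sum e f)))"
    by (subst sum.swap) (intro sum.cong refl, simp add: line_sum_adjoint DT)
  also have "\<dots> \<le> (\<Sum>d\<in>D. real (q\<^sup>2) * (real q - 1) * ip f (line_sum d f))"
  proof (intro sum_mono)
    fix d assume d: "d \<in> D"
    \<comment> \<open>The directions on the line of d, which are the multiples by the fewer than q
      elements of C.\<close>
    define B where "B = {e \<in> D. \<exists>u\<in>C. e = u \<otimes> d}"
    have cB: "real (card B) \<le> real q - 1"
    proof -
      have "B \<subseteq> (\<lambda>u. u \<otimes> d) ` C" by (auto simp: B_def)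
      then have "card B \<le> card C" using finite_C by (meson card_image_le card_mono finite_imageI le_trans)
      then show ?thesis using card_C by linarith
    qed
    have "(\<Sum>e\<in>D. ip f (line_sum d (line_sum e f))) = (\<Sum>e\<in>B. ip f (line_sum d (line_sum e f)))"
    proof (rule sum.mono_neutral_right[OF fD])
      show "B \<subseteq> D" by (auto simp: B_def)
      show "\<forall>e\<in>D - B. ip f (line_sum d (line_sum e f)) = 0"
      proof
        fix e assume e: "e \<in> D - B"
        have "line_sum d (line_sum e f) z = 0" if "z \<in> V" for z
          using line_sum_orthogonal[of d e f z] d e mean that unfolding B_def D_def by blast
        then show "ip f (line_sum d (line_sum e f)) = 0" unfolding ip_def by simp
      qed
    qed
    also have "\<dots> = (\<Sum>e\<in>B. real (q\<^sup>2) * ip f (line_sum d f))"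
    proof (intro sum.cong refl)
      fix e assume "e \<in> B"
      then obtain u where u: "u \<in> C" "e = u \<otimes> d" by (auto simp: B_def)
      have "line_sum d (line_sum e f) z = line_sum d (line_sum d f) z" if z: "z \<in> V" for z
        unfolding u(2) line_sum_def[of d "line_sum (u \<otimes> d) f"] line_sum_def[of d "line_sum d f"]
        using line_sum_scaled[OF DT[OF d] _ u(1)] z TT V_add DT[OF d] by (intro sum.cong refl) simp
      then have "ip f (line_sum d (line_sum e f)) = ip f (\<lambda>z. real (q\<^sup>2) * line_sum d f z)"
        using line_sum_twice[OF DT[OF d]] by (intro ip_cong) auto
      then show "ip f (line_sum d (line_sum e f)) = real (q\<^sup>2) * ip f (line_sum d f)"
        unfolding ip_def by (simp add: sum_distrib_left mult_ac)
    qed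
    also have "\<dots> = real (card B) * (real (q\<^sup>2) * ip f (line_sum d f))" by simp
    also have "\<dots> \<le> (real q - 1) * (real (q\<^sup>2) * ip f (line_sum d f))"
      using cB ip_line_sum_nonneg[OF DT[OF d]] by (intro mult_right_mono) auto
    finally show "(\<Sum>e\<in>D. ip f (line_sum d (line_sum e f))) \<le> real (q\<^sup>2) * (real q - 1) * ip f (line_sum d f)"
      by (simp add: mult_ac)
  qed
  also have "\<dots> = real (q\<^sup>2) * (real q - 1) * t" unfolding t_def sum_distrib_left ..
  finally have SS: "ip S S \<le> real (q\<^sup>2) * (real q - 1) * t" .
  have "t\<^sup>2 \<le> ip f f * ip S S"
    unfolding fS[symmetric] ip_def using Cauchy_Schwarz_ineq_sum[of f S V] by (simp add: power2_eq_square)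
  also have "\<dots> \<le> ip f f * (real (q\<^sup>2) * (real q - 1) * t)"
    using SS ip_nonneg by (intro mult_left_mono) auto
  finally have "t * t \<le> (real (q\<^sup>2) * (real q - 1) * ip f f) * t" by (simp add: power2_eq_square mult_ac)
  then have "t \<le> real (q\<^sup>2) * (real q - 1) * ip f f"
  proof (cases "t = 0")
    case True
    then show ?thesis using q_pos ip_nonneg[of f] by simp
  next
    case False
    then show ?thesis using t0 \<open>t * t \<le> _\<close> by (simp add: mult_le_cancel_right)
  qed
  then show ?thesis by (simp add: t_def D_def)
qed

text \<open>The unnormalised incidence operator of the link graph, in which (x, w) is joined to the
  q^2 vertices (y, w + x y).\<close>

definition transform :: "('a \<Rightarrow> 'a \<Rightarrow> real) \<Rightarrow> 'a \<Rightarrow> 'a \<Rightarrow> real" where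
  "transform f x w = (\<Sum>y\<in>T. f y (w \<oplus> x \<otimes> y))"

text \<open>Expanding the square gives inner products of f y with the line sum of f y' in the
  direction y' - y. Line sums are positive operators, so each mixed term is at most the mean of two
  diagonal ones. For fixed y the difference y' - y runs once through T, and
  \<open>sum_line_sum_bound\<close> applies to each f y separately.\<close>

lemma transform_norm_mean_zero:
  assumes mean: "\<And>y. y \<in> T \<Longrightarrow> (\<Sum>z\<in>V. f y z) = 0"
  shows "(\<Sum>x\<in>T. \<Sum>w\<in>V. (transform f x w)\<^sup>2) \<le> real q ^ 3 * (\<Sum>y\<in>T. ip (f y) (f y))"
proof -
  \<comment> \<open>Substituting z = w + x y leaves only the difference y' - y.\<close>
  have pair: "(\<Sum>x\<in>T. \<Sum>w\<in>V. f y (w \<oplus> x \<otimes> y) * f y' (w \<oplus> x \<otimes> y')) = ip (f y) (line_sum (y' \<ominus> y) (f y'))"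
    if y: "y \<in> T" "y' \<in> T" for y y'
  proof -
    have "(\<Sum>w\<in>V. f y (w \<oplus> x \<otimes> y) * f y' (w \<oplus> x \<otimes> y')) = (\<Sum>z\<in>V. f y z * f y' (z \<oplus> x \<otimes> (y' \<ominus> y)))"
      if x: "x \<in> T" for x
    proof -
      have c: "x \<in> carrier R" "y \<in> carrier R" "y' \<in> carrier R" using x y T_carrier by auto
      have "(\<Sum>w\<in>V. f y (w \<oplus> x \<otimes> y) * f y' (w \<oplus> x \<otimes> y'))
        = (\<Sum>w\<in>V. f y (w \<oplus> x \<otimes> y) * f y' (w \<oplus> x \<otimes> y \<oplus> x \<otimes> (y' \<ominus> y)))"
      proof (intro sum.cong refl)
        fix w assume "w \<in> V"
        then have w: "w \<in> carrier R" using V_carrier by blast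
        have "x \<otimes> y \<oplus> x \<otimes> (y' \<ominus> y) = x \<otimes> (y \<oplus> (y' \<ominus> y))" using c by (simp add: r_distr)
        also have "y \<oplus> (y' \<ominus> y) = y'"
          using c by (metis a_assoc a_comm a_inv_closed a_minus_def r_neg r_zero)
        finally have "w \<oplus> x \<otimes> y \<oplus> x \<otimes> (y' \<ominus> y) = w \<oplus> x \<otimes> y'"
          using c w by (metis a_assoc m_closed minus_closed)
        then show "f y (w \<oplus> x \<otimes> y) * f y' (w \<oplus> x \<otimes> y')
          = f y (w \<oplus> x \<otimes> y) * f y' (w \<oplus> x \<otimes> y \<oplus> x \<otimes> (y' \<ominus> y))" by simp
      qed
      also have "\<dots> = (\<Sum>z\<in>V. f y z * f y' (z \<oplus> x \<otimes> (y' \<ominus> y)))"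
        by (rule sum_shift_V[OF TT[OF x y(1)]])
      finally show ?thesis .
    qed
    then have "(\<Sum>x\<in>T. \<Sum>w\<in>V. f y (w \<oplus> x \<otimes> y) * f y' (w \<oplus> x \<otimes> y'))
      = (\<Sum>x\<in>T. \<Sum>z\<in>V. f y z * f y' (z \<oplus> x \<otimes> (y' \<ominus> y)))" by (rule sum.cong[OF refl])
    also have "\<dots> = ip (f y) (line_sum (y' \<ominus> y) (f y'))"
      unfolding ip_def line_sum_def sum_distrib_left by (rule sum.swap)
    finally show ?thesis .
  qed
  have "(\<Sum>x\<in>T. \<Sum>w\<in>V. (transform f x w)\<^sup>2)
    = (\<Sum>x\<in>T. \<Sum>w\<in>V. \<Sum>y\<in>T. \<Sum>y'\<in>T. f y (w \<oplus> x \<otimes> y) * f y' (w \<oplus> x \<otimes> y'))"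
    unfolding transform_def power2_eq_square sum_product ..
  also have "\<dots> = (\<Sum>x\<in>T. \<Sum>y\<in>T. \<Sum>w\<in>V. \<Sum>y'\<in>T. f y (w \<oplus> x \<otimes> y) * f y' (w \<oplus> x \<otimes> y'))"
    by (intro sum.cong[OF refl] sum.swap)
  also have "\<dots> = (\<Sum>y\<in>T. \<Sum>x\<in>T. \<Sum>w\<in>V. \<Sum>y'\<in>T. f y (w \<oplus> x \<otimes> y) * f y' (w \<oplus> x \<otimes> y'))"
    by (rule sum.swap)
  also have "\<dots> = (\<Sum>y\<in>T. \<Sum>x\<in>T. \<Sum>y'\<in>T. \<Sum>w\<in>V. f y (w \<oplus> x \<otimes> y) * f y' (w \<oplus> x \<otimes> y'))"
    by (intro sum.cong[OF refl] sum.swap)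
  also have "\<dots> = (\<Sum>y\<in>T. \<Sum>y'\<in>T. \<Sum>x\<in>T. \<Sum>w\<in>V. f y (w \<oplus> x \<otimes> y) * f y' (w \<oplus> x \<otimes> y'))"
    by (intro sum.cong[OF refl] sum.swap)
  also have "\<dots> = (\<Sum>y\<in>T. \<Sum>y'\<in>T. ip (f y) (line_sum (y' \<ominus> y) (f y')))"
    by (intro sum.cong refl pair)
  also have "\<dots> \<le> (\<Sum>y\<in>T. \<Sum>y'\<in>T. (ip (f y) (line_sum (y' \<ominus> y) (f y)) + ip (f y') (line_sum (y \<ominus> y') (f y'))) / 2)"
  proof (intro sum_mono)
    fix y y' assume y: "y \<in> T" "y' \<in> T"
    define d where "d = y' \<ominus> y"
    have d: "d \<in> T" unfolding d_def using T_diff y by blast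
    have "y \<ominus> y' = \<ominus> d" unfolding d_def using y T_carrier by (simp add: a_minus_def minus_add a_comm)
    then have e: "ip (f y') (line_sum (y \<ominus> y') (f y')) = ip (f y') (line_sum d (f y'))"
      using line_sum_minus[OF d] by (intro ip_cong) auto
    \<comment> \<open>Positivity enters as the norm of the difference of two line sums, which
      \<open>ip_line_sum\<close> converts back into inner products with one line sum.\<close>
    have "0 \<le> ip (\<lambda>z. line_sum d (f y) z - line_sum d (f y') z) (\<lambda>z. line_sum d (f y) z - line_sum d (f y') z)"
      by (rule ip_nonneg)
    also have "\<dots> = ip (line_sum d (f y)) (line_sum d (f y)) + ip (line_sum d (f y')) (line_sum d (f y'))
        - 2 * ip (line_sum d (f y)) (line_sum d (f y'))"
      unfolding ip_def sum_distrib_left sum.distrib[symmetric] sum_subtractf[symmetric]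
      by (intro sum.cong refl) (simp add: algebra_simps)
    finally have "2 * ip (line_sum d (f y)) (line_sum d (f y'))
      \<le> ip (line_sum d (f y)) (line_sum d (f y)) + ip (line_sum d (f y')) (line_sum d (f y'))" by simp
    then have "real (q\<^sup>2) * (2 * ip (f y) (line_sum d (f y')))
      \<le> real (q\<^sup>2) * (ip (f y) (line_sum d (f y)) + ip (f y') (line_sum d (f y')))"
      unfolding ip_line_sum[OF d, symmetric] by (simp add: algebra_simps)
    then have "2 * ip (f y) (line_sum d (f y')) \<le> ip (f y) (line_sum d (f y)) + ip (f y') (line_sum d (f y'))"
      using q2_pos mult_le_cancel_left_pos by blast
    then show "ip (f y) (line_sum (y' \<ominus> y) (f y'))
        \<le> (ip (f y) (line_sum (y' \<ominus> y) (f y)) + ip (f y') (line_sum (y \<ominus> y') (f y'))) / 2"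
      unfolding e d_def[symmetric] by simp
  qed
  also have "\<dots> = (\<Sum>y\<in>T. \<Sum>y'\<in>T. ip (f y) (line_sum (y' \<ominus> y) (f y)))"
  proof -
    have "(\<Sum>y\<in>T. \<Sum>y'\<in>T. ip (f y') (line_sum (y \<ominus> y') (f y'))) = (\<Sum>y\<in>T. \<Sum>y'\<in>T. ip (f y) (line_sum (y' \<ominus> y) (f y)))"
      by (rule sum.swap)
    then show ?thesis by (simp add: sum.distrib sum_divide_distrib[symmetric] add_divide_distrib)
  qed
  also have "\<dots> = (\<Sum>y\<in>T. \<Sum>d\<in>T. ip (f y) (line_sum d (f y)))"
  proof (rule sum.cong[OF refl])
    fix y assume "y \<in> T"
    then show "(\<Sum>y'\<in>T. ip (f y) (line_sum (y' \<ominus> y) (f y))) = (\<Sum>d\<in>T. ip (f y) (line_sum d (f y)))"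
      unfolding a_minus_def by (rule sum_shift_T[OF T_minus])
  qed
  also have "\<dots> \<le> (\<Sum>y\<in>T. real q ^ 3 * ip (f y) (f y))"
  proof (intro sum_mono)
    fix y assume y: "y \<in> T"
    \<comment> \<open>Relative to the squared norm of f y, the direction 0 contributes q^2 and all
      others together at most q^2 (q - 1), which makes q^3.\<close>
    have z: "\<zero> \<in> T" using additive_subgroup.zero_closed[OF T_sub] .
    have "line_sum \<zero> (f y) v = real (q\<^sup>2) * f y v" if "v \<in> V" for v
      using that T_carrier V_carrier by (simp add: line_sum_def card_T)
    then have "ip (f y) (line_sum \<zero> (f y)) = ip (f y) (\<lambda>v. real (q\<^sup>2) * f y v)" by (intro ip_cong) auto
    also have "\<dots> = real (q\<^sup>2) * ip (f y) (f y)" unfolding ip_def by (simp add: sum_distrib_left mult_ac)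
    finally have "(\<Sum>d\<in>T. ip (f y) (line_sum d (f y)))
      \<le> real (q\<^sup>2) * ip (f y) (f y) + real (q\<^sup>2) * (real q - 1) * ip (f y) (f y)"
      using sum_line_sum_bound[OF mean[OF y]] sum.remove[OF finite_T z, of "\<lambda>d. ip (f y) (line_sum d (f y))"] by simp
    also have "\<dots> = real q ^ 3 * ip (f y) (f y)" by (simp add: power2_eq_square power3_eq_cube algebra_simps)
    finally show "(\<Sum>d\<in>T. ip (f y) (line_sum d (f y))) \<le> real q ^ 3 * ip (f y) (f y)" .
  qed
  finally show ?thesis by (simp add: sum_distrib_left)
qed

text \<open>Subtracting from each f y its mean leaves the transform unchanged, since the means add
  up to zero, and does not increase the norm.\<close>

lemma transform_norm:
  assumes total: "(\<Sum>y\<in>T. \<Sum>z\<in>V. f y z) = 0"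
  shows "(\<Sum>x\<in>T. \<Sum>w\<in>V. (transform f x w)\<^sup>2) \<le> real q ^ 3 * (\<Sum>y\<in>T. \<Sum>z\<in>V. (f y z)\<^sup>2)"
proof -
  have cV: "real (card V) > 0"
    using finite_V additive_subgroup.zero_closed[OF V_sub] by (auto simp: card_gt_0_iff)
  define c where "c y = (\<Sum>z\<in>V. f y z) / real (card V)" for y
  define g where "g y z = f y z - c y" for y z
  have sc: "(\<Sum>z\<in>V. f y z) = real (card V) * c y" for y using cV by (simp add: c_def)
  have "(\<Sum>y\<in>T. c y) = 0" using total cV by (simp add: c_def sum_divide_distrib[symmetric])
  then have "transform g x w = transform f x w" for x w
    unfolding transform_def g_def by (simp add: sum_subtractf)
  then have "(\<Sum>x\<in>T. \<Sum>w\<in>V. (transform f x w)\<^sup>2) = (\<Sum>x\<in>T. \<Sum>w\<in>V. (transform g x w)\<^sup>2)" by simp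
  also have "\<dots> \<le> real q ^ 3 * (\<Sum>y\<in>T. ip (g y) (g y))"
    by (rule transform_norm_mean_zero) (simp add: g_def sum_subtractf sc)
  also have "\<dots> \<le> real q ^ 3 * (\<Sum>y\<in>T. \<Sum>z\<in>V. (f y z)\<^sup>2)"
  proof (intro mult_left_mono sum_mono)
    fix y
    have "ip (g y) (g y) = (\<Sum>z\<in>V. (f y z)\<^sup>2) - 2 * c y * (\<Sum>z\<in>V. f y z) + real (card V) * (c y)\<^sup>2"
    proof -
      have "ip (g y) (g y) = (\<Sum>z\<in>V. (f y z)\<^sup>2 - 2 * c y * f y z + (c y)\<^sup>2)"
        unfolding ip_def g_def by (intro sum.cong refl) (simp add: power2_eq_square algebra_simps)
      then show ?thesis by (simp add: sum.distrib sum_subtractf sum_distrib_left)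
    qed
    also have "\<dots> = (\<Sum>z\<in>V. (f y z)\<^sup>2) - real (card V) * (c y)\<^sup>2"
      unfolding sc by (simp add: power2_eq_square)
    also have "\<dots> \<le> (\<Sum>z\<in>V. (f y z)\<^sup>2)" by simp
    finally show "ip (g y) (g y) \<le> (\<Sum>z\<in>V. (f y z)\<^sup>2)" .
  qed simp
  finally show ?thesis .
qed

text \<open>Cauchy-Schwarz combined with \<open>transform_norm\<close>. The factor q^(3/2), measured
  against the degree q^2 of the graph, is the source of 1/sqrt q.\<close>

theorem expander_mixing:
  assumes total: "(\<Sum>y\<in>T. \<Sum>z\<in>V. f y z) = 0"
  shows "(\<Sum>x\<in>T. \<Sum>y\<in>T. \<Sum>z\<in>V. f y z * g x (z \<ominus> x \<otimes> y))
    \<le> sqrt (real q ^ 3 * (\<Sum>y\<in>T. \<Sum>z\<in>V. (f y z)\<^sup>2) * (\<Sum>x\<in>T. \<Sum>w\<in>V. (g x w)\<^sup>2))"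
proof -
  have "(\<Sum>x\<in>T. \<Sum>y\<in>T. \<Sum>z\<in>V. f y z * g x (z \<ominus> x \<otimes> y))
    = (\<Sum>x\<in>T. \<Sum>y\<in>T. \<Sum>w\<in>V. f y (w \<oplus> x \<otimes> y) * g x w)"
  proof (rule sum.cong[OF refl], rule sum.cong[OF refl])
    fix x y assume xy: "x \<in> T" "y \<in> T"
    have "(\<Sum>z\<in>V. f y z * g x (z \<ominus> x \<otimes> y)) = (\<Sum>w\<in>V. f y (w \<oplus> x \<otimes> y) * g x (w \<oplus> x \<otimes> y \<ominus> x \<otimes> y))"
      using sum_shift_V[OF TT[OF xy], of "\<lambda>z. f y z * g x (z \<ominus> x \<otimes> y)"] by simp
    also have "\<dots> = (\<Sum>w\<in>V. f y (w \<oplus> x \<otimes> y) * g x w)"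
      using xy T_carrier V_carrier by (intro sum.cong refl) (simp add: a_minus_def a_assoc r_neg)
    finally show "(\<Sum>z\<in>V. f y z * g x (z \<ominus> x \<otimes> y)) = (\<Sum>w\<in>V. f y (w \<oplus> x \<otimes> y) * g x w)" .
  qed
  also have "\<dots> = (\<Sum>x\<in>T. \<Sum>w\<in>V. transform f x w * g x w)"
    unfolding transform_def sum_distrib_right by (intro sum.cong[OF refl] sum.swap)
  also have "\<dots> = (\<Sum>p\<in>T \<times> V. transform f (fst p) (snd p) * g (fst p) (snd p))"
    by (simp add: sum.cartesian_product case_prod_unfold)
  also have "\<dots> \<le> sqrt ((\<Sum>p\<in>T \<times> V. (transform f (fst p) (snd p))\<^sup>2) * (\<Sum>p\<in>T \<times> V. (g (fst p) (snd p))\<^sup>2))"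
    using Cauchy_Schwarz_ineq_sum[of "\<lambda>p. transform f (fst p) (snd p)" "\<lambda>p. g (fst p) (snd p)" "T \<times> V"]
    by (rule real_le_rsqrt)
  also have "\<dots> = sqrt ((\<Sum>x\<in>T. \<Sum>w\<in>V. (transform f x w)\<^sup>2) * (\<Sum>x\<in>T. \<Sum>w\<in>V. (g x w)\<^sup>2))"
    by (simp add: sum.cartesian_product case_prod_unfold)
  also have "\<dots> \<le> sqrt (real q ^ 3 * (\<Sum>y\<in>T. \<Sum>z\<in>V. (f y z)\<^sup>2) * (\<Sum>x\<in>T. \<Sum>w\<in>V. (g x w)\<^sup>2))"
    using transform_norm[OF total] by (intro real_sqrt_le_mono mult_right_mono sum_nonneg) auto
  finally show ?thesis .
qed

end

section \<open>Truncated polynomials as a filtered ring\<close>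

lemma (in abelian_group) add_diff_cancel_left_carrier:
  assumes "c \<in> carrier G" "p \<in> carrier G" "r \<in> carrier G"
  shows "(c \<oplus> p) \<ominus> (c \<oplus> r) = p \<ominus> r"
proof -
  have "(c \<oplus> p) \<ominus> (c \<oplus> r) = (c \<oplus> \<ominus> c) \<oplus> (p \<oplus> \<ominus> r)"
    unfolding a_minus_def minus_add[OF assms(1,3)] using assms by (simp add: a_ac del: r_neg)
  then show ?thesis using assms by (simp add: r_neg a_minus_def)
qed

context truncated_polynomials
begin

section \<open>Constants and the variable in the truncated ring\<close>

definition const :: "'a \<Rightarrow> (nat \<Rightarrow> 'a) set" where "const c = proj (mn c 0)"

definition t :: "(nat \<Rightarrow> 'a) set" where "t = proj (mn \<one> 1)"

lemma const_P: "c \<in> carrier F \<Longrightarrow> const c \<in> P d"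
  unfolding const_def P_def using mn_low by blast

lemma t_P: "t \<in> P 1"
  unfolding t_def P_def using mn_low by blast

lemma const_carrier: "c \<in> carrier F \<Longrightarrow> const c \<in> carrier Rs"
  using const_P P_carrier by blast

lemma t_carrier: "t \<in> carrier Rs"
  using t_P P_carrier by blast

lemma const_add: "a \<in> carrier F \<Longrightarrow> b \<in> carrier F \<Longrightarrow> const (a \<oplus> b) = const a \<oplus>\<^bsub>Rs\<^esub> const b"
  unfolding const_def by (subst proj.hom_add[symmetric]) (simp_all add: UP.monom_add)

lemma const_mult: "a \<in> carrier F \<Longrightarrow> b \<in> carrier F \<Longrightarrow> const (a \<otimes> b) = const a \<otimes>\<^bsub>Rs\<^esub> const b"
  unfolding const_def using UP.monom_mult[of a b 0 0] by (subst proj.hom_mult[symmetric]) simp_all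

lemma const_one: "const \<one> = \<one>\<^bsub>Rs\<^esub>"
  unfolding const_def by (simp add: UP.monom_one)

lemma const_zero: "const \<zero> = \<zero>\<^bsub>Rs\<^esub>"
  unfolding const_def by (simp add: UP.monom_zero)

lemma const_minus: "a \<in> carrier F \<Longrightarrow> const (\<ominus> a) = \<ominus>\<^bsub>Rs\<^esub> const a"
  unfolding const_def by (subst proj.hom_a_inv[symmetric]) (simp_all add: UP.monom_a_inv)

lemma P1_cases:
  assumes "x \<in> P 1"
  obtains a b where "a \<in> carrier F" "b \<in> carrier F" "x = const a \<oplus>\<^bsub>Rs\<^esub> const b \<otimes>\<^bsub>Rs\<^esub> t"
proof -
  obtain a b where ab: "a \<in> carrier F" "b \<in> carrier F" "x = proj (mn a 0 \<oplus>\<^bsub>UP F\<^esub> mn b 1)"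
    using assms unfolding T_set_eq[symmetric] T_set_def by blast
  have "mn b 1 = mn b 0 \<otimes>\<^bsub>UP F\<^esub> mn \<one> 1" using UP.monom_mult[of b \<one> 0 1] ab by simp
  then have "x = const a \<oplus>\<^bsub>Rs\<^esub> const b \<otimes>\<^bsub>Rs\<^esub> t"
    unfolding ab(3) const_def t_def using ab(1,2) by (simp del: UP.monom_mult)
  then show thesis using that ab(1,2) by blast
qed

lemma P2_cases:
  assumes "v \<in> P 2"
  obtains w z where "w \<in> P 1" "z \<in> P 1" "v = w \<oplus>\<^bsub>Rs\<^esub> z \<otimes>\<^bsub>Rs\<^esub> t"
proof -
  define A where "A = {w \<oplus>\<^bsub>Rs\<^esub> z \<otimes>\<^bsub>Rs\<^esub> t | w z. w \<in> P 1 \<and> z \<in> P 1}"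
  have PR: "x \<in> carrier Rs" if "x \<in> P d" for x d using that P_carrier by blast
  have "P (Suc 1) \<subseteq> A"
  proof (rule P_span)
    fix x y assume "x \<in> A" "y \<in> A"
    then obtain w z w' z' where e: "w \<in> P 1" "z \<in> P 1" "x = w \<oplus>\<^bsub>Rs\<^esub> z \<otimes>\<^bsub>Rs\<^esub> t"
      "w' \<in> P 1" "z' \<in> P 1" "y = w' \<oplus>\<^bsub>Rs\<^esub> z' \<otimes>\<^bsub>Rs\<^esub> t" unfolding A_def by blast
    then have "x \<oplus>\<^bsub>Rs\<^esub> y = (w \<oplus>\<^bsub>Rs\<^esub> w') \<oplus>\<^bsub>Rs\<^esub> (z \<oplus>\<^bsub>Rs\<^esub> z') \<otimes>\<^bsub>Rs\<^esub> t"
      using PR t_carrier by (simp add: Rs.l_distr Rs.a_ac)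
    then show "x \<oplus>\<^bsub>Rs\<^esub> y \<in> A" unfolding A_def using P_add e by blast
  next
    fix x y assume xy: "x \<in> P 1" "y \<in> P 1"
    obtain a b where ab: "a \<in> carrier F" "b \<in> carrier F" "y = const a \<oplus>\<^bsub>Rs\<^esub> const b \<otimes>\<^bsub>Rs\<^esub> t"
      using P1_cases[OF xy(2)] by blast
    have "x \<otimes>\<^bsub>Rs\<^esub> y = x \<otimes>\<^bsub>Rs\<^esub> const a \<oplus>\<^bsub>Rs\<^esub> (x \<otimes>\<^bsub>Rs\<^esub> const b) \<otimes>\<^bsub>Rs\<^esub> t"
      unfolding ab(3) using PR[OF xy(1)] const_carrier ab t_carrier by (simp add: Rs.r_distr Rs.m_assoc)
    moreover have "x \<otimes>\<^bsub>Rs\<^esub> const a \<in> P 1" "x \<otimes>\<^bsub>Rs\<^esub> const b \<in> P 1"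
      using P_mult[OF xy(1) const_P[of _ 0]] ab by auto
    ultimately show "x \<otimes>\<^bsub>Rs\<^esub> y \<in> A" unfolding A_def by blast
  qed
  then have "v \<in> A" using assms by (auto simp: numeral_2_eq_2)
  then show thesis using that unfolding A_def by blast
qed

section \<open>Lines and the determinant of their directions\<close>

lemma proportional_or_independent:
  assumes ab: "a \<in> carrier F" "b \<in> carrier F" and ab': "a' \<in> carrier F" "b' \<in> carrier F"
    and nz: "\<not> (a = \<zero> \<and> b = \<zero>)" "\<not> (a' = \<zero> \<and> b' = \<zero>)" and D: "a \<otimes> b' = a' \<otimes> b"
  shows "\<exists>c\<in>carrier F - {\<zero>}. a' = c \<otimes> a \<and> b' = c \<otimes> b"
proof (cases "a = \<zero>")
  case False
  define c where "c = a' \<otimes> inv a"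
  have ia: "inv a \<in> carrier F" "inv a \<otimes> a = \<one>" "a \<otimes> inv a = \<one>" using False ab field_Units by auto
  have c: "c \<in> carrier F" unfolding c_def using ia ab' by simp
  have 1: "a' = c \<otimes> a" unfolding c_def using ia ab' ab by (simp add: m_assoc)
  have "c \<otimes> b = inv a \<otimes> (a' \<otimes> b)" unfolding c_def using ia ab ab' by (simp add: m_ac)
  also have "\<dots> = inv a \<otimes> (a \<otimes> b')" using D by simp
  also have "\<dots> = b'" using ia ab ab' by (simp add: m_assoc[symmetric])
  finally have 2: "b' = c \<otimes> b" ..
  have "c \<noteq> \<zero>" using 1 2 nz(2) ab by auto
  then show ?thesis using c 1 2 by blast
next
  case True
  then have b: "b \<noteq> \<zero>" using nz by blast
  define c where "c = b' \<otimes> inv b"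
  have ib: "inv b \<in> carrier F" "inv b \<otimes> b = \<one>" using b ab field_Units by auto
  have c: "c \<in> carrier F" unfolding c_def using ib ab' by simp
  have "a' \<otimes> b = \<zero>" using D True ab' by simp
  then have "a' = \<zero>" using b ab ab' integral by blast
  then have 1: "a' = c \<otimes> a" using True c by simp
  have 2: "b' = c \<otimes> b" unfolding c_def using ib ab' ab by (simp add: m_assoc)
  have "c \<noteq> \<zero>" using 1 2 nz(2) ab by auto
  then show ?thesis using c 1 2 by blast
qed

text \<open>Cramer's rule: with determinant D, the combinations B' d - B e and A e - A' d equal D
  and D t. So 1 and t are combinations of d and e with constant coefficients, and v = w + z t with w
  and z in P 1 is one with coefficients in P 1.\<close>

lemma independent_span:
  assumes ab: "a \<in> carrier F" "b \<in> carrier F" and ab': "a' \<in> carrier F" "b' \<in> carrier F"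
    and D: "a \<otimes> b' \<noteq> a' \<otimes> b" and v: "v \<in> P 2"
    and d: "d = const a \<oplus>\<^bsub>Rs\<^esub> const b \<otimes>\<^bsub>Rs\<^esub> t" and e: "e = const a' \<oplus>\<^bsub>Rs\<^esub> const b' \<otimes>\<^bsub>Rs\<^esub> t"
  shows "\<exists>x\<in>P 1. \<exists>y\<in>P 1. v = x \<otimes>\<^bsub>Rs\<^esub> d \<oplus>\<^bsub>Rs\<^esub> y \<otimes>\<^bsub>Rs\<^esub> e"
proof -
  define D where "D = a \<otimes> b' \<ominus> a' \<otimes> b"
  have Dc: "D \<in> carrier F" unfolding D_def using ab ab' by simp
  have D0: "D \<noteq> \<zero>" unfolding D_def using D ab ab' minus_eq_zero_iff[of "a \<otimes> b'" "a' \<otimes> b"] by simp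
  define k where "k = const (inv D)"
  have iD: "inv D \<in> carrier F" "inv D \<otimes> D = \<one>" using D0 Dc field_Units by auto
  define A B A' B' where "A = const a" and "B = const b" and "A' = const a'" and "B' = const b'"
  note defs = A_def B_def A'_def B'_def
  have c: "A \<in> carrier Rs" "B \<in> carrier Rs" "A' \<in> carrier Rs" "B' \<in> carrier Rs" "t \<in> carrier Rs" "k \<in> carrier Rs"
    unfolding defs k_def using ab ab' iD const_carrier t_carrier by auto
  have P0: "A \<in> P 0" "B \<in> P 0" "A' \<in> P 0" "B' \<in> P 0" "k \<in> P 0"
    unfolding defs k_def using ab ab' iD const_P by auto
  have dc: "d \<in> carrier Rs" "e \<in> carrier Rs" unfolding d e using c by (simp_all add: defs)
  have d': "d = A \<oplus>\<^bsub>Rs\<^esub> B \<otimes>\<^bsub>Rs\<^esub> t" and e': "e = A' \<oplus>\<^bsub>Rs\<^esub> B' \<otimes>\<^bsub>Rs\<^esub> t" using d e by (simp_all add: defs)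
  have cD: "const D = A \<otimes>\<^bsub>Rs\<^esub> B' \<ominus>\<^bsub>Rs\<^esub> A' \<otimes>\<^bsub>Rs\<^esub> B"
    unfolding D_def a_minus_def defs using ab ab' by (simp add: const_add const_minus const_mult)
  have kD: "k \<otimes>\<^bsub>Rs\<^esub> const D = \<one>\<^bsub>Rs\<^esub>" unfolding k_def using const_mult[OF iD(1) Dc] iD const_one by simp
  have one: "k \<otimes>\<^bsub>Rs\<^esub> (B' \<otimes>\<^bsub>Rs\<^esub> d \<ominus>\<^bsub>Rs\<^esub> B \<otimes>\<^bsub>Rs\<^esub> e) = \<one>\<^bsub>Rs\<^esub>"
  proof -
    have "B' \<otimes>\<^bsub>Rs\<^esub> d \<ominus>\<^bsub>Rs\<^esub> B \<otimes>\<^bsub>Rs\<^esub> e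
      = (B \<otimes>\<^bsub>Rs\<^esub> B' \<otimes>\<^bsub>Rs\<^esub> t \<oplus>\<^bsub>Rs\<^esub> A \<otimes>\<^bsub>Rs\<^esub> B') \<ominus>\<^bsub>Rs\<^esub> (B \<otimes>\<^bsub>Rs\<^esub> B' \<otimes>\<^bsub>Rs\<^esub> t \<oplus>\<^bsub>Rs\<^esub> A' \<otimes>\<^bsub>Rs\<^esub> B)"
      unfolding d' e' using c by (simp add: Rs.r_distr Rs.m_ac Rs.a_ac)
    also have "\<dots> = const D" unfolding cD using c by (intro Rs.add_diff_cancel_left_carrier) auto
    finally show ?thesis using kD by simp
  qed
  have tt: "k \<otimes>\<^bsub>Rs\<^esub> (A \<otimes>\<^bsub>Rs\<^esub> e \<ominus>\<^bsub>Rs\<^esub> A' \<otimes>\<^bsub>Rs\<^esub> d) = t"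
  proof -
    have "A \<otimes>\<^bsub>Rs\<^esub> e \<ominus>\<^bsub>Rs\<^esub> A' \<otimes>\<^bsub>Rs\<^esub> d
      = (A \<otimes>\<^bsub>Rs\<^esub> A' \<oplus>\<^bsub>Rs\<^esub> A \<otimes>\<^bsub>Rs\<^esub> B' \<otimes>\<^bsub>Rs\<^esub> t) \<ominus>\<^bsub>Rs\<^esub> (A \<otimes>\<^bsub>Rs\<^esub> A' \<oplus>\<^bsub>Rs\<^esub> A' \<otimes>\<^bsub>Rs\<^esub> B \<otimes>\<^bsub>Rs\<^esub> t)"
      unfolding d' e' using c by (simp add: Rs.r_distr Rs.m_ac Rs.a_ac)
    also have "\<dots> = A \<otimes>\<^bsub>Rs\<^esub> B' \<otimes>\<^bsub>Rs\<^esub> t \<ominus>\<^bsub>Rs\<^esub> A' \<otimes>\<^bsub>Rs\<^esub> B \<otimes>\<^bsub>Rs\<^esub> t"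
      using c by (intro Rs.add_diff_cancel_left_carrier) auto
    also have "\<dots> = const D \<otimes>\<^bsub>Rs\<^esub> t" unfolding cD a_minus_def using c by (simp add: Rs.l_distr Rs.l_minus)
    finally show ?thesis using kD c const_carrier[OF Dc] by (simp add: Rs.m_assoc[symmetric])
  qed
  obtain w z where wz: "w \<in> P 1" "z \<in> P 1" "v = w \<oplus>\<^bsub>Rs\<^esub> z \<otimes>\<^bsub>Rs\<^esub> t" using P2_cases[OF v] by blast
  have wc: "w \<in> carrier Rs" "z \<in> carrier Rs" using wz P_carrier by auto
  define x where "x = w \<otimes>\<^bsub>Rs\<^esub> (k \<otimes>\<^bsub>Rs\<^esub> B') \<oplus>\<^bsub>Rs\<^esub> \<ominus>\<^bsub>Rs\<^esub> (z \<otimes>\<^bsub>Rs\<^esub> (k \<otimes>\<^bsub>Rs\<^esub> A'))"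
  define y where "y = z \<otimes>\<^bsub>Rs\<^esub> (k \<otimes>\<^bsub>Rs\<^esub> A) \<oplus>\<^bsub>Rs\<^esub> \<ominus>\<^bsub>Rs\<^esub> (w \<otimes>\<^bsub>Rs\<^esub> (k \<otimes>\<^bsub>Rs\<^esub> B))"
  have mult0: "p \<otimes>\<^bsub>Rs\<^esub> r \<in> P d" if "p \<in> P d" "r \<in> P 0" for p r d using P_mult[OF that] by simp
  have "x \<in> P 1" "y \<in> P 1" unfolding x_def y_def using wz P0 by (auto intro!: P_add P_minus mult0)
  moreover have "v = x \<otimes>\<^bsub>Rs\<^esub> d \<oplus>\<^bsub>Rs\<^esub> y \<otimes>\<^bsub>Rs\<^esub> e"
  proof -
    have "v = w \<otimes>\<^bsub>Rs\<^esub> (k \<otimes>\<^bsub>Rs\<^esub> (B' \<otimes>\<^bsub>Rs\<^esub> d \<ominus>\<^bsub>Rs\<^esub> B \<otimes>\<^bsub>Rs\<^esub> e)) \<oplus>\<^bsub>Rs\<^esub> z \<otimes>\<^bsub>Rs\<^esub> (k \<otimes>\<^bsub>Rs\<^esub> (A \<otimes>\<^bsub>Rs\<^esub> e \<ominus>\<^bsub>Rs\<^esub> A' \<otimes>\<^bsub>Rs\<^esub> d))"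
      unfolding one tt using wz wc by simp
    also have "\<dots> = x \<otimes>\<^bsub>Rs\<^esub> d \<oplus>\<^bsub>Rs\<^esub> y \<otimes>\<^bsub>Rs\<^esub> e"
      unfolding x_def y_def a_minus_def using wc c dc
      by (simp add: Rs.r_distr Rs.l_distr Rs.l_minus Rs.r_minus Rs.m_ac Rs.a_ac)
    finally show ?thesis .
  qed
  ultimately show ?thesis by blast
qed

lemma filtered_matrix_ring_Rs:
  assumes "n \<ge> 2"
  shows "filtered_matrix_ring Rs n P"
proof (intro filtered_matrix_ring.intro matrix_ring.intro cring_Rs filtered_matrix_ring_axioms.intro)
  show "finite (carrier Rs)" unfolding carrier_Rs by (rule finite_P)
  \<comment> \<open>The whole ring is P (s - 1), but for s = 1 this has degree 0, while exhaustion
    asks for a degree at least 1; hence the passage to P s.\<close>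
  show "carrier Rs \<subseteq> (\<Union>d\<in>{1..}. P d)"
  proof -
    have "P (s - 1) \<subseteq> P s" unfolding P_def using low_mono[of "s - 1" s] by auto
    then show ?thesis using s_pos unfolding carrier_Rs by auto
  qed
  show "P (Suc d) \<subseteq> A" if "\<And>x y. x \<in> A \<Longrightarrow> y \<in> A \<Longrightarrow> x \<oplus>\<^bsub>Rs\<^esub> y \<in> A"
    "\<And>x y. x \<in> P d \<Longrightarrow> y \<in> P 1 \<Longrightarrow> x \<otimes>\<^bsub>Rs\<^esub> y \<in> A" for d A
    by (rule P_span) (fact that)+
qed (use assms one_neq_zero_Rs P_carrier P_zero P_add P_minus P_mult P_one in auto)

lemma additive_subgroup_P: "additive_subgroup (P d) Rs"
proof (rule additive_subgroup.intro, rule Rs.add.subgroupI)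
  show "P d \<noteq> {}" using P_zero by blast
qed (use P_carrier P_minus P_add in \<open>auto simp: a_inv_def[symmetric]\<close>)

text \<open>C consists of the nonzero constants. Nonzero directions that are not proportional by one
  of them have nonzero determinant, so \<open>independent_span\<close> gives the spanning
  property.\<close>

lemma expanding_product_Rs:
  assumes "s > 2"
  shows "expanding_product Rs (P 1) (P 2) (const ` (carrier F - {\<zero>})) (card (carrier F))"
proof (intro expanding_product.intro cring_Rs expanding_product_axioms.intro)
  let ?C = "const ` (carrier F - {\<zero>})"
  have q: "card (carrier F) > 0" using finite_F by (auto simp: card_gt_0_iff)
  show "card (P 1) = (card (carrier F))\<^sup>2" using card_P[of 1] assms by (simp add: power2_eq_square)
  show "card (carrier F) > 0" by (rule q)
  show "card ?C < card (carrier F)"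
  proof -
    have "card ?C \<le> card (carrier F - {\<zero>})" using finite_F by (intro card_image_le) auto
    also have "\<dots> < card (carrier F)" using finite_F by (intro card_Diff1_less) auto
    finally show ?thesis .
  qed
  show "x \<otimes>\<^bsub>Rs\<^esub> y \<in> P 2" if "x \<in> P 1" "y \<in> P 1" for x y
    using P_mult[OF that] by (simp add: numeral_2_eq_2)
  show "bij_betw (\<lambda>x. u \<otimes>\<^bsub>Rs\<^esub> x) (P 1) (P 1)" if u_mem: "u \<in> ?C" for u
  proof -
    obtain c where c': "u = const c" "c \<in> carrier F - {\<zero>}" using u_mem by (elim imageE)
    then have c: "c \<in> carrier F" "c \<noteq> \<zero>" "u = const c" by simp_all
    have ic: "inv c \<in> carrier F" "inv c \<otimes> c = \<one>" "c \<otimes> inv c = \<one>" using c field_Units by auto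
    have u: "const (inv c) \<otimes>\<^bsub>Rs\<^esub> const c = \<one>\<^bsub>Rs\<^esub>" "const c \<otimes>\<^bsub>Rs\<^esub> const (inv c) = \<one>\<^bsub>Rs\<^esub>"
      using const_mult[OF ic(1) c(1)] const_mult[OF c(1) ic(1)] ic const_one by auto
    have cc: "const c \<in> carrier Rs" "const (inv c) \<in> carrier Rs" using c ic const_carrier by auto
    have PR: "x \<in> carrier Rs" if "x \<in> P 1" for x using that P_carrier by blast
    have m: "const r \<otimes>\<^bsub>Rs\<^esub> x \<in> P 1" if "r \<in> carrier F" "x \<in> P 1" for r x
      using P_mult[OF const_P[OF that(1), of 0] that(2)] by simp
    show ?thesis unfolding c(3)
      by (rule bij_betw_byWitness[where f' = "\<lambda>x. const (inv c) \<otimes>\<^bsub>Rs\<^esub> x"])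
        (use u cc PR m c ic in \<open>auto simp: Rs.m_assoc[symmetric]\<close>)
  qed
  show "\<exists>x\<in>P 1. \<exists>y\<in>P 1. v = x \<otimes>\<^bsub>Rs\<^esub> d \<oplus>\<^bsub>Rs\<^esub> y \<otimes>\<^bsub>Rs\<^esub> e"
    if de: "d \<in> P 1 - {\<zero>\<^bsub>Rs\<^esub>}" "e \<in> P 1 - {\<zero>\<^bsub>Rs\<^esub>}" and ne: "\<forall>u\<in>?C. e \<noteq> u \<otimes>\<^bsub>Rs\<^esub> d" and v: "v \<in> P 2" for d e v
  proof -
    obtain a b where ab: "a \<in> carrier F" "b \<in> carrier F" "d = const a \<oplus>\<^bsub>Rs\<^esub> const b \<otimes>\<^bsub>Rs\<^esub> t"
      using P1_cases de(1) by blast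
    obtain a' b' where ab': "a' \<in> carrier F" "b' \<in> carrier F" "e = const a' \<oplus>\<^bsub>Rs\<^esub> const b' \<otimes>\<^bsub>Rs\<^esub> t"
      using P1_cases de(2) by blast
    have nz: "\<not> (a = \<zero> \<and> b = \<zero>)" "\<not> (a' = \<zero> \<and> b' = \<zero>)"
      using de ab ab' t_carrier by (auto simp: const_zero)
    have "a \<otimes> b' \<noteq> a' \<otimes> b"
    proof
      assume "a \<otimes> b' = a' \<otimes> b"
      then obtain c where c: "c \<in> carrier F - {\<zero>}" "a' = c \<otimes> a" "b' = c \<otimes> b"
        using proportional_or_independent[OF ab(1,2) ab'(1,2) nz] by blast
      have "e = const c \<otimes>\<^bsub>Rs\<^esub> d"
        unfolding ab(3) ab'(3) c(2,3) using c(1) ab const_carrier t_carrier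
        by (simp add: const_mult Rs.r_distr Rs.m_assoc)
      then show False using ne c(1) by blast
    qed
    then show ?thesis using independent_span[OF ab(1,2) ab'(1,2) _ v ab(3) ab'(3)] by blast
  qed
qed (use additive_subgroup_P finite_P finite_F const_carrier in auto)

end

section \<open>Expansion of the one-dimensional links\<close>

locale expanding_matrix_ring = filtered_matrix_ring R n P + expanding_product R "P 1" "P 2" C q
  for R (structure) and n P C q
begin

section \<open>Entries of matrices in an intersection group with two missing types\<close>

lemma meet_mem_iff:
  assumes "\<sigma> \<subseteq> {..n}"
  shows "A \<in> meet_subgroup G K \<sigma> \<longleftrightarrow> A \<in> carrier G \<and> (\<forall>i\<in>\<sigma>. A \<in> UT i)"
  unfolding meet_eq[OF assms] by simp

lemma UT_entry:
  "A \<in> UT x \<Longrightarrow> k \<le> n \<Longrightarrow> l \<le> n \<Longrightarrow> pos x k < pos x l \<Longrightarrow> A k l \<in> P (pos x l - pos x k)"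
  by (simp add: unitriangular_def)

text \<open>An index of \<sigma> is last in its own order, so its row is trivial; the index after it
  is first there, so that column is trivial. This leaves the rows i and j and the columns after
  them, and a mixed position survives only if the two types are adjacent.\<close>

lemma meet_entry_zero:
  assumes \<sigma>: "\<sigma> \<subseteq> {..n}" "{..n} - \<sigma> = {i, j}" "i \<noteq> j"
    and A: "A \<in> meet_subgroup G K \<sigma>" and kl: "k \<le> n" "l \<le> n" "k \<noteq> l" "A k l \<noteq> \<zero>"
  shows "k = i \<and> l = cyc i \<or> k = j \<and> l = cyc j \<or> k = i \<and> l = cyc j \<and> j = cyc i \<or> k = j \<and> l = cyc i \<and> i = cyc j"
proof -
  have ij: "i \<le> n" "j \<le> n" using \<sigma> by auto
  have lt: "pos x k < pos x l" if "x \<in> \<sigma>" for x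
  proof -
    have "A \<in> UT x" using A that meet_mem_iff[OF \<sigma>(1)] by blast
    then have "\<not> pos x l < pos x k" using kl by (auto simp: unitriangular_def)
    then show ?thesis using pos_neq[of x k l] kl that \<sigma>(1) by auto
  qed
  have k: "k \<in> {i, j}"
  proof (rule ccontr)
    assume "k \<notin> {i, j}"
    then have "k \<in> \<sigma>" using \<sigma>(2) kl(1) by auto
    then show False using lt[of k] cyclic_pos_self[of n k] cyclic_pos_le[OF kl(2), of k] by simp
  qed
  obtain l' where l': "l' \<le> n" "cyc l' = l" using cyclic_predecessor[OF kl(2)] by blast
  have "l' \<in> {i, j}"
  proof (rule ccontr)
    assume "l' \<notin> {i, j}"
    then have "l' \<in> \<sigma>" using \<sigma>(2) l'(1) by auto
    moreover have "pos l' l = 0" using l' by (auto simp: cyclic_pos_def) (cases "l' = n"; simp)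
    ultimately show False using lt[of l'] by simp
  qed
  moreover have cross: "y = cyc x" if xy: "x \<in> {i, j}" "y \<in> {i, j}" "x \<noteq> y" "k = x" "l = cyc y" for x y
  proof (rule ccontr)
    assume ne: "y \<noteq> cyc x"
    have x: "x \<le> n" using xy ij by auto
    \<comment> \<open>If y is not the successor c of x, then c lies in \<sigma>. In the order of c
      the index x is last but one, so the only column after x is c itself, which is not the
      successor of y.\<close>
    define c where "c = cyc x"
    have c: "c \<le> n" "c \<noteq> x" unfolding c_def using cyc[OF x] by simp_all
    have "{i, j} = {x, y}" using xy(1-3) by blast
    then have "c \<in> \<sigma>" using ne c \<sigma>(2) unfolding c_def[symmetric] by blast
    moreover have "pos c x + 1 = n"
      using cyclic_pos_Suc[OF c(1) x c(2)[symmetric]] cyclic_pos_self[of n c] unfolding c_def[symmetric] by simp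
    ultimately have "pos c l = n" using lt[of c] cyclic_pos_le[OF kl(2), of c] xy(4) by simp
    then have "l = c" using pos_neq[OF c(1) kl(2) c(1)] cyclic_pos_self[of n c] by metis
    moreover have "y \<le> n" using xy(2) ij by blast
    ultimately show False using cyc_inj[OF x, of y] xy(3,5) unfolding c_def by metis
  qed
  ultimately consider "k = i" "l' = i" | "k = j" "l' = j" | "k = i" "l' = j" | "k = j" "l' = i"
    using k by blast
  then show ?thesis
  proof cases
    case 3
    then have "j = cyc i" using cross[of i j] l' \<sigma>(3) by simp
    then show ?thesis using 3 l' by simp
  next
    case 4
    then have "i = cyc j" using cross[of j i] l' \<sigma>(3) by simp
    then show ?thesis using 4 l' by simp
  qed (use l' in simp_all)
qed

lemma meet_entry_step:
  assumes \<sigma>: "\<sigma> \<subseteq> {..n}" "\<sigma> \<noteq> {}" and A: "A \<in> meet_subgroup G K \<sigma>" and i: "i \<in> {..n} - \<sigma>"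
  shows "A i (cyc i) \<in> P 1"
proof -
  obtain x where x: "x \<in> \<sigma>" using \<sigma>(2) by blast
  then have "A \<in> UT x" using A meet_mem_iff[OF \<sigma>(1)] by blast
  moreover have "pos x (cyc i) = pos x i + 1" using cyclic_pos_Suc[of x n i] x \<sigma>(1) i by auto
  ultimately show ?thesis using UT_entry[of A x i "cyc i"] cyc[of i] i by simp
qed

lemma meet_entry_two_steps:
  assumes \<sigma>: "\<sigma> \<subseteq> {..n}" "\<sigma> \<noteq> {}" and A: "A \<in> meet_subgroup G K \<sigma>"
    and i: "i \<in> {..n} - \<sigma>" "cyc i \<in> {..n} - \<sigma>"
  shows "A i (cyc (cyc i)) \<in> P 2"
proof -
  obtain x where x: "x \<in> \<sigma>" using \<sigma>(2) by blast
  then have "A \<in> UT x" using A meet_mem_iff[OF \<sigma>(1)] by blast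
  moreover have ne: "x \<le> n" "i \<noteq> x" "cyc i \<noteq> x" "i \<le> n" "cyc i \<le> n" using x \<sigma>(1) i by auto
  have "pos x (cyc (cyc i)) = pos x i + 2"
    unfolding cyclic_pos_Suc[OF ne(1,5,3)] cyclic_pos_Suc[OF ne(1,4,2)] by simp
  ultimately show ?thesis using UT_entry[of A x i "cyc (cyc i)"] cyc(1)[OF ne(5)] ne by simp
qed

lemma el_meet:
  assumes \<sigma>: "\<sigma> \<subseteq> {..n}" "i \<in> {..n} - \<sigma>" "m \<in> P 1"
  shows "el i (cyc i) m \<in> meet_subgroup G K \<sigma>"
proof -
  have "meet_subgroup G K ({..n} - {i}) \<subseteq> meet_subgroup G K \<sigma>"
    using \<sigma> unfolding meet_subgroup_def by blast
  then show ?thesis using generator_meet[of i m] \<sigma> by auto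
qed

lemma el_meet_two:
  assumes \<sigma>: "\<sigma> \<subseteq> {..n}" "i \<in> {..n} - \<sigma>" "cyc i \<in> {..n} - \<sigma>" "m \<in> P 2"
  shows "el i (cyc (cyc i)) m \<in> meet_subgroup G K \<sigma>"
proof -
  have i: "i \<le> n" "cyc i \<le> n" "cyc (cyc i) \<le> n" "cyc (cyc i) \<noteq> i" using \<sigma> cyc cyc_cyc by auto
  have "el i (cyc (cyc i)) m \<in> UT x" if x: "x \<in> \<sigma>" for x
  proof (rule el_mat)
    have ne: "x \<le> n" "i \<noteq> x" "cyc i \<noteq> x" using x \<sigma> by auto
    have "pos x (cyc (cyc i)) = pos x i + 2"
      unfolding cyclic_pos_Suc[OF ne(1) i(2) ne(3)] cyclic_pos_Suc[OF ne(1) i(1) ne(2)] by simp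
    then show "pos x i < pos x (cyc (cyc i))" "m \<in> P (pos x (cyc (cyc i)) - pos x i)" using \<sigma>(4) by auto
  qed (use x \<sigma> i in auto)
  moreover have "el i (cyc (cyc i)) m \<in> carrier G" using el_G i PR[OF \<sigma>(4)] by auto
  ultimately show ?thesis using meet_mem_iff[OF \<sigma>(1)] by blast
qed

text \<open>The two root groups commute, so a depends only on the first coordinate and b only on the
  second. The sum of products then factors as S S', and mean zero forces S' = - S.\<close>

lemma expansion_commuting:
  fixes a b :: "(nat \<Rightarrow> nat \<Rightarrow> 'a) \<Rightarrow> real"
  assumes \<sigma>: "\<sigma> \<subseteq> {..n}" "\<sigma> \<noteq> {}" "{..n} - \<sigma> = {i, j}" "i \<noteq> j" and ne: "j \<noteq> cyc i" "i \<noteq> cyc j"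
    and a: "\<And>x y. x \<in> meet_subgroup G K \<sigma> \<Longrightarrow> y \<in> meet_subgroup G K ({..n} - {j}) \<Longrightarrow> a (x \<otimes>\<^bsub>G\<^esub> y) = a x"
    and b: "\<And>x y. x \<in> meet_subgroup G K \<sigma> \<Longrightarrow> y \<in> meet_subgroup G K ({..n} - {i}) \<Longrightarrow> b (x \<otimes>\<^bsub>G\<^esub> y) = b x"
    and s: "(\<Sum>x\<in>meet_subgroup G K \<sigma>. a x + b x) = 0"
  shows "(\<Sum>x\<in>meet_subgroup G K \<sigma>. a x * b x) \<le> 0"
proof -
  have ij: "i \<le> n" "j \<le> n" "cyc i \<le> n" "cyc j \<le> n" "cyc i \<noteq> i" "cyc j \<noteq> j" "cyc i \<noteq> cyc j"
    using \<sigma> cyc[of i] cyc[of j] cyc_inj[of i j] by auto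
  have mem: "i \<in> {..n} - \<sigma>" "j \<in> {..n} - \<sigma>" using \<sigma>(3) by auto
  let ?H = "meet_subgroup G K \<sigma>"
  define h where "h = (\<lambda>(x, y). el i (cyc i) x \<otimes>\<^bsub>M\<^esub> el j (cyc j) y)"
  have entry: "h (x, y) k l = (if k = l then \<one> else if k = i \<and> l = cyc i then x else if k = j \<and> l = cyc j then y else \<zero>)"
    if "x \<in> P 1" "y \<in> P 1" "k \<le> n" "l \<le> n" for x y k l
    unfolding h_def using that ij ne \<sigma>(4) PR[OF that(1)] PR[OF that(2)]
    by (auto simp: el_mult_entry el_carrier el_entry)
  have hH: "h (x, y) \<in> ?H" if "x \<in> P 1" "y \<in> P 1" for x y
    unfolding h_def prod.case G_mult[symmetric]
    using that el_meet[OF \<sigma>(1)] mem coset_geometry.subgroup_KK[OF coset_geometry_EL \<sigma>(1)]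
    by (intro subgroup.m_closed) auto
  have comm: "h (x, y) = el j (cyc j) y \<otimes>\<^bsub>M\<^esub> el i (cyc i) x" if "x \<in> P 1" "y \<in> P 1" for x y
  proof (rule M_eqI)
    fix k l assume kl: "k \<le> n" "l \<le> n"
    show "h (x, y) k l = (el j (cyc j) y \<otimes>\<^bsub>M\<^esub> el i (cyc i) x) k l"
      unfolding entry[OF that kl] using kl ij ne \<sigma>(4) PR[OF that(1)] PR[OF that(2)]
      by (auto simp: el_mult_entry el_carrier el_entry)
  qed (use that PR in \<open>auto simp: h_def el_carrier M_mult_closed\<close>)
  have bij: "bij_betw h (P 1 \<times> P 1) ?H"
    unfolding bij_betw_def
  proof
    show "inj_on h (P 1 \<times> P 1)"
    proof (rule inj_onI)
      fix p p' assume p: "p \<in> P 1 \<times> P 1" "p' \<in> P 1 \<times> P 1" "h p = h p'"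
      obtain x y x' y' where e: "p = (x, y)" "p' = (x', y')" by (cases p, cases p')
      have "h (x, y) i (cyc i) = h (x', y') i (cyc i)" "h (x, y) j (cyc j) = h (x', y') j (cyc j)"
        using p(3) e by auto
      then show "p = p'" using p(1,2) ij \<sigma>(4) unfolding e by (auto simp: entry)
    qed
    show "h ` (P 1 \<times> P 1) = ?H"
    proof (intro equalityI subsetI)
      fix A assume A: "A \<in> ?H"
      have AG: "A \<in> carrier G" using A meet_mem_iff[OF \<sigma>(1)] by blast
      have P1: "A i (cyc i) \<in> P 1" "A j (cyc j) \<in> P 1" using meet_entry_step[OF \<sigma>(1,2) A] mem by auto
      obtain x0 where "x0 \<in> \<sigma>" using \<sigma>(2) by blast
      then have diag: "A k k = \<one>" if "k \<le> n" for k
        using A meet_mem_iff[OF \<sigma>(1)] that unfolding unitriangular_def by blast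
      have "A = h (A i (cyc i), A j (cyc j))"
      proof (rule M_eqI[OF G_M[OF AG]])
        show "h (A i (cyc i), A j (cyc j)) \<in> carrier M"
          using hH[OF P1] meet_mem_iff[OF \<sigma>(1)] G_M by blast
        fix k l assume kl: "k \<le> n" "l \<le> n"
        show "A k l = h (A i (cyc i), A j (cyc j)) k l"
          unfolding entry[OF P1 kl] using diag[OF kl(1)] meet_entry_zero[OF \<sigma>(1,3,4) A kl] ne by auto
      qed
      then show "A \<in> h ` (P 1 \<times> P 1)"
        by (rule image_eqI) (use P1 in simp)
    qed (use hH in auto)
  qed
  have ah: "a (h (x, y)) = a (el i (cyc i) x)" if "x \<in> P 1" "y \<in> P 1" for x y
    using a[OF el_meet[OF \<sigma>(1) mem(1) that(1)] generator_meet[OF ij(2) that(2)]] unfolding h_def G_mult by simp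
  have bh: "b (h (x, y)) = b (el j (cyc j) y)" if "x \<in> P 1" "y \<in> P 1" for x y
    using b[OF el_meet[OF \<sigma>(1) mem(2) that(2)] generator_meet[OF ij(1) that(1)]] unfolding comm[OF that] G_mult by simp
  define S where "S = (\<Sum>x\<in>P 1. a (el i (cyc i) x))"
  define S' where "S' = (\<Sum>y\<in>P 1. b (el j (cyc j) y))"
  have sumH: "(\<Sum>A\<in>?H. f A) = (\<Sum>x\<in>P 1. \<Sum>y\<in>P 1. f (h (x, y)))" for f :: "_ \<Rightarrow> real"
    unfolding sum.reindex_bij_betw[OF bij, symmetric] sum.cartesian_product by (simp add: case_prod_unfold)
  have "(\<Sum>A\<in>?H. a A + b A) = (\<Sum>x\<in>P 1. \<Sum>y\<in>P 1. a (el i (cyc i) x) + b (el j (cyc j) y))"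
    unfolding sumH by (intro sum.cong refl) (simp add: ah bh del: One_nat_def)
  also have "\<dots> = real (card (P 1)) * (S + S')"
    by (simp add: sum.distrib S_def S'_def sum_distrib_left[symmetric] distrib_left del: One_nat_def)
  finally have "S + S' = 0" using s card_T q_pos by simp
  then have S': "S' = - S" by simp
  have "(\<Sum>A\<in>?H. a A * b A) = (\<Sum>x\<in>P 1. \<Sum>y\<in>P 1. a (el i (cyc i) x) * b (el j (cyc j) y))"
    unfolding sumH by (intro sum.cong refl) (simp add: ah bh del: One_nat_def)
  also have "\<dots> = S * S'" unfolding S_def S'_def sum_product ..
  also have "\<dots> \<le> 0" unfolding S' by simp
  finally show ?thesis .
qed

text \<open>For adjacent types the group \<open>K\<^sub>\<sigma>\<close> is a Heisenberg group; in the coordinates \<open>h x y z\<close> the two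
  families of cosets are parametrised by \<open>(y, z)\<close> and by \<open>(x, z - x y)\<close>.\<close>

lemma expansion_adjacent:
  fixes a b :: "(nat \<Rightarrow> nat \<Rightarrow> 'a) \<Rightarrow> real"
  assumes \<sigma>: "\<sigma> \<subseteq> {..n}" "\<sigma> \<noteq> {}" "{..n} - \<sigma> = {i, j}" and j: "j = cyc i"
    and a: "\<And>x y. x \<in> meet_subgroup G K \<sigma> \<Longrightarrow> y \<in> meet_subgroup G K ({..n} - {j}) \<Longrightarrow> a (x \<otimes>\<^bsub>G\<^esub> y) = a x"
    and b: "\<And>x y. x \<in> meet_subgroup G K \<sigma> \<Longrightarrow> y \<in> meet_subgroup G K ({..n} - {i}) \<Longrightarrow> b (x \<otimes>\<^bsub>G\<^esub> y) = b x"
    and s: "(\<Sum>x\<in>meet_subgroup G K \<sigma>. b x) = 0"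
  shows "(\<Sum>x\<in>meet_subgroup G K \<sigma>. a x * b x)
    \<le> 1 / sqrt (real q) * sqrt ((\<Sum>x\<in>meet_subgroup G K \<sigma>. (a x)\<^sup>2) * (\<Sum>x\<in>meet_subgroup G K \<sigma>. (b x)\<^sup>2))"
proof -
  define l where "l = cyc j"
  have ij: "i \<le> n" "j \<le> n" "l \<le> n" "j \<noteq> i" "l \<noteq> j" "l \<noteq> i" "i \<noteq> j"
    using \<sigma> cyc[of i] cyc[of j] cyc_cyc[of i] unfolding l_def j by auto
  have mem: "i \<in> {..n} - \<sigma>" "j \<in> {..n} - \<sigma>" using \<sigma>(3) by auto
  let ?H = "meet_subgroup G K \<sigma>"
  note sg = coset_geometry.subgroup_KK[OF coset_geometry_EL \<sigma>(1)]
  \<comment> \<open>Coordinates in which x, y and z are exactly the entries at (i, j), (j, l) and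
    (i, l).\<close>
  define h where "h x y z = el i l z \<otimes>\<^bsub>M\<^esub> (el j l y \<otimes>\<^bsub>M\<^esub> el i j x)" for x y z
  have T_R: "x \<in> carrier R" if "x \<in> P 1" for x using PR that .
  have V_R: "z \<in> carrier R" if "z \<in> P 2" for z using PR that .
  have entry: "h x y z k m = (if k = m then \<one> else if k = i \<and> m = j then x else if k = j \<and> m = l then y
      else if k = i \<and> m = l then z else \<zero>)"
    if "x \<in> P 1" "y \<in> P 1" "z \<in> P 2" "k \<le> n" "m \<le> n" for x y z k m
    unfolding h_def using that(4,5) ij T_R[OF that(1)] T_R[OF that(2)] V_R[OF that(3)]
    by (simp add: el_mult_entry el_carrier M_mult_closed) (auto simp: el_entry)
  have hM: "h x y z \<in> carrier M" if "x \<in> P 1" "y \<in> P 1" "z \<in> P 2" for x y z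
    unfolding h_def using that T_R V_R by (simp add: el_carrier M_mult_closed del: One_nat_def)
  have elH: "el i j x \<in> ?H" "el j l x \<in> ?H" if "x \<in> P 1" for x
    using el_meet[OF \<sigma>(1) mem(1) that] el_meet[OF \<sigma>(1) mem(2) that] unfolding l_def j by auto
  have elH2: "el i l z \<in> ?H" if "z \<in> P 2" for z
    using el_meet_two[OF \<sigma>(1) mem(1) _ that] mem(2) unfolding l_def j by auto
  have hH: "h x y z \<in> ?H" if "x \<in> P 1" "y \<in> P 1" "z \<in> P 2" for x y z
    unfolding h_def G_mult[symmetric] using elH elH2 that by (intro subgroup.m_closed[OF sg]) auto
  have bij: "bij_betw (\<lambda>(x, y, z). h x y z) (P 1 \<times> P 1 \<times> P 2) ?H"
    unfolding bij_betw_def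
  proof
    show "inj_on (\<lambda>(x, y, z). h x y z) (P 1 \<times> P 1 \<times> P 2)"
    proof (rule inj_onI)
      fix p p' assume pp: "p \<in> P 1 \<times> P 1 \<times> P 2" "p' \<in> P 1 \<times> P 1 \<times> P 2"
        "(case p of (x, y, z) \<Rightarrow> h x y z) = (case p' of (x, y, z) \<Rightarrow> h x y z)"
      obtain x y z x' y' z' where e: "p = (x, y, z)" "p' = (x', y', z')" by (cases p, cases p')
      have p: "x \<in> P 1" "y \<in> P 1" "z \<in> P 2" "x' \<in> P 1" "y' \<in> P 1" "z' \<in> P 2" "h x y z = h x' y' z'"
        using pp unfolding e by simp_all
      have "h x y z i j = h x' y' z' i j" "h x y z j l = h x' y' z' j l" "h x y z i l = h x' y' z' i l"
        using p(7) by auto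
      then show "p = p'"
        unfolding e entry[OF p(1-3) ij(1,2)] entry[OF p(4-6) ij(1,2)] entry[OF p(1-3) ij(2,3)]
          entry[OF p(4-6) ij(2,3)] entry[OF p(1-3) ij(1,3)] entry[OF p(4-6) ij(1,3)]
        using ij by auto
    qed
    show "(\<lambda>(x, y, z). h x y z) ` (P 1 \<times> P 1 \<times> P 2) = ?H"
    proof (intro equalityI subsetI)
      fix A assume A: "A \<in> ?H"
      have AG: "A \<in> carrier G" using A meet_mem_iff[OF \<sigma>(1)] by blast
      have P1: "A i j \<in> P 1" "A j l \<in> P 1" using meet_entry_step[OF \<sigma>(1,2) A] mem unfolding l_def j by auto
      have P2: "A i l \<in> P 2" using meet_entry_two_steps[OF \<sigma>(1,2) A mem(1)] mem(2) unfolding l_def j by auto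
      obtain x0 where "x0 \<in> \<sigma>" using \<sigma>(2) by blast
      then have diag: "A k k = \<one>" if "k \<le> n" for k
        using A meet_mem_iff[OF \<sigma>(1)] that unfolding unitriangular_def by blast
      have "A = h (A i j) (A j l) (A i l)"
      proof (rule M_eqI[OF G_M[OF AG] hM[OF P1 P2]])
        fix k m assume km: "k \<le> n" "m \<le> n"
        show "A k m = h (A i j) (A j l) (A i l) k m"
          unfolding entry[OF P1 P2 km]
          using diag[OF km(1)] meet_entry_zero[OF \<sigma>(1,3) ij(7) A km] j ij l_def by auto
      qed
      then show "A \<in> (\<lambda>(x, y, z). h x y z) ` (P 1 \<times> P 1 \<times> P 2)"
        using P1 P2 by (intro image_eqI[of _ _ "(A i j, A j l, A i l)"]) auto
    qed (use hH in auto)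
  qed
  have sumH: "(\<Sum>A\<in>?H. f A) = (\<Sum>x\<in>P 1. \<Sum>y\<in>P 1. \<Sum>z\<in>P 2. f (h x y z))" for f :: "_ \<Rightarrow> real"
    unfolding sum.reindex_bij_betw[OF bij, symmetric] sum.cartesian_product by (simp add: case_prod_unfold)
  define \<beta> where "\<beta> y z = b (h \<zero> y z)" for y z
  define \<alpha> where "\<alpha> x w = a (h x \<zero> w)" for x w
  have z1: "\<zero> \<in> P 1" "\<zero> \<in> P 2" using P_zero by auto
  have bh: "b (h x y z) = \<beta> y z" if xyz: "x \<in> P 1" "y \<in> P 1" "z \<in> P 2" for x y z
  proof -
    have "h \<zero> y z \<otimes>\<^bsub>M\<^esub> el i j x = h x y z"
      unfolding h_def using xyz T_R V_R ij
      by (simp add: el_zero M_assoc M_r_one el_carrier M_mult_closed del: One_nat_def)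
    moreover have "el i j x \<in> meet_subgroup G K ({..n} - {i})"
      using generator_meet[OF ij(1) xyz(1)] unfolding j .
    ultimately show ?thesis using b[OF hH[OF z1(1) xyz(2,3)]] unfolding \<beta>_def G_mult by metis
  qed
  have ah: "a (h x y z) = \<alpha> x (z \<ominus> x \<otimes> y)" if xyz: "x \<in> P 1" "y \<in> P 1" "z \<in> P 2" for x y z
  proof -
    have c: "x \<in> carrier R" "y \<in> carrier R" "z \<in> carrier R" using xyz T_R V_R by auto
    have w: "z \<ominus> x \<otimes> y \<in> P 2" unfolding a_minus_def using TT xyz V_add V_minus by blast
    have zw: "x \<otimes> y \<oplus> (z \<ominus> x \<otimes> y) = z"
      using c by (metis a_assoc a_comm a_inv_closed a_minus_def m_closed r_neg r_zero)
    \<comment> \<open>In this order of the factors the two root elements produce x y in the corner,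
      which the shift of z by x y compensates.\<close>
    have "h x \<zero> (z \<ominus> x \<otimes> y) \<otimes>\<^bsub>M\<^esub> el j l y = el i l (z \<ominus> x \<otimes> y) \<otimes>\<^bsub>M\<^esub> (el i j x \<otimes>\<^bsub>M\<^esub> el j l y)"
      unfolding h_def using c ij by (simp add: el_zero M_assoc M_l_one el_carrier M_mult_closed)
    also have "\<dots> = h x y z"
    proof (rule M_eqI)
      fix k m assume km: "k \<le> n" "m \<le> n"
      show "(el i l (z \<ominus> x \<otimes> y) \<otimes>\<^bsub>M\<^esub> (el i j x \<otimes>\<^bsub>M\<^esub> el j l y)) k m = h x y z k m"
        unfolding entry[OF xyz km] using km ij c zw
        by (simp add: el_mult_entry el_carrier M_mult_closed) (auto simp: el_entry)
    qed (use c hM[OF xyz] in \<open>auto simp: el_carrier M_mult_closed\<close>)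
    finally have "h x \<zero> (z \<ominus> x \<otimes> y) \<otimes>\<^bsub>G\<^esub> el j l y = h x y z" unfolding G_mult .
    moreover have "el j l y \<in> meet_subgroup G K ({..n} - {j})"
      using generator_meet[OF ij(2) xyz(2)] unfolding l_def .
    ultimately show ?thesis using a[OF hH[OF xyz(1) z1(1) w]] unfolding \<alpha>_def by metis
  qed
  have q2: "real (card (P 1)) = real q ^ 2" using card_T by simp
  have "(\<Sum>A\<in>?H. b A) = (\<Sum>x\<in>P 1. \<Sum>y\<in>P 1. \<Sum>z\<in>P 2. \<beta> y z)"
    unfolding sumH by (intro sum.cong refl bh)
  then have b0: "(\<Sum>y\<in>P 1. \<Sum>z\<in>P 2. \<beta> y z) = 0" using s q2 q_pos by simp
  have B: "(\<Sum>A\<in>?H. (b A)\<^sup>2) = real q ^ 2 * (\<Sum>y\<in>P 1. \<Sum>z\<in>P 2. (\<beta> y z)\<^sup>2)"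
  proof -
    have "(\<Sum>A\<in>?H. (b A)\<^sup>2) = (\<Sum>x\<in>P 1. \<Sum>y\<in>P 1. \<Sum>z\<in>P 2. (\<beta> y z)\<^sup>2)"
      unfolding sumH by (intro sum.cong refl) (simp add: bh del: One_nat_def)
    then show ?thesis using q2 by simp
  qed
  have A: "(\<Sum>A\<in>?H. (a A)\<^sup>2) = real q ^ 2 * (\<Sum>x\<in>P 1. \<Sum>w\<in>P 2. (\<alpha> x w)\<^sup>2)"
  proof -
    have "(\<Sum>A\<in>?H. (a A)\<^sup>2) = (\<Sum>x\<in>P 1. \<Sum>y\<in>P 1. \<Sum>z\<in>P 2. (\<alpha> x (z \<ominus> x \<otimes> y))\<^sup>2)"
      unfolding sumH by (intro sum.cong refl) (simp add: ah del: One_nat_def)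
    also have "\<dots> = (\<Sum>x\<in>P 1. \<Sum>y\<in>P 1. \<Sum>w\<in>P 2. (\<alpha> x w)\<^sup>2)"
    proof (rule sum.cong[OF refl], rule sum.cong[OF refl])
      fix x y assume "x \<in> P 1" "y \<in> P 1"
      then have "\<ominus> (x \<otimes> y) \<in> P 2" using TT V_minus by blast
      then show "(\<Sum>z\<in>P 2. (\<alpha> x (z \<ominus> x \<otimes> y))\<^sup>2) = (\<Sum>w\<in>P 2. (\<alpha> x w)\<^sup>2)"
        unfolding a_minus_def by (rule sum_shift_V)
    qed
    also have "\<dots> = real q ^ 2 * (\<Sum>x\<in>P 1. \<Sum>w\<in>P 2. (\<alpha> x w)\<^sup>2)"
      using q2 by (simp add: sum_distrib_left)
    finally show ?thesis .
  qed
  have "(\<Sum>A\<in>?H. a A * b A) = (\<Sum>x\<in>P 1. \<Sum>y\<in>P 1. \<Sum>z\<in>P 2. \<beta> y z * \<alpha> x (z \<ominus> x \<otimes> y))"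
    unfolding sumH by (intro sum.cong refl) (simp add: ah bh mult.commute del: One_nat_def)
  also have "\<dots> \<le> sqrt (real q ^ 3 * (\<Sum>y\<in>P 1. \<Sum>z\<in>P 2. (\<beta> y z)\<^sup>2) * (\<Sum>x\<in>P 1. \<Sum>w\<in>P 2. (\<alpha> x w)\<^sup>2))"
    by (rule expander_mixing[OF b0])
  \<comment> \<open>Each sum over the group carries a factor q^2, the size of a root group; q^3
    divided by the two of them leaves 1/q under the root.\<close>
  also have "\<dots> = 1 / sqrt (real q) * sqrt ((\<Sum>A\<in>?H. (a A)\<^sup>2) * (\<Sum>A\<in>?H. (b A)\<^sup>2))"
  proof -
    define u where "u = (\<Sum>y\<in>P 1. \<Sum>z\<in>P 2. (\<beta> y z)\<^sup>2)"
    define v where "v = (\<Sum>x\<in>P 1. \<Sum>w\<in>P 2. (\<alpha> x w)\<^sup>2)"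
    have "1 / sqrt (real q) * sqrt (real q ^ 2 * v * (real q ^ 2 * u)) = sqrt (1 / real q * (real q ^ 2 * v * (real q ^ 2 * u)))"
      by (simp add: real_sqrt_mult real_sqrt_divide)
    also have "1 / real q * (real q ^ 2 * v * (real q ^ 2 * u)) = real q ^ 3 * u * v"
      using q_pos by (simp add: power2_eq_square power3_eq_cube)
    finally show ?thesis unfolding A B u_def[symmetric] v_def[symmetric] by simp
  qed
  finally show ?thesis .
qed

text \<open>The hypothesis fixes only the mean of a + b. Adding the mean of b to a and subtracting
  it from b removes the component along the function with values 1 and - 1 on the two sides of the
  graph; this can only raise the sum of products and lower the norms.\<close>

lemma expansion_adjacent_sum:
  fixes a b :: "(nat \<Rightarrow> nat \<Rightarrow> 'a) \<Rightarrow> real"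
  assumes \<sigma>: "\<sigma> \<subseteq> {..n}" "\<sigma> \<noteq> {}" "{..n} - \<sigma> = {i, j}" and j: "j = cyc i"
    and a: "\<And>x y. x \<in> meet_subgroup G K \<sigma> \<Longrightarrow> y \<in> meet_subgroup G K ({..n} - {j}) \<Longrightarrow> a (x \<otimes>\<^bsub>G\<^esub> y) = a x"
    and b: "\<And>x y. x \<in> meet_subgroup G K \<sigma> \<Longrightarrow> y \<in> meet_subgroup G K ({..n} - {i}) \<Longrightarrow> b (x \<otimes>\<^bsub>G\<^esub> y) = b x"
    and s: "(\<Sum>x\<in>meet_subgroup G K \<sigma>. a x + b x) = 0"
  shows "2 * (\<Sum>x\<in>meet_subgroup G K \<sigma>. a x * b x)
    \<le> 1 / sqrt (real q) * (\<Sum>x\<in>meet_subgroup G K \<sigma>. (a x)\<^sup>2 + (b x)\<^sup>2)"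
proof -
  let ?H = "meet_subgroup G K \<sigma>"
  interpret X: coset_geometry G n K by (rule coset_geometry_EL)
  have fH: "finite ?H" by (rule finite_subset[OF _ X.finite_carrier]) (auto simp: meet_subgroup_def)
  define N where "N = real (card ?H)"
  have N: "N > 0" unfolding N_def
    using fH subgroup.one_closed[OF X.subgroup_KK[OF \<sigma>(1)]] by (auto simp: card_gt_0_iff)
  define c where "c = (\<Sum>x\<in>?H. b x) / N"
  have sb: "(\<Sum>x\<in>?H. b x) = N * c" using N by (simp add: c_def)
  have sa: "(\<Sum>x\<in>?H. a x) = - (N * c)" using s sb by (simp add: sum.distrib)
  define a' where "a' x = a x + c" for x
  define b' where "b' x = b x - c" for x
  have "(\<Sum>x\<in>?H. b' x) = 0"
    unfolding b'_def by (simp add: sum_subtractf sb N_def[symmetric] del: One_nat_def)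
  then have mix: "(\<Sum>x\<in>?H. a' x * b' x) \<le> 1 / sqrt (real q) * sqrt ((\<Sum>x\<in>?H. (a' x)\<^sup>2) * (\<Sum>x\<in>?H. (b' x)\<^sup>2))"
    using a b by (intro expansion_adjacent[OF \<sigma> j]) (auto simp: a'_def b'_def)
  have ab: "(\<Sum>x\<in>?H. a' x * b' x) = (\<Sum>x\<in>?H. a x * b x) + N * c\<^sup>2"
  proof -
    have "(\<Sum>x\<in>?H. a' x * b' x) = (\<Sum>x\<in>?H. a x * b x) - c * (\<Sum>x\<in>?H. a x) + c * (\<Sum>x\<in>?H. b x) - (\<Sum>x\<in>?H. c\<^sup>2)"
      unfolding a'_def b'_def sum_distrib_left sum.distrib[symmetric] sum_subtractf[symmetric]
      by (intro sum.cong refl) (simp add: power2_eq_square algebra_simps)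
    then show ?thesis unfolding sa sb by (simp add: N_def[symmetric] power2_eq_square del: One_nat_def)
  qed
  have aa: "(\<Sum>x\<in>?H. (a' x)\<^sup>2) = (\<Sum>x\<in>?H. (a x)\<^sup>2) - N * c\<^sup>2"
  proof -
    have "(\<Sum>x\<in>?H. (a' x)\<^sup>2) = (\<Sum>x\<in>?H. (a x)\<^sup>2) + 2 * c * (\<Sum>x\<in>?H. a x) + (\<Sum>x\<in>?H. c\<^sup>2)"
      unfolding a'_def sum_distrib_left sum.distrib[symmetric]
      by (intro sum.cong refl) (simp add: power2_eq_square algebra_simps)
    then show ?thesis unfolding sa by (simp add: N_def[symmetric] power2_eq_square del: One_nat_def)
  qed
  have bb: "(\<Sum>x\<in>?H. (b' x)\<^sup>2) = (\<Sum>x\<in>?H. (b x)\<^sup>2) - N * c\<^sup>2"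
  proof -
    have "(\<Sum>x\<in>?H. (b' x)\<^sup>2) = (\<Sum>x\<in>?H. (b x)\<^sup>2) - 2 * c * (\<Sum>x\<in>?H. b x) + (\<Sum>x\<in>?H. c\<^sup>2)"
      unfolding b'_def sum_distrib_left sum.distrib[symmetric] sum_subtractf[symmetric]
      by (intro sum.cong refl) (simp add: power2_eq_square algebra_simps)
    then show ?thesis unfolding sb by (simp add: N_def[symmetric] power2_eq_square del: One_nat_def)
  qed
  define u where "u = (\<Sum>x\<in>?H. (a' x)\<^sup>2)"
  define v where "v = (\<Sum>x\<in>?H. (b' x)\<^sup>2)"
  have uv: "u \<ge> 0" "v \<ge> 0" unfolding u_def v_def by (auto intro: sum_nonneg)
  have "2 * sqrt (u * v) \<le> u + v" using arith_geo_mean_sqrt[OF uv] by simp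
  then have "1 / sqrt (real q) * (2 * sqrt (u * v)) \<le> 1 / sqrt (real q) * (u + v)"
    by (intro mult_left_mono) auto
  moreover have "2 * (\<Sum>x\<in>?H. a x * b x) \<le> 2 * (\<Sum>x\<in>?H. a' x * b' x)" unfolding ab using N by simp
  moreover have "1 / sqrt (real q) * (u + v) \<le> 1 / sqrt (real q) * (\<Sum>x\<in>?H. (a x)\<^sup>2 + (b x)\<^sup>2)"
    unfolding u_def v_def aa bb sum.distrib using N by (intro mult_left_mono) auto
  ultimately show ?thesis using mix unfolding u_def[symmetric] v_def[symmetric] by linarith
qed

theorem coset_expander_EL:
  assumes q: "sqrt (real q) > real n - 1"
  shows "coset_expander G n K q"
proof (intro coset_expander.intro coset_geometry_EL coset_expander_axioms.intro)
  fix \<sigma> i j and a b :: "(nat \<Rightarrow> nat \<Rightarrow> 'a) \<Rightarrow> real"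
  assume \<sigma>: "\<sigma> \<subseteq> {..n}" and ij: "{..n} - \<sigma> = {i, j}" "i \<noteq> j"
    and a: "\<And>x y. x \<in> meet_subgroup G K \<sigma> \<Longrightarrow> y \<in> meet_subgroup G K ({..n} - {j}) \<Longrightarrow> a (x \<otimes>\<^bsub>G\<^esub> y) = a x"
    and b: "\<And>x y. x \<in> meet_subgroup G K \<sigma> \<Longrightarrow> y \<in> meet_subgroup G K ({..n} - {i}) \<Longrightarrow> b (x \<otimes>\<^bsub>G\<^esub> y) = b x"
    and s: "(\<Sum>x\<in>meet_subgroup G K \<sigma>. a x + b x) = 0"
  have ne: "\<sigma> \<noteq> {}"
  proof
    assume "\<sigma> = {}"
    then have "card {..n} = 2" using ij by simp
    then show False using n_ge_2 by simp
  qed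
  consider "j = cyc i" | "i = cyc j" | "j \<noteq> cyc i" "i \<noteq> cyc j" by blast
  then show "2 * (\<Sum>x\<in>meet_subgroup G K \<sigma>. a x * b x)
    \<le> 1 / sqrt (real q) * (\<Sum>x\<in>meet_subgroup G K \<sigma>. (a x)\<^sup>2 + (b x)\<^sup>2)"
  proof cases
    case 1
    then show ?thesis using expansion_adjacent_sum[OF \<sigma> ne ij(1) 1 a b s] by blast
  next
    case 2
    \<comment> \<open>Here i follows j, so the two types, and with them a and b, exchange
      roles.\<close>
    have "{..n} - \<sigma> = {j, i}" using ij(1) by auto
    then have "2 * (\<Sum>x\<in>meet_subgroup G K \<sigma>. b x * a x)
      \<le> 1 / sqrt (real q) * (\<Sum>x\<in>meet_subgroup G K \<sigma>. (b x)\<^sup>2 + (a x)\<^sup>2)"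
      using s by (intro expansion_adjacent_sum[OF \<sigma> ne _ 2]) (auto simp: a b add.commute)
    then show ?thesis by (simp add: mult.commute add.commute)
  next
    case 3
    have "(\<Sum>x\<in>meet_subgroup G K \<sigma>. a x * b x) \<le> 0"
      by (rule expansion_commuting[OF \<sigma> ne ij 3 a b s])
    moreover have "0 \<le> 1 / sqrt (real q) * (\<Sum>x\<in>meet_subgroup G K \<sigma>. (a x)\<^sup>2 + (b x)\<^sup>2)"
      by (intro mult_nonneg_nonneg sum_nonneg) auto
    ultimately show ?thesis by linarith
  qed
qed (use n_ge_2 q in auto)

end

section \<open>The action of the dihedral group\<close>

lemma dihedral_carrier:
  "carrier (dihedral n) = {\<rho> \<in> Bij {..n}. \<forall>i\<in>{..n}. \<forall>j\<in>{..n}.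
     cyclically_adjacent n i j \<longleftrightarrow> cyclically_adjacent n (\<rho> i) (\<rho> j)}"
  by (simp add: dihedral_def)

lemma dihedral_Bij: "\<rho> \<in> carrier (dihedral n) \<Longrightarrow> \<rho> \<in> Bij {..n}"
  by (simp add: dihedral_carrier)

lemma dihedral_le:
  assumes "\<rho> \<in> carrier (dihedral n)" "i \<le> n"
  shows "\<rho> i \<le> n"
proof -
  have "\<rho> i \<in> {..n}"
    by (rule funcset_mem[OF Bij_imp_funcset[OF dihedral_Bij[OF assms(1)]]]) (simp add: assms(2))
  then show ?thesis by simp
qed

lemma dihedral_mult:
  assumes "\<rho> \<in> carrier (dihedral n)" "\<rho>' \<in> carrier (dihedral n)"
  shows "\<rho> \<otimes>\<^bsub>dihedral n\<^esub> \<rho>' = compose {..n} \<rho> \<rho>'"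
proof -
  have "\<rho> \<in> Bij {..n}" "\<rho>' \<in> Bij {..n}" using assms dihedral_Bij by blast+
  then show ?thesis by (simp add: dihedral_def BijGroup_def)
qed

lemma dihedral_one: "\<one>\<^bsub>dihedral n\<^esub> = (\<lambda>x\<in>{..n}. x)"
  by (simp add: dihedral_def BijGroup_def)

lemma group_dihedral: "group (dihedral n)"
proof -
  interpret B: group "BijGroup {..n}" by (rule group_BijGroup)
  have fin: "finite (carrier (BijGroup {..n}))"
  proof (rule finite_subset)
    show "carrier (BijGroup {..n}) \<subseteq> {..n} \<rightarrow>\<^sub>E {..n}"
      by (auto simp: BijGroup_def Bij_def bij_betw_def PiE_def)
  qed (simp add: finite_PiE)
  have "subgroup (carrier (dihedral n)) (BijGroup {..n})"
  proof (rule B.finite_submonoid_subgroup[OF fin])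
    show "carrier (dihedral n) \<subseteq> carrier (BijGroup {..n})" by (auto simp: dihedral_carrier BijGroup_def)
    show "\<one>\<^bsub>BijGroup {..n}\<^esub> \<in> carrier (dihedral n)"
      by (auto simp: dihedral_carrier BijGroup_def id_Bij)
    fix \<rho> \<rho>' assume r: "\<rho> \<in> carrier (dihedral n)" "\<rho>' \<in> carrier (dihedral n)"
    then have "\<rho> \<otimes>\<^bsub>BijGroup {..n}\<^esub> \<rho>' = compose {..n} \<rho> \<rho>'"
      using dihedral_Bij by (simp add: BijGroup_def)
    moreover have "compose {..n} \<rho> \<rho>' \<in> carrier (dihedral n)"
      using r dihedral_le[OF r(2)] by (auto simp: dihedral_carrier compose_Bij compose_eq)
    ultimately show "\<rho> \<otimes>\<^bsub>BijGroup {..n}\<^esub> \<rho>' \<in> carrier (dihedral n)" by simp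
  qed
  then show ?thesis using subgroup.subgroup_is_group B.group_axioms
    by (metis dihedral_def dihedral_carrier)
qed

lemma dihedral_inj: "\<rho> \<in> carrier (dihedral n) \<Longrightarrow> inj_on \<rho> {..n}"
  using dihedral_Bij by (force simp: Bij_def bij_betw_def)

lemma dihedral_surj: "\<rho> \<in> carrier (dihedral n) \<Longrightarrow> \<rho> ` {..n} = {..n}"
  using dihedral_Bij by (force simp: Bij_def bij_betw_def)

context coset_geometry
begin

lemma finite_vertices_X: "finite (vertices X)"
  using finite_X by (auto simp: vertices_def coset_complex_def)

lemma subset_vertices: "s \<in> X \<Longrightarrow> s \<subseteq> vertices X"
  by (auto simp: vertices_def)

text \<open>The pair of g and \<rho> sends the coset of h of type i to the coset of
  \<open>g \<otimes> \<theta> \<rho> h\<close> of type \<rho> i, which makes sense because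
  \<open>\<theta> \<rho>\<close> carries \<open>K i\<close> to \<open>K (\<rho> i)\<close>.
  Faithfulness is visible on the chamber of the unit element: the types of its image give \<rho>,
  and its cosets give g since the \<open>K i\<close> intersect trivially.\<close>

theorem semidirect_product_acts:
  fixes \<theta> :: "(nat \<Rightarrow> nat) \<Rightarrow> 'a \<Rightarrow> 'a"
  assumes \<theta>: "\<theta> \<in> hom (dihedral n) (AutoGroup G)"
    and \<theta>_K: "\<And>\<rho> i. \<rho> \<in> carrier (dihedral n) \<Longrightarrow> i \<le> n \<Longrightarrow> \<theta> \<rho> ` K i = K (\<rho> i)"
  shows "\<exists>\<Phi>. \<Phi> \<in> mon (semidirect_product G (dihedral n) \<theta>) (simplicial_automorphisms X) \<and>
    (\<forall>g\<in>carrier G. \<forall>v\<in>vertices X. \<Phi> (g, \<one>\<^bsub>dihedral n\<^esub>) v = left_mult G g v) \<and>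
    (\<forall>\<sigma>\<in>simplices X (int n). \<forall>\<sigma>'\<in>simplices X (int n).
       \<exists>g\<in>carrier G. \<Phi> (g, \<one>\<^bsub>dihedral n\<^esub>) ` \<sigma> = \<sigma>') \<and>
    (\<forall>\<rho>\<in>carrier (dihedral n). \<forall>\<sigma>\<in>X. simplex_type (\<Phi> (\<one>, \<rho>) ` \<sigma>) = \<rho> ` simplex_type \<sigma>)"
proof -
  let ?D = "dihedral n"
  interpret D: group ?D by (rule group_dihedral)
  interpret A: group "AutoGroup G" by (rule AutoGroup)
  have \<theta>_auto: "\<theta> \<rho> \<in> auto G" if "\<rho> \<in> carrier ?D" for \<rho>
    using hom_in_carrier[OF \<theta> that] by (simp add: AutoGroup_def)
  have \<theta>_closed: "\<theta> \<rho> x \<in> carrier G" if "\<rho> \<in> carrier ?D" "x \<in> carrier G" for \<rho> x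
    using \<theta>_auto[OF that(1)] that(2) by (auto simp: auto_def hom_def)
  have \<theta>_mult: "\<theta> \<rho> (x \<otimes> y) = \<theta> \<rho> x \<otimes> \<theta> \<rho> y" if "\<rho> \<in> carrier ?D" "x \<in> carrier G" "y \<in> carrier G" for \<rho> x y
    using \<theta>_auto[OF that(1)] that(2,3) by (auto simp: auto_def hom_def)
  have \<theta>_inj: "inj_on (\<theta> \<rho>) (carrier G)" if "\<rho> \<in> carrier ?D" for \<rho>
    using \<theta>_auto[OF that] by (auto simp: auto_def Bij_def bij_betw_def)
  have \<theta>_comp: "\<theta> (\<rho> \<otimes>\<^bsub>?D\<^esub> \<rho>') x = \<theta> \<rho> (\<theta> \<rho>' x)"
    if r: "\<rho> \<in> carrier ?D" "\<rho>' \<in> carrier ?D" and x: "x \<in> carrier G" for \<rho> \<rho>' x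
  proof -
    have "\<theta> \<rho> \<in> Bij (carrier G)" "\<theta> \<rho>' \<in> Bij (carrier G)" using \<theta>_auto r by (auto simp: auto_def)
    then have "\<theta> (\<rho> \<otimes>\<^bsub>?D\<^esub> \<rho>') = compose (carrier G) (\<theta> \<rho>) (\<theta> \<rho>')"
      using hom_mult[OF \<theta> r] by (simp add: AutoGroup_def BijGroup_def)
    then show ?thesis using x by (simp add: compose_eq)
  qed
  have \<theta>_one: "\<theta> \<one>\<^bsub>?D\<^esub> x = x" if "x \<in> carrier G" for x
    using hom_one[OF \<theta> D.group_axioms A.group_axioms] that by (simp add: AutoGroup_def BijGroup_def)
  \<comment> \<open>Cosets are moved as sets, so no representative is chosen; the restriction to the
    vertices makes the map extensional, as \<open>Bij\<close> demands.\<close>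
  define \<Phi> where "\<Phi> = (\<lambda>(g, \<rho>). \<lambda>v\<in>vertices X. (\<rho> (fst v) :: nat, (\<lambda>h. g \<otimes> \<theta> \<rho> h) ` snd v))"
  have vertex: "\<exists>i h. v = (i, h <#\<^bsub>G\<^esub> K i) \<and> i \<le> n \<and> h \<in> carrier G" if "v \<in> vertices X" for v
    using that unfolding vertices_X coset_vertices_def by blast
  have vertexI: "(i, h <#\<^bsub>G\<^esub> K i) \<in> vertices X" if "i \<le> n" "h \<in> carrier G" for i h
    using that unfolding vertices_X coset_vertices_def by blast
  have act: "\<Phi> (g, \<rho>) (i, h <#\<^bsub>G\<^esub> K i) = (\<rho> i, (g \<otimes> \<theta> \<rho> h) <#\<^bsub>G\<^esub> K (\<rho> i))"
    if g: "g \<in> carrier G" and r: "\<rho> \<in> carrier ?D" and i: "i \<le> n" and h: "h \<in> carrier G" for g \<rho> i h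
  proof -
    have "(\<lambda>x. g \<otimes> \<theta> \<rho> x) ` (h <#\<^bsub>G\<^esub> K i) = (\<lambda>x. g \<otimes> \<theta> \<rho> (h \<otimes> x)) ` K i"
      unfolding l_coset_def by auto
    also have "\<dots> = (\<lambda>x. g \<otimes> \<theta> \<rho> h \<otimes> \<theta> \<rho> x) ` K i"
      using g h r K_carrier[OF i] \<theta>_closed by (intro image_cong refl) (simp add: \<theta>_mult m_assoc)
    also have "\<dots> = (\<lambda>y. g \<otimes> \<theta> \<rho> h \<otimes> y) ` (\<theta> \<rho> ` K i)" by (simp add: image_image)
    also have "\<dots> = (g \<otimes> \<theta> \<rho> h) <#\<^bsub>G\<^esub> K (\<rho> i)" unfolding \<theta>_K[OF r i] l_coset_def by auto
    finally show ?thesis unfolding \<Phi>_def using vertexI[OF i h] by simp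
  qed
  have actF: "\<Phi> (g, \<rho>) ` F h \<sigma> = F (g \<otimes> \<theta> \<rho> h) (\<rho> ` \<sigma>)"
    if "g \<in> carrier G" "\<rho> \<in> carrier ?D" "\<sigma> \<subseteq> {..n}" "h \<in> carrier G" for g \<rho> \<sigma> h
    unfolding face_def image_image using act[OF that(1,2) _ that(4)] that(3) by (intro image_cong refl) auto
  have maps: "\<Phi> (g, \<rho>) v \<in> vertices X" if "g \<in> carrier G" "\<rho> \<in> carrier ?D" "v \<in> vertices X" for g \<rho> v
    using vertex[OF that(3)] act[OF that(1,2)] vertexI dihedral_le[OF that(2)] \<theta>_closed[OF that(2)] that(1)
    by fastforce
  have inj: "inj_on (\<Phi> (g, \<rho>)) (vertices X)" if g: "g \<in> carrier G" and r: "\<rho> \<in> carrier ?D" for g \<rho>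
  proof (rule inj_onI)
    fix v v' assume v: "v \<in> vertices X" "v' \<in> vertices X" "\<Phi> (g, \<rho>) v = \<Phi> (g, \<rho>) v'"
    obtain i h where ih: "v = (i, h <#\<^bsub>G\<^esub> K i)" "i \<le> n" "h \<in> carrier G" using vertex[OF v(1)] by blast
    obtain j h' where jh: "v' = (j, h' <#\<^bsub>G\<^esub> K j)" "j \<le> n" "h' \<in> carrier G" using vertex[OF v(2)] by blast
    have e: "\<rho> i = \<rho> j" "(g \<otimes> \<theta> \<rho> h) <#\<^bsub>G\<^esub> K (\<rho> i) = (g \<otimes> \<theta> \<rho> h') <#\<^bsub>G\<^esub> K (\<rho> j)"
      using v(3) ih jh act[OF g r] by auto
    have ij: "i = j" using inj_onD[OF dihedral_inj[OF r] e(1)] ih jh by simp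
    have tc: "\<theta> \<rho> h \<in> carrier G" "\<theta> \<rho> h' \<in> carrier G" using \<theta>_closed r ih jh by auto
    have "inv (g \<otimes> \<theta> \<rho> h) \<otimes> (g \<otimes> \<theta> \<rho> h') \<in> K (\<rho> i)"
      using coset_eq_iff[OF subgroup_K[OF dihedral_le[OF r ih(2)]], of "g \<otimes> \<theta> \<rho> h" "g \<otimes> \<theta> \<rho> h'"] e g tc ij by simp
    also have "inv (g \<otimes> \<theta> \<rho> h) \<otimes> (g \<otimes> \<theta> \<rho> h') = inv (\<theta> \<rho> h) \<otimes> \<theta> \<rho> h'"
      using g tc by (simp add: inv_mult_group m_assoc inv_mult_cancel)
    finally obtain k where k: "k \<in> K i" "inv (\<theta> \<rho> h) \<otimes> \<theta> \<rho> h' = \<theta> \<rho> k"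
      unfolding \<theta>_K[OF r ih(2), symmetric] by blast
    have kc: "k \<in> carrier G" using k(1) K_carrier ih by blast
    have "\<theta> \<rho> h' = \<theta> \<rho> (h \<otimes> k)"
      using \<theta>_mult[OF r ih(3) kc] k(2) mult_inv_cancel[OF tc] by metis
    then have "h' = h \<otimes> k" using inj_onD[OF \<theta>_inj[OF r]] jh(3) ih(3) kc by blast
    then have "h <#\<^bsub>G\<^esub> K i = h' <#\<^bsub>G\<^esub> K i"
      using coset_eq_iff[OF subgroup_K[OF ih(2)] ih(3) jh(3)] k(1) inv_mult_cancel[OF ih(3) kc] by simp
    then show "v = v'" using ih jh ij by simp
  qed
  have bij: "\<Phi> (g, \<rho>) \<in> Bij (vertices X)" if "g \<in> carrier G" "\<rho> \<in> carrier ?D" for g \<rho>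
  proof -
    have "\<Phi> (g, \<rho>) ` vertices X = vertices X"
      using maps[OF that] inj[OF that] finite_vertices_X by (intro endo_inj_surj) auto
    then show ?thesis using inj[OF that] unfolding Bij_def bij_betw_def by (simp add: \<Phi>_def)
  qed
  have aut: "\<Phi> (g, \<rho>) ` s \<in> X \<longleftrightarrow> s \<in> X"
    if g: "g \<in> carrier G" and r: "\<rho> \<in> carrier ?D" and s: "s \<subseteq> vertices X" for g \<rho> s
  proof -
    have fwd: "\<Phi> (g, \<rho>) ` s \<in> X" if sX: "s \<in> X" for s
    proof -
      obtain h \<sigma> where h: "h \<in> carrier G" "\<sigma> \<subseteq> {..n}" "s = F h \<sigma>" using X_eq_F[OF sX] by blast
      have "\<rho> ` \<sigma> \<subseteq> {..n}" using dihedral_le[OF r] h(2) by auto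
      then show ?thesis unfolding h(3) actF[OF g r h(2,1)] using F_in_X g \<theta>_closed[OF r h(1)] by simp
    qed
    \<comment> \<open>For the converse, the induced map on the finite set of simplices is injective,
      hence onto.\<close>
    have "inj_on (\<lambda>s. \<Phi> (g, \<rho>) ` s) X"
    proof (rule inj_onI)
      fix s t assume "s \<in> X" "t \<in> X" "\<Phi> (g, \<rho>) ` s = \<Phi> (g, \<rho>) ` t"
      then show "s = t" using inj_on_image_eq_iff[OF inj[OF g r] subset_vertices subset_vertices] by simp
    qed
    then have surj: "(\<lambda>s. \<Phi> (g, \<rho>) ` s) ` X = X"
      using fwd finite_X by (intro endo_inj_surj) auto
    have "s \<in> X" if "\<Phi> (g, \<rho>) ` s \<in> X"
    proof -
      have "\<Phi> (g, \<rho>) ` s \<in> (\<lambda>s. \<Phi> (g, \<rho>) ` s) ` X" using surj that by simp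
      then obtain s' where "\<Phi> (g, \<rho>) ` s = \<Phi> (g, \<rho>) ` s'" "s' \<in> X" by (elim imageE)
      then have s': "s' \<in> X" "\<Phi> (g, \<rho>) ` s' = \<Phi> (g, \<rho>) ` s" by simp_all
      then have "s' = s" using inj_on_image_eq_iff[OF inj[OF g r] subset_vertices[OF s'(1)] s] by simp
      then show ?thesis using s' by simp
    qed
    then show ?thesis using fwd by blast
  qed
  have in_aut: "\<Phi> (g, \<rho>) \<in> carrier (simplicial_automorphisms X)" if "g \<in> carrier G" "\<rho> \<in> carrier ?D" for g \<rho>
    unfolding simplicial_automorphisms_def using bij[OF that] aut[OF that] by simp
  have mult: "\<Phi> (g \<otimes> \<theta> \<rho> g', \<rho> \<otimes>\<^bsub>?D\<^esub> \<rho>') = \<Phi> (g, \<rho>) \<otimes>\<^bsub>simplicial_automorphisms X\<^esub> \<Phi> (g', \<rho>')"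
    if g: "g \<in> carrier G" "g' \<in> carrier G" and r: "\<rho> \<in> carrier ?D" "\<rho>' \<in> carrier ?D" for g g' \<rho> \<rho>'
  proof -
    have rr: "\<rho> \<otimes>\<^bsub>?D\<^esub> \<rho>' \<in> carrier ?D" using r by simp
    have gg: "g \<otimes> \<theta> \<rho> g' \<in> carrier G" using g \<theta>_closed r by simp
    have "\<Phi> (g, \<rho>) \<otimes>\<^bsub>simplicial_automorphisms X\<^esub> \<Phi> (g', \<rho>') = compose (vertices X) (\<Phi> (g, \<rho>)) (\<Phi> (g', \<rho>'))"
      using bij g r by (simp add: simplicial_automorphisms_def BijGroup_def)
    also have "\<dots> = \<Phi> (g \<otimes> \<theta> \<rho> g', \<rho> \<otimes>\<^bsub>?D\<^esub> \<rho>')"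
    proof (rule extensionalityI[of _ "vertices X"])
      fix v assume v: "v \<in> vertices X"
      obtain i h where ih: "v = (i, h <#\<^bsub>G\<^esub> K i)" "i \<le> n" "h \<in> carrier G" using vertex[OF v] by blast
      have t: "\<theta> \<rho>' h \<in> carrier G" "\<theta> \<rho> g' \<in> carrier G" "\<theta> \<rho> (\<theta> \<rho>' h) \<in> carrier G"
        using \<theta>_closed r ih g by auto
      have "compose (vertices X) (\<Phi> (g, \<rho>)) (\<Phi> (g', \<rho>')) v
        = (\<rho> (\<rho>' i), (g \<otimes> \<theta> \<rho> (g' \<otimes> \<theta> \<rho>' h)) <#\<^bsub>G\<^esub> K (\<rho> (\<rho>' i)))"
        using v g t dihedral_le[OF r(2) ih(2)] unfolding ih(1)
        by (simp add: compose_eq act[OF g(2) r(2) ih(2,3)] act[OF g(1) r(1)])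
      also have "\<dots> = \<Phi> (g \<otimes> \<theta> \<rho> g', \<rho> \<otimes>\<^bsub>?D\<^esub> \<rho>') v"
      proof -
        have "(\<rho> \<otimes>\<^bsub>?D\<^esub> \<rho>') i = \<rho> (\<rho>' i)" using ih(2) by (simp add: dihedral_mult[OF r] compose_eq)
        moreover have "g \<otimes> \<theta> \<rho> (g' \<otimes> \<theta> \<rho>' h) = g \<otimes> \<theta> \<rho> g' \<otimes> \<theta> (\<rho> \<otimes>\<^bsub>?D\<^esub> \<rho>') h"
          unfolding \<theta>_comp[OF r ih(3)] \<theta>_mult[OF r(1) g(2) t(1)] using g t by (simp add: m_assoc)
        ultimately show ?thesis unfolding ih(1) act[OF gg rr ih(2,3)] by simp
      qed
      finally show "compose (vertices X) (\<Phi> (g, \<rho>)) (\<Phi> (g', \<rho>')) v = \<Phi> (g \<otimes> \<theta> \<rho> g', \<rho> \<otimes>\<^bsub>?D\<^esub> \<rho>') v" .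
    qed (simp_all add: compose_def \<Phi>_def)
    finally show ?thesis by simp
  qed
  have injPhi: "g = g' \<and> \<rho> = \<rho>'"
    if g: "g \<in> carrier G" "g' \<in> carrier G" and r: "\<rho> \<in> carrier ?D" "\<rho>' \<in> carrier ?D"
      and e: "\<Phi> (g, \<rho>) = \<Phi> (g', \<rho>')" for g g' \<rho> \<rho>'
  proof -
    have \<theta>1: "\<theta> \<rho> \<one> = \<one>" if "\<rho> \<in> carrier ?D" for \<rho>
      using \<theta>_mult[OF that one_closed one_closed] \<theta>_closed[OF that one_closed] by simp
    have a: "\<rho> i = \<rho>' i \<and> g <#\<^bsub>G\<^esub> K (\<rho> i) = g' <#\<^bsub>G\<^esub> K (\<rho>' i)" if "i \<le> n" for i
    proof -
      have "(\<rho> i, (g \<otimes> \<theta> \<rho> \<one>) <#\<^bsub>G\<^esub> K (\<rho> i)) = (\<rho>' i, (g' \<otimes> \<theta> \<rho>' \<one>) <#\<^bsub>G\<^esub> K (\<rho>' i))"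
        unfolding act[OF g(1) r(1) that one_closed, symmetric] act[OF g(2) r(2) that one_closed, symmetric] e ..
      then show ?thesis unfolding \<theta>1[OF r(1)] \<theta>1[OF r(2)] r_one[OF g(1)] r_one[OF g(2)] prod.inject .
    qed
    have "\<rho> = \<rho>'"
      using a dihedral_Bij r by (intro extensionalityI[of _ "{..n}"]) (auto simp: Bij_def)
    moreover have "inv g \<otimes> g' \<in> K (\<rho> i)" if "i \<le> n" for i
    proof -
      have "g <#\<^bsub>G\<^esub> K (\<rho> i) = g' <#\<^bsub>G\<^esub> K (\<rho> i)" using a[OF that] by metis
      then show ?thesis by (rule coset_eq_iff[OF subgroup_K[OF dihedral_le[OF r(1) that]] g, THEN iffD1])
    qed
    then have "inv g \<otimes> g' \<in> KK {..n}"
      using g dihedral_surj[OF r(1)] unfolding meet_subgroup_def by (auto, metis atMost_iff imageE)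
    then have "inv g \<otimes> g' = \<one>" using meet_all by simp
    then have "g = g'" using mult_inv_cancel[OF g] g by simp
    ultimately show ?thesis by simp
  qed
  have mon: "\<Phi> \<in> mon (semidirect_product G ?D \<theta>) (simplicial_automorphisms X)"
    unfolding mon_def hom_def semidirect_product_def
    using in_aut mult injPhi by (auto simp: inj_on_def Pi_def)
  have Done: "\<one>\<^bsub>?D\<^esub> \<in> carrier ?D" by simp
  have D1: "\<one>\<^bsub>?D\<^esub> i = i" if "i \<le> n" for i using that by (simp add: dihedral_one)
  have left: "\<Phi> (g, \<one>\<^bsub>?D\<^esub>) v = left_mult G g v" if g: "g \<in> carrier G" and v: "v \<in> vertices X" for g v
  proof -
    obtain i h where ih: "v = (i, h <#\<^bsub>G\<^esub> K i)" "i \<le> n" "h \<in> carrier G" using vertex[OF v] by blast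
    have "K i \<subseteq> carrier G" using K_carrier ih by blast
    then have "g <#\<^bsub>G\<^esub> (h <#\<^bsub>G\<^esub> K i) = (g \<otimes> h) <#\<^bsub>G\<^esub> K i" using lcos_m_assoc g ih by blast
    then show ?thesis unfolding ih(1) act[OF g Done ih(2,3)] left_mult_def
      using \<theta>_one[OF ih(3)] D1[OF ih(2)] by simp
  qed
  have trans: "\<exists>g\<in>carrier G. \<Phi> (g, \<one>\<^bsub>?D\<^esub>) ` s = s'"
    if ss: "s \<in> simplices X (int n)" "s' \<in> simplices X (int n)" for s s'
  proof -
    obtain h where h: "h \<in> carrier G" "s = F h {..n}" using ss(1) unfolding top_simplices_X by (elim imageE)
    obtain h' where h': "h' \<in> carrier G" "s' = F h' {..n}" using ss(2) unfolding top_simplices_X by (elim imageE)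
    have "\<one>\<^bsub>?D\<^esub> ` {..n} = {..n}" using D1 by force
    then have "\<Phi> (h' \<otimes> inv h, \<one>\<^bsub>?D\<^esub>) ` s = s'"
      using actF[OF _ Done order.refl h(1), of "h' \<otimes> inv h"] h h' \<theta>_one by (simp add: m_assoc)
    then show ?thesis using h h' by (intro bexI[of _ "h' \<otimes> inv h"]) auto
  qed
  have type: "simplex_type (\<Phi> (\<one>, \<rho>) ` s) = \<rho> ` simplex_type s" if r: "\<rho> \<in> carrier ?D" and s: "s \<in> X" for \<rho> s
  proof -
    obtain h \<sigma> where h: "h \<in> carrier G" "\<sigma> \<subseteq> {..n}" "s = F h \<sigma>" using X_eq_F[OF s] by blast
    show ?thesis unfolding h(3) actF[OF one_closed r h(2,1)] simplex_type_def fst_F ..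
  qed
  show ?thesis using mon left trans type by (intro exI[of _ \<Phi>]) blast
qed

end

section \<open>Adjacency modulo n + 1, rotations and reflections\<close>

lemma mod_Suc_one:
  assumes "i \<le> (n::nat)" "j \<le> n"
  shows "[int i - int j = 1] (mod int (n + 1)) \<longleftrightarrow> i = (j + 1) mod (n + 1)"
proof -
  have "[int i - int j = 1] (mod int (n + 1)) \<longleftrightarrow> [int i = int (j + 1)] (mod int (n + 1))"
    by (simp add: cong_iff_dvd_diff algebra_simps)
  also have "\<dots> \<longleftrightarrow> [i = j + 1] (mod (n + 1))" by (simp only: cong_int_iff)
  also have "\<dots> \<longleftrightarrow> i = (j + 1) mod (n + 1)" using assms(1) by (simp add: cong_def)
  finally show ?thesis .
qed

lemma cyclically_adjacent_iff:
  assumes "i \<le> n" "j \<le> n"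
  shows "cyclically_adjacent n i j \<longleftrightarrow> i = (j + 1) mod (n + 1) \<or> j = (i + 1) mod (n + 1)"
proof -
  have "[int i - int j = - 1] (mod int (n + 1)) \<longleftrightarrow> [int j - int i = 1] (mod int (n + 1))"
    using cong_minus_minus_iff[of "int i - int j" "- 1" "int (n + 1)"] by simp
  then show ?thesis unfolding cyclically_adjacent_def using mod_Suc_one assms by simp
qed

context filtered_matrix_ring
begin

definition rotation :: "(nat \<Rightarrow> nat) \<Rightarrow> bool" where
  "rotation \<rho> \<longleftrightarrow> (\<forall>j\<le>n. \<rho> (cyc j) = cyc (\<rho> j))"

text \<open>That is, \<open>\<rho> (j + 1) = \<rho> j - 1\<close> modulo \<open>n + 1\<close>.\<close>

definition reflection :: "(nat \<Rightarrow> nat) \<Rightarrow> bool" where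
  "reflection \<rho> \<longleftrightarrow> (\<forall>j\<le>n. cyc (\<rho> (cyc j)) = \<rho> j)"

lemma cyc_induct:
  assumes "Q 0" "\<And>j. j \<le> n \<Longrightarrow> Q j \<Longrightarrow> Q (cyc j)" "j \<le> n"
  shows "Q j"
  using assms(3)
proof (induction j)
  case (Suc j)
  then have "Q (cyc j)" using assms(2)[of j] by simp
  moreover have "cyc j = Suc j" using Suc.prems by simp
  ultimately show ?case by simp
qed (rule assms(1))

text \<open>Each step of \<rho> goes one forward or one backward on the cycle. A change of direction
  would give j and j + 2 the same image, although these differ on a cycle with at least three
  vertices; so the direction at 0 decides.\<close>

lemma rotation_or_reflection:
  assumes r: "\<rho> \<in> carrier (dihedral n)"
  shows "rotation \<rho> \<or> reflection \<rho>"
proof -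
  have le: "\<rho> j \<le> n" if "j \<le> n" for j using dihedral_le[OF r that] .
  have inj: "i = j" if "\<rho> i = \<rho> j" "i \<le> n" "j \<le> n" for i j
    using inj_onD[OF dihedral_inj[OF r] that(1)] that by simp
  have adj: "\<rho> (cyc j) = cyc (\<rho> j) \<or> cyc (\<rho> (cyc j)) = \<rho> j" if j: "j \<le> n" for j
  proof -
    have "cyclically_adjacent n (cyc j) j" using j cyc(1)[OF j] by (simp add: cyclically_adjacent_iff)
    then have "cyclically_adjacent n (\<rho> (cyc j)) (\<rho> j)" using r j cyc(1)[OF j] by (auto simp: dihedral_carrier)
    then show ?thesis using le[OF j] le[OF cyc(1)[OF j]] by (auto simp: cyclically_adjacent_iff)
  qed
  have c: "cyc j \<le> n" "cyc (cyc j) \<le> n" "cyc (cyc j) \<noteq> j" if "j \<le> n" for j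
    using cyc(1)[OF that] cyc(1)[OF cyc(1)[OF that]] cyc_cyc[OF that] by auto
  show ?thesis
  proof (cases "\<rho> (cyc 0) = cyc (\<rho> 0)")
    case True
    have "\<rho> (cyc j) = cyc (\<rho> j)" if "j \<le> n" for j
    proof (rule cyc_induct[of "\<lambda>j. \<rho> (cyc j) = cyc (\<rho> j)", OF True _ that])
      fix j assume j: "j \<le> n" "\<rho> (cyc j) = cyc (\<rho> j)"
      show "\<rho> (cyc (cyc j)) = cyc (\<rho> (cyc j))"
      proof (rule ccontr)
        assume "\<rho> (cyc (cyc j)) \<noteq> cyc (\<rho> (cyc j))"
        then have "cyc (\<rho> (cyc (cyc j))) = cyc (\<rho> j)" using adj[OF c(1)[OF j(1)]] j(2) by simp
        then have "\<rho> (cyc (cyc j)) = \<rho> j" by (rule cyc_inj[OF le[OF c(2)[OF j(1)]] le[OF j(1)]])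
        then have "cyc (cyc j) = j" by (rule inj[OF _ c(2)[OF j(1)] j(1)])
        then show False using c(3)[OF j(1)] by simp
      qed
    qed
    then show ?thesis by (simp add: rotation_def)
  next
    case False
    then have start: "cyc (\<rho> (cyc 0)) = \<rho> 0" using adj[of 0] by simp
    have "cyc (\<rho> (cyc j)) = \<rho> j" if "j \<le> n" for j
    proof (rule cyc_induct[of "\<lambda>j. cyc (\<rho> (cyc j)) = \<rho> j", OF start _ that])
      fix j assume j: "j \<le> n" "cyc (\<rho> (cyc j)) = \<rho> j"
      show "cyc (\<rho> (cyc (cyc j))) = \<rho> (cyc j)"
      proof (rule ccontr)
        assume "cyc (\<rho> (cyc (cyc j))) \<noteq> \<rho> (cyc j)"
        then have "\<rho> (cyc (cyc j)) = \<rho> j" using adj[OF c(1)[OF j(1)]] j(2) by simp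
        then have "cyc (cyc j) = j" by (rule inj[OF _ c(2)[OF j(1)] j(1)])
        then show False using c(3)[OF j(1)] by simp
      qed
    qed
    then show ?thesis by (simp add: reflection_def)
  qed
qed

text \<open>Otherwise two steps forward would lead back to the start, which is impossible on a cycle
  with at least three vertices.\<close>

lemma not_rotation_and_reflection:
  assumes "\<rho> \<in> carrier (dihedral n)" "rotation \<rho>" "reflection \<rho>"
  shows False
proof -
  have "cyc (cyc (\<rho> 0)) = \<rho> 0" using assms(2,3) unfolding rotation_def reflection_def by (metis zero_le)
  then show False using cyc_cyc dihedral_le[OF assms(1), of 0] by simp
qed

abbreviation "gen j m \<equiv> el j (cyc j) m"

lemma gen_G: "j \<le> n \<Longrightarrow> m \<in> P 1 \<Longrightarrow> gen j m \<in> carrier G"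
  using el_G cyc[of j] PR by auto

lemma subgroup_containing_generators:
  assumes "subgroup H G" "\<And>j m. j \<le> n \<Longrightarrow> m \<in> P 1 \<Longrightarrow> gen j m \<in> H"
  shows "carrier G \<subseteq> H"
  by (rule G_subset[OF assms(1)]) (rule el_G_generated[OF assms])

lemma hom_unique:
  assumes "\<phi> \<in> hom G G" "\<psi> \<in> hom G G" "\<And>j m. j \<le> n \<Longrightarrow> m \<in> P 1 \<Longrightarrow> \<phi> (gen j m) = \<psi> (gen j m)"
    and "x \<in> carrier G"
  shows "\<phi> x = \<psi> x"
proof -
  have "subgroup {x \<in> carrier G. \<phi> x = \<psi> x} G"
    by (rule G.finite_submonoid_subgroup[OF finite_G[OF finite_R]])
      (auto simp: hom_mult[OF assms(1)] hom_mult[OF assms(2)] hom_one[OF assms(1) group_G group_G] hom_one[OF assms(2) group_G group_G])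
  then have "carrier G \<subseteq> {x \<in> carrier G. \<phi> x = \<psi> x}"
    by (rule subgroup_containing_generators) (use assms(3) gen_G in auto)
  then show ?thesis using assms(4) by blast
qed

section \<open>Permuting indices and transposing\<close>

definition reindex :: "(nat \<Rightarrow> nat) \<Rightarrow> (nat \<Rightarrow> nat \<Rightarrow> 'a) \<Rightarrow> nat \<Rightarrow> nat \<Rightarrow> 'a" where
  "reindex f A = (\<lambda>k\<in>{..n}. \<lambda>l\<in>{..n}. A (f k) (f l))"

definition reindex_transpose :: "(nat \<Rightarrow> nat) \<Rightarrow> (nat \<Rightarrow> nat \<Rightarrow> 'a) \<Rightarrow> nat \<Rightarrow> nat \<Rightarrow> 'a" where
  "reindex_transpose f A = (\<lambda>k\<in>{..n}. \<lambda>l\<in>{..n}. A (f l) (f k))"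

lemma finsum_bij:
  assumes f: "bij_betw f {..n} {..n}" and h: "\<And>m. m \<le> n \<Longrightarrow> h m \<in> carrier R"
  shows "(\<Oplus>m\<in>{..n}. h (f m)) = (\<Oplus>m\<in>{..n}. h m)"
proof -
  have "(\<Oplus>m\<in>f ` {..n}. h m) = (\<Oplus>m\<in>{..n}. h (f m))"
    using f h by (intro add.finprod_reindex) (auto simp: bij_betw_def)
  then show ?thesis using f by (simp add: bij_betw_def)
qed

context
  fixes f g :: "nat \<Rightarrow> nat"
  assumes f: "\<And>x. x \<le> n \<Longrightarrow> f x \<le> n" and g: "\<And>x. x \<le> n \<Longrightarrow> g x \<le> n"
    and fg: "\<And>x. x \<le> n \<Longrightarrow> f (g x) = x" and gf: "\<And>x. x \<le> n \<Longrightarrow> g (f x) = x"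
begin

lemma bij_f: "bij_betw f {..n} {..n}"
  by (rule bij_betw_byWitness[where f' = g]) (auto simp: f g fg gf)

lemma reindex_M: "A \<in> carrier M \<Longrightarrow> reindex f A \<in> carrier M"
  using f by (auto simp: reindex_def M_carrier_iff)

lemma reindex_transpose_M: "A \<in> carrier M \<Longrightarrow> reindex_transpose f A \<in> carrier M"
  using f by (auto simp: reindex_transpose_def M_carrier_iff)

lemma reindex_mult:
  assumes A: "A \<in> carrier M" and B: "B \<in> carrier M"
  shows "reindex f (A \<otimes>\<^bsub>M\<^esub> B) = reindex f A \<otimes>\<^bsub>M\<^esub> reindex f B"
proof (rule M_eqI)
  fix k l assume kl: "k \<le> n" "l \<le> n"
  have "reindex f (A \<otimes>\<^bsub>M\<^esub> B) k l = (\<Oplus>m\<in>{..n}. A (f k) m \<otimes> B m (f l))"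
    using kl f by (simp add: reindex_def M_mult)
  also have "\<dots> = (\<Oplus>m\<in>{..n}. A (f k) (f m) \<otimes> B (f m) (f l))"
    using kl f M_entry[OF A] M_entry[OF B] by (intro finsum_bij[OF bij_f, symmetric]) auto
  also have "\<dots> = (reindex f A \<otimes>\<^bsub>M\<^esub> reindex f B) k l"
    using kl f M_entry[OF A] M_entry[OF B] unfolding M_mult[OF kl]
    by (intro finsum_cong') (auto simp: reindex_def)
  finally show "reindex f (A \<otimes>\<^bsub>M\<^esub> B) k l = (reindex f A \<otimes>\<^bsub>M\<^esub> reindex f B) k l" .
qed (simp_all add: assms reindex_M M_mult_closed)

lemma reindex_transpose_mult:
  assumes A: "A \<in> carrier M" and B: "B \<in> carrier M"
  shows "reindex_transpose f (A \<otimes>\<^bsub>M\<^esub> B) = reindex_transpose f B \<otimes>\<^bsub>M\<^esub> reindex_transpose f A"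
proof (rule M_eqI)
  fix k l assume kl: "k \<le> n" "l \<le> n"
  have "reindex_transpose f (A \<otimes>\<^bsub>M\<^esub> B) k l = (\<Oplus>m\<in>{..n}. A (f l) m \<otimes> B m (f k))"
    using kl f by (simp add: reindex_transpose_def M_mult)
  also have "\<dots> = (\<Oplus>m\<in>{..n}. A (f l) (f m) \<otimes> B (f m) (f k))"
    using kl f M_entry[OF A] M_entry[OF B] by (intro finsum_bij[OF bij_f, symmetric]) auto
  also have "\<dots> = (reindex_transpose f B \<otimes>\<^bsub>M\<^esub> reindex_transpose f A) k l"
    using kl f M_entry[OF A] M_entry[OF B] unfolding M_mult[OF kl]
    by (intro finsum_cong') (auto simp: reindex_transpose_def m_comm)
  finally show "reindex_transpose f (A \<otimes>\<^bsub>M\<^esub> B) k l = (reindex_transpose f B \<otimes>\<^bsub>M\<^esub> reindex_transpose f A) k l" .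
qed (simp_all add: assms reindex_transpose_M M_mult_closed)

lemma f_eq_iff: "k \<le> n \<Longrightarrow> a \<le> n \<Longrightarrow> f k = a \<longleftrightarrow> k = g a"
  using fg gf by metis

lemma f_inj_iff: "k \<le> n \<Longrightarrow> l \<le> n \<Longrightarrow> f k = f l \<longleftrightarrow> k = l"
  using gf by metis

lemma reindex_el:
  assumes "a \<le> n" "b \<le> n" "r \<in> carrier R"
  shows "reindex f (el a b r) = el (g a) (g b) r"
proof (rule M_eqI)
  fix k l assume kl: "k \<le> n" "l \<le> n"
  have "reindex f (el a b r) k l = el a b r (f k) (f l)" using kl by (simp add: reindex_def)
  also have "\<dots> = el (g a) (g b) r k l"
    unfolding el_entry[OF f[OF kl(1)] f[OF kl(2)]] el_entry[OF kl] f_inj_iff[OF kl]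
      f_eq_iff[OF kl(1) assms(1)] f_eq_iff[OF kl(2) assms(2)] ..
  finally show "reindex f (el a b r) k l = el (g a) (g b) r k l" .
qed (simp_all add: assms(3) reindex_M el_carrier)

lemma reindex_transpose_el:
  assumes "a \<le> n" "b \<le> n" "r \<in> carrier R"
  shows "reindex_transpose f (el a b r) = el (g b) (g a) r"
proof (rule M_eqI)
  fix k l assume kl: "k \<le> n" "l \<le> n"
  have "reindex_transpose f (el a b r) k l = el a b r (f l) (f k)" using kl by (simp add: reindex_transpose_def)
  also have "\<dots> = el (g b) (g a) r k l"
    unfolding el_entry[OF f[OF kl(2)] f[OF kl(1)]] el_entry[OF kl] f_inj_iff[OF kl(2,1)]
      f_eq_iff[OF kl(2) assms(1)] f_eq_iff[OF kl(1) assms(2)] by auto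
  finally show "reindex_transpose f (el a b r) k l = el (g b) (g a) r k l" .
qed (simp_all add: assms(3) reindex_transpose_M el_carrier)

lemma reindex_one: "reindex f \<one>\<^bsub>M\<^esub> = \<one>\<^bsub>M\<^esub>"
  using reindex_el[of 0 1 \<zero>] n_ge_2 by (simp add: el_zero)

lemma reindex_transpose_one: "reindex_transpose f \<one>\<^bsub>M\<^esub> = \<one>\<^bsub>M\<^esub>"
  using reindex_transpose_el[of 0 1 \<zero>] n_ge_2 by (simp add: el_zero)

lemma g_neq: "a \<le> n \<Longrightarrow> b \<le> n \<Longrightarrow> a \<noteq> b \<Longrightarrow> g a \<noteq> g b"
  using fg by metis

lemma reindex_G:
  assumes "A \<in> carrier G"
  shows "reindex f A \<in> carrier G"
proof -
  have "subgroup {A \<in> carrier G. reindex f A \<in> carrier G} G"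
  proof (rule G.finite_submonoid_subgroup[OF finite_G[OF finite_R]])
    show "\<one>\<^bsub>G\<^esub> \<in> {A \<in> carrier G. reindex f A \<in> carrier G}"
      using G.one_closed by (simp add: G_one reindex_one)
    fix A B assume "A \<in> {A \<in> carrier G. reindex f A \<in> carrier G}" "B \<in> {A \<in> carrier G. reindex f A \<in> carrier G}"
    then show "A \<otimes>\<^bsub>G\<^esub> B \<in> {A \<in> carrier G. reindex f A \<in> carrier G}"
      using G.m_closed[of "reindex f A" "reindex f B"] G.m_closed[of A B] G_M by (simp add: G_mult reindex_mult)
  qed blast
  then have "carrier G \<subseteq> {A \<in> carrier G. reindex f A \<in> carrier G}"
    by (rule G_subset) (simp add: reindex_el el_G g g_neq)
  then show ?thesis using assms by blast
qed

lemma reindex_transpose_G: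
  assumes "A \<in> carrier G"
  shows "reindex_transpose f A \<in> carrier G"
proof -
  have "subgroup {A \<in> carrier G. reindex_transpose f A \<in> carrier G} G"
  proof (rule G.finite_submonoid_subgroup[OF finite_G[OF finite_R]])
    show "\<one>\<^bsub>G\<^esub> \<in> {A \<in> carrier G. reindex_transpose f A \<in> carrier G}"
      using G.one_closed by (simp add: G_one reindex_transpose_one)
    fix A B assume "A \<in> {A \<in> carrier G. reindex_transpose f A \<in> carrier G}" "B \<in> {A \<in> carrier G. reindex_transpose f A \<in> carrier G}"
    then show "A \<otimes>\<^bsub>G\<^esub> B \<in> {A \<in> carrier G. reindex_transpose f A \<in> carrier G}"
      using G.m_closed[of "reindex_transpose f B" "reindex_transpose f A"] G.m_closed[of A B] G_M
      by (simp add: G_mult reindex_transpose_mult)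
  qed blast
  then have "carrier G \<subseteq> {A \<in> carrier G. reindex_transpose f A \<in> carrier G}"
    by (rule G_subset) (simp add: reindex_transpose_el el_G g g_neq)
  then show ?thesis using assms by blast
qed

lemma reindex_hom: "reindex f \<in> hom G G"
  by (rule homI) (simp_all add: reindex_G G_mult reindex_mult G_M)

text \<open>Inversion and transposition both reverse products, so together they preserve
  them.\<close>

lemma inverse_transpose_hom: "(\<lambda>A. reindex_transpose f (inv\<^bsub>G\<^esub> A)) \<in> hom G G"
proof (rule homI)
  fix A B assume AB: "A \<in> carrier G" "B \<in> carrier G"
  have "reindex_transpose f (inv\<^bsub>G\<^esub> (A \<otimes>\<^bsub>G\<^esub> B)) = reindex_transpose f (inv\<^bsub>G\<^esub> B \<otimes>\<^bsub>M\<^esub> inv\<^bsub>G\<^esub> A)"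
    using AB by (simp add: G.inv_mult_group G_mult[symmetric])
  also have "\<dots> = reindex_transpose f (inv\<^bsub>G\<^esub> A) \<otimes>\<^bsub>M\<^esub> reindex_transpose f (inv\<^bsub>G\<^esub> B)"
    using AB G_M by (intro reindex_transpose_mult) auto
  finally show "reindex_transpose f (inv\<^bsub>G\<^esub> (A \<otimes>\<^bsub>G\<^esub> B))
    = reindex_transpose f (inv\<^bsub>G\<^esub> A) \<otimes>\<^bsub>G\<^esub> reindex_transpose f (inv\<^bsub>G\<^esub> B)" by (simp add: G_mult)
qed (simp add: reindex_transpose_G)

end

lemma inv_el:
  assumes "k \<le> n" "l \<le> n" "k \<noteq> l" "r \<in> carrier R"
  shows "inv\<^bsub>G\<^esub> (el k l r) = el k l (\<ominus> r)"
  using assms by (intro G.inv_equality) (simp_all add: el_G G_mult el_mult_elem l_neg el_zero G_one)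

text \<open>Reflections involve an inverse, which negates the coefficient of a root element;
  rotations do not.\<close>

definition sgn_rot :: "(nat \<Rightarrow> nat) \<Rightarrow> 'a \<Rightarrow> 'a" where
  "sgn_rot \<rho> m = (if rotation \<rho> then m else \<ominus> m)"

lemma sgn_P: "m \<in> P d \<Longrightarrow> sgn_rot \<rho> m \<in> P d"
  by (simp add: sgn_rot_def P_minus)

lemma dihedral_inv_into:
  assumes r: "\<rho> \<in> carrier (dihedral n)" and x: "x \<le> n"
  shows "inv_into {..n} \<rho> x \<le> n" "\<rho> (inv_into {..n} \<rho> x) = x" "inv_into {..n} \<rho> (\<rho> x) = x"
proof -
  have "x \<in> \<rho> ` {..n}" using dihedral_surj[OF r] x by simp
  then show "inv_into {..n} \<rho> x \<le> n" "\<rho> (inv_into {..n} \<rho> x) = x"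
    using inv_into_into[of x \<rho> "{..n}"] f_inv_into_f[of x \<rho> "{..n}"] by auto
  show "inv_into {..n} \<rho> (\<rho> x) = x" using inv_into_f_f[OF dihedral_inj[OF r]] x by simp
qed

definition pred_cyc :: "nat \<Rightarrow> nat" where "pred_cyc k = (if k = 0 then n else k - 1)"

lemma pred_cyc:
  assumes "k \<le> n"
  shows "pred_cyc k \<le> n" "cyc (pred_cyc k) = k" "pred_cyc (cyc k) = k"
proof -
  show "pred_cyc k \<le> n" using assms by (auto simp: pred_cyc_def)
  show "cyc (pred_cyc k) = k"
  proof (cases k)
    case (Suc m)
    then show ?thesis using assms by (simp add: pred_cyc_def)
  qed (simp add: pred_cyc_def)
  show "pred_cyc (cyc k) = k" using assms by (cases "k = n") (simp_all add: pred_cyc_def)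
qed

text \<open>A rotation acts by renaming indices. For a reflection, the inverse transpose moves the
  root element at (j, j + 1) to (j + 1, j), and a renaming of indices has to take this position to
  \<rho> j and its successor.\<close>

lemma automorphism_exists:
  assumes r: "\<rho> \<in> carrier (dihedral n)"
  shows "\<exists>\<phi>. \<phi> \<in> hom G G \<and> (\<forall>j\<le>n. \<forall>m\<in>P 1. \<phi> (gen j m) = gen (\<rho> j) (sgn_rot \<rho> m))"
proof (cases "rotation \<rho>")
  case True
  note inv = dihedral_inv_into[OF r]
  have "reindex (inv_into {..n} \<rho>) \<in> hom G G"
    by (rule reindex_hom[of _ \<rho>]) (auto simp: inv dihedral_le[OF r])
  moreover have "reindex (inv_into {..n} \<rho>) (gen j m) = gen (\<rho> j) (sgn_rot \<rho> m)" if "j \<le> n" "m \<in> P 1" for j m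
  proof -
    have "reindex (inv_into {..n} \<rho>) (gen j m) = el (\<rho> j) (\<rho> (cyc j)) m"
      using that PR cyc(1)[OF that(1)] by (intro reindex_el) (auto simp: inv dihedral_le[OF r])
    then show ?thesis using True that(1) by (simp add: rotation_def sgn_rot_def)
  qed
  ultimately show ?thesis by blast
next
  case False
  then have refl: "cyc (\<rho> (cyc j)) = \<rho> j" if "j \<le> n" for j
    using rotation_or_reflection[OF r] that by (simp add: reflection_def)
  note inv = dihedral_inv_into[OF r]
  \<comment> \<open>The renaming g is \<rho> shifted by one: it takes \<open>cyc j\<close> to \<rho>
    j and, since \<rho> reverses direction, j to \<open>cyc (\<rho> j)\<close>. Its inverse is
    f.\<close>
  define f where "f x = cyc (inv_into {..n} \<rho> x)" for x
  define g where "g x = \<rho> (pred_cyc x)" for x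
  have fg: "x \<le> n \<Longrightarrow> f x \<le> n" "x \<le> n \<Longrightarrow> g x \<le> n" "x \<le> n \<Longrightarrow> f (g x) = x" "x \<le> n \<Longrightarrow> g (f x) = x" for x
    unfolding f_def g_def using inv[of x] inv(3)[of "pred_cyc x"] pred_cyc dihedral_le[OF r] cyc(1) by auto
  have "(\<lambda>A. reindex_transpose f (inv\<^bsub>G\<^esub> A)) \<in> hom G G"
    by (rule inverse_transpose_hom[of f g]) (rule fg; assumption)+
  moreover have "reindex_transpose f (inv\<^bsub>G\<^esub> (gen j m)) = gen (\<rho> j) (sgn_rot \<rho> m)" if "j \<le> n" "m \<in> P 1" for j m
  proof -
    have m: "m \<in> carrier R" using PR that by blast
    have c: "cyc j \<le> n" "cyc j \<noteq> j" using cyc that by auto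
    have "reindex_transpose f (inv\<^bsub>G\<^esub> (gen j m)) = reindex_transpose f (gen j (\<ominus> m))"
      using inv_el[OF that(1) c(1) c(2)[symmetric] m] by simp
    also have "\<dots> = el (g (cyc j)) (g j) (\<ominus> m)"
      by (rule reindex_transpose_el[of f g]) (use fg that(1) c(1) m in auto)
    also have "g (cyc j) = \<rho> j" unfolding g_def using pred_cyc(3)[OF that(1)] by simp
    also have "g j = cyc (\<rho> j)"
      unfolding g_def using refl[OF pred_cyc(1)[OF that(1)]] pred_cyc(2)[OF that(1)] by simp
    finally show ?thesis using False by (simp add: sgn_rot_def)
  qed
  ultimately show ?thesis by blast
qed

text \<open>Values on the generators determine the homomorphism on the group
  (\<open>hom_unique\<close>), so the choice is immaterial and identities between such maps can be
  checked on generators. The restriction makes it extensional, as \<open>AutoGroup\<close>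
  requires.\<close>

definition aut_hom :: "(nat \<Rightarrow> nat) \<Rightarrow> (nat \<Rightarrow> nat \<Rightarrow> 'a) \<Rightarrow> nat \<Rightarrow> nat \<Rightarrow> 'a" where
  "aut_hom \<rho> = restrict (SOME \<phi>. \<phi> \<in> hom G G \<and>
     (\<forall>j\<le>n. \<forall>m\<in>P 1. \<phi> (gen j m) = gen (\<rho> j) (sgn_rot \<rho> m))) (carrier G)"

lemma aut_hom:
  assumes "\<rho> \<in> carrier (dihedral n)"
  shows "aut_hom \<rho> \<in> hom G G"
    "\<And>j m. j \<le> n \<Longrightarrow> m \<in> P 1 \<Longrightarrow> aut_hom \<rho> (gen j m) = gen (\<rho> j) (sgn_rot \<rho> m)"
    "aut_hom \<rho> \<in> extensional (carrier G)"
proof -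
  define \<phi> where "\<phi> = (SOME \<phi>. \<phi> \<in> hom G G \<and> (\<forall>j\<le>n. \<forall>m\<in>P 1. \<phi> (gen j m) = gen (\<rho> j) (sgn_rot \<rho> m)))"
  have \<phi>: "\<phi> \<in> hom G G \<and> (\<forall>j\<le>n. \<forall>m\<in>P 1. \<phi> (gen j m) = gen (\<rho> j) (sgn_rot \<rho> m))"
    unfolding \<phi>_def by (rule someI_ex[OF automorphism_exists[OF assms]])
  have e: "aut_hom \<rho> = restrict \<phi> (carrier G)" unfolding aut_hom_def \<phi>_def ..
  show "aut_hom \<rho> \<in> hom G G" unfolding e using \<phi> G.m_closed by (auto simp: hom_def Pi_def)
  show "aut_hom \<rho> (gen j m) = gen (\<rho> j) (sgn_rot \<rho> m)" if "j \<le> n" "m \<in> P 1" for j m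
    unfolding e using \<phi> gen_G that by simp
  show "aut_hom \<rho> \<in> extensional (carrier G)" unfolding e by simp
qed

text \<open>The image contains all generators, so the map is onto, and by finiteness
  bijective.\<close>

lemma aut_hom_auto:
  assumes r: "\<rho> \<in> carrier (dihedral n)"
  shows "aut_hom \<rho> \<in> auto G"
proof -
  note h = aut_hom[OF r]
  interpret h: group_hom G G "aut_hom \<rho>" using h(1) group_G by (simp add: group_hom_def group_hom_axioms_def)
  have "subgroup (aut_hom \<rho> ` carrier G) G" using h.img_is_subgroup .
  then have "carrier G \<subseteq> aut_hom \<rho> ` carrier G"
  proof (rule subgroup_containing_generators)
    fix j m assume jm: "j \<le> n" "m \<in> P 1"
    obtain i where i: "i \<le> n" "\<rho> i = j" using dihedral_inv_into[OF r jm(1)] by blast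
    have "sgn_rot \<rho> (sgn_rot \<rho> m) = m" using PR[OF jm(2)] by (simp add: sgn_rot_def)
    then have "gen j m = aut_hom \<rho> (gen i (sgn_rot \<rho> m))"
      using h(2)[OF i(1) sgn_P[OF jm(2)]] i(2) by simp
    then show "gen j m \<in> aut_hom \<rho> ` carrier G" using gen_G[OF i(1) sgn_P[OF jm(2)]] by blast
  qed
  then have surj: "aut_hom \<rho> ` carrier G = carrier G" by auto
  then have "inj_on (aut_hom \<rho>) (carrier G)" using finite_G[OF finite_R] by (metis eq_card_imp_inj_on)
  then show ?thesis using h(1,3) surj by (simp add: auto_def Bij_def bij_betw_def)
qed

text \<open>Directions multiply like signs, which makes \<open>sgn_rot\<close> compatible with
  composition.\<close>

lemma rotation_compose:
  assumes r: "\<rho> \<in> carrier (dihedral n)" "\<rho>' \<in> carrier (dihedral n)"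
  shows "rotation (\<rho> \<otimes>\<^bsub>dihedral n\<^esub> \<rho>') \<longleftrightarrow> (rotation \<rho> \<longleftrightarrow> rotation \<rho>')"
proof -
  interpret D: group "dihedral n" by (rule group_dihedral)
  define \<rho>'' where "\<rho>'' = \<rho> \<otimes>\<^bsub>dihedral n\<^esub> \<rho>'"
  have r'': "\<rho>'' \<in> carrier (dihedral n)" using r by (simp add: \<rho>''_def)
  have e: "\<rho>'' j = \<rho> (\<rho>' j)" if "j \<le> n" for j
    using that by (simp add: \<rho>''_def dihedral_mult[OF r] compose_eq)
  note le = dihedral_le[OF r(2)]
  have rot: "rotation \<rho>''" if "rotation \<rho> \<and> rotation \<rho>' \<or> reflection \<rho> \<and> reflection \<rho>'"
    unfolding rotation_def
  proof (intro allI impI)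
    fix j assume j: "j \<le> n"
    show "\<rho>'' (cyc j) = cyc (\<rho>'' j)"
      using that e[OF j] e[OF cyc(1)[OF j]] le[OF j] le[OF cyc(1)[OF j]] j
      unfolding rotation_def reflection_def by metis
  qed
  have ref: "reflection \<rho>''" if "rotation \<rho> \<and> reflection \<rho>' \<or> reflection \<rho> \<and> rotation \<rho>'"
    unfolding reflection_def
  proof (intro allI impI)
    fix j assume j: "j \<le> n"
    show "cyc (\<rho>'' (cyc j)) = \<rho>'' j"
      using that e[OF j] e[OF cyc(1)[OF j]] le[OF j] le[OF cyc(1)[OF j]] j
      unfolding rotation_def reflection_def by metis
  qed
  show ?thesis unfolding \<rho>''_def[symmetric]
    using rot ref rotation_or_reflection[OF r(1)] rotation_or_reflection[OF r(2)]
      not_rotation_and_reflection[OF r''] not_rotation_and_reflection[OF r(1)] not_rotation_and_reflection[OF r(2)]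
    by blast
qed

lemma aut_hom_hom: "aut_hom \<in> hom (dihedral n) (AutoGroup G)"
proof (rule homI)
  show "aut_hom \<rho> \<in> carrier (AutoGroup G)" if "\<rho> \<in> carrier (dihedral n)" for \<rho>
    using aut_hom_auto[OF that] by (simp add: AutoGroup_def)
  interpret D: group "dihedral n" by (rule group_dihedral)
  fix \<rho> \<rho>' assume r: "\<rho> \<in> carrier (dihedral n)" "\<rho>' \<in> carrier (dihedral n)"
  define \<rho>'' where "\<rho>'' = \<rho> \<otimes>\<^bsub>dihedral n\<^esub> \<rho>'"
  have r'': "\<rho>'' \<in> carrier (dihedral n)" using r by (simp add: \<rho>''_def)
  have a: "aut_hom \<rho> \<in> Bij (carrier G)" "aut_hom \<rho>' \<in> Bij (carrier G)"
    using aut_hom_auto r by (auto simp: auto_def)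
  have "aut_hom \<rho>'' = compose (carrier G) (aut_hom \<rho>) (aut_hom \<rho>')"
  proof (rule extensionalityI[of _ "carrier G"])
    fix x assume x: "x \<in> carrier G"
    have comp: "compose (carrier G) (aut_hom \<rho>) (aut_hom \<rho>') \<in> hom G G"
      using G.hom_compose[OF aut_hom(1)[OF r(2)] aut_hom(1)[OF r(1)]] .
    show "aut_hom \<rho>'' x = compose (carrier G) (aut_hom \<rho>) (aut_hom \<rho>') x"
    proof (rule hom_unique[OF aut_hom(1)[OF r''] comp _ x])
      fix j m assume jm: "j \<le> n" "m \<in> P 1"
      have "sgn_rot \<rho>'' m = sgn_rot \<rho> (sgn_rot \<rho>' m)"
        using rotation_compose[OF r] PR[OF jm(2)] by (auto simp: sgn_rot_def \<rho>''_def)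
      moreover have "\<rho>'' j = \<rho> (\<rho>' j)" using jm by (simp add: \<rho>''_def dihedral_mult[OF r] compose_eq)
      ultimately show "aut_hom \<rho>'' (gen j m) = compose (carrier G) (aut_hom \<rho>) (aut_hom \<rho>') (gen j m)"
        using aut_hom(2)[OF r'' jm] aut_hom(2)[OF r(2) jm]
          aut_hom(2)[OF r(1) dihedral_le[OF r(2) jm(1)] sgn_P[OF jm(2)]] gen_G[OF jm]
        by (simp add: compose_eq)
    qed
  qed (use aut_hom(3)[OF r''] in \<open>simp_all add: compose_def\<close>)
  then show "aut_hom (\<rho> \<otimes>\<^bsub>dihedral n\<^esub> \<rho>') = aut_hom \<rho> \<otimes>\<^bsub>AutoGroup G\<^esub> aut_hom \<rho>'"
    using a by (simp add: \<rho>''_def AutoGroup_def BijGroup_def)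
qed

text \<open>Generators of a type j \<noteq> i go to generators of the type \<rho> j \<noteq> \<rho>
  i, which gives one inclusion; equality follows because \<open>card_K\<close> assigns both groups
  the same order.\<close>

lemma aut_hom_K:
  assumes r: "\<rho> \<in> carrier (dihedral n)" and i: "i \<le> n"
  shows "aut_hom \<rho> ` K i = K (\<rho> i)"
proof (rule card_subset_eq)
  note h = aut_hom[OF r]
  interpret h: group_hom G G "aut_hom \<rho>" using h(1) group_G by (simp add: group_hom_def group_hom_axioms_def)
  have ri: "\<rho> i \<le> n" using dihedral_le[OF r i] .
  have sub: "subgroup (K j) G" if "j \<le> n" for j using subgroup_mat[OF that] K_eq_mat[OF that] by simp
  have fin: "finite (K j)" if "j \<le> n" for j
    using subgroup.subset[OF sub[OF that]] finite_G[OF finite_R] finite_subset by blast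
  show "finite (K (\<rho> i))" using fin ri .
  have inj: "inj_on (aut_hom \<rho>) (K i)"
    using aut_hom_auto[OF r] subgroup.subset[OF sub[OF i]] inj_on_subset
    unfolding auto_def Bij_def bij_betw_def by blast
  show "card (aut_hom \<rho> ` K i) = card (K (\<rho> i))"
    using card_image[OF inj] card_K[OF i] card_K[OF ri] by simp
  have pre: "subgroup {x \<in> carrier G. aut_hom \<rho> x \<in> K (\<rho> i)} G"
    by (rule G.finite_submonoid_subgroup[OF finite_G[OF finite_R]])
      (use subgroup.one_closed[OF sub[OF ri]] subgroup.m_closed[OF sub[OF ri]] in \<open>auto simp: hom_mult[OF h(1)]\<close>)
  have "K i \<subseteq> {x \<in> carrier G. aut_hom \<rho> x \<in> K (\<rho> i)}"
    unfolding K_subgroup_def[of R "P 1" n i]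
  proof (rule G.generate_subgroup_incl[OF _ pre], rule subsetI)
    fix x assume "x \<in> {gen j m | j m. j \<in> {..n} - {i} \<and> m \<in> P 1}"
    then obtain j m where jm: "x = gen j m" "j \<le> n" "j \<noteq> i" "m \<in> P 1" by blast
    have "\<rho> j \<noteq> \<rho> i" using inj_onD[OF dihedral_inj[OF r], of j i] jm i by auto
    then have "gen (\<rho> j) (sgn_rot \<rho> m) \<in> K (\<rho> i)"
      unfolding K_eq_mat[OF ri] using generator_mat[OF ri dihedral_le[OF r jm(2)] _ sgn_P[OF jm(4)]] by blast
    then show "x \<in> {x \<in> carrier G. aut_hom \<rho> x \<in> K (\<rho> i)}"
      using h(2)[OF jm(2,4)] gen_G[OF jm(2,4)] jm(1) by simp
  qed
  then show "aut_hom \<rho> ` K i \<subseteq> K (\<rho> i)" by blast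
qed

theorem dihedral_semidirect_acts:
  "\<exists>\<theta> \<Phi>. \<theta> \<in> hom (dihedral n) (AutoGroup G) \<and>
    \<Phi> \<in> mon (semidirect_product G (dihedral n) \<theta>) (simplicial_automorphisms (coset_complex G K {..n})) \<and>
    (\<forall>g\<in>carrier G. \<forall>v\<in>vertices (coset_complex G K {..n}). \<Phi> (g, \<one>\<^bsub>dihedral n\<^esub>) v = left_mult G g v) \<and>
    (\<forall>\<sigma>\<in>simplices (coset_complex G K {..n}) (int n). \<forall>\<sigma>'\<in>simplices (coset_complex G K {..n}) (int n).
       \<exists>g\<in>carrier G. \<Phi> (g, \<one>\<^bsub>dihedral n\<^esub>) ` \<sigma> = \<sigma>') \<and>
    (\<forall>\<rho>\<in>carrier (dihedral n). \<forall>\<sigma>\<in>coset_complex G K {..n}.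
       simplex_type (\<Phi> (\<one>\<^bsub>G\<^esub>, \<rho>) ` \<sigma>) = \<rho> ` simplex_type \<sigma>)"
proof -
  interpret X: coset_geometry G n K by (rule coset_geometry_EL)
  note acts = X.semidirect_product_acts[OF aut_hom_hom]
  show ?thesis
    using acts aut_hom_hom aut_hom_K by (intro exI[of _ aut_hom]) simp
qed

end

section \<open>The family of complexes\<close>

text \<open>The order of each \<open>K i\<close>: the entry between positions a < b runs through the
  polynomials of degree at most b - a, of which there are q^(b - a + 1).\<close>

definition chambers_per_vertex :: "nat \<Rightarrow> nat \<Rightarrow> nat" where
  "chambers_per_vertex n q = (\<Prod>a\<le>n. \<Prod>b\<le>n. if a < b then q ^ (b - a + 1) else 1)"

lemma chambers_per_vertex_pos: "q > 0 \<Longrightarrow> chambers_per_vertex n q > 0"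
  unfolding chambers_per_vertex_def by (intro prod_pos) auto

context truncated_polynomials
begin

abbreviation "q \<equiv> card (carrier F)"

lemma expanding_matrix_ring_Rs:
  assumes "n \<ge> 2" "s > n"
  shows "expanding_matrix_ring Rs n P (const ` (carrier F - {\<zero>})) q"
  using assms by (intro expanding_matrix_ring.intro filtered_matrix_ring_Rs expanding_product_Rs) auto

lemma X_complex_eq: "X_complex F n s = coset_complex (EL Rs n) (K_subgroup Rs (P 1) n) {..n}"
  by (simp add: X_complex_def EL_trunc_def T_set_eq del: One_nat_def)

lemma q_ge_2: "q \<ge> 2"
proof -
  have "card {\<zero>, \<one>} \<le> q" using finite_F by (intro card_mono) auto
  then show ?thesis by simp
qed

lemma sqrt_q:
  assumes "n \<ge> 2" "q > (n - 1)\<^sup>2"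
  shows "sqrt (real q) > real n - 1"
proof -
  have "real ((n - 1)\<^sup>2) < real q" using assms(2) by (simp only: of_nat_less_iff)
  then have "(real n - 1)\<^sup>2 < real q" using assms(1) by (simp add: of_nat_diff)
  then show ?thesis by (rule real_less_rsqrt)
qed

lemma X_properties:
  assumes n: "n \<ge> 2" and s: "s > n" and q: "q > (n - 1)\<^sup>2"
  defines "X \<equiv> X_complex F n s"
  shows "pure_dim X (int n)" "partite X n" "strongly_gallery_connected X n" "clique_complex X"
    "\<not> (\<exists>\<sigma>. free_face X n \<sigma>)" "finite X"
    "\<And>v. v \<in> vertices X \<Longrightarrow> card {\<sigma> \<in> simplices X (int n). v \<in> \<sigma>} = chambers_per_vertex n q"
    "\<And>\<tau>. \<tau> \<in> simplices X (int n - 2) \<Longrightarrow> simple_walk_mu (link X \<tau>) \<le> 1 / sqrt (real q)"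
    "one_sided_local_spectral_expander X n (1 / (sqrt (real q) - (real n - 1)))"
    "link_mu X n (- 1) {} \<le> 1 / (sqrt (real q) - (real n - 1))"
    "automorphisms_contain_semidirect F n s"
    "q ^ s \<le> card (vertices X) * chambers_per_vertex n q"
proof -
  let ?K = "K_subgroup Rs (P 1) n"
  interpret E: expanding_matrix_ring Rs n P "const ` (carrier F - {\<zero>})" q
    by (rule expanding_matrix_ring_Rs[OF n s])
  interpret X: coset_expander "EL Rs n" n ?K q
    by (rule E.coset_expander_EL[OF sqrt_q[OF n q]])
  have X: "X = coset_complex (EL Rs n) ?K {..n}" unfolding X_def by (rule X_complex_eq)
  \<comment> \<open>All distances b - a are at most n < s, so \<open>card_P\<close> applies and s
    drops out of the count.\<close>
  have card_K: "card (?K i) = chambers_per_vertex n q" if "i \<le> n" for i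
    unfolding E.card_K[OF that] chambers_per_vertex_def
    using s by (intro prod.cong refl) (auto simp: card_P)
  show "pure_dim X (int n)" unfolding X by (rule X.pure_X)
  show "partite X n" unfolding X by (rule X.partite_X)
  show "strongly_gallery_connected X n" unfolding X by (rule X.strongly_gallery_connected_X)
  show "clique_complex X" unfolding X by (rule X.clique_complex_X)
  show "\<not> (\<exists>\<sigma>. free_face X n \<sigma>)" unfolding X using X.no_free_face by blast
  show "finite X" unfolding X by (rule X.finite_X)
  show "card {\<sigma> \<in> simplices X (int n). v \<in> \<sigma>} = chambers_per_vertex n q" if "v \<in> vertices X" for v
    using X.card_chambers_at_vertex[of v] that card_K unfolding X by simp
  show "simple_walk_mu (link X \<tau>) \<le> 1 / sqrt (real q)" if "\<tau> \<in> simplices X (int n - 2)" for \<tau>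
    using X.simple_walk_mu_X that unfolding X by blast
  show le: "one_sided_local_spectral_expander X n (1 / (sqrt (real q) - (real n - 1)))"
    unfolding X by (rule X.local_spectral_expander_X)
  have "{} \<in> simplices X (- 1)" unfolding X by (rule X.empty_simplex)
  then show "link_mu X n (- 1) {} \<le> 1 / (sqrt (real q) - (real n - 1))"
    using le n unfolding one_sided_local_spectral_expander_def by force
  show "automorphisms_contain_semidirect F n s"
    unfolding automorphisms_contain_semidirect_def Let_def X_complex_eq EL_trunc_def
    by (rule E.dihedral_semidirect_acts)
  \<comment> \<open>A single root group of the elementary group already has q^s elements.\<close>
  have "q ^ s = card (carrier Rs)" using card_P[of "s - 1"] s_pos by (simp add: carrier_Rs)
  also have "\<dots> \<le> card (carrier (EL Rs n))" by (rule E.card_R_le)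
  also have "\<dots> \<le> card (vertices X) * chambers_per_vertex n q"
    using X.card_carrier_le card_K[of 0] unfolding X by simp
  finally show "q ^ s \<le> card (vertices X) * chambers_per_vertex n q" .
qed

end

lemma truncated_polynomials_finite_field:
  assumes "finite_field_of_order F q" "s \<ge> 1"
  shows "truncated_polynomials F s"
  using assms unfolding finite_field_of_order_def truncated_polynomials_def truncated_polynomials_axioms_def by simp

text \<open>The group has at least q^s elements and is covered by cosets of a size c independent of
  s. The threshold n + 1 + Z c ensures both s > n and Z c \<le> s \<le> q^s.\<close>

lemma card_vertices_at_top:
  assumes n: "n \<ge> 2" and F: "finite_field_of_order F q" and q: "q > (n - 1)\<^sup>2"
  shows "filterlim (\<lambda>s. card (vertices (X_complex F n s))) at_top sequentially"
  unfolding filterlim_at_top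
proof
  fix Z :: nat
  define c where "c = chambers_per_vertex n q"
  have cF: "card (carrier F) = q" using F by (simp add: finite_field_of_order_def)
  have "Z \<le> card (vertices (X_complex F n s))" if s: "s \<ge> n + 1 + Z * c" for s
  proof -
    interpret truncated_polynomials F s using truncated_polynomials_finite_field[OF F] s by simp
    have q2: "q \<ge> 2" using q_ge_2 by (simp add: cF)
    have c: "c > 0" unfolding c_def using q2 by (intro chambers_per_vertex_pos) simp
    have "Z * c \<le> s" using s by simp
    also have "\<dots> \<le> q ^ s" using q2 by (meson less_exp less_imp_le order.trans power_mono zero_le)
    also have "\<dots> \<le> card (vertices (X_complex F n s)) * c"
      using X_properties(12)[OF n] s q unfolding cF c_def by simp
    finally show ?thesis using c by simp
  qed
  then show "\<forall>\<^sub>F s in sequentially. Z \<le> card (vertices (X_complex F n s))"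
    unfolding eventually_sequentially by blast
qed

lemma expander_mono:
  "one_sided_local_spectral_expander X n l \<Longrightarrow> l \<le> l' \<Longrightarrow> one_sided_local_spectral_expander X n l'"
  unfolding one_sided_local_spectral_expander_def by (meson order.trans)

text \<open>The residues modulo a large prime, carried over to \<open>nat\<close>; this shows that
  the quantification over fields on \<open>nat\<close> in the final statement is not void.\<close>

lemma ex_finite_nat_field:
  "\<exists>q \<ge> q0. \<exists>F :: nat ring. finite_field_of_order F q"
proof -
  obtain p where p: "prime p" "p > q0" using bigger_prime by blast
  interpret residues_prime p "residue_ring (int p)" using p(1) by unfold_locales auto
  define S :: "nat ring" where "S = \<lparr>carrier = {..<p}, monoid.mult = (\<lambda>x y. x * y mod p), one = 1,
    zero = 0, add = (\<lambda>x y. (x + y) mod p)\<rparr>"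
  have p2: "p \<ge> 2" using p(1) prime_ge_2_nat by blast
  have "nat \<in> ring_iso (residue_ring (int p)) S"
  proof (rule ring_iso_memI)
    show "bij_betw nat (carrier (residue_ring (int p))) (carrier S)"
      by (rule bij_betw_byWitness[where f' = int]) (auto simp: residue_ring_def S_def)
  qed (use p2 in \<open>auto simp: residue_ring_def S_def nat_mod_distrib nat_mult_distrib nat_add_distrib\<close>)
  then have "field (S\<lparr>zero := nat \<zero>\<^bsub>residue_ring (int p)\<^esub>\<rparr>)"
    by (rule field.ring_iso_imp_img_field[OF is_field])
  \<comment> \<open>Transport along the isomorphism yields the ring with its zero overwritten by the
    image of zero, which here changes nothing.\<close>
  moreover have "S\<lparr>zero := nat \<zero>\<^bsub>residue_ring (int p)\<^esub>\<rparr> = S"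
    by (simp add: S_def residue_ring_def)
  ultimately have "finite_field_of_order S p" by (simp add: finite_field_of_order_def) (simp add: S_def)
  then show ?thesis using p(2) by (intro exI[of _ p]) auto
qed

text \<open>The bound on q is chosen to give sqrt q - (n - 1) \<ge> 1/l, so that the expansion
  constant is at most l; it also implies q > (n - 1)^2.\<close>

lemma family_properties:
  fixes F :: "'a ring"
  assumes n: "n \<ge> 2" and l: "l > 0" and F: "finite_field_of_order F q" and q: "real q \<ge> (real n + 1 / l)\<^sup>2"
  shows "infinite (X_family F n)" "infinite ((\<lambda>Y. card (vertices Y)) ` X_family F n)"
    "\<And>Y. Y \<in> X_family F n \<Longrightarrow> pure_dim Y (int n) \<and> one_sided_local_spectral_expander Y n l"
    "uniformly_locally_finite (X_family F n) n"
proof -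
  have cF: "card (carrier F) = q" using F by (simp add: finite_field_of_order_def)
  have sq: "sqrt (real q) \<ge> real n + 1 / l"
    using real_sqrt_le_mono[OF q] l by simp
  have "(real n - 1)\<^sup>2 < (real n + 1 / l)\<^sup>2" using n l by (intro power_strict_mono) (auto simp: field_simps)
  then have "real ((n - 1)\<^sup>2) < real q" using q n by (simp add: of_nat_diff)
  then have q': "q > (n - 1)\<^sup>2" by (simp only: of_nat_less_iff)
  have "1 / l \<le> sqrt (real q) - (real n - 1)" using sq by simp
  from le_imp_inverse_le[OF this] have le: "1 / (sqrt (real q) - (real n - 1)) \<le> l"
    using l by (simp add: inverse_eq_divide)
  \<comment> \<open>The threshold 2^(n - 1) is at least n, so all members of the family satisfy s >
    n.\<close>
  have sn: "s > n" if "s > 2 ^ (n - 1)" for s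
  proof -
    have "n - 1 < 2 ^ (n - 1)" by (rule less_exp)
    then show ?thesis using that by linarith
  qed
  have member: "\<exists>s>n. Y = X_complex F n s" if "Y \<in> X_family F n" for Y
    using that sn unfolding X_family_def by blast
  \<comment> \<open>Different s might a priori give the same complex; unbounded numbers of vertices
    show that the family is infinite nevertheless.\<close>
  show inf: "infinite ((\<lambda>Y. card (vertices Y)) ` X_family F n)"
  proof
    assume fin: "finite ((\<lambda>Y. card (vertices Y)) ` X_family F n)"
    obtain B where B: "\<And>Y. Y \<in> X_family F n \<Longrightarrow> card (vertices Y) \<le> B"
      using Max_ge[OF fin] by blast
    have "\<forall>\<^sub>F s in sequentially. B + 1 \<le> card (vertices (X_complex F n s))"
      using card_vertices_at_top[OF n F q'] unfolding filterlim_at_top by blast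
    then obtain N where N: "\<And>s. s \<ge> N \<Longrightarrow> B + 1 \<le> card (vertices (X_complex F n s))"
      unfolding eventually_sequentially by blast
    define s where "s = N + 2 ^ (n - 1) + 1"
    have "X_complex F n s \<in> X_family F n" unfolding X_family_def s_def by force
    then show False using B N[of s] by (fastforce simp: s_def)
  qed
  then show "infinite (X_family F n)" by blast
  show "pure_dim Y (int n) \<and> one_sided_local_spectral_expander Y n l" if Y: "Y \<in> X_family F n" for Y
  proof -
    obtain s where s: "s > n" "Y = X_complex F n s" using member[OF Y] by blast
    interpret truncated_polynomials F s using truncated_polynomials_finite_field[OF F] s by simp
    show ?thesis unfolding s(2) using X_properties(1,9)[OF n s(1)] q' expander_mono le by (simp add: cF) blast
  qed
  show "uniformly_locally_finite (X_family F n) n"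
    unfolding uniformly_locally_finite_def
  proof (intro exI[of _ "chambers_per_vertex n q"] ballI)
    fix Y v assume Y: "Y \<in> X_family F n" and v: "v \<in> vertices Y"
    obtain s where s: "s > n" "Y = X_complex F n s" using member[OF Y] by blast
    interpret truncated_polynomials F s using truncated_polynomials_finite_field[OF F] s by simp
    have "finite Y" "card {\<sigma> \<in> simplices Y (int n). v \<in> \<sigma>} = chambers_per_vertex n q"
      using X_properties(6,7)[OF n s(1)] q' v by (simp_all add: cF s(2))
    moreover from this have "finite {\<sigma> \<in> simplices Y (int n). v \<in> \<sigma>}"
      by (intro finite_subset[OF _ \<open>finite Y\<close>]) (auto simp: simplices_def)
    ultimately show "finite {\<sigma> \<in> simplices Y (int n). v \<in> \<sigma>} \<and>
      card {\<sigma> \<in> simplices Y (int n). v \<in> \<sigma>} \<le> chambers_per_vertex n q" by simp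
  qed
qed

text \<open>\<open>Q\<close> is quantified before q, the field and s: for fixed n, the number of
  chambers at a vertex depends on q alone. The last part speaks of fields carried by
  \<open>nat\<close>, a type that supports finite fields of unbounded order.\<close>

theorem theorem4p10:
  fixes n :: nat
  assumes "n \<ge> 2"
  shows
    "(\<exists>Q :: nat \<Rightarrow> nat. \<forall>q. \<forall>F :: 'a ring.
        primepow q \<and> q > (n - 1)\<^sup>2 \<and> finite_field_of_order F q \<longrightarrow>
        (\<forall>s > n.
           pure_dim (X_complex F n s) (int n) \<and>
           partite (X_complex F n s) n \<and>
           strongly_gallery_connected (X_complex F n s) n \<and>
           clique_complex (X_complex F n s) \<and>
           \<not> (\<exists>\<sigma>. free_face (X_complex F n s) n \<sigma>) \<and>
           finite (X_complex F n s) \<and>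
           (\<forall>v\<in>vertices (X_complex F n s).
              card {\<sigma> \<in> simplices (X_complex F n s) (int n). v \<in> \<sigma>} = Q q) \<and>
           (\<forall>\<tau>\<in>simplices (X_complex F n s) (int n - 2).
              simple_walk_mu (link (X_complex F n s) \<tau>) \<le> 1 / sqrt (real q)) \<and>
           one_sided_local_spectral_expander (X_complex F n s) n
             (1 / (sqrt (real q) - (real n - 1))) \<and>
           link_mu (X_complex F n s) n (- 1) {} \<le> 1 / (sqrt (real q) - (real n - 1)) \<and>
           automorphisms_contain_semidirect F n s) \<and>
        filterlim (\<lambda>s. card (vertices (X_complex F n s))) at_top sequentially)
     \<and>
     (\<forall>l::real. l > 0 \<longrightarrow> (\<exists>q0.
        (\<exists>q \<ge> q0. \<exists>F :: nat ring. finite_field_of_order F q) \<and>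
        (\<forall>q \<ge> q0. \<forall>F :: nat ring. finite_field_of_order F q \<longrightarrow>
           infinite (X_family F n) \<and>
           infinite ((\<lambda>Y. card (vertices Y)) ` X_family F n) \<and>
           (\<forall>Y\<in>X_family F n.
              pure_dim Y (int n) \<and> one_sided_local_spectral_expander Y n l) \<and>
           uniformly_locally_finite (X_family F n) n)))"
proof (rule conjI[OF exI[of _ "chambers_per_vertex n"]], goal_cases)
  case 1
  show ?case
  proof (intro allI impI, goal_cases)
    case (1 q F)
    then have q: "q > (n - 1)\<^sup>2" and F: "finite_field_of_order F q" by simp_all
    have cF: "card (carrier F) = q" using F by (simp add: finite_field_of_order_def)
    show ?case
    proof (rule conjI[OF _ card_vertices_at_top[OF assms F q]], intro allI impI, goal_cases)
      case (1 s)
      interpret truncated_polynomials F s using truncated_polynomials_finite_field[OF F] 1 by simp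
      note X = X_properties[OF assms 1, unfolded cF, OF q]
      show ?case by (intro conjI ballI X)
    qed
  qed
next
  case 2
  show ?case
  proof (intro allI impI, goal_cases)
    case (1 l)
    define q0 where "q0 = nat \<lceil>(real n + 1 / l)\<^sup>2\<rceil>"
    have q0: "real q \<ge> (real n + 1 / l)\<^sup>2" if "q \<ge> q0" for q
      using that real_nat_ceiling_ge[of "(real n + 1 / l)\<^sup>2"] unfolding q0_def by linarith
    show ?case
    proof (rule exI[of _ q0], rule conjI[OF ex_finite_nat_field], intro allI impI, goal_cases)
      case prems: (1 q F)
      note fam = family_properties[OF assms 1 prems(2) q0[OF prems(1)]]
      show ?case by (intro conjI ballI fam(1,2,4)) (simp_all add: fam(3))
    qed
  qed
qed

end
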